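(* Let $N\in\mathbb N_+$, $j,j_1,\dots,j_N\in\frac12\mathbb N_+$ and $v_1,\dots,v_N\in\mathbb C^*$. The normalized transfer matrix $\tilde{\boldsymbol t}^{j,\boldsymbol{\bar\jmath}}(u)$ is a (noncommutative) polynomial of total degree $4Nj$ in the two operators $\mathcal W_0^{(N)}$, $\mathcal W_1^{(N)}$, with scalar coefficients depending on $u$ (and on the boundary and inhomogeneity parameters, $q$ and the spins).
   Context: **Conventions.** $q\in\mathbb C^*$ is not a root of unity, $[n]_q=\frac{q^n-q^{-n}}{q-q^{-1}}$, $c(u)=u-u^{-1}$, $X_1=X\otimes\mathbb I$, $X_2=\mathbb I\otimes X$. Boundary parameters: $k_\pm\in\mathbb C^*$, $\varepsilon_\pm,\bar\varepsilon_\pm,\bar k_\pm\in\mathbb C$. "Total degree" is the formal degree of an expression in which $\mathcal W_0^{(N)},\mathcal W_1^{(N)}$ both have degree 1 (maximal degree for generic parameters; it may drop for special boundary parameters). **Fusion.** $B_{j,j'}=\sqrt{[j+j']_q[j-j'+1]_q}$; spin-$j$ matrices $(S_+)_{mn}=B_{j,j+1-m}\delta_{m,n-1}$, $(S_-)_{mn}=B_{j,j+1-n}\delta_{m-1,n}$, $(S_3)_{mn}=2(j+1-n)\delta_{mn}$. $\mathcal E^{(j)}:\mathbb C^{2j+1}\to\mathbb C^2\otimes\mathbb C^{2j}$ has nonzero entries $\mathcal E_{1,1}=1$, $\mathcal E_{1+n,1+n}=\prod_{p=0}^{n-1}\frac{B_{j-1/2,j-p-1/2}}{B_{j,j-p}}$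 ($1\le n\le2j-1$), $\mathcal E_{2j+m,1+m}=[m]_q\mathcal E_{m,m}/B_{j,j+1-m}$ ($1\le m\le2j$). $\mathcal F^{(j)}:\mathbb C^2\otimes\mathbb C^{2j}\to\mathbb C^{2j+1}$ has nonzero entries $\mathcal F_{1,1}=1$, $\mathcal F_{n,n+2j-1}=\frac{\mathcal E_{n+2j-1,n}}{\mathcal E_{n,n}^2+\mathcal E_{n+2j-1,n}^2}$, $\mathcal F_{n,n}=\frac{1-\mathcal F_{n,n+2j-1}\mathcal E_{n+2j-1,n}}{\mathcal E_{n,n}}$ ($2\le n\le2j$), $\mathcal F_{2j+1,4j}=\mathcal E_{4j,2j+1}^{-1}$. **R-matrices.** $R^{(\frac12,0)}=\mathbb I_2$, $R^{(0,j)}=\mathbb I$, $R^{(\frac12,j)}(u)=\prod_{k=0}^{2j-2}c(uq^{j-\frac12-k})\Big((q-q^{-1})(\sigma_+\otimes S_-+\sigma_-\otimes S_+)+uq^{\frac12(\mathbb I+\sigma_z\otimes S_3)}-u^{-1}q^{-\frac12(\mathbb I+\sigma_z\otimes S_3)}\Big)$, $R^{(j_1,j_2)}(u)=\mathcal F^{(j_1)}_{\langle12\rangle}R_{13}^{(\frac12,j_2)}(uq^{-j_1+\frac12})R_{23}^{(j_1-\frac12,j_2)}(uq^{\frac12})\mathcal E^{(j_1)}_{\langle12\rangle}$; normalized: $\tilde R^{(j_1,j_2)}(u)=\Big(\prod_{k=0}^{2j_1-1}\prod_{\ell=0}^{2j_2-1}c(uq^{j_1+j_2-k-\ell})\Big)^{-1}R^{(j_1,j_2)}(u)$.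 **K-matrices.** $K^{(0)}=1$, $K^{(\frac12)}(u)=\begin{pmatrix}u\varepsilon_++u^{-1}\varepsilon_-&k_+c(u^2)/(q-q^{-1})\\k_-c(u^2)/(q-q^{-1})&u\varepsilon_-+u^{-1}\varepsilon_+\end{pmatrix}$, $K^{(j)}(u)=\mathcal F^{(j)}K_1^{(\frac12)}(uq^{-j+\frac12})R^{(\frac12,j-\frac12)}(u^2q^{-j+1})K_2^{(j-\frac12)}(uq^{\frac12})\mathcal E^{(j)}$; $\tilde K^{(j)}(u)=\Big(\prod_{\ell=0}^{2j-2}c(u^2q^{1-\ell})\Big)^{-1}K^{(j)}(u)$; $\tilde K^{+(j)}(u)=\big(\tilde K^{(j)}(u^{-1}q^{-1})\big)^t$ with $\varepsilon_\pm\to\bar\varepsilon_\mp$, $k_\pm\to-\bar k_\mp$. **Normalized transfer matrix.** $\tilde{\boldsymbol t}^{j,\boldsymbol{\bar\jmath}}(u)=\mathrm{tr}_{\mathbb C^{2j+1}}\big(\tilde K_a^{+(j)}(u)\tilde R_{Na}^{(j_N,j)}(uv_N)\cdots\tilde R_{1a}^{(j_1,j)}(uv_1)\tilde K_a^{(j)}(u)\tilde R_{1a}^{(j_1,j)}(uv_1^{-1})\cdots\tilde R_{Na}^{(j_N,j)}(uv_N^{-1})\big)$, trace over the auxiliary space $a$; it acts on $\mathbb C^{2j_N+1}\otimes\dots\otimes\mathbb C^{2j_1+1}$. **The two operators.** $\mathcal W_0^{(0)}=\varepsilon_+$, $\mathcal W_1^{(0)}=\varepsilon_-$ and, with $S_\pm,S_3$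 of spin $j_N$ on the first factor, $\mathcal W_0^{(N)}=\big(k_+v_Nq^{\frac12}S_+q^{\frac12S_3}+k_-v_N^{-1}q^{-\frac12}S_-q^{\frac12S_3}\big)\otimes\mathbb I^{(N-1)}+q^{S_3}\otimes\mathcal W_0^{(N-1)}$, $\mathcal W_1^{(N)}=\big(k_+v_N^{-1}q^{-\frac12}S_+q^{-\frac12S_3}+k_-v_Nq^{\frac12}S_-q^{-\frac12S_3}\big)\otimes\mathbb I^{(N-1)}+q^{-S_3}\otimes\mathcal W_1^{(N-1)}$. *)

theory Defs
  imports
    "Jordan_Normal_Form.Matrix"
    "HOL-Library.Poly_Mapping"
    "HOL-Analysis.Product_Topology"
begin

text \<open>
  Conventions.
  \<^item> Spins are given by their doubles: a natural number \<open>J\<close> stands for the spin \<open>j = J/2\<close>,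
    and an integer \<open>b\<close> stands for the half-integer \<open>b/2\<close>.
  \<^item> \<open>h\<close> is a fixed square root of \<open>q\<close>; every half-integer power \<open>q^(e/2)\<close> is \<open>h powi e\<close>.
  \<^item> A tensor product of spaces of dimensions \<open>m\<close> and \<open>n\<close> has the basis ordered
    lexicographically, the first factor being the most significant one. The chain
    \<open>V_N \<otimes> ... \<otimes> V_1 \<otimes> V_a\<close> is ordered in the same way.
\<close>

section \<open>Tensor products\<close>

definition mat1 :: "nat \<Rightarrow> nat \<Rightarrow> (nat \<Rightarrow> nat \<Rightarrow> complex) \<Rightarrow> complex mat" where
  \<comment> \<open>entries given by indices starting from 1\<close>
  "mat1 m n f = mat m n (\<lambda>(i, j). f (i + 1) (j + 1))"

definition kron :: "complex mat \<Rightarrow> complex mat \<Rightarrow> complex mat" where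
  "kron A B = mat (dim_row A * dim_row B) (dim_col A * dim_col B)
     (\<lambda>(i, j). A $$ (i div dim_row B, j div dim_col B) * B $$ (i mod dim_row B, j mod dim_col B))"

definition emb13 :: "nat \<Rightarrow> nat \<Rightarrow> nat \<Rightarrow> complex mat \<Rightarrow> complex mat" where
  \<comment> \<open>the operator \<open>A\<close> on \<open>U \<otimes> W\<close>, acting on the outer factors of \<open>U \<otimes> V \<otimes> W\<close>;
      \<open>d1\<close>, \<open>d2\<close>, \<open>d3\<close> are the dimensions of \<open>U\<close>, \<open>V\<close>, \<open>W\<close>\<close>
  "emb13 d1 d2 d3 A = mat (d1 * d2 * d3) (d1 * d2 * d3)
     (\<lambda>(i, j). if (i div d3) mod d2 = (j div d3) mod d2
        then A $$ (i div (d2 * d3) * d3 + i mod d3, j div (d2 * d3) * d3 + j mod d3) else 0)"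

definition ptrace :: "nat \<Rightarrow> nat \<Rightarrow> complex mat \<Rightarrow> complex mat" where
  \<comment> \<open>trace over the last factor of \<open>V \<otimes> W\<close>, with \<open>dim V = D\<close> and \<open>dim W = d\<close>\<close>
  "ptrace D d A = mat D D (\<lambda>(i, j). \<Sum>k<d. A $$ (i * d + k, j * d + k))"

definition prod_mats :: "nat \<Rightarrow> complex mat list \<Rightarrow> complex mat" where
  "prod_mats n As = foldr (*) As (1\<^sub>m n)"

section \<open>Noncommutative polynomials in two variables\<close>

datatype nc_var = X0 | X1

type_synonym nc_poly = "nc_var list \<Rightarrow>\<^sub>0 complex"

definition nc_degree :: "nc_poly \<Rightarrow> nat" where
  "nc_degree p = Max (insert 0 (length ` Poly_Mapping.keys p))"

definition nc_word :: "complex mat \<Rightarrow> complex mat \<Rightarrow> nc_var list \<Rightarrow> complex mat" where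
  "nc_word A B w =
     prod_mats (dim_row A) (map (\<lambda>x. case x of X0 \<Rightarrow> A | X1 \<Rightarrow> B) w)"

definition nc_eval :: "nc_poly \<Rightarrow> complex mat \<Rightarrow> complex mat \<Rightarrow> complex mat" where
  "nc_eval p A B = mat (dim_row A) (dim_row A)
     (\<lambda>ij. \<Sum>w\<in>Poly_Mapping.keys p. Poly_Mapping.lookup p w * nc_word A B w $$ ij)"

section \<open>Fused R-matrices and K-matrices\<close>

definition qnum :: "complex \<Rightarrow> int \<Rightarrow> complex" where
  "qnum q n = (q powi n - q powi (- n)) / (q - inverse q)"

definition cfun :: "complex \<Rightarrow> complex" where
  "cfun u = u - inverse u"

definition sigma_p :: "complex mat" where
  "sigma_p = mat1 2 2 (\<lambda>m n. if m = 1 \<and> n = 2 then 1 else 0)"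

definition sigma_m :: "complex mat" where
  "sigma_m = mat1 2 2 (\<lambda>m n. if m = 2 \<and> n = 1 then 1 else 0)"

text \<open>\<open>(\<epsilon>\<^sub>+, \<epsilon>\<^sub>-, k\<^sub>+, k\<^sub>-)\<close>\<close>
type_synonym bparams = "complex \<times> complex \<times> complex \<times> complex"

context
  fixes h :: complex
begin

definition qB :: "int \<Rightarrow> int \<Rightarrow> complex" where
  \<comment> \<open>\<open>qB a b\<close> is \<open>B\<^bsub>a/2, b/2\<^esub>\<close>, used for \<open>a\<close>, \<open>b\<close> of equal parity\<close>
  "qB a b = csqrt (qnum (h^2) ((a + b) div 2) * qnum (h^2) ((a - b) div 2 + 1))"

definition S_plus :: "nat \<Rightarrow> complex mat" where
  "S_plus J = mat1 (J + 1) (J + 1)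
     (\<lambda>m n. if n = m + 1 then qB (int J) (int J + 2 - 2 * int m) else 0)"

definition S_minus :: "nat \<Rightarrow> complex mat" where
  "S_minus J = mat1 (J + 1) (J + 1)
     (\<lambda>m n. if m = n + 1 then qB (int J) (int J + 2 - 2 * int n) else 0)"

definition S3_eig :: "nat \<Rightarrow> nat \<Rightarrow> int" where
  \<comment> \<open>the \<open>n\<close>-th diagonal entry \<open>2(j + 1 - n)\<close> of \<open>S\<^sub>3\<close>, \<open>n\<close> starting from 1\<close>
  "S3_eig J n = int J + 2 - 2 * int n"

definition pow_S3 :: "complex \<Rightarrow> nat \<Rightarrow> complex mat" where
  \<comment> \<open>\<open>x\<close> to the power \<open>S\<^sub>3\<close>\<close>
  "pow_S3 x J = mat1 (J + 1) (J + 1) (\<lambda>m n. if m = n then x powi (S3_eig J n) else 0)"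

definition pow_I_sz_S3 :: "complex \<Rightarrow> nat \<Rightarrow> complex mat" where
  \<comment> \<open>\<open>x\<close> to the power \<open>I + \<sigma>\<^sub>z \<otimes> S\<^sub>3\<close>\<close>
  "pow_I_sz_S3 x J = mat (2 * (J + 1)) (2 * (J + 1)) (\<lambda>(i, k). if i = k then
      x powi (1 + (if i div (J + 1) = 0 then 1 else - 1) * S3_eig J (i mod (J + 1) + 1)) else 0)"

definition E_diag :: "nat \<Rightarrow> nat \<Rightarrow> complex" where
  "E_diag J n = (\<Prod>p<n - 1. qB (int J - 1) (int J - 2 * int p - 1) / qB (int J) (int J - 2 * int p))"

definition E_entry :: "nat \<Rightarrow> nat \<Rightarrow> nat \<Rightarrow> complex" where
  "E_entry J r s =
     (if r = s \<and> s \<le> J then E_diag J s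
      else if 2 \<le> s \<and> r = J + (s - 1)
        then qnum (h^2) (int (s - 1)) * E_diag J (s - 1) / qB (int J) (int J + 2 - 2 * int (s - 1))
      else 0)"

definition E_mat :: "nat \<Rightarrow> complex mat" where
  "E_mat J = mat1 (2 * J) (J + 1) (E_entry J)"

definition F_off :: "nat \<Rightarrow> nat \<Rightarrow> complex" where
  "F_off J n = E_entry J (n + J - 1) n / ((E_entry J n n)^2 + (E_entry J (n + J - 1) n)^2)"

definition F_mat :: "nat \<Rightarrow> complex mat" where
  "F_mat J = mat1 (J + 1) (2 * J) (\<lambda>r s.
      if r = 1 \<and> s = 1 then 1
      else if 2 \<le> r \<and> r \<le> J \<and> s = r + J - 1 then F_off J r
      else if 2 \<le> r \<and> r \<le> J \<and> s = r
        then (1 - F_off J r * E_entry J (r + J - 1) r) / E_entry J r r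
      else if r = J + 1 \<and> s = 2 * J then inverse (E_entry J (2 * J) (J + 1))
      else 0)"

definition R_half :: "nat \<Rightarrow> complex \<Rightarrow> complex mat" where
  "R_half J u =
     (if J = 0 then 1\<^sub>m 2
      else (\<Prod>k<J - 1. cfun (u * h powi (int J - 1 - 2 * int k))) \<cdot>\<^sub>m
        ((h^2 - inverse (h^2)) \<cdot>\<^sub>m (kron sigma_p (S_minus J) + kron sigma_m (S_plus J))
          + u \<cdot>\<^sub>m pow_I_sz_S3 h J - inverse u \<cdot>\<^sub>m pow_I_sz_S3 (inverse h) J))"

fun R_mat :: "nat \<Rightarrow> nat \<Rightarrow> complex \<Rightarrow> complex mat" where
  "R_mat 0 J2 u = 1\<^sub>m (J2 + 1)"
| "R_mat (Suc 0) J2 u = R_half J2 u"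
| "R_mat (Suc (Suc m)) J2 u =
     kron (F_mat (m + 2)) (1\<^sub>m (J2 + 1))
     * emb13 2 (m + 2) (J2 + 1) (R_half J2 (u * h powi (- int (m + 1))))
     * kron (1\<^sub>m 2) (R_mat (Suc m) J2 (u * h))
     * kron (E_mat (m + 2)) (1\<^sub>m (J2 + 1))"

definition R_norm :: "nat \<Rightarrow> nat \<Rightarrow> complex \<Rightarrow> complex" where
  "R_norm J1 J2 u =
     (\<Prod>k<J1. \<Prod>l<J2. cfun (u * h powi (int J1 + int J2 - 2 * int k - 2 * int l)))"

definition R_tilde :: "nat \<Rightarrow> nat \<Rightarrow> complex \<Rightarrow> complex mat" where
  "R_tilde J1 J2 u = inverse (R_norm J1 J2 u) \<cdot>\<^sub>m R_mat J1 J2 u"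

definition K_half :: "bparams \<Rightarrow> complex \<Rightarrow> complex mat" where
  "K_half \<beta> u = (case \<beta> of (ep, em, kp, km) \<Rightarrow> mat_of_rows_list 2
     [[u * ep + inverse u * em, kp * cfun (u^2) / (h^2 - inverse (h^2))],
      [km * cfun (u^2) / (h^2 - inverse (h^2)), u * em + inverse u * ep]])"

fun K_mat :: "bparams \<Rightarrow> nat \<Rightarrow> complex \<Rightarrow> complex mat" where
  "K_mat \<beta> 0 u = 1\<^sub>m 1"
| "K_mat \<beta> (Suc 0) u = K_half \<beta> u"
| "K_mat \<beta> (Suc (Suc m)) u =
     F_mat (m + 2)
     * kron (K_half \<beta> (u * h powi (- int (m + 1)))) (1\<^sub>m (m + 2))
     * R_half (m + 1) (u^2 * h powi (- int m))
     * kron (1\<^sub>m 2) (K_mat \<beta> (Suc m) (u * h))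
     * E_mat (m + 2)"

definition K_norm :: "nat \<Rightarrow> complex \<Rightarrow> complex" where
  "K_norm J u = (\<Prod>l<J - 1. cfun (u^2 * h powi (2 - 2 * int l)))"

definition K_tilde :: "bparams \<Rightarrow> nat \<Rightarrow> complex \<Rightarrow> complex mat" where
  "K_tilde \<beta> J u = inverse (K_norm J u) \<cdot>\<^sub>m K_mat \<beta> J u"

definition K_tilde_plus :: "bparams \<Rightarrow> nat \<Rightarrow> complex \<Rightarrow> complex mat" where
  \<comment> \<open>the argument is the tuple of barred parameters\<close>
  "K_tilde_plus \<beta> J u = (case \<beta> of (ep, em, kp, km) \<Rightarrow>
     transpose_mat (K_tilde (em, ep, - km, - kp) J (inverse u * inverse (h^2))))"

section \<open>The transfer matrix\<close>

context
  fixes Js :: "nat \<Rightarrow> nat" and v :: "nat \<Rightarrow> complex"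
begin

definition chain_dim :: "nat \<Rightarrow> nat" where
  "chain_dim N = (\<Prod>i\<in>{1..N}. Js i + 1)"

definition R_site :: "nat \<Rightarrow> nat \<Rightarrow> nat \<Rightarrow> complex \<Rightarrow> complex mat" where
  \<comment> \<open>\<open>R_tilde\<close> acting on the site \<open>i\<close> and the auxiliary space of \<open>V_N \<otimes> ... \<otimes> V_1 \<otimes> V_a\<close>\<close>
  "R_site N J i u = kron (1\<^sub>m (\<Prod>k\<in>{i<..N}. Js k + 1))
     (emb13 (Js i + 1) (\<Prod>k\<in>{1..<i}. Js k + 1) (J + 1) (R_tilde (Js i) J u))"

definition transfer_mat :: "bparams \<Rightarrow> bparams \<Rightarrow> nat \<Rightarrow> nat \<Rightarrow> complex \<Rightarrow> complex mat" where
  "transfer_mat \<beta> \<beta>' N J u =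
     ptrace (chain_dim N) (J + 1)
      (kron (1\<^sub>m (chain_dim N)) (K_tilde_plus \<beta>' J u)
       * prod_mats (chain_dim N * (J + 1)) (map (\<lambda>i. R_site N J i (u * v i)) (rev [1..<N + 1]))
       * kron (1\<^sub>m (chain_dim N)) (K_tilde \<beta> J u)
       * prod_mats (chain_dim N * (J + 1)) (map (\<lambda>i. R_site N J i (u * inverse (v i))) [1..<N + 1]))"

text \<open>
  The normalized transfer matrix is a rational function of \<open>u\<close>, which may have poles.
  Its defining formula makes sense where no normalizing factor vanishes.
\<close>
definition transfer_regular :: "nat \<Rightarrow> nat \<Rightarrow> complex \<Rightarrow> bool" where
  "transfer_regular N J u \<longleftrightarrow> u \<noteq> 0
     \<and> K_norm J u \<noteq> 0 \<and> K_norm J (inverse u * inverse (h^2)) \<noteq> 0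
     \<and> (\<forall>i\<in>{1..N}. R_norm (Js i) J (u * v i) \<noteq> 0 \<and> R_norm (Js i) J (u * inverse (v i)) \<noteq> 0)"

primrec W0_op :: "bparams \<Rightarrow> nat \<Rightarrow> complex mat" where
  "W0_op \<beta> 0 = (case \<beta> of (ep, em, kp, km) \<Rightarrow> ep \<cdot>\<^sub>m 1\<^sub>m 1)"
| "W0_op \<beta> (Suc n) = (case \<beta> of (ep, em, kp, km) \<Rightarrow>
     kron ((kp * v (Suc n) * h) \<cdot>\<^sub>m (S_plus (Js (Suc n)) * pow_S3 h (Js (Suc n)))
           + (km * inverse (v (Suc n)) * inverse h) \<cdot>\<^sub>m (S_minus (Js (Suc n)) * pow_S3 h (Js (Suc n))))
          (1\<^sub>m (chain_dim n))
     + kron (pow_S3 (h^2) (Js (Suc n))) (W0_op \<beta> n))"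

primrec W1_op :: "bparams \<Rightarrow> nat \<Rightarrow> complex mat" where
  "W1_op \<beta> 0 = (case \<beta> of (ep, em, kp, km) \<Rightarrow> em \<cdot>\<^sub>m 1\<^sub>m 1)"
| "W1_op \<beta> (Suc n) = (case \<beta> of (ep, em, kp, km) \<Rightarrow>
     kron ((kp * inverse (v (Suc n)) * inverse h) \<cdot>\<^sub>m (S_plus (Js (Suc n)) * pow_S3 (inverse h) (Js (Suc n)))
           + (km * v (Suc n) * h) \<cdot>\<^sub>m (S_minus (Js (Suc n)) * pow_S3 (inverse h) (Js (Suc n))))
          (1\<^sub>m (chain_dim n))
     + kron (pow_S3 (inverse (h^2)) (Js (Suc n))) (W1_op \<beta> n))"

end

end

end

theory Submission
  imports Defs "HOL-Computational_Algebra.Formal_Power_Series" "HOL-Computational_Algebra.Polynomial"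
begin

text \<open>
  Why the theorem is true. The operators \<open>\<W>\<^sub>0\<close>, \<open>\<W>\<^sub>1\<close> are coupled to the spin one half dressed
  K-matrix \<open>\<K>(u) = L\<^sub>N(u v\<^sub>N) \<cdots> L\<^sub>1(u v\<^sub>1) K(u) L\<^sub>1(u/v\<^sub>1) \<cdots> L\<^sub>N(u/v\<^sub>N)\<close> by two linear intertwining
  relations, and the transfer matrix of spin \<open>J/2\<close> is a scalar combination of the entries of a
  dressed K-matrix of size \<open>J + 1\<close>. The proof has two independent halves.

  The first half shows that the entries of \<open>\<K>(u)\<close> are polynomials of degree at most \<open>2N\<close> in the two
  operators. They are \<open>u X + Y/u\<close>, \<open>c(u\<^sup>2) b\<close>, \<open>c(u\<^sup>2) c\<close>, \<open>X/u + u Y\<close>, where \<open>X, Y, b, c\<close> are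
  polynomials of degree \<open>N\<close> in \<open>U = q u\<^sup>2 + 1/(q u\<^sup>2)\<close> (\<open>KK_Suc\<close>). The intertwining relations (\<open>M0_KK\<close>,
  \<open>M1_KK\<close>) express \<open>X\<close>, \<open>Y\<close> and a combination of \<open>b\<close> and \<open>c\<close> with constant coefficients through
  commutators with \<open>\<W>\<^sub>0\<close>, \<open>\<W>\<^sub>1\<close> (\<open>KK_relations\<close>). Expanding in powers of \<open>u\<^sup>-\<^sup>2\<close> gives, for every \<open>m\<close>, the
  combination \<open>k\<^sub>+ c\<^sub>m - k\<^sub>- b\<^sub>m\<close> of the coefficients of order \<open>m\<close>; a second, independent combination comes
  from the fact that \<open>\<K>(u) \<K>(1/u)\<close> is a scalar (\<open>KK_quadratic\<close>). Since \<open>q\<close> is not a root of unity the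
  two combinations can be solved, and an induction on \<open>m\<close> places \<open>b\<^sub>m, c\<^sub>m\<close> in degree \<open>2m\<close> (\<open>BC_filt\<close>)
  and hence the entries in degree \<open>2N\<close> (\<open>entries_filt\<close>).

  The second half is fusion. In a rescaled basis the fusion map \<open>\<E>\<close> becomes
  \<open>(\<E> \<psi>)(a, m) = \<psi>(a + m)\<close>, so that a state of spin \<open>S/2\<close> is a function of the total index. The relation
  \<open>\<E> K\<^sup>(\<^sup>J\<^sup>)(u) = K\<^sub>1 R\<^sub>1\<^sub>2 K\<^sub>2\<^sup>(\<^sup>J\<^sup>-\<^sup>1\<^sup>) \<E>\<close> then follows from the recursive definition as soon as its
  right-hand side is symmetric under exchange of neighbouring indices (\<open>fusion_step\<close>), and the
  symmetry is a finite computation (\<open>exch\<close>, \<open>exch_K\<close>). The relation survives dressing because each site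
  satisfies an RLL relation (\<open>FusK_dress\<close>). It writes every entry of the dressed matrix of size \<open>J + 1\<close>
  through products of an entry of size \<open>2\<close> and an entry of size \<open>J\<close>, so by induction these entries have
  degree at most \<open>2NJ\<close> (\<open>KC_filt\<close>).

  For the exact degree a representing polynomial must contain a word of length \<open>2NJ\<close>. If \<open>NJ \<ge> 2\<close>, the
  relation \<open>dolan_grady\<close> lets one add a polynomial that evaluates to \<open>0\<close> and contains such a word. If
  \<open>N = J = 1\<close>, the coefficients of the two words \<open>\<W>\<^sub>0\<W>\<^sub>1\<close> and \<open>\<W>\<^sub>1\<W>\<^sub>0\<close> are computed; they do not both
  vanish for generic parameters (\<open>transfer_two\<close>).
\<close>

section \<open>Algebras over the complex numbers\<close>

text \<open>
  The matrices on the chain have a dimension that varies with the number of sites, so they cannot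
  form a ring as a type. All algebra is therefore done in an abstract complex algebra; the
  periodic embedding \<open>pm\<close> below provides the instance in which all chains live at once.
\<close>

class calg = ring_1 +
  fixes scC :: "complex \<Rightarrow> 'a \<Rightarrow> 'a" (infixr "*\<^sub>C" 74)
  assumes scC_add_right: "a *\<^sub>C (x + y) = a *\<^sub>C x + a *\<^sub>C y"
    and scC_add_left: "(a + b) *\<^sub>C x = a *\<^sub>C x + b *\<^sub>C x"
    and scC_scC [simp]: "a *\<^sub>C b *\<^sub>C x = (a * b) *\<^sub>C x"
    and scC_one [simp]: "1 *\<^sub>C x = x"
    and scC_mult_left [simp]: "(a *\<^sub>C x) * y = a *\<^sub>C (x * y)"
    and scC_mult_right [simp]: "x * (a *\<^sub>C y) = a *\<^sub>C (x * y)"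

instantiation complex :: calg
begin
definition scC_complex :: "complex \<Rightarrow> complex \<Rightarrow> complex" where
  "scC_complex a x = a * x"
instance by standard (auto simp: scC_complex_def algebra_simps)
end

lemma scC_zero_right [simp]: "a *\<^sub>C (0::'a::calg) = 0"
  using scC_add_right[of a 0 "0::'a"] by simp
lemma scC_zero_left [simp]: "0 *\<^sub>C (x::'a::calg) = 0"
  using scC_add_left[of 0 0 x] by simp
lemma scC_minus_right [simp]: "a *\<^sub>C (- x::'a::calg) = - (a *\<^sub>C x)"
  using scC_add_right[of a x "-x"] by (simp add: eq_neg_iff_add_eq_0 add.commute)
lemma scC_minus_left [simp]: "(- a) *\<^sub>C (x::'a::calg) = - (a *\<^sub>C x)"
  using scC_add_left[of a "-a" x] by (simp add: eq_neg_iff_add_eq_0 add.commute)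
lemma scC_diff_right: "a *\<^sub>C (x - y::'a::calg) = a *\<^sub>C x - a *\<^sub>C y"
  using scC_add_right[of a x "-y"] by simp
lemma scC_diff_left: "(a - b) *\<^sub>C (x::'a::calg) = a *\<^sub>C x - b *\<^sub>C x"
  using scC_add_left[of a "-b" x] by simp
lemma scC_sum_right: "a *\<^sub>C (sum f A::'a::calg) = (\<Sum>i\<in>A. a *\<^sub>C f i)"
  by (induction A rule: infinite_finite_induct) (auto simp: scC_add_right)
lemma scC_sum_left: "(sum f A) *\<^sub>C (x::'a::calg) = (\<Sum>i\<in>A. f i *\<^sub>C x)"
  by (induction A rule: infinite_finite_induct) (auto simp: scC_add_left)
lemma scC_cancel: "a \<noteq> 0 \<Longrightarrow> a *\<^sub>C (x::'a::calg) = a *\<^sub>C y \<longleftrightarrow> x = y"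
  by (metis left_inverse scC_one scC_scC)

lemmas calg_simps = scC_add_right scC_add_left scC_diff_right scC_diff_left algebra_simps

section \<open>Matrices of size two over an algebra and the operators of a site\<close>

datatype 'a m22 = M22 (m11: 'a) (m12: 'a) (m21: 'a) (m22: 'a)

instantiation m22 :: (calg) monoid_mult
begin
definition "one_m22 = M22 1 0 0 1"
fun times_m22 :: "'a m22 \<Rightarrow> 'a m22 \<Rightarrow> 'a m22" where
  "times_m22 (M22 a b c d) (M22 a' b' c' d') =
     M22 (a * a' + b * c') (a * b' + b * d') (c * a' + d * c') (c * b' + d * d')"
instance
proof
  fix x y z :: "'a m22"
  show "x * y * z = x * (y * z)" by (cases x; cases y; cases z) (simp add: algebra_simps)
  show "1 * x = x" "x * 1 = x" by (cases x; simp add: one_m22_def)+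
qed
end

definition sM :: "complex \<Rightarrow> 'a::calg m22" where "sM s = M22 (s *\<^sub>C 1) 0 0 (s *\<^sub>C 1)"

lemma sM_comm: "sM s * A = A * sM s"
  by (cases A) (simp add: sM_def)
lemma sM_mult: "sM s * sM t = sM (s * t)"
  by (simp add: sM_def) (simp only: mult.commute)

text \<open>The relations of the quantum group in the form in which a site uses them: \<open>k\<close> is \<open>q\<close> to the power
  \<open>S\<^sub>3/2\<close>, and \<open>e\<close>, \<open>f\<close> are the raising and lowering operators scaled by \<open>q - 1/q\<close>, which removes all
  denominators. The central value \<open>kap\<close> is that of the Casimir element.\<close>

locale qsite =
  fixes h hi kap :: complex and e f k k' :: "'r::calg"
  assumes hhi: "h * hi = 1" and kk': "k * k' = 1" and k'k: "k' * k = 1"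
    and ke: "k * e = (h * h) *\<^sub>C (e * k)" and k'e: "k' * e = (hi * hi) *\<^sub>C (e * k')"
    and kf: "k * f = (hi * hi) *\<^sub>C (f * k)" and k'f: "k' * f = (h * h) *\<^sub>C (f * k')"
    and fe: "f * e = kap *\<^sub>C 1 - (h * h) *\<^sub>C (k * k) - (hi * hi) *\<^sub>C (k' * k')"
    and ef: "e * f = kap *\<^sub>C 1 - (hi * hi) *\<^sub>C (k * k) - (h * h) *\<^sub>C (k' * k')"
begin

lemma assoc_rules:
  "h * (hi * a) = a"
  "k * (k' * z) = z" "k' * (k * z) = z"
  "k * (e * z) = (h * h) *\<^sub>C (e * (k * z))" "k' * (e * z) = (hi * hi) *\<^sub>C (e * (k' * z))"
  "k * (f * z) = (hi * hi) *\<^sub>C (f * (k * z))" "k' * (f * z) = (h * h) *\<^sub>C (f * (k' * z))"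
  "f * (e * z) = kap *\<^sub>C z - (h * h) *\<^sub>C (k * (k * z)) - (hi * hi) *\<^sub>C (k' * (k' * z))"
  "e * (f * z) = kap *\<^sub>C z - (hi * hi) *\<^sub>C (k * (k * z)) - (h * h) *\<^sub>C (k' * (k' * z))"
  by (simp_all only: mult.assoc[symmetric] hhi kk' k'k ke k'e kf k'f fe ef scC_mult_left
      left_diff_distrib mult_1_left)

lemmas rules = hhi kk' k'k ke k'e kf k'f fe ef assoc_rules

definition L :: "complex \<Rightarrow> complex \<Rightarrow> 'r m22" where
  "L x xi = M22 ((x * h) *\<^sub>C k - (xi * hi) *\<^sub>C k') f e ((x * h) *\<^sub>C k' - (xi * hi) *\<^sub>C k)"

lemma inv_assoc: "(x::complex) * y = 1 \<Longrightarrow> x * (y * z) = z"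
  by (metis mult.assoc mult_1)

text \<open>The products \<open>e f\<close> and \<open>f e\<close> reduce to \<open>k\<^sup>2\<close> and \<open>k\<^sup>-\<^sup>2\<close>; this is where the Casimir value enters.\<close>

lemma L_unit:
  assumes "x * xi = 1"
  shows "L x xi * L xi x = sM (kap - x * x - xi * xi)"
  using assms inv_assoc[OF assms]
  by (simp add: L_def sM_def rules calg_simps)
text \<open>One step of the dressing of the intertwining relation: the left-hand matrix is the one with the
  operator of the longer chain, the right-hand one with the operator of the shorter chain,
  multiplied by \<open>k\<^sup>2\<close>.\<close>

lemma L_M0:
  fixes kp km :: complex
  assumes u: "u * ui = 1" and v: "v * vi = 1"
    and comm: "W * k = k * W" "W * k' = k' * W" "W * e = e * W" "W * f = f * W"
  defines "w \<equiv> (kp * v * h) *\<^sub>C (e * k) + (km * vi * hi) *\<^sub>C (f * k)"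
  shows "L (u * vi) (ui * v) *
         M22 ((h * h) *\<^sub>C (w + k * (k * W))) (((h * h - hi * hi) * kp * u) *\<^sub>C 1)
             (((h * h - hi * hi) * km * ui) *\<^sub>C 1) ((hi * hi) *\<^sub>C (w + k * (k * W)))
       = M22 (w + (h * h) *\<^sub>C (k * (k * W))) (((h * h - hi * hi) * kp * u) *\<^sub>C (k * k))
             (((h * h - hi * hi) * km * ui) *\<^sub>C (k * k)) (w + (hi * hi) *\<^sub>C (k * (k * W)))
         * L (u * vi) (ui * v)"
proof -
  have c2: "W * (k * z) = k * (W * z)" "W * (k' * z) = k' * (W * z)" "W * (e * z) = e * (W * z)"
    "W * (f * z) = f * (W * z)" for z
    using comm by (metis mult.assoc)+
  show ?thesis
    unfolding w_def L_def
    by (simp add: rules comm c2 u v inv_assoc[OF u] inv_assoc[OF v] calg_simps)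
qed

end

definition kmat :: "complex \<Rightarrow> complex \<Rightarrow> 'r::calg \<Rightarrow> 'r \<Rightarrow> 'r \<Rightarrow> 'r \<Rightarrow> 'r m22" where
  "kmat u ui X Y b c = M22 (u *\<^sub>C X + ui *\<^sub>C Y) ((u * u - ui * ui) *\<^sub>C b)
     ((u * u - ui * ui) *\<^sub>C c) (ui *\<^sub>C X + u *\<^sub>C Y)"

definition R6 :: "complex \<Rightarrow> complex \<Rightarrow> complex \<Rightarrow> complex \<Rightarrow> nat \<Rightarrow> nat \<Rightarrow> nat \<Rightarrow> nat \<Rightarrow> complex" where
  "R6 h hi z zi a b a' b' = (if a = b \<and> a' = a \<and> b' = a then z * h * h - zi * hi * hi
     else if a \<noteq> b \<and> a' = a \<and> b' = b then z - zi
     else if a \<noteq> b \<and> a' = b \<and> b' = a then h * h - hi * hi else 0)"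

context qsite begin

lemma M0_L:
  fixes kp km :: complex
  assumes u: "u * ui = 1" and v: "v * vi = 1"
    and comm: "W * k = k * W" "W * k' = k' * W" "W * e = e * W" "W * f = f * W"
  defines "w \<equiv> (kp * v * h) *\<^sub>C (e * k) + (km * vi * hi) *\<^sub>C (f * k)"
  shows "M22 ((h * h) *\<^sub>C (w + k * (k * W))) (((h * h - hi * hi) * kp * ui) *\<^sub>C 1)
             (((h * h - hi * hi) * km * u) *\<^sub>C 1) ((hi * hi) *\<^sub>C (w + k * (k * W)))
         * L (u * v) (ui * vi)
       = L (u * v) (ui * vi)
         * M22 (w + (h * h) *\<^sub>C (k * (k * W))) (((h * h - hi * hi) * kp * ui) *\<^sub>C (k * k))
             (((h * h - hi * hi) * km * u) *\<^sub>C (k * k)) (w + (hi * hi) *\<^sub>C (k * (k * W)))"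
proof -
  have c2: "W * (k * z) = k * (W * z)" "W * (k' * z) = k' * (W * z)" "W * (e * z) = e * (W * z)"
    "W * (f * z) = f * (W * z)" for z
    using comm by (metis mult.assoc)+
  show ?thesis
    unfolding w_def L_def
    by (simp add: rules comm c2 u v inv_assoc[OF u] inv_assoc[OF v] calg_simps)
qed

lemma L_M1:
  fixes kp km :: complex
  assumes u: "u * ui = 1" and v: "v * vi = 1"
    and comm: "W * k = k * W" "W * k' = k' * W" "W * e = e * W" "W * f = f * W"
  defines "w \<equiv> (kp * vi * hi) *\<^sub>C (e * k') + (km * v * h) *\<^sub>C (f * k')"
  shows "L (u * vi) (ui * v) *
         M22 ((hi * hi) *\<^sub>C (w + k' * (k' * W))) (((h * h - hi * hi) * kp * ui) *\<^sub>C 1)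
             (((h * h - hi * hi) * km * u) *\<^sub>C 1) ((h * h) *\<^sub>C (w + k' * (k' * W)))
       = M22 (w + (hi * hi) *\<^sub>C (k' * (k' * W))) (((h * h - hi * hi) * kp * ui) *\<^sub>C (k' * k'))
             (((h * h - hi * hi) * km * u) *\<^sub>C (k' * k')) (w + (h * h) *\<^sub>C (k' * (k' * W)))
         * L (u * vi) (ui * v)"
proof -
  have c2: "W * (k * z) = k * (W * z)" "W * (k' * z) = k' * (W * z)" "W * (e * z) = e * (W * z)"
    "W * (f * z) = f * (W * z)" for z
    using comm by (metis mult.assoc)+
  show ?thesis
    unfolding w_def L_def
    by (simp add: rules comm c2 u v inv_assoc[OF u] inv_assoc[OF v] calg_simps)
qed

lemma M1_L:
  fixes kp km :: complex
  assumes u: "u * ui = 1" and v: "v * vi = 1"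
    and comm: "W * k = k * W" "W * k' = k' * W" "W * e = e * W" "W * f = f * W"
  defines "w \<equiv> (kp * vi * hi) *\<^sub>C (e * k') + (km * v * h) *\<^sub>C (f * k')"
  shows "M22 ((hi * hi) *\<^sub>C (w + k' * (k' * W))) (((h * h - hi * hi) * kp * u) *\<^sub>C 1)
             (((h * h - hi * hi) * km * ui) *\<^sub>C 1) ((h * h) *\<^sub>C (w + k' * (k' * W)))
         * L (u * v) (ui * vi)
       = L (u * v) (ui * vi)
         * M22 (w + (hi * hi) *\<^sub>C (k' * (k' * W))) (((h * h - hi * hi) * kp * u) *\<^sub>C (k' * k'))
             (((h * h - hi * hi) * km * ui) *\<^sub>C (k' * k')) (w + (h * h) *\<^sub>C (k' * (k' * W)))"
proof -
  have c2: "W * (k * z) = k * (W * z)" "W * (k' * z) = k' * (W * z)" "W * (e * z) = e * (W * z)"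
    "W * (f * z) = f * (W * z)" for z
    using comm by (metis mult.assoc)+
  show ?thesis
    unfolding w_def L_def
    by (simp add: rules comm c2 u v inv_assoc[OF u] inv_assoc[OF v] calg_simps)
qed

text \<open>The shape of the K-matrix is stable under dressing by a site. The new entries \<open>X, Y, b, c\<close> are
  again free of \<open>u\<close> except through the symmetric variable \<open>U\<close>, and the degree in \<open>U\<close> grows by one.\<close>

lemma L_kmat_L:
  assumes u: "u * ui = 1" and v: "v * vi = 1"
    and commX: "X * k = k * X" "X * k' = k' * X" "X * e = e * X" "X * f = f * X"
    and commY: "Y * k = k * Y" "Y * k' = k' * Y" "Y * e = e * Y" "Y * f = f * Y"
    and commb: "b * k = k * b" "b * k' = k' * b" "b * e = e * b" "b * f = f * b"
    and commc: "c * k = k * c" "c * k' = k' * c" "c * e = e * c" "c * f = f * c"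
    and U: "U = h * h * u * u + hi * hi * ui * ui"
  shows "L (u * v) (ui * vi) * kmat u ui X Y b c * L (u * vi) (ui * v) =
    kmat u ui
     (U *\<^sub>C (k * (k * X)) - (v * v + vi * vi) *\<^sub>C X + kap *\<^sub>C Y - (h * h + hi * hi) *\<^sub>C (k' * (k' * Y))
       + (U * v * hi) *\<^sub>C (k * (e * b)) - ((h * h + hi * hi) * vi * h) *\<^sub>C (k' * (e * b))
       + (U * vi * hi) *\<^sub>C (f * (k * c)) - ((h * h + hi * hi) * v * h) *\<^sub>C (f * (k' * c)))
     (U *\<^sub>C (k' * (k' * Y)) - (v * v + vi * vi) *\<^sub>C Y + kap *\<^sub>C X - (h * h + hi * hi) *\<^sub>C (k * (k * X))
       + (U * vi * h) *\<^sub>C (k' * (e * b)) - ((h * h + hi * hi) * v * hi) *\<^sub>C (k * (e * b))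
       + (U * v * h) *\<^sub>C (f * (k' * c)) - ((h * h + hi * hi) * vi * hi) *\<^sub>C (f * (k * c)))
     (U *\<^sub>C b - (v * v) *\<^sub>C (k * (k * b)) - (vi * vi) *\<^sub>C (k' * (k' * b))
       + (v * hi) *\<^sub>C (f * (k * X)) + (vi * h) *\<^sub>C (f * (k' * Y)) + f * (f * c))
     (U *\<^sub>C c - (v * v) *\<^sub>C (k' * (k' * c)) - (vi * vi) *\<^sub>C (k * (k * c))
       + (vi * h) *\<^sub>C (e * (k * X)) + (v * hi) *\<^sub>C (e * (k' * Y)) + e * (e * b))"
proof -
  have c2: "X * (k * z) = k * (X * z)" "X * (k' * z) = k' * (X * z)" "X * (e * z) = e * (X * z)"
    "X * (f * z) = f * (X * z)" 
    "Y * (k * z) = k * (Y * z)" "Y * (k' * z) = k' * (Y * z)" "Y * (e * z) = e * (Y * z)"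
    "Y * (f * z) = f * (Y * z)" 
    "b * (k * z) = k * (b * z)" "b * (k' * z) = k' * (b * z)" "b * (e * z) = e * (b * z)"
    "b * (f * z) = f * (b * z)" 
    "c * (k * z) = k * (c * z)" "c * (k' * z) = k' * (c * z)" "c * (e * z) = e * (c * z)"
    "c * (f * z) = f * (c * z)" for z
    using commX commY commb commc by (metis mult.assoc)+
  show ?thesis
    unfolding L_def kmat_def U
    by (simp add: rules commX commY commb commc c2 u v inv_assoc[OF u] inv_assoc[OF v] calg_simps)
qed

definition Lent :: "complex \<Rightarrow> complex \<Rightarrow> nat \<Rightarrow> nat \<Rightarrow> 'r" where
  "Lent x xi a b = (if a = 0 \<and> b = 0 then (x * h) *\<^sub>C k - (xi * hi) *\<^sub>C k'
     else if a = 0 \<and> b = 1 then f else if a = 1 \<and> b = 0 then e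
     else if a = 1 \<and> b = 1 then (x * h) *\<^sub>C k' - (xi * hi) *\<^sub>C k else 0)"

lemma RLL:
  assumes x: "x * xi = 1" and y: "y * yi = 1" and "a < 2" "b < 2" "a' < 2" "b' < 2"
  shows "(\<Sum>b1<2. \<Sum>a2<2. R6 h hi (x * y) (xi * yi) a b1 a2 b' *\<^sub>C (Lent x xi b b1 * Lent y yi a2 a'))
       = (\<Sum>a1<2. \<Sum>b2<2. R6 h hi (x * y) (xi * yi) a1 b a' b2 *\<^sub>C (Lent y yi a a1 * Lent x xi b2 b'))"
proof -
  have *: "{..<2::nat} = {0, 1}" by auto
  have "a = 0 \<or> a = 1" "b = 0 \<or> b = 1" "a' = 0 \<or> a' = 1" "b' = 0 \<or> b' = 1" using assms by auto
  then show ?thesis unfolding *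
    by (elim disjE; simp add: Lent_def R6_def rules x y inv_assoc[OF x] inv_assoc[OF y] calg_simps)
qed

end

no_notation vec_index (infixl "$" 100)
unbundle fps_syntax

section \<open>The filtration by word length\<close>

definition wordv :: "'r::calg \<Rightarrow> 'r \<Rightarrow> nc_var list \<Rightarrow> 'r" where
  "wordv A B w = prod_list (map (\<lambda>x. case x of X0 \<Rightarrow> A | X1 \<Rightarrow> B) w)"

text \<open>The span of the words of length at most \<open>d\<close>. Membership is the notion of degree of the theorem for
  an operator, which need not have a unique representing polynomial.\<close>

inductive_set filt :: "'r::calg \<Rightarrow> 'r \<Rightarrow> nat \<Rightarrow> 'r set" for A B d where
  word: "length w \<le> d \<Longrightarrow> wordv A B w \<in> filt A B d"
| add: "x \<in> filt A B d \<Longrightarrow> y \<in> filt A B d \<Longrightarrow> x + y \<in> filt A B d"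
| scC: "x \<in> filt A B d \<Longrightarrow> a *\<^sub>C x \<in> filt A B d"

lemma filt_one: "1 \<in> filt A B d"
  using filt.word[of "[]" d A B] by (simp add: wordv_def)
lemma filt_zero: "0 \<in> filt A B d"
  using filt.scC[OF filt_one, of 0] by simp
lemma filt_minus: "x \<in> filt A B d \<Longrightarrow> - x \<in> filt A B d"
  using filt.scC[of x A B d "-1"] by simp
lemma filt_diff: "x \<in> filt A B d \<Longrightarrow> y \<in> filt A B d \<Longrightarrow> x - y \<in> filt A B d"
  using filt.add[OF _ filt_minus] by fastforce
lemma filt_sum: "(\<And>i. i \<in> I \<Longrightarrow> g i \<in> filt A B d) \<Longrightarrow> sum g I \<in> filt A B d"
  by (induction I rule: infinite_finite_induct) (auto simp: filt_zero intro: filt.add)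
lemma filt_mono: "x \<in> filt A B d \<Longrightarrow> d \<le> d' \<Longrightarrow> x \<in> filt A B d'"
  by (induction rule: filt.induct) (auto intro: filt.intros)
lemma filt_mult:
  assumes "x \<in> filt A B d" "y \<in> filt A B d'" shows "x * y \<in> filt A B (d + d')"
  using assms(1)
proof (induction rule: filt.induct)
  case (word w)
  show ?case using assms(2)
  proof (induction rule: filt.induct)
    case (word w')
    then show ?case using \<open>length w \<le> d\<close> filt.word[of "w @ w'" "d + d'" A B]
      by (simp add: wordv_def)
  qed (auto simp: distrib_left intro: filt.intros)
qed (auto simp: distrib_right intro: filt.intros)
lemma filt_mult_le:
  "x \<in> filt A B d \<Longrightarrow> y \<in> filt A B d' \<Longrightarrow> d + d' \<le> d'' \<Longrightarrow> x * y \<in> filt A B d''"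
  using filt_mult filt_mono by blast
lemma filt_gen: "1 \<le> d \<Longrightarrow> A \<in> filt A B d" "1 \<le> d \<Longrightarrow> B \<in> filt A B d"
  using filt.word[of "[X0]" d A B] filt.word[of "[X1]" d A B] by (auto simp: wordv_def)
lemma filt_scC_iff: "a \<noteq> 0 \<Longrightarrow> a *\<^sub>C x \<in> filt A B d \<longleftrightarrow> x \<in> filt A B d"
  using filt.scC[of "a *\<^sub>C x" A B d "inverse a"] filt.scC[of x A B d a] by auto

section \<open>Coefficients of polynomials with values in a subspace\<close>

definition subsp :: "'r::calg set \<Rightarrow> bool" where
  "subsp S \<longleftrightarrow> 0 \<in> S \<and> (\<forall>x\<in>S. \<forall>y\<in>S. x + y \<in> S) \<and> (\<forall>a. \<forall>x\<in>S. a *\<^sub>C x \<in> S)"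

lemma subsp_diff: "subsp S \<Longrightarrow> x \<in> S \<Longrightarrow> y \<in> S \<Longrightarrow> x - y \<in> S"
  unfolding subsp_def by (metis scC_minus_left scC_one uminus_add_conv_diff add.commute)

lemma subsp_sum: "subsp S \<Longrightarrow> (\<And>i. i \<in> I \<Longrightarrow> g i \<in> S) \<Longrightarrow> sum g I \<in> S"
  by (induction I rule: infinite_finite_induct) (auto simp: subsp_def)

text \<open>A polynomial whose values lie in a subspace for all large arguments has its coefficients there, since
  a suitable combination of the values at \<open>w\<close> and \<open>2w\<close> removes the leading term.\<close>

lemma coeff_extraction:
  fixes r :: "nat \<Rightarrow> 'r::calg"
  assumes S: "subsp S" and "\<And>w. norm w > K \<Longrightarrow> (\<Sum>i\<le>M. w ^ i *\<^sub>C r i) \<in> S" and "i \<le> M"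
  shows "r i \<in> S"
  using assms(2,3)
proof (induction M arbitrary: r i)
  case 0
  have "(\<Sum>i\<le>0. (of_real (\<bar>K\<bar> + 1)) ^ i *\<^sub>C r i) \<in> S"
    by (rule 0(1)) (auto simp del: of_real_add)
  then show ?case using 0 by simp
next
  case (Suc M)
  have lower: "r j \<in> S" if "j \<le> M" for j
  proof -
    have "(\<Sum>i\<le>M. w ^ i *\<^sub>C ((2 ^ i - 2 ^ Suc M) *\<^sub>C r i)) \<in> S" if "norm w > K" for w
    proof -
      have "norm (2 * w) > K" using that norm_ge_zero[of w] unfolding norm_mult norm_numeral by linarith
      then have "(\<Sum>i\<le>Suc M. (2 * w) ^ i *\<^sub>C r i) - 2 ^ Suc M *\<^sub>C (\<Sum>i\<le>Suc M. w ^ i *\<^sub>C r i) \<in> S"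
        using subsp_diff[OF S Suc.prems(1)[of "2 * w"], of "2 ^ Suc M *\<^sub>C (\<Sum>i\<le>Suc M. w ^ i *\<^sub>C r i)"]
          Suc.prems(1)[OF that] S by (auto simp: subsp_def)
      moreover have "(\<Sum>i\<le>Suc M. (2 * w) ^ i *\<^sub>C r i) - 2 ^ Suc M *\<^sub>C (\<Sum>i\<le>Suc M. w ^ i *\<^sub>C r i)
          = (\<Sum>i\<le>Suc M. w ^ i *\<^sub>C ((2 ^ i - 2 ^ Suc M) *\<^sub>C r i))"
        unfolding scC_sum_right sum_subtractf[symmetric]
        by (intro sum.cong) (auto simp: scC_diff_left scC_diff_right power_mult_distrib algebra_simps)
      ultimately show ?thesis by simp
    qed
    from Suc.IH[OF this that] have *: "(2 ^ j - 2 ^ Suc M) *\<^sub>C r j \<in> S" .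
    have "(2::nat) ^ j < 2 ^ Suc M" using that by (intro power_strict_increasing) auto
    then have "(2::nat) ^ j \<noteq> 2 ^ Suc M" by simp
    then have "(2::complex) ^ j - 2 ^ Suc M \<noteq> 0"
      by (metis of_nat_eq_iff of_nat_numeral of_nat_power right_minus_eq)
    with * S have "inverse (2 ^ j - 2 ^ Suc M) *\<^sub>C ((2 ^ j - 2 ^ Suc M) *\<^sub>C r j) \<in> S"
      unfolding subsp_def by blast
    with \<open>(2::complex) ^ j - 2 ^ Suc M \<noteq> 0\<close> show ?thesis by simp
  qed
  show ?case
  proof (cases "i \<le> M")
    case False
    then have [simp]: "i = Suc M" using Suc.prems by simp
    define w :: complex where "w = of_real (\<bar>K\<bar> + 1)"
    have w: "norm w > K" "w \<noteq> 0" unfolding w_def by (auto simp del: of_real_add)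
    have "(\<Sum>i\<le>M. w ^ i *\<^sub>C r i) \<in> S"
      using lower S by (intro subsp_sum) (auto simp: subsp_def)
    then have "w ^ Suc M *\<^sub>C r (Suc M) \<in> S"
      using subsp_diff[OF S Suc.prems(1)[OF w(1)], of "(\<Sum>i\<le>M. w ^ i *\<^sub>C r i)"] by simp
    then have "inverse (w ^ Suc M) *\<^sub>C (w ^ Suc M *\<^sub>C r (Suc M)) \<in> S" using S unfolding subsp_def by blast
    with w show ?thesis by (simp add: field_simps)
  qed (use lower in auto)
qed

section \<open>Representation of polynomial functions near infinity\<close>

text \<open>A polynomial function is recorded by the formal power series of its coefficients. Only large
  arguments are compared, because there every argument is attained by a suitable spectral parameter.\<close>

definition rep :: "(complex \<Rightarrow> 'r::calg) \<Rightarrow> 'r fps \<Rightarrow> bool" where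
  "rep g p \<longleftrightarrow> (\<exists>M K. (\<forall>i>M. p $ i = 0) \<and> (\<forall>w. norm w > K \<longrightarrow> g w = (\<Sum>i\<le>M. w ^ i *\<^sub>C p $ i)))"

lemma rep_extend:
  assumes "\<forall>i>M. p $ i = (0::'r::calg)" "M \<le> M'"
  shows "(\<Sum>i\<le>M'. w ^ i *\<^sub>C p $ i) = (\<Sum>i\<le>M. w ^ i *\<^sub>C p $ i)"
  using assms by (intro sum.mono_neutral_right) auto

lemma repE:
  assumes "rep g p" "rep g' p'"
  obtains M K where "\<forall>i>M. p $ i = 0" "\<forall>i>M. p' $ i = 0"
    "\<And>w. norm w > K \<Longrightarrow> g w = (\<Sum>i\<le>M. w ^ i *\<^sub>C p $ i)"
    "\<And>w. norm w > K \<Longrightarrow> g' w = (\<Sum>i\<le>M. w ^ i *\<^sub>C p' $ i)"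
proof -
  from assms obtain M K M' K' where *: "\<forall>i>M. p $ i = 0" "\<forall>w. norm w > K \<longrightarrow> g w = (\<Sum>i\<le>M. w ^ i *\<^sub>C p $ i)"
    "\<forall>i>M'. p' $ i = 0" "\<forall>w. norm w > K' \<longrightarrow> g' w = (\<Sum>i\<le>M'. w ^ i *\<^sub>C p' $ i)"
    unfolding rep_def by blast
  show ?thesis
    by (rule that[of "max M M'" "max K K'"])
      (use * rep_extend[OF *(1), of "max M M'"] rep_extend[OF *(3), of "max M M'"] in auto)
qed

lemma rep_add: "rep g p \<Longrightarrow> rep g' p' \<Longrightarrow> rep (\<lambda>w. g w + g' w) (p + p')"
  by (erule (1) repE, unfold rep_def, rule_tac x = M in exI, rule_tac x = K in exI)
    (auto simp: scC_add_right sum.distrib)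
lemma rep_diff: "rep g p \<Longrightarrow> rep g' p' \<Longrightarrow> rep (\<lambda>w. g w - g' w) (p - p')"
  by (erule (1) repE, unfold rep_def, rule_tac x = M in exI, rule_tac x = K in exI)
    (auto simp: scC_diff_right sum_subtractf)
lemma rep_const: "rep (\<lambda>w. x) (fps_const x)"
  unfolding rep_def by (rule exI[of _ 0], rule exI[of _ 0]) auto
lemma rep_mult:
  assumes "rep g p" "rep g' p'" shows "rep (\<lambda>w. g w * g' w) (p * p')"
proof -
  from assms obtain M K where *: "\<forall>i>M. p $ i = 0" "\<forall>i>M. p' $ i = 0"
    "\<And>w. norm w > K \<Longrightarrow> g w = (\<Sum>i\<le>M. w ^ i *\<^sub>C p $ i)"
    "\<And>w. norm w > K \<Longrightarrow> g' w = (\<Sum>i\<le>M. w ^ i *\<^sub>C p' $ i)"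
    by (rule repE) blast
  have "p $ i * p' $ (n - i) = 0" if "n > 2 * M" "i \<le> n" for n i
    using *(1,2) that by (cases "i > M") auto
  then have 1: "\<forall>n>2*M. (p * p') $ n = 0" by (simp add: fps_mult_nth)
  have "g w * g' w = (\<Sum>n\<le>2*M. w ^ n *\<^sub>C (p * p') $ n)" if "norm w > K" for w
  proof -
    have "g w * g' w = (\<Sum>(i,j)\<in>{..M}\<times>{..M}. w ^ (i + j) *\<^sub>C (p $ i * p' $ j))"
      by (simp add: *(3,4) that sum_product sum.cartesian_product power_add mult.commute)
    also have "\<dots> = (\<Sum>(i,j)\<in>{(i,j). i + j \<le> 2 * M}. w ^ (i + j) *\<^sub>C (p $ i * p' $ j))"
    proof (rule sum.mono_neutral_left)
      have "{(i, j). i + j \<le> 2 * M} \<subseteq> {..2*M} \<times> {..2*M}" by auto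
      then show "finite {(i, j). i + j \<le> 2 * M}" by (rule finite_subset) auto
      show "\<forall>x\<in>{(i, j). i + j \<le> 2 * M} - {..M} \<times> {..M}. (case x of (i, j) \<Rightarrow> w ^ (i + j) *\<^sub>C (p $ i * p' $ j)) = 0"
        using *(1,2) by auto (metis mult_zero_left mult_zero_right not_le scC_zero_right)+
    qed auto
    also have "\<dots> = (\<Sum>n\<le>2*M. \<Sum>i\<le>n. w ^ (i + (n - i)) *\<^sub>C (p $ i * p' $ (n - i)))"
      by (rule sum.triangle_reindex_eq)
    finally show ?thesis by (simp add: fps_mult_nth scC_sum_right atLeast0AtMost)
  qed
  with 1 show ?thesis unfolding rep_def by blast
qed
lemma rep_scC: "rep g p \<Longrightarrow> rep (\<lambda>w. a *\<^sub>C g w) (fps_const (a *\<^sub>C 1) * p)"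
  using rep_mult[OF rep_const[of "a *\<^sub>C 1"], of g p] by simp
lemma rep_X: "rep (\<lambda>w. w *\<^sub>C 1) fps_X"
  unfolding rep_def by (rule exI[of _ 1], rule exI[of _ 0]) (auto simp: fps_X_def)
lemma rep_wpow: "rep g p \<Longrightarrow> rep (\<lambda>w. w ^ n *\<^sub>C g w) (fps_X ^ n * p)"
proof (induction n)
  case (Suc n)
  then show ?case using rep_mult[OF rep_X Suc.IH[OF Suc.prems]]
    by (simp add: mult.assoc mult.commute[where 'a = complex])
qed simp
lemma rep_scale:
  assumes "rep g p" "s \<noteq> 0" shows "rep (\<lambda>w. g (s * w)) (Abs_fps (\<lambda>i. s ^ i *\<^sub>C p $ i))"
proof -
  from assms(1) obtain M K where *: "\<forall>i>M. p $ i = 0" "\<And>w. norm w > K \<Longrightarrow> g w = (\<Sum>i\<le>M. w ^ i *\<^sub>C p $ i)"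
    unfolding rep_def by blast
  have "norm w > K / norm s \<Longrightarrow> norm (s * w) > K" for w
    using assms(2) by (simp add: norm_mult divide_less_eq mult.commute)
  with * show ?thesis unfolding rep_def
    by (intro exI[of _ M] exI[of _ "K / norm s"]) (auto simp: power_mult_distrib mult.commute)
qed
lemma rep_subsp:
  assumes "rep g p" "subsp S" "\<And>w. norm w > K \<Longrightarrow> g w \<in> S" shows "p $ i \<in> S"
proof -
  from assms(1) obtain M K' where *: "\<forall>i>M. p $ i = 0" "\<And>w. norm w > K' \<Longrightarrow> g w = (\<Sum>i\<le>M. w ^ i *\<^sub>C p $ i)"
    unfolding rep_def by blast
  show ?thesis
  proof (cases "i \<le> M")
    case True
    show ?thesis
      by (rule coeff_extraction[OF assms(2) _ True, where K = "max K K'"]) (metis *(2) assms(3) max_less_iff_conj)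
  qed (use * assms(2) in \<open>auto simp: subsp_def\<close>)
qed
lemma rep_unique:
  assumes "rep g p" "rep g' p'" "\<And>w. norm w > K \<Longrightarrow> g w = g' w" shows "p = p'"
proof -
  have "(p - p') $ i \<in> {0}" for i
    by (rule rep_subsp[OF rep_diff[OF assms(1,2)], where K = K]) (auto simp: subsp_def assms(3))
  then show ?thesis by (simp add: fps_eq_iff)
qed

lemma fps_mult_filt:
  assumes "\<And>i. i \<le> j \<Longrightarrow> a $ i \<in> filt A B (2 * i + s)" "\<And>i. i \<le> j \<Longrightarrow> b $ i \<in> filt A B (2 * i + t)"
    "2 * j + s + t \<le> d"
  shows "(a * b) $ j \<in> filt A B d"
  unfolding fps_mult_nth
  by (intro filt_sum filt_mult_le[OF assms(1,2)]) (use assms(3) in auto)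

text \<open>polynomials in U\<close>

text \<open>A polynomial of formal degree \<open>n\<close> with prescribed coefficient of \<open>U^n\<close>, the coefficients being listed
  from the top.\<close>

definition PU :: "nat \<Rightarrow> 'r::calg \<Rightarrow> (complex \<Rightarrow> 'r) \<Rightarrow> bool" where
  "PU n r0 g \<longleftrightarrow> (\<exists>r. r 0 = r0 \<and> (\<forall>U. g U = (\<Sum>m\<le>n. U ^ (n - m) *\<^sub>C r m)))"

lemma PU_U: "PU n r0 g \<Longrightarrow> PU (Suc n) r0 (\<lambda>U. U *\<^sub>C g U)"
  unfolding PU_def
proof (elim exE conjE)
  fix r assume r: "r 0 = r0" "\<forall>U. g U = (\<Sum>m\<le>n. U ^ (n - m) *\<^sub>C r m)"
  show "\<exists>r. r 0 = r0 \<and> (\<forall>U. U *\<^sub>C g U = (\<Sum>m\<le>Suc n. U ^ (Suc n - m) *\<^sub>C r m))"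
    using r by (intro exI[of _ "\<lambda>m. if m \<le> n then r m else 0"])
      (auto simp: scC_sum_right Suc_diff_le intro!: sum.cong)
qed
lemma PU_shift: "PU n r0 g \<Longrightarrow> PU (Suc n) 0 g"
  unfolding PU_def
proof (elim exE conjE)
  fix r assume r: "r 0 = r0" "\<forall>U. g U = (\<Sum>m\<le>n. U ^ (n - m) *\<^sub>C r m)"
  show "\<exists>r. r 0 = 0 \<and> (\<forall>U. g U = (\<Sum>m\<le>Suc n. U ^ (Suc n - m) *\<^sub>C r m))"
    using r by (intro exI[of _ "\<lambda>m. if m = 0 then 0 else r (m - 1)"])
      (auto simp: sum.atMost_Suc_shift simp del: sum.atMost_Suc)
qed
lemma PU_add: "PU n r0 g \<Longrightarrow> PU n r0' g' \<Longrightarrow> PU n (r0 + r0') (\<lambda>U. g U + g' U)"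
  unfolding PU_def
  by (elim exE conjE, rule_tac x = "\<lambda>m. r m + ra m" in exI) (auto simp: scC_add_right sum.distrib)
lemma PU_lmult: "PU n r0 g \<Longrightarrow> PU n (x * r0) (\<lambda>U. x * g U)"
  unfolding PU_def
  by (elim exE conjE, rule_tac x = "\<lambda>m. x * r m" in exI) (auto simp: sum_distrib_left)
lemma PU_scC: "PU n r0 g \<Longrightarrow> PU n (a *\<^sub>C r0) (\<lambda>U. a *\<^sub>C g U)"
  unfolding PU_def
  by (elim exE conjE, rule_tac x = "\<lambda>m. a *\<^sub>C r m" in exI) (auto simp: scC_sum_right mult.commute)
lemma PU_diff: "PU n r0 g \<Longrightarrow> PU n r0' g' \<Longrightarrow> PU n (r0 - r0') (\<lambda>U. g U - g' U)"
  using PU_add[of n r0 g "- r0'" "\<lambda>U. - g' U"] PU_scC[of n r0' g' "-1"] by simp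

lemma coeff_P_pow: 
  fixes q qi :: complex
  shows "poly.coeff ([:q, 0, qi:] ^ k) 0 = q ^ k" "poly.coeff ([:q, 0, qi:] ^ k) (Suc 0) = 0"
  by (induction k) (auto simp: coeff_mult)

text \<open>The coefficients of \<open>w^n g(q/w + w/q)\<close> in \<open>w\<close>, for a polynomial \<open>g\<close> given by its coefficients from the
  top. With \<open>w = u\<^sup>-\<^sup>2\<close> the argument of \<open>g\<close> is \<open>q u\<^sup>2 + 1/(q u\<^sup>2)\<close>.\<close>

definition UP_fps :: "complex \<Rightarrow> nat \<Rightarrow> (nat \<Rightarrow> 'r::calg) \<Rightarrow> 'r fps" where
  "UP_fps q n r = Abs_fps (\<lambda>i. \<Sum>a\<le>n. if a \<le> i then poly.coeff ([:q, 0, inverse q:] ^ (n - a)) (i - a) *\<^sub>C r a else 0)"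

lemma rep_UP:
  assumes g: "\<And>U. g U = (\<Sum>m\<le>n. U ^ (n - m) *\<^sub>C r m)"
  shows "rep (\<lambda>w. w ^ n *\<^sub>C g (q / w + inverse q * w)) (UP_fps q n r)"
proof -
  let ?P = "[:q, 0, inverse q:]"
  have deg: "degree (?P ^ k) \<le> 2 * k" for k
    using degree_power_le[of ?P k] by (simp split: if_splits)
  have 1: "\<forall>i>2*n. UP_fps q n r $ i = 0"
  proof (intro allI impI)
    fix i assume "i > 2 * n"
    then have "poly.coeff (?P ^ (n - a)) (i - a) = 0" if "a \<le> n" for a
      using deg[of "n - a"] that by (intro coeff_eq_0) linarith
    then show "UP_fps q n r $ i = 0" by (auto simp: UP_fps_def intro!: sum.neutral)
  qed
  have "w ^ n *\<^sub>C g (q / w + inverse q * w) = (\<Sum>i\<le>2*n. w ^ i *\<^sub>C UP_fps q n r $ i)" if "norm w > 0" for w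
  proof -
    have w: "w \<noteq> 0" using that by auto
    have "w ^ n *\<^sub>C g (q / w + inverse q * w) = (\<Sum>a\<le>n. (w ^ a * poly (?P ^ (n - a)) w) *\<^sub>C r a)"
      unfolding g scC_sum_right scC_scC
    proof (rule sum.cong)
      fix a assume "a \<in> {..n}"
      then have "w ^ n = w ^ a * w ^ (n - a)" by (simp add: power_add[symmetric])
      moreover have "poly ?P w = w * (q / w + inverse q * w)" using w by (simp add: field_simps)
      ultimately show "(w ^ n * (q / w + inverse q * w) ^ (n - a)) *\<^sub>C r a = (w ^ a * poly (?P ^ (n - a)) w) *\<^sub>C r a"
        by (simp add: poly_power power_mult_distrib mult.assoc del: poly_pCons)
    qed simp
    also have "\<dots> = (\<Sum>a\<le>n. \<Sum>i\<le>2*n. w ^ i *\<^sub>C (if a \<le> i then poly.coeff (?P ^ (n - a)) (i - a) *\<^sub>C r a else 0))"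
    proof (rule sum.cong)
      fix a assume a: "a \<in> {..n}"
      have "poly (?P ^ (n - a)) w = (\<Sum>j\<le>2*n-a. poly.coeff (?P ^ (n - a)) j * w ^ j)"
        unfolding poly_altdef
        by (rule sum.mono_neutral_left) (use a deg[of "n - a"] in \<open>auto simp: coeff_eq_0\<close>)
      then have "(w ^ a * poly (?P ^ (n - a)) w) *\<^sub>C r a = (\<Sum>j\<le>2*n-a. w ^ (a + j) *\<^sub>C (poly.coeff (?P ^ (n - a)) j *\<^sub>C r a))"
        by (simp add: sum_distrib_left scC_sum_left power_add mult_ac)
      also have "\<dots> = (\<Sum>i\<in>{a..2*n}. w ^ i *\<^sub>C (poly.coeff (?P ^ (n - a)) (i - a) *\<^sub>C r a))"
        by (rule sum.reindex_bij_witness[of _ "\<lambda>i. i - a" "\<lambda>j. a + j"]) (use a in auto)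
      also have "\<dots> = (\<Sum>i\<le>2*n. w ^ i *\<^sub>C (if a \<le> i then poly.coeff (?P ^ (n - a)) (i - a) *\<^sub>C r a else 0))"
        by (rule sum.mono_neutral_cong_left) auto
      finally show "(w ^ a * poly (?P ^ (n - a)) w) *\<^sub>C r a = \<dots>" .
    qed simp
    also have "\<dots> = (\<Sum>i\<le>2*n. w ^ i *\<^sub>C UP_fps q n r $ i)"
      by (subst sum.swap) (simp add: UP_fps_def scC_sum_right)
    finally show ?thesis .
  qed
  with 1 show ?thesis unfolding rep_def by blast
qed

text \<open>The two sets of coefficients are related by a triangular system with diagonal entries \<open>q^(n-m)\<close>;
  hence degree bounds can be carried from one to the other.\<close>

lemma UP_fps_nth:
  assumes "m \<le> n"
  shows "UP_fps q n r $ m = q ^ (n - m) *\<^sub>C r m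
    + (\<Sum>a<m. poly.coeff ([:q, 0, inverse q:] ^ (n - a)) (m - a) *\<^sub>C r a)"
proof -
  have "UP_fps q n r $ m = (\<Sum>a\<le>m. poly.coeff ([:q, 0, inverse q:] ^ (n - a)) (m - a) *\<^sub>C r a)"
    unfolding UP_fps_def fps_nth_Abs_fps
    by (rule sum.mono_neutral_cong_right) (use assms in auto)
  then show ?thesis by (simp add: lessThan_Suc_atMost[symmetric] coeff_P_pow add.commute)
qed

section \<open>The dressed K-matrix of auxiliary spin one half\<close>

definition cm :: "'r::calg \<Rightarrow> 'r \<Rightarrow> bool" where "cm x y \<longleftrightarrow> x * y = y * x"
lemma cm_intros:
  "cm x y \<Longrightarrow> cm x z \<Longrightarrow> cm x (y + z)" "cm x y \<Longrightarrow> cm x z \<Longrightarrow> cm x (y - z)"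
  "cm x y \<Longrightarrow> cm x (a *\<^sub>C y)" "cm x 1" "cm x y \<Longrightarrow> cm x z \<Longrightarrow> cm x (y * z)"
      apply (simp_all add: cm_def algebra_simps)
  by (metis mult.assoc)
lemma cm_sym: "cm x y \<Longrightarrow> cm y x" by (simp add: cm_def)

lemma cm_intros_left:
  "cm y x \<Longrightarrow> cm z x \<Longrightarrow> cm (y + z) x" "cm y x \<Longrightarrow> cm (a *\<^sub>C y) x"
  "cm y x \<Longrightarrow> cm z x \<Longrightarrow> cm (y * z) x"
  using cm_intros cm_sym by meson+

lemma sandwich_assoc:
  fixes a :: "'b::monoid_mult"
  assumes "a * l = l * n" "n * k = k * n'" "l' * m = n' * l'"
  shows "a * (l * k * l') = l * k * l' * m"
proof -
  have "a * (l * k * l') = (a * l) * k * l'" by (simp add: mult.assoc)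
  also have "\<dots> = l * (n * k) * l'" unfolding assms(1) by (simp add: mult.assoc)
  also have "\<dots> = l * k * (n' * l')" unfolding assms(2) by (simp add: mult.assoc)
  finally show ?thesis unfolding assms(3)[symmetric] by (simp add: mult.assoc)
qed

lemma sM_left: "A * (sM t * B) = sM t * (A * B)"
  by (simp only: mult.assoc[symmetric] sM_comm[of t A])

text \<open>An operator of one site enters the intertwiner of the longer chain through \<open>w\<close> and a group-like
  factor \<open>g\<close>; both commute with the shorter chain and pass through its K-matrix.\<close>

lemma sandwich_middle:
  fixes W w g :: "'r::calg"
  assumes "M22 (q *\<^sub>C W) (s *\<^sub>C 1) (t *\<^sub>C 1) (q' *\<^sub>C W) * M22 A B C D
         = M22 A B C D * M22 (q *\<^sub>C W) (s' *\<^sub>C 1) (t' *\<^sub>C 1) (q' *\<^sub>C W)"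
    and "cm w A" "cm w B" "cm w C" "cm w D" and g: "cm g A" "cm g B" "cm g C" "cm g D"
  shows "M22 (w + q *\<^sub>C (g * W)) (s *\<^sub>C g) (t *\<^sub>C g) (w + q' *\<^sub>C (g * W)) * M22 A B C D
         = M22 A B C D * M22 (w + q *\<^sub>C (g * W)) (s' *\<^sub>C g) (t' *\<^sub>C g) (w + q' *\<^sub>C (g * W))"
proof -
  from assms(1) have eqs:
    "q *\<^sub>C (W * A) + s *\<^sub>C C = q *\<^sub>C (A * W) + t' *\<^sub>C B"
    "q *\<^sub>C (W * B) + s *\<^sub>C D = s' *\<^sub>C A + q' *\<^sub>C (B * W)"
    "t *\<^sub>C A + q' *\<^sub>C (W * C) = q *\<^sub>C (C * W) + t' *\<^sub>C D"
    "t *\<^sub>C B + q' *\<^sub>C (W * D) = s' *\<^sub>C C + q' *\<^sub>C (D * W)" by simp_all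
  note e = eqs[THEN arg_cong[where f = "\<lambda>x. g * x"]]
  have "A * g = g * A" "B * g = g * B" "C * g = g * C" "D * g = g * D"
    using g by (auto simp: cm_def)
  moreover have "A * (g * x) = g * (A * x)" "B * (g * x) = g * (B * x)" "C * (g * x) = g * (C * x)"
    "D * (g * x) = g * (D * x)" for x
    using calculation by (simp_all add: mult.assoc[symmetric])
  ultimately show ?thesis using assms(2-5) e
    by (simp add: cm_def distrib_left distrib_right mult.assoc add.assoc add.left_commute)
qed

text \<open>A chain of mutually commuting sites. \<open>Wa\<close> and \<open>Wb\<close> below are \<open>\<W>\<^sub>0\<close> and \<open>\<W>\<^sub>1\<close>.\<close>

locale qchain =
  fixes h :: complex and v kap :: "nat \<Rightarrow> complex" and e f k k' :: "nat \<Rightarrow> 'r::calg"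
    and ep em kp km :: complex and N :: nat
  assumes site: "\<And>i. 1 \<le> i \<Longrightarrow> i \<le> N \<Longrightarrow> qsite h (inverse h) (kap i) (e i) (f i) (k i) (k' i)"
    and v0: "\<And>i. 1 \<le> i \<Longrightarrow> i \<le> N \<Longrightarrow> v i \<noteq> 0"
    and comm: "\<And>i j x y. 1 \<le> i \<Longrightarrow> i < j \<Longrightarrow> j \<le> N \<Longrightarrow> x \<in> {e i, f i, k i, k' i} \<Longrightarrow>
       y \<in> {e j, f j, k j, k' j} \<Longrightarrow> x * y = y * x"
    and h0: "h \<noteq> 0" and nonroot: "\<And>n. n > 0 \<Longrightarrow> (h * h) ^ n \<noteq> 1"
    and kp0: "kp \<noteq> 0" and km0: "km \<noteq> 0"
begin

abbreviation "q \<equiv> h * h"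
abbreviation "qi \<equiv> inverse h * inverse h"
abbreviation "lam \<equiv> h * h - inverse h * inverse h"

lemma lam0: "lam \<noteq> 0"
proof
  assume "lam = 0"
  then have "(h * h) ^ 2 = 1" using h0 by (simp add: power2_eq_square field_simps)
  then show False using nonroot[of 2] by simp
qed

lemma lam_cancel: "lam *\<^sub>C (inverse lam *\<^sub>C x) = (x::'r)"
  by (simp only: scC_scC right_inverse[OF lam0] scC_one)

primrec quad :: "nat \<Rightarrow> complex \<Rightarrow> 'r \<times> 'r \<times> 'r \<times> 'r" where
  "quad 0 U = (ep *\<^sub>C 1, em *\<^sub>C 1, (kp / lam) *\<^sub>C 1, (km / lam) *\<^sub>C 1)"
| "quad (Suc n) U = (case quad n U of (X, Y, b, c) \<Rightarrow>
    let E = e (Suc n); G = f (Suc n); K = k (Suc n); K' = k' (Suc n); V = v (Suc n);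
      Vi = inverse (v (Suc n)); hi = inverse h; kp = kap (Suc n) in
     (U *\<^sub>C (K * (K * X)) - (V * V + Vi * Vi) *\<^sub>C X + kp *\<^sub>C Y - (h * h + hi * hi) *\<^sub>C (K' * (K' * Y))
       + (U * V * hi) *\<^sub>C (K * (E * b)) - ((h * h + hi * hi) * Vi * h) *\<^sub>C (K' * (E * b))
       + (U * Vi * hi) *\<^sub>C (G * (K * c)) - ((h * h + hi * hi) * V * h) *\<^sub>C (G * (K' * c)),
     U *\<^sub>C (K' * (K' * Y)) - (V * V + Vi * Vi) *\<^sub>C Y + kp *\<^sub>C X - (h * h + hi * hi) *\<^sub>C (K * (K * X))
       + (U * Vi * h) *\<^sub>C (K' * (E * b)) - ((h * h + hi * hi) * V * hi) *\<^sub>C (K * (E * b))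
       + (U * V * h) *\<^sub>C (G * (K' * c)) - ((h * h + hi * hi) * Vi * hi) *\<^sub>C (G * (K * c)),
     U *\<^sub>C b - (V * V) *\<^sub>C (K * (K * b)) - (Vi * Vi) *\<^sub>C (K' * (K' * b))
       + (V * hi) *\<^sub>C (G * (K * X)) + (Vi * h) *\<^sub>C (G * (K' * Y)) + G * (G * c),
     U *\<^sub>C c - (V * V) *\<^sub>C (K' * (K' * c)) - (Vi * Vi) *\<^sub>C (K * (K * c))
       + (Vi * h) *\<^sub>C (E * (K * X)) + (V * hi) *\<^sub>C (E * (K' * Y)) + E * (E * b)))"

primrec Wa :: "nat \<Rightarrow> 'r" where
  "Wa 0 = ep *\<^sub>C 1"
| "Wa (Suc n) = inverse lam *\<^sub>C ((kp * v (Suc n) * h) *\<^sub>C (e (Suc n) * k (Suc n))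
     + (km * inverse (v (Suc n)) * inverse h) *\<^sub>C (f (Suc n) * k (Suc n))) + k (Suc n) * (k (Suc n) * Wa n)"

primrec Wb :: "nat \<Rightarrow> 'r" where
  "Wb 0 = em *\<^sub>C 1"
| "Wb (Suc n) = inverse lam *\<^sub>C ((kp * inverse (v (Suc n)) * inverse h) *\<^sub>C (e (Suc n) * k' (Suc n))
     + (km * v (Suc n) * h) *\<^sub>C (f (Suc n) * k' (Suc n))) + k' (Suc n) * (k' (Suc n) * Wb n)"

definition Xf where "Xf n U = fst (quad n U)"
definition Yf where "Yf n U = fst (snd (quad n U))"
definition bf where "bf n U = fst (snd (snd (quad n U)))"
definition cf where "cf n U = snd (snd (snd (quad n U)))"
lemmas quad_defs = Xf_def Yf_def bf_def cf_def

lemma cm_chain: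
  assumes "\<And>i y. 1 \<le> i \<Longrightarrow> i \<le> n \<Longrightarrow> y \<in> {e i, f i, k i, k' i} \<Longrightarrow> cm g y"
  shows "cm g (Xf n U) \<and> cm g (Yf n U) \<and> cm g (bf n U) \<and> cm g (cf n U) \<and> cm g (Wa n) \<and> cm g (Wb n)"
  using assms
proof (induction n)
  case 0
  then show ?case by (auto simp: quad_defs intro: cm_intros)
next
  case (Suc n)
  then have IH: "cm g (Xf n U)" "cm g (Yf n U)" "cm g (bf n U)" "cm g (cf n U)" "cm g (Wa n)" "cm g (Wb n)"
    by auto
  have "cm g (e (Suc n))" "cm g (f (Suc n))" "cm g (k (Suc n))" "cm g (k' (Suc n))"
    using Suc.prems[of "Suc n"] by auto
  note * = this IH[unfolded quad_defs]
  obtain X Y b c where "quad n U = (X, Y, b, c)" by (metis prod_cases4)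
  with * show ?case by (simp add: quad_defs Let_def) (intro conjI cm_intros; assumption)
qed

lemma site_cm:
  assumes "Suc n \<le> N" "y \<in> {e (Suc n), f (Suc n), k (Suc n), k' (Suc n)}"
  shows "cm y (Xf n U)" "cm y (Yf n U)" "cm y (bf n U)" "cm y (cf n U)" "cm y (Wa n)" "cm y (Wb n)"
proof -
  have "cm y z" if "1 \<le> i" "i \<le> n" "z \<in> {e i, f i, k i, k' i}" for i z
    using comm[of i "Suc n" z y] that assms by (auto simp: cm_def)
  from cm_chain[where n = n and g = y and U = U, OF this] show "cm y (Xf n U)" "cm y (Yf n U)" "cm y (bf n U)" "cm y (cf n U)"
    "cm y (Wa n)" "cm y (Wb n)" by auto
qed

abbreviation "Uu u \<equiv> h * h * u * u + inverse h * inverse h * inverse u * inverse u"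

definition KK :: "nat \<Rightarrow> complex \<Rightarrow> 'r m22" where
  "KK n u = kmat u (inverse u) (Xf n (Uu u)) (Yf n (Uu u)) (bf n (Uu u)) (cf n (Uu u))"

abbreviation "LL i x \<equiv> qsite.L h (inverse h) (e i) (f i) (k i) (k' i) x (inverse x)"

lemma KK_Suc:
  assumes n: "Suc n \<le> N" and u: "u \<noteq> 0"
  shows "KK (Suc n) u = LL (Suc n) (u * v (Suc n)) * KK n u * LL (Suc n) (u * inverse (v (Suc n)))"
proof -
  interpret S: qsite h "inverse h" "kap (Suc n)" "e (Suc n)" "f (Suc n)" "k (Suc n)" "k' (Suc n)"
    using site n by simp
  obtain X Y b c where q: "quad n (Uu u) = (X, Y, b, c)" by (metis prod_cases4)
  have *: "Xf n (Uu u) = X" "Yf n (Uu u) = Y" "bf n (Uu u) = b" "cf n (Uu u) = c"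
    by (simp_all add: quad_defs q)
  note cms = site_cm(1-4)[OF n, of _ "Uu u", unfolded * cm_def]
  have "v (Suc n) \<noteq> 0" using v0 n by simp
  note L = S.L_kmat_L[of u "inverse u" "v (Suc n)" "inverse (v (Suc n))" X Y b c "Uu u"]
  show ?thesis
    unfolding KK_def * 
    using \<open>v (Suc n) \<noteq> 0\<close> u
    by (simp only: inverse_mult_distrib inverse_inverse_eq, subst L)
      (auto simp: cms[symmetric] quad_defs q Let_def)
qed

text \<open>Each site contributes \<open>L(x) L(1/x)\<close>, a scalar, and the scalar K-matrix has the same property.\<close>

lemma KK_unit:
  assumes "n \<le> N" "u \<noteq> 0" shows "\<exists>s. KK n u * KK n (inverse u) = sM s"
  using assms(1)
proof (induction n)
  case 0
  have two: "a *\<^sub>C x + a *\<^sub>C x = (a * 2) *\<^sub>C (x::'r)" for a x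
    by (simp only: scC_add_left[symmetric] mult_2_right)
  have "kmat u ui (ep *\<^sub>C 1) (em *\<^sub>C 1) (P *\<^sub>C 1) (Q *\<^sub>C 1) * kmat ui u (ep *\<^sub>C 1) (em *\<^sub>C 1) (P *\<^sub>C 1) (Q *\<^sub>C (1::'r))
    = sM ((u * ep + ui * em) * (ui * ep + u * em) - (u * u - ui * ui) * (u * u - ui * ui) * P * Q)" for ui P Q
    by (simp add: kmat_def sM_def calg_simps)
      (simp add: two mult.assoc)
  from this[of "inverse u" "kp / lam" "km / lam"]
  have "\<exists>s. KK 0 u * KK 0 (inverse u) = sM s" by (auto simp: KK_def quad_defs)
  then show ?case .
next
  case (Suc n)
  then obtain s where s: "KK n u * KK n (inverse u) = sM s" by auto
  interpret S: qsite h "inverse h" "kap (Suc n)" "e (Suc n)" "f (Suc n)" "k (Suc n)" "k' (Suc n)"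
    using site Suc.prems by simp
  have v: "v (Suc n) \<noteq> 0" using v0 Suc.prems by simp
  define a b where "a = u * v (Suc n)" and "b = u * inverse (v (Suc n))"
  have ab: "a * inverse a = 1" "b * inverse b = 1" using v assms(2) by (auto simp: a_def b_def field_simps)
  have L: "LL (Suc n) a * LL (Suc n) (inverse a) = sM (kap (Suc n) - a * a - inverse a * inverse a)"
    "LL (Suc n) b * LL (Suc n) (inverse b) = sM (kap (Suc n) - b * b - inverse b * inverse b)"
    using S.L_unit[OF ab(1)] S.L_unit[OF ab(2)] by simp_all
  have "KK (Suc n) u = LL (Suc n) a * KK n u * LL (Suc n) b"
    using KK_Suc[OF Suc.prems assms(2)] by (simp add: a_def b_def)
  moreover have "KK (Suc n) (inverse u) = LL (Suc n) (inverse b) * KK n (inverse u) * LL (Suc n) (inverse a)"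
    using KK_Suc[OF Suc.prems, of "inverse u"] assms(2) by (simp add: a_def b_def)
  ultimately have "KK (Suc n) u * KK (Suc n) (inverse u) =
    LL (Suc n) a * (KK n u * ((LL (Suc n) b * LL (Suc n) (inverse b)) * (KK n (inverse u) * LL (Suc n) (inverse a))))"
    by (simp add: mult.assoc)
  also have "\<dots> = sM (kap (Suc n) - b * b - inverse b * inverse b) * (LL (Suc n) a * ((KK n u * KK n (inverse u)) * LL (Suc n) (inverse a)))"
    unfolding L by (simp only: sM_left mult.assoc)
  also have "\<dots> = sM (kap (Suc n) - b * b - inverse b * inverse b) * (sM s * (LL (Suc n) a * LL (Suc n) (inverse a)))"
    unfolding s by (intro arg_cong2[where f = "(*)"] refl sM_left)
  finally show ?case unfolding L sM_mult by blast
qed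

definition M0 where
  "M0 n u = M22 (q *\<^sub>C (lam *\<^sub>C Wa n)) ((lam * kp * u) *\<^sub>C 1) ((lam * km * inverse u) *\<^sub>C 1) (qi *\<^sub>C (lam *\<^sub>C Wa n))"
definition M1 where
  "M1 n u = M22 (qi *\<^sub>C (lam *\<^sub>C Wb n)) ((lam * kp * inverse u) *\<^sub>C 1) ((lam * km * u) *\<^sub>C 1) (q *\<^sub>C (lam *\<^sub>C Wb n))"

text \<open>The matrix \<open>M0\<close> collects \<open>\<W>\<^sub>0\<close> and the boundary constants. The relation is inherited from the chain
  with one site less, because \<open>M0\<close> passes through the site's \<open>L\<close> by \<open>L_M0\<close>.\<close>

lemma M0_KK:
  assumes "n \<le> N" "u \<noteq> 0" shows "M0 n (inverse u) * KK n u = KK n u * M0 n u"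
  using assms(1)
proof (induction n)
  case 0
  show ?case using assms(2) lam0 h0
    by (simp add: M0_def KK_def kmat_def quad_defs scC_add_left[symmetric] scC_add_right scC_diff_left[symmetric]
       scC_minus_left[symmetric] del: scC_minus_left)
      (intro conjI arg_cong[where f = "\<lambda>x. x *\<^sub>C 1"]; simp add: field_simps)
next
  case (Suc n)
  interpret S: qsite h "inverse h" "kap (Suc n)" "e (Suc n)" "f (Suc n)" "k (Suc n)" "k' (Suc n)"
    using site Suc.prems by simp
  have v: "v (Suc n) \<noteq> 0" using v0 Suc.prems by simp
  have IH: "M0 n (inverse u) * KK n u = KK n u * M0 n u" using Suc by simp
  define w where "w = (kp * v (Suc n) * h) *\<^sub>C (e (Suc n) * k (Suc n)) + (km * inverse (v (Suc n)) * inverse h) *\<^sub>C (f (Suc n) * k (Suc n))"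
  define W where "W = lam *\<^sub>C Wa n"
  define K where "K = k (Suc n)"
  have W: "lam *\<^sub>C Wa (Suc n) = w + K * (K * W)"
    by (subst Wa.simps(2), subst scC_add_right, subst lam_cancel) (simp add: w_def W_def K_def)
  note cms = site_cm[OF Suc.prems]
  have cw: "W * y = y * W" if "y \<in> {e (Suc n), f (Suc n), k (Suc n), k' (Suc n)}" for y
    using cms(5)[OF that] by (simp add: W_def cm_def)
  note i1 = S.M0_L[of u "inverse u" "v (Suc n)" "inverse (v (Suc n))" W kp km, folded w_def K_def]
  note i2 = S.L_M0[of u "inverse u" "v (Suc n)" "inverse (v (Suc n))" W kp km, folded w_def K_def]
  let ?N = "\<lambda>u. M22 (w + q *\<^sub>C (K * (K * W))) ((lam * kp * u) *\<^sub>C (K * K)) ((lam * km * inverse u) *\<^sub>C (K * K)) (w + qi *\<^sub>C (K * (K * W)))"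
  have 1: "M0 (Suc n) (inverse u) * LL (Suc n) (u * v (Suc n)) = LL (Suc n) (u * v (Suc n)) * ?N (inverse u)"
    unfolding M0_def W using i1 assms(2) v cw by (simp add: K_def)
  have 2: "LL (Suc n) (u * inverse (v (Suc n))) * M0 (Suc n) u = ?N u * LL (Suc n) (u * inverse (v (Suc n)))"
    unfolding M0_def W using i2 assms(2) v cw by (simp add: K_def)
  have 3: "?N (inverse u) * KK n u = KK n u * ?N u"
  proof -
    have cmw: "cm w (Xf n U)" "cm w (Yf n U)" "cm w (bf n U)" "cm w (cf n U)" for U
      unfolding w_def by (intro cm_intros_left cms; simp)+
    have cmk: "cm (K * K) (Xf n U)" "cm (K * K) (Yf n U)" "cm (K * K) (bf n U)" "cm (K * K) (cf n U)" for U
      unfolding K_def by (intro cm_intros_left cms; simp)+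
    obtain A B C D where K4: "KK n u = M22 A B C D" by (cases "KK n u")
    then have ABCD: "A = u *\<^sub>C Xf n (Uu u) + inverse u *\<^sub>C Yf n (Uu u)"
      "B = (u * u - inverse u * inverse u) *\<^sub>C bf n (Uu u)"
      "C = (u * u - inverse u * inverse u) *\<^sub>C cf n (Uu u)"
      "D = inverse u *\<^sub>C Xf n (Uu u) + u *\<^sub>C Yf n (Uu u)"
      by (simp_all add: KK_def kmat_def)
    have "cm w A" "cm w B" "cm w C" "cm w D" "cm (K * K) A" "cm (K * K) B" "cm (K * K) C" "cm (K * K) D"
      unfolding ABCD by (intro cm_intros(1-3) cmw cmk)+
    note sandwich_middle[OF IH[unfolded M0_def K4 W_def[symmetric]] this]
    then show ?thesis unfolding K4 mult.assoc .
  qed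
  show ?case
    unfolding KK_Suc[OF Suc.prems assms(2)] by (rule sandwich_assoc[OF 1 3 2])
qed

lemma M1_KK:
  assumes "n \<le> N" "u \<noteq> 0" shows "M1 n (inverse u) * KK n u = KK n u * M1 n u"
  using assms(1)
proof (induction n)
  case 0
  show ?case using assms(2) lam0 h0
    by (simp add: M1_def KK_def kmat_def quad_defs scC_add_left[symmetric] scC_add_right scC_diff_left[symmetric]
       scC_minus_left[symmetric] del: scC_minus_left)
      (intro conjI arg_cong[where f = "\<lambda>x. x *\<^sub>C 1"]; simp add: field_simps)
next
  case (Suc n)
  interpret S: qsite h "inverse h" "kap (Suc n)" "e (Suc n)" "f (Suc n)" "k (Suc n)" "k' (Suc n)"
    using site Suc.prems by simp
  have v: "v (Suc n) \<noteq> 0" using v0 Suc.prems by simp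
  have IH: "M1 n (inverse u) * KK n u = KK n u * M1 n u" using Suc by simp
  define w where "w = (kp * inverse (v (Suc n)) * inverse h) *\<^sub>C (e (Suc n) * k' (Suc n)) + (km * v (Suc n) * h) *\<^sub>C (f (Suc n) * k' (Suc n))"
  define W where "W = lam *\<^sub>C Wb n"
  define K where "K = k' (Suc n)"
  have W: "lam *\<^sub>C Wb (Suc n) = w + K * (K * W)"
    by (subst Wb.simps(2), subst scC_add_right, subst lam_cancel) (simp add: w_def W_def K_def)
  note cms = site_cm[OF Suc.prems]
  have cw: "W * y = y * W" if "y \<in> {e (Suc n), f (Suc n), k (Suc n), k' (Suc n)}" for y
    using cms(6)[OF that] by (simp add: W_def cm_def)
  note i1 = S.M1_L[of u "inverse u" "v (Suc n)" "inverse (v (Suc n))" W kp km, folded w_def K_def]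
  note i2 = S.L_M1[of u "inverse u" "v (Suc n)" "inverse (v (Suc n))" W kp km, folded w_def K_def]
  let ?N = "\<lambda>u. M22 (w + qi *\<^sub>C (K * (K * W))) ((lam * kp * inverse u) *\<^sub>C (K * K)) ((lam * km * u) *\<^sub>C (K * K)) (w + q *\<^sub>C (K * (K * W)))"
  have 1: "M1 (Suc n) (inverse u) * LL (Suc n) (u * v (Suc n)) = LL (Suc n) (u * v (Suc n)) * ?N (inverse u)"
    unfolding M1_def W using i1 assms(2) v cw by (simp add: K_def)
  have 2: "LL (Suc n) (u * inverse (v (Suc n))) * M1 (Suc n) u = ?N u * LL (Suc n) (u * inverse (v (Suc n)))"
    unfolding M1_def W using i2 assms(2) v cw by (simp add: K_def)
  have 3: "?N (inverse u) * KK n u = KK n u * ?N u"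
  proof -
    have cmw: "cm w (Xf n U)" "cm w (Yf n U)" "cm w (bf n U)" "cm w (cf n U)" for U
      unfolding w_def by (intro cm_intros_left cms; simp)+
    have cmk: "cm (K * K) (Xf n U)" "cm (K * K) (Yf n U)" "cm (K * K) (bf n U)" "cm (K * K) (cf n U)" for U
      unfolding K_def by (intro cm_intros_left cms; simp)+
    obtain A B C D where K4: "KK n u = M22 A B C D" by (cases "KK n u")
    then have ABCD: "A = u *\<^sub>C Xf n (Uu u) + inverse u *\<^sub>C Yf n (Uu u)"
      "B = (u * u - inverse u * inverse u) *\<^sub>C bf n (Uu u)"
      "C = (u * u - inverse u * inverse u) *\<^sub>C cf n (Uu u)"
      "D = inverse u *\<^sub>C Xf n (Uu u) + u *\<^sub>C Yf n (Uu u)"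
      by (simp_all add: KK_def kmat_def)
    have "cm w A" "cm w B" "cm w C" "cm w D" "cm (K * K) A" "cm (K * K) B" "cm (K * K) C" "cm (K * K) D"
      unfolding ABCD by (intro cm_intros(1-3) cmw cmk)+
    note sandwich_middle[OF IH[unfolded M1_def K4 W_def[symmetric]] this]
    then show ?thesis unfolding K4 mult.assoc .
  qed
  show ?case
    unfolding KK_Suc[OF Suc.prems assms(2)] by (rule sandwich_assoc[OF 1 3 2])
qed

end

section \<open>Commutation relations between the entries\<close>

context qchain begin

lemma swap4: "P + R = S + T \<Longrightarrow> S - R = P - (T::'r)"
  by (simp add: algebra_simps)

lemma swap4': "P + R = S + T \<Longrightarrow> R - S = T - (P::'r)"
  by (simp add: algebra_simps)

text \<open>The entries of the two intertwining relations, divided by \<open>u\<^sup>2 - u\<^sup>-\<^sup>2\<close> where that factor occurs.\<close>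

lemma KK_relations:
  assumes n: "n \<le> N" and u: "u \<noteq> 0" and cc: "u * u - inverse u * inverse u \<noteq> 0"
  defines "U \<equiv> Uu u"
  defines "X \<equiv> Xf n U" and "Y \<equiv> Yf n U" and "b \<equiv> bf n U" and "c \<equiv> cf n U"
  shows "kp *\<^sub>C X = q *\<^sub>C (Wa n * b) - qi *\<^sub>C (b * Wa n)"
    and "kp *\<^sub>C Y = q *\<^sub>C (b * Wb n) - qi *\<^sub>C (Wb n * b)"
    and "(q + qi) *\<^sub>C (kp *\<^sub>C c - km *\<^sub>C b) = X * Wa n - Wa n * X"
    and "U *\<^sub>C (X * Wa n - Wa n * X) = - ((q + qi) *\<^sub>C (Y * Wa n - Wa n * Y))"
proof -
  let ?i = "inverse u"
  let ?A = "u *\<^sub>C X + ?i *\<^sub>C Y" and ?D = "?i *\<^sub>C X + u *\<^sub>C Y"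
  define z where "z = u * u - ?i * ?i"
  define xi where "xi = X * Wa n - Wa n * X"
  define et where "et = Y * Wa n - Wa n * Y"
  have z: "z \<noteq> 0" using cc by (simp add: z_def)
  have KK: "KK n u = M22 ?A (z *\<^sub>C b) (z *\<^sub>C c) ?D"
    by (simp add: KK_def kmat_def X_def Y_def b_def c_def U_def z_def)
  have lz: "lam *\<^sub>C (x::'r) = lam *\<^sub>C y \<Longrightarrow> x = y" for x y using scC_cancel[OF lam0] by blast
  have e0: "q *\<^sub>C (Wa n * ?A) + (kp * ?i) *\<^sub>C (z *\<^sub>C c) = q *\<^sub>C (?A * Wa n) + (km * ?i) *\<^sub>C (z *\<^sub>C b)"
    "q *\<^sub>C (Wa n * (z *\<^sub>C b)) + (kp * ?i) *\<^sub>C ?D = (kp * u) *\<^sub>C ?A + qi *\<^sub>C (z *\<^sub>C b * Wa n)"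
    "(km * u) *\<^sub>C (z *\<^sub>C b) + qi *\<^sub>C (Wa n * ?D) = (kp * u) *\<^sub>C (z *\<^sub>C c) + qi *\<^sub>C (?D * Wa n)"
  proof -
    have m: "M22 (q *\<^sub>C (lam *\<^sub>C Wa n)) ((lam * kp * ?i) *\<^sub>C 1) ((lam * km * u) *\<^sub>C 1) (qi *\<^sub>C (lam *\<^sub>C Wa n))
       * M22 A (z *\<^sub>C b) (z *\<^sub>C c) D = M22 A (z *\<^sub>C b) (z *\<^sub>C c) D *
       M22 (q *\<^sub>C (lam *\<^sub>C Wa n)) ((lam * kp * u) *\<^sub>C 1) ((lam * km * ?i) *\<^sub>C 1) (qi *\<^sub>C (lam *\<^sub>C Wa n)) \<Longrightarrow>
       lam *\<^sub>C (q *\<^sub>C (Wa n * A) + (kp * ?i) *\<^sub>C (z *\<^sub>C c)) = lam *\<^sub>C (q *\<^sub>C (A * Wa n) + (km * ?i) *\<^sub>C (z *\<^sub>C b)) \<and>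
       lam *\<^sub>C (q *\<^sub>C (Wa n * (z *\<^sub>C b)) + (kp * ?i) *\<^sub>C D) = lam *\<^sub>C ((kp * u) *\<^sub>C A + qi *\<^sub>C (z *\<^sub>C b * Wa n)) \<and>
       lam *\<^sub>C ((km * u) *\<^sub>C (z *\<^sub>C b) + qi *\<^sub>C (Wa n * D)) = lam *\<^sub>C ((kp * u) *\<^sub>C (z *\<^sub>C c) + qi *\<^sub>C (D * Wa n))" for A D
      unfolding times_m22.simps m22.inject scC_mult_left scC_mult_right mult_1_left mult_1_right scC_scC
        scC_add_right
      by (simp only: mult.assoc mult.left_commute mult.commute) 
    have "M0 n ?i * KK n u = KK n u * M0 n u" by (rule M0_KK[OF n u])
    from m[OF this[unfolded KK M0_def inverse_inverse_eq]]
    show "q *\<^sub>C (Wa n * ?A) + (kp * ?i) *\<^sub>C (z *\<^sub>C c) = q *\<^sub>C (?A * Wa n) + (km * ?i) *\<^sub>C (z *\<^sub>C b)"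
    "q *\<^sub>C (Wa n * (z *\<^sub>C b)) + (kp * ?i) *\<^sub>C ?D = (kp * u) *\<^sub>C ?A + qi *\<^sub>C (z *\<^sub>C b * Wa n)"
    "(km * u) *\<^sub>C (z *\<^sub>C b) + qi *\<^sub>C (Wa n * ?D) = (kp * u) *\<^sub>C (z *\<^sub>C c) + qi *\<^sub>C (?D * Wa n)"
      by (blast dest: lz)+
  qed
  have e1: "qi *\<^sub>C (Wb n * (z *\<^sub>C b)) + (kp * u) *\<^sub>C ?D = (kp * ?i) *\<^sub>C ?A + q *\<^sub>C (z *\<^sub>C b * Wb n)"
  proof -
    have m: "M22 (qi *\<^sub>C (lam *\<^sub>C Wb n)) ((lam * kp * u) *\<^sub>C 1) ((lam * km * ?i) *\<^sub>C 1) (q *\<^sub>C (lam *\<^sub>C Wb n))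
       * M22 A (z *\<^sub>C b) (z *\<^sub>C c) D = M22 A (z *\<^sub>C b) (z *\<^sub>C c) D *
       M22 (qi *\<^sub>C (lam *\<^sub>C Wb n)) ((lam * kp * ?i) *\<^sub>C 1) ((lam * km * u) *\<^sub>C 1) (q *\<^sub>C (lam *\<^sub>C Wb n)) \<Longrightarrow>
       lam *\<^sub>C (qi *\<^sub>C (Wb n * (z *\<^sub>C b)) + (kp * u) *\<^sub>C D) = lam *\<^sub>C ((kp * ?i) *\<^sub>C A + q *\<^sub>C (z *\<^sub>C b * Wb n))" for A D
      unfolding times_m22.simps m22.inject scC_mult_left scC_mult_right mult_1_left mult_1_right scC_scC
        scC_add_right
      by (simp only: mult.assoc mult.left_commute mult.commute)
    have "M1 n ?i * KK n u = KK n u * M1 n u" by (rule M1_KK[OF n u])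
    from m[OF this[unfolded KK M1_def inverse_inverse_eq]] show ?thesis by (rule lz)
  qed
  have ui: "u * ?i = 1" using u by simp
  have ui2: "u * (?i * y) = y" for y using u by simp
  have zz: "z *\<^sub>C x = z *\<^sub>C y \<Longrightarrow> x = (y::'r)" for x y using scC_cancel[OF z] by blast
  have kpA: "(kp * u) *\<^sub>C ?A - (kp * ?i) *\<^sub>C ?D = z *\<^sub>C (kp *\<^sub>C X)"
    "(kp * u) *\<^sub>C ?D - (kp * ?i) *\<^sub>C ?A = z *\<^sub>C (kp *\<^sub>C Y)"
    by (simp_all add: z_def calg_simps)
  show "kp *\<^sub>C X = q *\<^sub>C (Wa n * b) - qi *\<^sub>C (b * Wa n)"
  proof (rule zz)
    show "z *\<^sub>C (kp *\<^sub>C X) = z *\<^sub>C (q *\<^sub>C (Wa n * b) - qi *\<^sub>C (b * Wa n))"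
      unfolding kpA(1)[symmetric] swap4[OF e0(2)]
      by (simp add: scC_diff_right mult.commute[of z])
  qed
  show "kp *\<^sub>C Y = q *\<^sub>C (b * Wb n) - qi *\<^sub>C (Wb n * b)"
  proof (rule zz)
    show "z *\<^sub>C (kp *\<^sub>C Y) = z *\<^sub>C (q *\<^sub>C (b * Wb n) - qi *\<^sub>C (Wb n * b))"
      unfolding kpA(2)[symmetric] swap4'[OF e1]
      by (simp add: scC_diff_right mult.commute[of z])
  qed
  define De where "De = kp *\<^sub>C c - km *\<^sub>C b"
  have f1: "?i *\<^sub>C (z *\<^sub>C De) = q *\<^sub>C (u *\<^sub>C xi + ?i *\<^sub>C et)"
    using e0(1) unfolding De_def xi_def et_def 
    by (simp add: calg_simps)
  have f2: "u *\<^sub>C (z *\<^sub>C De) = - (qi *\<^sub>C (?i *\<^sub>C xi + u *\<^sub>C et))"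
    using e0(3) unfolding De_def xi_def et_def 
    by (simp add: calg_simps)
  have uyi: "u * (y * inverse u) = y" "inverse u * (y * u) = y" "inverse u * (u * y) = y" 
    "u * (inverse h * (inverse h * inverse u)) = inverse h * inverse h" for y using u by (simp_all add: field_simps)
  have g1: "z *\<^sub>C De = (q * u * u) *\<^sub>C xi + q *\<^sub>C et"
    using arg_cong[OF f1, of "\<lambda>x. u *\<^sub>C x"] u by (simp add: calg_simps uyi)
  have g2: "z *\<^sub>C De = - ((qi * ?i * ?i) *\<^sub>C xi + qi *\<^sub>C et)"
    using arg_cong[OF f2, of "\<lambda>x. ?i *\<^sub>C x"] u by (simp add: calg_simps uyi)
  have "((q * u * u) *\<^sub>C xi + q *\<^sub>C et) + ((qi * ?i * ?i) *\<^sub>C xi + qi *\<^sub>C et) = 0"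
    using trans[OF g1[symmetric] g2] by (rule iffD1[OF eq_neg_iff_add_eq_0])
  then have "U *\<^sub>C xi + (q + qi) *\<^sub>C et = 0"
    unfolding U_def by (simp only: scC_add_left ac_simps)
  then have "U *\<^sub>C xi = - ((q + qi) *\<^sub>C et)"
    by (simp only: eq_neg_iff_add_eq_0)
  then show "U *\<^sub>C (X * Wa n - Wa n * X) = - ((q + qi) *\<^sub>C (Y * Wa n - Wa n * Y))"
    by (simp only: xi_def et_def)
  have hh: "h * (inverse h * y) = y" "h * (h * (y * (z * qi))) = y * z" for y z using h0 by (simp_all add: field_simps)
  have "z *\<^sub>C ((q + qi) *\<^sub>C De) = qi *\<^sub>C (z *\<^sub>C De) + q *\<^sub>C (z *\<^sub>C De)"
    by (simp add: scC_add_left[symmetric] algebra_simps)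
  also have "\<dots> = qi *\<^sub>C ((q * u * u) *\<^sub>C xi + q *\<^sub>C et) + q *\<^sub>C (- ((qi * ?i * ?i) *\<^sub>C xi + qi *\<^sub>C et))"
    using g1 g2 by metis
  also have "\<dots> = z *\<^sub>C xi"
    using h0 by (simp add: z_def calg_simps hh)
  finally show "(q + qi) *\<^sub>C (kp *\<^sub>C c - km *\<^sub>C b) = X * Wa n - Wa n * X"
    using zz by (simp only: xi_def De_def)
qed

text \<open>The diagonal entry of the scalar product \<open>\<K>(u) \<K>(1/u)\<close>.\<close>

lemma KK_quadratic:
  assumes n: "n \<le> N" and u: "u \<noteq> 0"
  defines "U \<equiv> Uu u" and "U' \<equiv> Uu (inverse u)" 
  defines "z \<equiv> u * u - inverse u * inverse u"
  shows "\<exists>s. (Xf n U * Xf n U' + Yf n U * Yf n U') + (u * u) *\<^sub>C (Xf n U * Yf n U')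
     + (inverse u * inverse u) *\<^sub>C (Yf n U * Xf n U') - (z * z) *\<^sub>C (bf n U * cf n U') = s *\<^sub>C 1"
proof -
  obtain s where s: "KK n u * KK n (inverse u) = sM s" using KK_unit[OF n u] by blast
  have ui2: "u * (inverse u * y) = y" "u * inverse u = 1" for y using u by simp_all
  have z': "inverse u * inverse u - u * u = - z" by (simp add: z_def)
  have K': "KK n (inverse u) = kmat (inverse u) u (Xf n U') (Yf n U') (bf n U') (cf n U')"
    by (simp add: KK_def U'_def)
  have K: "KK n u = kmat u (inverse u) (Xf n U) (Yf n U) (bf n U) (cf n U)"
    by (simp add: KK_def U_def)
  have "m11 (KK n u * KK n (inverse u)) = (Xf n U * Xf n U' + Yf n U * Yf n U') + (u * u) *\<^sub>C (Xf n U * Yf n U')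
     + (inverse u * inverse u) *\<^sub>C (Yf n U * Xf n U') - (z * z) *\<^sub>C (bf n U * cf n U')"
    unfolding K K' kmat_def z' z_def[symmetric] by (simp add: calg_simps ui2)
  then show ?thesis unfolding s by (metis sM_def m22.sel(1))
qed

lemma PU_rules:
  "PU n r0 g \<Longrightarrow> PU (Suc n) (a *\<^sub>C r0) (\<lambda>U. (U * a) *\<^sub>C g U)"
  "PU n r0 g \<Longrightarrow> PU (Suc n) ((a * b) *\<^sub>C r0) (\<lambda>U. (U * a * b) *\<^sub>C g U)"
  using PU_U[OF PU_scC[of n r0 g a]] PU_U[OF PU_scC[of n r0 g "a * b"]] by (simp_all add: mult.assoc)

lemma PU_quad:
  "\<exists>x0 y0. PU n x0 (Xf n) \<and> PU n y0 (Yf n) \<and> PU n ((kp / lam) *\<^sub>C 1) (bf n) \<and> PU n ((km / lam) *\<^sub>C 1) (cf n)"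
proof (induction n)
  case 0
  have "PU 0 x (\<lambda>U. x)" for x :: 'r by (auto simp: PU_def intro!: exI[of _ "\<lambda>_. x"])
  then show ?case by (auto simp: quad_defs)
next
  case (Suc n)
  then obtain x0 y0 where IH: "PU n x0 (Xf n)" "PU n y0 (Yf n)" "PU n ((kp / lam) *\<^sub>C 1) (bf n)"
    "PU n ((km / lam) *\<^sub>C 1) (cf n)" by blast
  note L = PU_lmult[where n = n] PU_lmult[OF PU_lmult[where n = n]]
  have q: "quad n U = (Xf n U, Yf n U, bf n U, cf n U)" for U by (simp add: quad_defs)
  have sX: "Xf (Suc n) = (\<lambda>U. fst (quad (Suc n) U))" "Yf (Suc n) = (\<lambda>U. fst (snd (quad (Suc n) U)))"
    "bf (Suc n) = (\<lambda>U. fst (snd (snd (quad (Suc n) U))))" "cf (Suc n) = (\<lambda>U. snd (snd (snd (quad (Suc n) U))))"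
    by (simp_all add: quad_defs fun_eq_iff)
  note rs = PU_add PU_diff PU_rules PU_U PU_shift[OF PU_scC] PU_shift[OF PU_lmult] PU_lmult[where n = n] IH
  have "\<exists>x. PU (Suc n) x (Xf (Suc n))" 
    unfolding sX quad.simps q Let_def prod.case fst_conv snd_conv by (rule exI, (rule rs)+)
  moreover have "\<exists>x. PU (Suc n) x (Yf (Suc n))"
    unfolding sX quad.simps q Let_def prod.case fst_conv snd_conv by (rule exI, (rule rs)+)
  moreover have "PU (Suc n) ((kp / lam) *\<^sub>C 1 - 0 - 0 + 0 + 0 + 0) (bf (Suc n))"
    unfolding sX quad.simps q Let_def prod.case fst_conv snd_conv by (rule rs)+
  moreover have "PU (Suc n) ((km / lam) *\<^sub>C 1 - 0 - 0 + 0 + 0 + 0) (cf (Suc n))"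
    unfolding sX quad.simps q Let_def prod.case fst_conv snd_conv by (rule rs)+
  ultimately show ?case by auto
qed

text \<open>At \<open>u\<^sup>2 = \<plusminus>1\<close> the K-matrix has no off-diagonal part, and its diagonal is the scalar inherited from the
  zero-site chain. These two points give \<open>X \<plusminus> Y\<close>, which the generating relations leave undetermined by
  one degree.\<close>

lemma special_values:
  "\<exists>s. Xf n (q + qi) + Yf n (q + qi) = s *\<^sub>C 1"
  "\<exists>s. Xf n (- (q + qi)) - Yf n (- (q + qi)) = s *\<^sub>C 1"
proof -
  define t where "t = q + qi"
  have "\<exists>s. Xf n t + Yf n t = s *\<^sub>C 1"
  proof (induction n)
    case 0 show ?case by (auto simp: quad_defs scC_add_left[symmetric])
  next
    case (Suc n)
    then obtain s where s: "Xf n t + Yf n t = s *\<^sub>C 1" by blast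
    have q: "quad n t = (Xf n t, Yf n t, bf n t, cf n t)" by (simp add: quad_defs)
    have "Xf (Suc n) t + Yf (Suc n) t = (kap (Suc n) - v (Suc n) * v (Suc n) - inverse (v (Suc n)) * inverse (v (Suc n))) *\<^sub>C (Xf n t + Yf n t)"
      unfolding Xf_def[of "Suc n"] Yf_def[of "Suc n"] quad.simps q Let_def prod.case fst_conv snd_conv t_def[symmetric]
      by (simp add: calg_simps)
    then show ?case unfolding s scC_scC by blast
  qed
  then show "\<exists>s. Xf n (q + qi) + Yf n (q + qi) = s *\<^sub>C 1" by (simp add: t_def)
  have "\<exists>s. Xf n (- t) - Yf n (- t) = s *\<^sub>C 1"
  proof (induction n)
    case 0 show ?case by (auto simp: quad_defs scC_diff_left[symmetric])
  next
    case (Suc n)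
    then obtain s where s: "Xf n (- t) - Yf n (- t) = s *\<^sub>C 1" by blast
    have q: "quad n (- t) = (Xf n (- t), Yf n (- t), bf n (- t), cf n (- t))" by (simp add: quad_defs)
    have "Xf (Suc n) (- t) - Yf (Suc n) (- t) = (- kap (Suc n) - v (Suc n) * v (Suc n) - inverse (v (Suc n)) * inverse (v (Suc n))) *\<^sub>C (Xf n (- t) - Yf n (- t))"
      unfolding Xf_def[of "Suc n"] Yf_def[of "Suc n"] quad.simps q Let_def prod.case fst_conv snd_conv t_def[symmetric]
      by (simp add: calg_simps)
    then show ?case unfolding s scC_scC by blast
  qed
  then show "\<exists>s. Xf n (- (q + qi)) - Yf n (- (q + qi)) = s *\<^sub>C 1" by (simp add: t_def)
qed

end

lemma rep_UP_inv:
  fixes q :: complex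
  assumes g: "\<And>U. g U = (\<Sum>m\<le>n. U ^ (n - m) *\<^sub>C r m)" and q: "q \<noteq> 0"
  shows "rep (\<lambda>w. w ^ n *\<^sub>C g (q * w + inverse q / w)) (Abs_fps (\<lambda>i. (inverse q ^ (2 * n) * (q ^ 2) ^ i) *\<^sub>C UP_fps q n r $ i))"
proof -
  have r: "rep (\<lambda>w. inverse q ^ (2 * n) *\<^sub>C ((q ^ 2 * w) ^ n *\<^sub>C g (q / (q ^ 2 * w) + inverse q * (q ^ 2 * w))))
     (fps_const (inverse q ^ (2 * n) *\<^sub>C 1) * Abs_fps (\<lambda>i. (q ^ 2) ^ i *\<^sub>C UP_fps q n r $ i))"
    by (rule rep_scC[OF rep_scale[OF rep_UP[OF g]]]) (use q in auto)
  have "inverse q ^ (2 * n) * (q ^ 2 * w) ^ n = w ^ n" "q / (q ^ 2 * w) + inverse q * (q ^ 2 * w) = q * w + inverse q / w" for w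
    using q by (simp_all add: power_mult_distrib mult_2 mult_2_right power_add field_simps power2_eq_square)
  moreover have "fps_const (inverse q ^ (2 * n) *\<^sub>C 1) * Abs_fps (\<lambda>i. (q ^ 2) ^ i *\<^sub>C UP_fps q n r $ i)
     = Abs_fps (\<lambda>i. (inverse q ^ (2 * n) * (q ^ 2) ^ i) *\<^sub>C UP_fps q n r $ i)"
    by (simp add: fps_eq_iff mult.commute)
  ultimately show ?thesis using r by simp
qed

context qchain begin

lemma point:
  assumes "norm w > 1"
  obtains u where "u \<noteq> 0" "u * u = inverse w" "inverse u * inverse u = w"
    "Uu u = q / w + inverse q * w" "Uu (inverse u) = q * w + inverse q / w"
    "u * u - inverse u * inverse u \<noteq> 0"
proof -
  have w: "w \<noteq> 0" using assms by auto
  (* Any square root of 1/w is a spectral parameter belonging to w. *)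
  define u where "u = csqrt (inverse w)"
  have 1: "u * u = inverse w" unfolding u_def using power2_csqrt[of "inverse w"] by (simp add: power2_eq_square)
  then have 2: "inverse u * inverse u = w" by (metis inverse_inverse_eq inverse_mult_distrib)
  have u: "u \<noteq> 0" using 1 w by auto
  have "inverse w \<noteq> w"
  proof
    assume "inverse w = w"
    then have "w * w = 1" using w by (metis right_inverse)
    then have "norm w * norm w = 1" by (metis norm_mult norm_one)
    moreover have "1 * 1 < norm w * norm w" using assms by (intro mult_strict_mono) auto
    ultimately show False by simp
  qed
  then have 3: "u * u - inverse u * inverse u \<noteq> 0" unfolding 1 2 by simp
  show ?thesis
  proof (rule that[OF u 1 2 _ _ 3])
    show "Uu u = q / w + inverse q * w"
      unfolding mult.assoc 1 2 by (simp add: divide_inverse mult.assoc)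
    show "Uu (inverse u) = q * w + inverse q / w"
      unfolding mult.assoc inverse_inverse_eq 1 2 by (simp add: divide_inverse mult.assoc)
  qed
qed

definition expansion where
  "expansion n rX rY rb rc \<longleftrightarrow> (\<forall>U. Xf n U = (\<Sum>m\<le>n. U ^ (n - m) *\<^sub>C rX m)) \<and>
    (\<forall>U. Yf n U = (\<Sum>m\<le>n. U ^ (n - m) *\<^sub>C rY m)) \<and> (\<forall>U. bf n U = (\<Sum>m\<le>n. U ^ (n - m) *\<^sub>C rb m)) \<and>
    (\<forall>U. cf n U = (\<Sum>m\<le>n. U ^ (n - m) *\<^sub>C rc m)) \<and> rb 0 = (kp / lam) *\<^sub>C 1 \<and> rc 0 = (km / lam) *\<^sub>C 1"

lemma expansion_exists: "\<exists>rX rY rb rc. expansion n rX rY rb rc"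
proof -
  obtain x0 y0 where PU: "PU n x0 (Xf n)" "PU n y0 (Yf n)" "PU n ((kp / lam) *\<^sub>C 1) (bf n)"
    "PU n ((km / lam) *\<^sub>C 1) (cf n)" using PU_quad[of n] by blast
  obtain rX where 1: "\<forall>U. Xf n U = (\<Sum>m\<le>n. U ^ (n - m) *\<^sub>C rX m)" using PU(1) unfolding PU_def by blast
  obtain rY where 2: "\<forall>U. Yf n U = (\<Sum>m\<le>n. U ^ (n - m) *\<^sub>C rY m)" using PU(2) unfolding PU_def by blast
  obtain rb where 3: "\<forall>U. bf n U = (\<Sum>m\<le>n. U ^ (n - m) *\<^sub>C rb m)" "rb 0 = (kp / lam) *\<^sub>C 1" using PU(3) unfolding PU_def by blast
  obtain rc where 4: "\<forall>U. cf n U = (\<Sum>m\<le>n. U ^ (n - m) *\<^sub>C rc m)" "rc 0 = (km / lam) *\<^sub>C 1" using PU(4) unfolding PU_def by blast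
  have "expansion n rX rY rb rc" unfolding expansion_def by (intro conjI 1 2 3 4)
  then show ?thesis by (intro exI)
qed

context
  fixes n rX rY rb rc
  assumes nN: "n \<le> N" and ex: "expansion n rX rY rb rc"
begin

abbreviation "Xp \<equiv> UP_fps q n rX"
abbreviation "Yp \<equiv> UP_fps q n rY"
abbreviation "Bp \<equiv> UP_fps q n rb"
abbreviation "Cp \<equiv> UP_fps q n rc"
abbreviation "Aw \<equiv> Wa n"
abbreviation "Bw \<equiv> Wb n"
abbreviation "conj_fps p \<equiv> Abs_fps (\<lambda>i. (inverse q ^ (2 * n) * (q ^ 2) ^ i) *\<^sub>C p $ i)"

lemma exs:
  "Xf n U = (\<Sum>m\<le>n. U ^ (n - m) *\<^sub>C rX m)" "Yf n U = (\<Sum>m\<le>n. U ^ (n - m) *\<^sub>C rY m)"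
  "bf n U = (\<Sum>m\<le>n. U ^ (n - m) *\<^sub>C rb m)" "cf n U = (\<Sum>m\<le>n. U ^ (n - m) *\<^sub>C rc m)"
  "rb 0 = (kp / lam) *\<^sub>C 1" "rc 0 = (km / lam) *\<^sub>C 1"
  using ex unfolding expansion_def by blast+

lemma q0: "q \<noteq> 0" using h0 by simp
lemmas reps = rep_UP[where q = q, OF exs(1)] rep_UP[where q = q, OF exs(2)]
  rep_UP[where q = q, OF exs(3)] rep_UP[where q = q, OF exs(4)]
lemmas reps' = rep_UP_inv[where q = q, OF exs(1) q0] rep_UP_inv[where q = q, OF exs(2) q0]
  rep_UP_inv[where q = q, OF exs(3) q0] rep_UP_inv[where q = q, OF exs(4) q0]

text \<open>The relations between the entries, read off coefficient by coefficient. The variable is \<open>w = u\<^sup>-\<^sup>2\<close>, and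
  every relation is multiplied by the power of \<open>w\<close> that makes it polynomial.\<close>

lemma X_coeff: "kp *\<^sub>C Xp $ m = q *\<^sub>C (Aw * Bp $ m) - qi *\<^sub>C (Bp $ m * Aw)"
proof -
  have "fps_const (kp *\<^sub>C 1) * Xp = fps_const (q *\<^sub>C 1) * (fps_const Aw * Bp) - fps_const (qi *\<^sub>C 1) * (Bp * fps_const Aw)"
  proof (rule rep_unique[OF rep_scC[OF reps(1)] rep_diff[OF rep_scC[OF rep_mult[OF rep_const reps(3)]] rep_scC[OF rep_mult[OF reps(3) rep_const]]]])
    fix w :: complex assume w: "norm w > 1"
    obtain u where u: "u \<noteq> 0" "Uu u = q / w + inverse q * w" "u * u - inverse u * inverse u \<noteq> 0" by (rule point[OF w])
    show "kp *\<^sub>C w ^ n *\<^sub>C Xf n (q / w + inverse q * w) = q *\<^sub>C (Aw * (w ^ n *\<^sub>C bf n (q / w + inverse q * w)))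
       - qi *\<^sub>C (w ^ n *\<^sub>C bf n (q / w + inverse q * w) * Aw)"
      using arg_cong[OF KK_relations(1)[OF nN u(1,3)], of "\<lambda>x. w ^ n *\<^sub>C x"] unfolding u(2)
      by (simp add: scC_diff_right mult.commute)
  qed
  from arg_cong[OF this, of "\<lambda>p. p $ m"] show ?thesis by simp
qed

lemma Y_coeff: "kp *\<^sub>C Yp $ m = q *\<^sub>C (Bp $ m * Bw) - qi *\<^sub>C (Bw * Bp $ m)"
proof -
  have "fps_const (kp *\<^sub>C 1) * Yp = fps_const (q *\<^sub>C 1) * (Bp * fps_const Bw) - fps_const (qi *\<^sub>C 1) * (fps_const Bw * Bp)"
  proof (rule rep_unique[OF rep_scC[OF reps(2)] rep_diff[OF rep_scC[OF rep_mult[OF reps(3) rep_const]] rep_scC[OF rep_mult[OF rep_const reps(3)]]]])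
    fix w :: complex assume w: "norm w > 1"
    obtain u where u: "u \<noteq> 0" "Uu u = q / w + inverse q * w" "u * u - inverse u * inverse u \<noteq> 0" by (rule point[OF w])
    show "kp *\<^sub>C w ^ n *\<^sub>C Yf n (q / w + inverse q * w) = q *\<^sub>C (w ^ n *\<^sub>C bf n (q / w + inverse q * w) * Bw)
       - qi *\<^sub>C (Bw * (w ^ n *\<^sub>C bf n (q / w + inverse q * w)))"
      using arg_cong[OF KK_relations(2)[OF nN u(1,3)], of "\<lambda>x. w ^ n *\<^sub>C x"] unfolding u(2)
      by (simp add: scC_diff_right mult.commute)
  qed
  from arg_cong[OF this, of "\<lambda>p. p $ m"] show ?thesis by simp
qed

lemma C_minus_B_coeff: "(q + qi) *\<^sub>C (kp *\<^sub>C Cp $ m - km *\<^sub>C Bp $ m) = Xp $ m * Aw - Aw * Xp $ m"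
proof -
  have "fps_const ((q + qi) *\<^sub>C 1) * (fps_const (kp *\<^sub>C 1) * Cp - fps_const (km *\<^sub>C 1) * Bp) = Xp * fps_const Aw - fps_const Aw * Xp"
  proof (rule rep_unique[OF rep_scC[OF rep_diff[OF rep_scC[OF reps(4)] rep_scC[OF reps(3)]]] rep_diff[OF rep_mult[OF reps(1) rep_const] rep_mult[OF rep_const reps(1)]]])
    fix w :: complex assume w: "norm w > 1"
    obtain u where u: "u \<noteq> 0" "Uu u = q / w + inverse q * w" "u * u - inverse u * inverse u \<noteq> 0" by (rule point[OF w])
    show "(q + qi) *\<^sub>C (kp *\<^sub>C w ^ n *\<^sub>C cf n (q / w + inverse q * w) - km *\<^sub>C w ^ n *\<^sub>C bf n (q / w + inverse q * w)) =
       w ^ n *\<^sub>C Xf n (q / w + inverse q * w) * Aw - Aw * (w ^ n *\<^sub>C Xf n (q / w + inverse q * w))"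
      using arg_cong[OF KK_relations(3)[OF nN u(1,3)], of "\<lambda>x. w ^ n *\<^sub>C x"] unfolding u(2)
      by (simp add: scC_diff_right mult.commute mult.left_commute mult.assoc)
  qed
  from arg_cong[OF this, of "\<lambda>p. p $ m"] show ?thesis by (simp add: scC_diff_right mult.assoc)
qed

lemma XY_commutator_coeff: "q *\<^sub>C (Xp $ m * Aw - Aw * Xp $ m) + (if m < 2 then 0 else qi *\<^sub>C (Xp $ (m - 2) * Aw - Aw * Xp $ (m - 2)))
   = (if m = 0 then 0 else - ((q + qi) *\<^sub>C (Yp $ (m - 1) * Aw - Aw * Yp $ (m - 1))))"
proof -
  define xi where "xi = Xp * fps_const Aw - fps_const Aw * Xp"
  define et where "et = Yp * fps_const Aw - fps_const Aw * Yp"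
  define gx where "gx w = w ^ n *\<^sub>C Xf n (q / w + inverse q * w) * Aw - Aw * (w ^ n *\<^sub>C Xf n (q / w + inverse q * w))" for w
  define gy where "gy w = w ^ n *\<^sub>C Yf n (q / w + inverse q * w) * Aw - Aw * (w ^ n *\<^sub>C Yf n (q / w + inverse q * w))" for w
  have xi: "rep gx xi" unfolding gx_def xi_def by (rule rep_diff[OF rep_mult[OF reps(1) rep_const] rep_mult[OF rep_const reps(1)]])
  have et: "rep gy et" unfolding gy_def et_def by (rule rep_diff[OF rep_mult[OF reps(2) rep_const] rep_mult[OF rep_const reps(2)]])
  have "fps_const (q *\<^sub>C 1) * xi + fps_const (qi *\<^sub>C 1) * (fps_X ^ 2 * xi) = fps_const ((- (q + qi)) *\<^sub>C 1) * (fps_X ^ 1 * et)"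
  proof (rule rep_unique[OF rep_add[OF rep_scC[OF xi] rep_scC[OF rep_wpow[OF xi]]] rep_scC[OF rep_wpow[OF et]]])
    fix w :: complex assume w: "norm w > 1"
    then have w0: "w \<noteq> 0" by auto
    obtain u where u: "u \<noteq> 0" "Uu u = q / w + inverse q * w" "u * u - inverse u * inverse u \<noteq> 0" by (rule point[OF w])
    have gx: "gx w = w ^ n *\<^sub>C (Xf n (q / w + inverse q * w) * Aw - Aw * Xf n (q / w + inverse q * w))"
      by (simp add: gx_def scC_diff_right)
    have gy: "gy w = w ^ n *\<^sub>C (Yf n (q / w + inverse q * w) * Aw - Aw * Yf n (q / w + inverse q * w))"
      by (simp add: gy_def scC_diff_right)
    have c1: "q * w ^ n + qi * w\<^sup>2 * w ^ n = w ^ Suc n * (q / w + inverse q * w)"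
      using w0 by (simp add: field_simps power2_eq_square)
    have "q *\<^sub>C gx w + qi *\<^sub>C w\<^sup>2 *\<^sub>C gx w = (q * w ^ n + qi * w\<^sup>2 * w ^ n) *\<^sub>C (Xf n (q / w + inverse q * w) * Aw - Aw * Xf n (q / w + inverse q * w))"
      unfolding gx scC_add_left scC_scC by (simp add: mult.assoc)
    also have "\<dots> = w ^ Suc n *\<^sub>C ((q / w + inverse q * w) *\<^sub>C (Xf n (q / w + inverse q * w) * Aw - Aw * Xf n (q / w + inverse q * w)))"
      unfolding c1 scC_scC ..
    also have "\<dots> = w ^ Suc n *\<^sub>C (- ((q + qi) *\<^sub>C (Yf n (q / w + inverse q * w) * Aw - Aw * Yf n (q / w + inverse q * w))))"
      using KK_relations(4)[OF nN u(1,3)] unfolding u(2) by (rule arg_cong)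
    also have "\<dots> = (- (q + qi)) *\<^sub>C w ^ 1 *\<^sub>C gy w" by (simp only: gy scC_minus_left scC_minus_right mult_minus_left mult_minus_right scC_scC power_Suc power_one_right mult_ac)
    finally show "q *\<^sub>C gx w + qi *\<^sub>C w\<^sup>2 *\<^sub>C gx w = (- (q + qi)) *\<^sub>C w ^ 1 *\<^sub>C gy w" .
  qed
  have neg: "(- q - qi) *\<^sub>C x = - ((q + qi) *\<^sub>C (x::'r))" for x
    by (simp add: scC_diff_left scC_add_left)
  from arg_cong[OF \<open>_ = fps_const ((- (q + qi)) *\<^sub>C 1) * (fps_X ^ 1 * et)\<close>, of "\<lambda>p. p $ m"] show ?thesis
    by (auto simp: xi_def et_def fps_X_power_mult_nth neg simp del: power_one_right)
qed

text \<open>The scalar product \<open>\<K>(u) \<K>(1/u)\<close> in coefficients. Replacing \<open>u\<close> by \<open>1/u\<close> acts on the generating series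
  by reversal, which equals, up to powers of \<open>q\<close>, the rescaling of the variable in \<open>conj_fps\<close>.\<close>

lemma unitarity_coeff:
  defines "P \<equiv> Bp * conj_fps Cp"
  shows "\<exists>s. (fps_X ^ 2 * (Xp * conj_fps Xp + Yp * conj_fps Yp) + fps_X ^ 1 * (Xp * conj_fps Yp)
     + fps_X ^ 3 * (Yp * conj_fps Xp) - (P - fps_const (2 *\<^sub>C 1) * (fps_X ^ 2 * P) + fps_X ^ 4 * P)) $ m = s *\<^sub>C 1"
proof -
  have "(fps_X ^ 2 * (Xp * conj_fps Xp + Yp * conj_fps Yp) + fps_X ^ 1 * (Xp * conj_fps Yp)
     + fps_X ^ 3 * (Yp * conj_fps Xp) - (P - fps_const (2 *\<^sub>C 1) * (fps_X ^ 2 * P) + fps_X ^ 4 * P)) $ m \<in> {s *\<^sub>C 1 |s. True}"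
    unfolding P_def
  proof (rule rep_subsp[OF rep_diff[OF rep_add[OF rep_add[OF rep_wpow[OF rep_add[OF rep_mult[OF reps(1) reps'(1)]
     rep_mult[OF reps(2) reps'(2)]]] rep_wpow[OF rep_mult[OF reps(1) reps'(2)]]] rep_wpow[OF rep_mult[OF reps(2) reps'(1)]]]
     rep_add[OF rep_diff[OF rep_mult[OF reps(3) reps'(4)] rep_scC[OF rep_wpow[OF rep_mult[OF reps(3) reps'(4)]]]] 
       rep_wpow[OF rep_mult[OF reps(3) reps'(4)]]]]])
    show "subsp {s *\<^sub>C (1::'r) |s. True}" unfolding subsp_def
    proof (intro conjI ballI allI)
      show "0 \<in> {s *\<^sub>C (1::'r) |s. True}" by (auto intro!: exI[of _ 0])
    qed (auto simp: scC_add_left[symmetric])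
    fix w :: complex assume w: "norm w > 1"
    then have w0: "w \<noteq> 0" by auto
    obtain u where u: "u \<noteq> 0" "u * u = inverse w" "inverse u * inverse u = w"
      "Uu u = q / w + inverse q * w" "Uu (inverse u) = q * w + inverse q / w" by (rule point[OF w])
    from KK_quadratic[OF nN u(1)] obtain s where 
      s: "(Xf n (q / w + inverse q * w) * Xf n (q * w + inverse q / w) + Yf n (q / w + inverse q * w) * Yf n (q * w + inverse q / w))
       + (inverse w) *\<^sub>C (Xf n (q / w + inverse q * w) * Yf n (q * w + inverse q / w))
       + w *\<^sub>C (Yf n (q / w + inverse q * w) * Xf n (q * w + inverse q / w))
       - ((inverse w - w) * (inverse w - w)) *\<^sub>C (bf n (q / w + inverse q * w) * cf n (q * w + inverse q / w)) = s *\<^sub>C 1"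
      unfolding u by blast
    have gen: "w\<^sup>2 *\<^sub>C (w ^ n *\<^sub>C x * w ^ n *\<^sub>C x' + w ^ n *\<^sub>C y * w ^ n *\<^sub>C y') + w ^ 1 *\<^sub>C (w ^ n *\<^sub>C x * w ^ n *\<^sub>C y')
        + w ^ 3 *\<^sub>C (w ^ n *\<^sub>C y * w ^ n *\<^sub>C x') - (w ^ n *\<^sub>C b * w ^ n *\<^sub>C c - 2 *\<^sub>C w\<^sup>2 *\<^sub>C (w ^ n *\<^sub>C b * w ^ n *\<^sub>C c)
          + w ^ 4 *\<^sub>C (w ^ n *\<^sub>C b * w ^ n *\<^sub>C c))
       = (w ^ n * w ^ n * w\<^sup>2) *\<^sub>C ((x * x' + y * y') + inverse w *\<^sub>C (x * y') + w *\<^sub>C (y * x')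
           - ((inverse w - w) * (inverse w - w)) *\<^sub>C (b * c))" for x x' y y' b c :: 'r
    proof -
      have z: "(w ^ n * w ^ n * w\<^sup>2) * ((inverse w - w) * (inverse w - w)) = w ^ n * w ^ n - 2 * w\<^sup>2 * (w ^ n * w ^ n) + w ^ 4 * (w ^ n * w ^ n)"
        using w0 by (simp add: field_simps power2_eq_square power4_eq_xxxx)
      have z2: "(w ^ n * w ^ n * w\<^sup>2) * inverse w = w * (w ^ n * w ^ n)" "(w ^ n * w ^ n * w\<^sup>2) * w = w ^ 3 * (w ^ n * w ^ n)"
        using w0 by (simp_all add: field_simps power2_eq_square power3_eq_cube)
      show ?thesis
        unfolding scC_add_right scC_diff_right scC_scC scC_mult_left scC_mult_right z z2 scC_add_left scC_diff_left
        by (simp add: mult_ac)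
    qed
    show "w\<^sup>2 *\<^sub>C (w ^ n *\<^sub>C Xf n (q / w + inverse q * w) * w ^ n *\<^sub>C Xf n (q * w + inverse q / w) +
              w ^ n *\<^sub>C Yf n (q / w + inverse q * w) * w ^ n *\<^sub>C Yf n (q * w + inverse q / w)) +
         w ^ 1 *\<^sub>C (w ^ n *\<^sub>C Xf n (q / w + inverse q * w) * w ^ n *\<^sub>C Yf n (q * w + inverse q / w)) +
         w ^ 3 *\<^sub>C (w ^ n *\<^sub>C Yf n (q / w + inverse q * w) * w ^ n *\<^sub>C Xf n (q * w + inverse q / w)) -
         (w ^ n *\<^sub>C bf n (q / w + inverse q * w) * w ^ n *\<^sub>C cf n (q * w + inverse q / w) -
          2 *\<^sub>C w\<^sup>2 *\<^sub>C (w ^ n *\<^sub>C bf n (q / w + inverse q * w) * w ^ n *\<^sub>C cf n (q * w + inverse q / w)) +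
          w ^ 4 *\<^sub>C (w ^ n *\<^sub>C bf n (q / w + inverse q * w) * w ^ n *\<^sub>C cf n (q * w + inverse q / w)))
         \<in> {s *\<^sub>C 1 |s. True}"
      unfolding gen s unfolding scC_scC by blast
  qed
  then show ?thesis by blast
qed

end
end

section \<open>The degree of the entries\<close>

lemma pw_ids:
  fixes Q l x :: complex
  assumes "Q \<noteq> 0"
  shows "Q ^ n * (inverse Q ^ (2 * n) * (Q ^ 2) ^ 0 * Q ^ n) = 1"
    and "Q ^ n * (x / l) * (inverse Q ^ (2 * n) * (Q ^ 2) ^ m) = inverse Q ^ n * inverse l * (Q ^ (2 * m) * x)"
proof -
  define a b where "a = Q ^ n" and "b = inverse Q ^ n"
  have ab: "a * b = 1" unfolding a_def b_def using assms by (simp add: power_mult_distrib[symmetric])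
  have b2: "inverse Q ^ (2 * n) = b * b" by (simp add: b_def mult_2 power_add)
  have "a * (b * b * 1 * a) = (a * b) * (a * b)" by (simp only: mult_ac mult_1_right mult_1_left)
  then show "Q ^ n * (inverse Q ^ (2 * n) * (Q ^ 2) ^ 0 * Q ^ n) = 1"
    unfolding b2 a_def[symmetric] by (simp only: ab power_0 mult_1_right)
  have "a * (x * inverse l) * (b * b * Q ^ (2 * m)) = (a * b) * (b * inverse l * (Q ^ (2 * m) * x))"
    by (simp only: mult_ac)
  then show "Q ^ n * (x / l) * (inverse Q ^ (2 * n) * (Q ^ 2) ^ m) = inverse Q ^ n * inverse l * (Q ^ (2 * m) * x)"
    unfolding b2 a_def[symmetric] b_def[symmetric] power_mult[symmetric] divide_inverse by (simp only: ab mult_1_left)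
qed

context qchain begin
context
  fixes n rX rY rb rc
  assumes nN: "n \<le> N" and ex: "expansion n rX rY rb rc"
begin

abbreviation "XP \<equiv> UP_fps q n rX"
abbreviation "YP \<equiv> UP_fps q n rY"
abbreviation "BP \<equiv> UP_fps q n rb"
abbreviation "CP \<equiv> UP_fps q n rc"
abbreviation "FF \<equiv> filt (Wa n) (Wb n)"
abbreviation "cjf p \<equiv> Abs_fps (\<lambda>i. (inverse q ^ (2 * n) * (q ^ 2) ^ i) *\<^sub>C p $ i)"

lemmas G1 = X_coeff[OF nN ex] and G2 = Y_coeff[OF nN ex] and G3 = C_minus_B_coeff[OF nN ex] and G4 = XY_commutator_coeff[OF nN ex]
  and G5 = unitarity_coeff[OF nN ex]

lemma top: "BP $ 0 = (q ^ n * (kp / lam)) *\<^sub>C 1" "CP $ 0 = (q ^ n * (km / lam)) *\<^sub>C 1"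
  using UP_fps_nth[of 0 n q rb] UP_fps_nth[of 0 n q rc] exs(5,6)[OF nN ex] by simp_all

lemma qq_pow: "1 + q ^ (2 * m) \<noteq> 0"
proof
  assume "1 + q ^ (2 * m) = 0"
  then have "q ^ (2 * m) = -1" by (simp add: eq_neg_iff_add_eq_0 add.commute)
  then have "q ^ (4 * m) = 1" by (metis mult_2 numeral_Bit0 power_add mult_minus1 minus_minus mult.commute power_mult power2_minus one_power2)
  moreover have "m > 0" using \<open>1 + q ^ (2 * m) = 0\<close> by (cases m) auto
  ultimately show False using nonroot[of "4 * m"] by simp
qed

lemma FX: "BP $ m \<in> FF (2 * m) \<Longrightarrow> XP $ m \<in> FF (2 * m + 1)"
proof -
  assume B: "BP $ m \<in> FF (2 * m)"
  have "kp *\<^sub>C XP $ m \<in> FF (2 * m + 1)" unfolding G1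
    by (intro filt_diff filt.scC filt_mult_le[OF filt_gen(1) B] filt_mult_le[OF B filt_gen(1)]) auto
  then show ?thesis using filt_scC_iff[OF kp0] by blast
qed
lemma FY: "BP $ m \<in> FF (2 * m) \<Longrightarrow> YP $ m \<in> FF (2 * m + 1)"
proof -
  assume B: "BP $ m \<in> FF (2 * m)"
  have "kp *\<^sub>C YP $ m \<in> FF (2 * m + 1)" unfolding G2
    by (intro filt_diff filt.scC filt_mult_le[OF filt_gen(2) B] filt_mult_le[OF B filt_gen(2)]) auto
  then show ?thesis using filt_scC_iff[OF kp0] by blast
qed

text \<open>The commutator of the \<open>m\<close>-th coefficient of \<open>X\<close> with \<open>\<W>\<^sub>0\<close> would a priori have degree \<open>2m + 2\<close>. The
  relation between the commutators of \<open>X\<close> and \<open>Y\<close> expresses it by coefficients of lower index.\<close>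

lemma difference_filt:
  assumes IH: "\<And>a. a < m \<Longrightarrow> BP $ a \<in> FF (2 * a)"
  shows "kp *\<^sub>C CP $ m - km *\<^sub>C BP $ m \<in> FF (2 * m)"
proof -
  have qq: "q + qi \<noteq> 0"
  proof
    assume "q + qi = 0"
    then have "q ^ 2 = -1" using h0 by (simp add: field_simps power2_eq_square eq_neg_iff_add_eq_0)
    then have "1 + q ^ (2 * 1) = 0" by simp
    then show False using qq_pow by blast
  qed
  have xi: "XP $ a * Wa n - Wa n * XP $ a \<in> FF (2 * a)" if "a \<le> m" for a
    using that
  proof (induction a rule: less_induct)
    case (less a)
    have "q *\<^sub>C (XP $ a * Wa n - Wa n * XP $ a) = (if a = 0 then 0 else - ((q + qi) *\<^sub>C (YP $ (a - 1) * Wa n - Wa n * YP $ (a - 1))))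
        - (if a < 2 then 0 else qi *\<^sub>C (XP $ (a - 2) * Wa n - Wa n * XP $ (a - 2)))"
      using G4[of a] by (simp add: eq_diff_eq)
    also have "\<dots> \<in> FF (2 * a)"
    proof (intro filt_diff)
      show "(if a = 0 then 0 else - ((q + qi) *\<^sub>C (YP $ (a - 1) * Wa n - Wa n * YP $ (a - 1)))) \<in> FF (2 * a)"
      proof (cases "a = 0")
        case False
        then have y: "YP $ (a - 1) \<in> FF (2 * (a - 1) + 1)" using IH less.prems by (intro FY) auto
        have "YP $ (a - 1) * Wa n \<in> FF (2 * a)"
          by (rule filt_mult_le[OF y filt_gen(1)[of 1]]) (use False in auto)
        moreover have "Wa n * YP $ (a - 1) \<in> FF (2 * a)"
          by (rule filt_mult_le[OF filt_gen(1)[of 1] y]) (use False in auto)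
        ultimately have "(q + qi) *\<^sub>C (YP $ (a - 1) * Wa n - Wa n * YP $ (a - 1)) \<in> FF (2 * a)"
          by (intro filt.scC filt_diff)
        from filt_minus[OF this] show ?thesis using False by simp
      qed (simp add: filt_zero)
      show "(if a < 2 then 0 else qi *\<^sub>C (XP $ (a - 2) * Wa n - Wa n * XP $ (a - 2))) \<in> FF (2 * a)"
        using filt_mono[OF less.IH[of "a - 2"], of "2 * a"] less.prems by (auto intro: filt.scC filt_zero)
    qed
    finally show ?case using filt_scC_iff[of q] h0 by (metis mult_eq_0_iff)
  qed
  have "(q + qi) *\<^sub>C (kp *\<^sub>C CP $ m - km *\<^sub>C BP $ m) \<in> FF (2 * m)" unfolding G3 by (rule xi) simp
  then show ?thesis using filt_scC_iff[OF qq] by blast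
qed

lemma cjf_filt: "p $ i \<in> FF d \<Longrightarrow> cjf p $ i \<in> FF d"
  by (auto intro: filt.scC)

text \<open>In the coefficient of order \<open>m\<close> of \<open>\<K>(u) \<K>(1/u)\<close> the unknowns of order \<open>m\<close> occur only multiplied
  by the scalars \<open>b\<^sub>0\<close> and \<open>c\<^sub>0\<close>; everything else has lower index. The weight \<open>q^(2m)\<close> comes from the
  rescaling and makes this equation independent of \<open>difference_filt\<close>.\<close>

lemma sum_filt:
  assumes m: "m > 0" and IH: "\<And>a. a < m \<Longrightarrow> BP $ a \<in> FF (2 * a)" "\<And>a. a < m \<Longrightarrow> CP $ a \<in> FF (2 * a)"
  shows "km *\<^sub>C BP $ m + (q ^ (2 * m) * kp) *\<^sub>C CP $ m \<in> FF (2 * m)"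
proof -
  define P where "P = BP * cjf CP"
  have X: "XP $ a \<in> FF (Suc (2 * a))" and Y: "YP $ a \<in> FF (Suc (2 * a))" if "a < m" for a
    using FX[OF IH(1)[OF that]] FY[OF IH(1)[OF that]] by simp_all
  have 1: "(fps_X ^ 2 * (XP * cjf XP + YP * cjf YP)) $ m \<in> FF (2 * m)"
  proof (cases "m < 2")
    case False
    have "(XP * cjf XP) $ (m - 2) \<in> FF (2 * m)" "(YP * cjf YP) $ (m - 2) \<in> FF (2 * m)"
      using False by (auto intro!: fps_mult_filt[where s = 1 and t = 1] X Y filt.scC)
    then show ?thesis using False by (simp add: fps_X_power_mult_nth filt.add)
  qed (simp add: fps_X_power_mult_nth filt_zero)
  have 2: "(fps_X ^ 1 * (XP * cjf YP)) $ m \<in> FF (2 * m)"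
  proof -
    have "(XP * cjf YP) $ (m - 1) \<in> FF (2 * m)"
      using m by (auto intro!: fps_mult_filt[where s = 1 and t = 1] X Y filt.scC)
    then show ?thesis using m unfolding fps_X_power_mult_nth by simp
  qed
  have 3: "(fps_X ^ 3 * (YP * cjf XP)) $ m \<in> FF (2 * m)"
  proof (cases "m < 3")
    case False
    have "(YP * cjf XP) $ (m - 3) \<in> FF (2 * m)"
      using False by (auto intro!: fps_mult_filt[where s = 1 and t = 1] X Y filt.scC)
    then show ?thesis using False by (simp add: fps_X_power_mult_nth)
  qed (simp add: fps_X_power_mult_nth filt_zero)
  have Plow: "P $ j \<in> FF (2 * m)" if "j < m" for j
    unfolding P_def using that by (intro fps_mult_filt[where s = 0 and t = 0]) (auto intro!: IH filt.scC)
  have 4: "(fps_const (2 *\<^sub>C 1) * (fps_X ^ 2 * P)) $ m \<in> FF (2 * m)" "(fps_X ^ 4 * P) $ m \<in> FF (2 * m)"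
    using m by (auto simp: fps_X_power_mult_nth filt_zero intro!: Plow filt.scC)
  obtain s where s: "(fps_X ^ 2 * (XP * cjf XP + YP * cjf YP) + fps_X ^ 1 * (XP * cjf YP)
     + fps_X ^ 3 * (YP * cjf XP) - (P - fps_const (2 *\<^sub>C 1) * (fps_X ^ 2 * P) + fps_X ^ 4 * P)) $ m = s *\<^sub>C 1"
    using G5[of m] unfolding P_def by blast
  have "P $ m = (fps_X ^ 2 * (XP * cjf XP + YP * cjf YP)) $ m + (fps_X ^ 1 * (XP * cjf YP)) $ m
     + (fps_X ^ 3 * (YP * cjf XP)) $ m - s *\<^sub>C 1 + (fps_const (2 *\<^sub>C 1) * (fps_X ^ 2 * P)) $ m - (fps_X ^ 4 * P) $ m"
    using s unfolding fps_add_nth fps_sub_nth by (simp add: algebra_simps)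
  also have "\<dots> \<in> FF (2 * m)"
    by (intro filt_diff filt.add 1 2 3 4 filt.scC filt_one)
  finally have P: "P $ m \<in> FF (2 * m)" .
  have "{0..m} = insert 0 (insert m {0<..<m})" using m by auto
  then have split: "P $ m = BP $ 0 * cjf CP $ m + BP $ m * cjf CP $ 0 + (\<Sum>i\<in>{0<..<m}. BP $ i * cjf CP $ (m - i))"
    unfolding P_def fps_mult_nth using m by (simp add: add.assoc)
  have sumF: "(\<Sum>i\<in>{0<..<m}. BP $ i * cjf CP $ (m - i)) \<in> FF (2 * m)"
    by (intro filt_sum filt_mult_le[OF IH(1) cjf_filt[OF IH(2)]]) auto
  have eq: "BP $ 0 * cjf CP $ m + BP $ m * cjf CP $ 0 = P $ m - (\<Sum>i\<in>{0<..<m}. BP $ i * cjf CP $ (m - i))"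
    unfolding split by (rule add_diff_cancel_right'[symmetric])
  have "BP $ 0 * cjf CP $ m + BP $ m * cjf CP $ 0 \<in> FF (2 * m)" unfolding eq by (rule filt_diff[OF P sumF])
  also have "BP $ 0 * cjf CP $ m + BP $ m * cjf CP $ 0 = (inverse q ^ n * inverse lam) *\<^sub>C (km *\<^sub>C BP $ m + (q ^ (2 * m) * kp) *\<^sub>C CP $ m)"
  proof -
    have e: "(inverse q ^ (2 * n) * (q ^ 2) ^ m) * (q ^ n * (kp / lam)) = (inverse q ^ n * inverse lam) * (q ^ (2 * m) * kp)"
      "(inverse q ^ (2 * n) * (q ^ 2) ^ 0) * (q ^ n * (km / lam)) = (inverse q ^ n * inverse lam) * km"
      using pw_ids(2)[of q n kp lam m] pw_ids(2)[of q n km lam 0] h0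
      by (simp_all only: mult.commute mult_1_right mult_1_left power_0 mult_0_right) auto
    show ?thesis unfolding fps_nth_Abs_fps top scC_mult_left mult_1_left scC_mult_right mult_1_right scC_scC e scC_add_right
      by (rule add.commute)
  qed
  finally have "(inverse q ^ n * inverse lam) *\<^sub>C (km *\<^sub>C BP $ m + (q ^ (2 * m) * kp) *\<^sub>C CP $ m) \<in> FF (2 * m)" .
  moreover have "inverse q ^ n * inverse lam \<noteq> 0" using h0 lam0 by simp
  ultimately show ?thesis using filt_scC_iff by blast
qed

text \<open>The determinant of the two linear equations is \<open>1 + q^(2m)\<close> up to a nonzero factor, and \<open>q\<close> is not a
  root of unity.\<close>

lemma BC_filt: "BP $ m \<in> FF (2 * m) \<and> CP $ m \<in> FF (2 * m)"
proof (induction m rule: less_induct)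
  case (less m)
  show ?case
  proof (cases "m = 0")
    case True
    then show ?thesis unfolding True top by (auto intro: filt.scC filt_one)
  next
    case False
    define D S where "D = kp *\<^sub>C CP $ m - km *\<^sub>C BP $ m" and "S = km *\<^sub>C BP $ m + (q ^ (2 * m) * kp) *\<^sub>C CP $ m"
    have D: "D \<in> FF (2 * m)" unfolding D_def by (rule difference_filt) (use less in auto)
    have S: "S \<in> FF (2 * m)" unfolding S_def by (rule sum_filt) (use less False in auto)
    have "(1 + q ^ (2 * m)) *\<^sub>C (kp *\<^sub>C CP $ m) = S + D"
      by (simp add: S_def D_def scC_add_left distrib_right)
    then have "(1 + q ^ (2 * m)) *\<^sub>C (kp *\<^sub>C CP $ m) \<in> FF (2 * m)" using S D by (auto intro: filt.add)
    then have kC: "kp *\<^sub>C CP $ m \<in> FF (2 * m)" using filt_scC_iff[OF qq_pow] by blast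
    have "km *\<^sub>C BP $ m = kp *\<^sub>C CP $ m - D" by (simp add: D_def)
    then have "km *\<^sub>C BP $ m \<in> FF (2 * m)" using kC D by (auto intro: filt_diff)
    then show ?thesis using kC filt_scC_iff[OF kp0] filt_scC_iff[OF km0] by blast
  qed
qed

lemma UP_filt:
  assumes "\<And>m. UP_fps q n r $ m \<in> FF (2 * m + d)" "m \<le> n" shows "r m \<in> FF (2 * m + d)"
  using assms(2)
proof (induction m rule: less_induct)
  case (less m)
  have "q ^ (n - m) *\<^sub>C r m = UP_fps q n r $ m - (\<Sum>a<m. poly.coeff ([:q, 0, inverse q:] ^ (n - a)) (m - a) *\<^sub>C r a)"
    using UP_fps_nth[OF less.prems, of q r] by simp
  also have "\<dots> \<in> FF (2 * m + d)"
    by (intro filt_diff assms(1) filt_sum filt.scC filt_mono[OF less.IH]) (use less.prems in auto)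
  finally have "q ^ (n - m) *\<^sub>C r m \<in> FF (2 * m + d)" .
  moreover have "q ^ (n - m) \<noteq> 0" using h0 by simp
  ultimately show ?case using filt_scC_iff by blast
qed

text \<open>The coefficients of \<open>X\<close> and \<open>Y\<close> of order \<open>m\<close> have degree \<open>2m + 1\<close>, one too many when \<open>m = n\<close>. The scalar
  values of \<open>X + Y\<close> and \<open>X - Y\<close> at the two special points trade the coefficient of order \<open>n\<close> for those of
  lower order.\<close>

lemma entries_filt:
  assumes "1 \<le> n"
  shows "bf n U \<in> FF (2 * n)" "cf n U \<in> FF (2 * n)" "Xf n U \<in> FF (2 * n - 1)" "Yf n U \<in> FF (2 * n - 1)"
proof -
  note exs = exs[OF nN ex]
  have b: "rb m \<in> FF (2 * m + 0)" "rc m \<in> FF (2 * m + 0)" if "m \<le> n" for m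
    by (rule UP_filt[OF _ that], simp add: BC_filt)+
  show "bf n U \<in> FF (2 * n)" unfolding exs
    by (intro filt_sum filt.scC filt_mono[OF b(1)]) auto
  show "cf n U \<in> FF (2 * n)" unfolding exs
    by (intro filt_sum filt.scC filt_mono[OF b(2)]) auto
  have x: "rX m \<in> FF (2 * m + 1)" "rY m \<in> FF (2 * m + 1)" if "m \<le> n" for m
    by (rule UP_filt[OF _ that], simp add: BC_filt FX[simplified] FY[simplified])+
  have low: "(\<Sum>m<n. t ^ (n - m) *\<^sub>C rX m) \<in> FF (2 * n - 1)" "(\<Sum>m<n. t ^ (n - m) *\<^sub>C rY m) \<in> FF (2 * n - 1)" for t
    by (intro filt_sum filt.scC filt_mono[OF x(1)] filt_mono[OF x(2)]; auto)+
  have top: "Xf n t = (\<Sum>m<n. t ^ (n - m) *\<^sub>C rX m) + rX n" "Yf n t = (\<Sum>m<n. t ^ (n - m) *\<^sub>C rY m) + rY n" for t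
    unfolding exs by (simp_all add: lessThan_Suc_atMost[symmetric])
  define t where "t = q + qi"
  obtain s1 where s1: "Xf n t + Yf n t = s1 *\<^sub>C 1" unfolding t_def using special_values(1) by blast
  obtain s2 where s2: "Xf n (- t) - Yf n (- t) = s2 *\<^sub>C 1" unfolding t_def using special_values(2) by blast
  have one: "s *\<^sub>C 1 \<in> FF (2 * n - 1)" for s by (intro filt.scC filt_one)
  have "rX n + rY n = s1 *\<^sub>C 1 - ((\<Sum>m<n. t ^ (n - m) *\<^sub>C rX m) + (\<Sum>m<n. t ^ (n - m) *\<^sub>C rY m))"
    unfolding s1[symmetric] top by simp
  also have "\<dots> \<in> FF (2 * n - 1)" by (intro filt_diff filt.add low one)
  finally have sum: "rX n + rY n \<in> FF (2 * n - 1)" .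
  have "rX n - rY n = s2 *\<^sub>C 1 - ((\<Sum>m<n. (- t) ^ (n - m) *\<^sub>C rX m) - (\<Sum>m<n. (- t) ^ (n - m) *\<^sub>C rY m))"
    unfolding s2[symmetric] top by simp
  also have "\<dots> \<in> FF (2 * n - 1)" by (intro filt_diff filt.add low one)
  finally have diff: "rX n - rY n \<in> FF (2 * n - 1)" .
  have "2 *\<^sub>C rX n = (rX n + rY n) + (rX n - rY n)" "2 *\<^sub>C rY n = (rX n + rY n) - (rX n - rY n)"
    using scC_add_left[of 1 1 "rX n"] scC_add_left[of 1 1 "rY n"] by simp_all
  then have "2 *\<^sub>C rX n \<in> FF (2 * n - 1)" "2 *\<^sub>C rY n \<in> FF (2 * n - 1)"
    using filt.add[OF sum diff] filt_diff[OF sum diff] by simp_all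
  then have r: "rX n \<in> FF (2 * n - 1)" "rY n \<in> FF (2 * n - 1)" by (simp_all add: filt_scC_iff)
  then show "Xf n U \<in> FF (2 * n - 1)" "Yf n U \<in> FF (2 * n - 1)" unfolding top
    using filt.add[OF low(1) r(1)] filt.add[OF low(2) r(2)] by simp_all
qed

lemma XY_top: "XP $ 0 = q ^ n *\<^sub>C Wa n" "YP $ 0 = q ^ n *\<^sub>C Wb n"
proof -
  have "kp *\<^sub>C XP $ 0 = kp *\<^sub>C (q ^ n *\<^sub>C Wa n)"
  proof -
    have "q * (q ^ n * (kp / lam)) - qi * (q ^ n * (kp / lam)) = lam * (q ^ n * (kp / lam))"
      by (simp only: left_diff_distrib)
    also have "\<dots> = kp * q ^ n" using lam0 by simp
    finally show ?thesis unfolding G1 top by (simp only: scC_mult_left scC_mult_right mult_1_left mult_1_right scC_scC scC_diff_left[symmetric])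
  qed
  then show "XP $ 0 = q ^ n *\<^sub>C Wa n" using scC_cancel[OF kp0] by blast
  have "kp *\<^sub>C YP $ 0 = kp *\<^sub>C (q ^ n *\<^sub>C Wb n)"
  proof -
    have "q * (q ^ n * (kp / lam)) - qi * (q ^ n * (kp / lam)) = lam * (q ^ n * (kp / lam))"
      by (simp only: left_diff_distrib)
    also have "\<dots> = kp * q ^ n" using lam0 by simp
    finally show ?thesis unfolding G2 top by (simp only: scC_mult_left scC_mult_right mult_1_left mult_1_right scC_scC scC_diff_left[symmetric])
  qed
  then show "YP $ 0 = q ^ n *\<^sub>C Wb n" using scC_cancel[OF kp0] by blast
qed

lemma first_coeffs:
  "\<exists>s. (1 + q ^ 2) *\<^sub>C (kp *\<^sub>C CP $ 1) = q ^ n *\<^sub>C (q *\<^sub>C (Wa n * Wb n) - qi *\<^sub>C (Wb n * Wa n)) + s *\<^sub>C 1 \<and>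
       (1 + q ^ 2) *\<^sub>C (km *\<^sub>C BP $ 1) = q ^ n *\<^sub>C (q *\<^sub>C (Wb n * Wa n) - qi *\<^sub>C (Wa n * Wb n)) + s *\<^sub>C 1"
proof -
  define A B b c where "A = Wa n" and "B = Wb n" and "b = km *\<^sub>C BP $ 1" and "c = kp *\<^sub>C CP $ 1"
  have qq: "q + qi \<noteq> 0"
  proof
    assume "q + qi = 0"
    then have "q ^ 2 = -1" using h0 by (simp add: field_simps power2_eq_square eq_neg_iff_add_eq_0)
    then have "1 + q ^ (2 * 1) = 0" by simp
    then show False using qq_pow by blast
  qed
  have "q *\<^sub>C ((q + qi) *\<^sub>C (c - b)) = - ((q + qi) *\<^sub>C (q ^ n *\<^sub>C (B * A - A * B)))"
    unfolding b_def c_def G3 using G4[of 1] by (simp add: XY_top A_def B_def scC_diff_right)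
  then have "(q + qi) *\<^sub>C (q *\<^sub>C (c - b)) = (q + qi) *\<^sub>C (q ^ n *\<^sub>C (A * B - B * A))"
    by (simp add: scC_diff_right mult.commute)
  then have cb: "q *\<^sub>C (c - b) = q ^ n *\<^sub>C (A * B - B * A)" using scC_cancel[OF qq] by blast
  obtain s where s: "(fps_X ^ 2 * (XP * cjf XP + YP * cjf YP) + fps_X ^ 1 * (XP * cjf YP)
     + fps_X ^ 3 * (YP * cjf XP) - (BP * cjf CP - fps_const (2 *\<^sub>C 1) * (fps_X ^ 2 * (BP * cjf CP)) + fps_X ^ 4 * (BP * cjf CP))) $ 1 = s *\<^sub>C 1"
    using G5[of 1] by blast
  have q1: "q ^ n * (inverse q ^ (2 * n) * (q ^ 2) ^ 0 * q ^ n) = 1" 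
    "(inverse q ^ (2 * n) * (q ^ 2) ^ 1) * (q ^ n * (kp / lam)) = (inverse q ^ n * inverse lam) * (q ^ 2 * kp)"
    "(inverse q ^ (2 * n) * (q ^ 2) ^ 0) * (q ^ n * (km / lam)) = (inverse q ^ n * inverse lam) * km"
    using pw_ids(1)[of q n] pw_ids(2)[of q n kp lam 1] pw_ids(2)[of q n km lam 0] h0
    by (simp_all only: mult.commute mult_1_right mult_1_left power_0 mult_0_right) auto
  have 1: "(XP * cjf YP) $ 0 = A * B" unfolding fps_mult_nth using XY_top q1(1)
    by (simp add: A_def B_def mult_ac)
  have 2: "(BP * cjf CP) $ 1 = (inverse q ^ n * inverse lam) *\<^sub>C (b + q ^ 2 *\<^sub>C c)"
  proof -
    have "(BP * cjf CP) $ 1 = BP $ 0 * cjf CP $ 1 + BP $ 1 * cjf CP $ 0" by (simp add: fps_mult_nth)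
    also have "\<dots> = ((inverse q ^ n * inverse lam) * (q ^ 2 * kp)) *\<^sub>C CP $ 1 + ((inverse q ^ n * inverse lam) * km) *\<^sub>C BP $ 1"
      unfolding fps_nth_Abs_fps top q1(2,3)[symmetric] by (simp add: mult.commute)
    finally show ?thesis by (simp add: b_def c_def scC_add_right add.commute)
  qed
  have "A * B - (inverse q ^ n * inverse lam) *\<^sub>C (b + q ^ 2 *\<^sub>C c) = s *\<^sub>C 1"
    using s unfolding fps_add_nth fps_sub_nth fps_mult_left_const_nth fps_X_power_mult_nth 2 using 1 by simp
  then have "(inverse q ^ n * inverse lam) *\<^sub>C (b + q ^ 2 *\<^sub>C c) = A * B - s *\<^sub>C 1" by (simp add: algebra_simps)
  from arg_cong[OF this, of "\<lambda>x. (q ^ n * lam) *\<^sub>C x"]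
  have bc: "b + q ^ 2 *\<^sub>C c = (q ^ n * lam) *\<^sub>C (A * B - s *\<^sub>C 1)"
  proof -
    have "(q ^ n * lam) * (inverse q ^ n * inverse lam) = 1" using h0 lam0 by (simp add: field_simps)
    then show ?thesis using \<open>(q ^ n * lam) *\<^sub>C (inverse q ^ n * inverse lam) *\<^sub>C (b + q ^ 2 *\<^sub>C c) = (q ^ n * lam) *\<^sub>C (A * B - s *\<^sub>C 1)\<close>
      by (simp only: scC_scC scC_one)
  qed
  have cb': "c - b = (q ^ n * qi) *\<^sub>C (A * B - B * A)"
  proof -
    have "qi * q = 1" using h0 by (simp add: field_simps)
    then show ?thesis using arg_cong[OF cb, of "\<lambda>x. qi *\<^sub>C x"] by (simp only: scC_scC scC_one mult.commute)
  qed
  define t where "t = - (q ^ n * lam * s)"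
  have c: "(1 + q ^ 2) *\<^sub>C c = q ^ n *\<^sub>C (q *\<^sub>C (A * B) - qi *\<^sub>C (B * A)) + t *\<^sub>C 1"
  proof -
    have "(1 + q ^ 2) *\<^sub>C c = (b + q ^ 2 *\<^sub>C c) + (c - b)" by (simp add: scC_add_left)
    then show ?thesis unfolding bc cb' t_def by (simp add: calg_simps)
  qed
  have b: "(1 + q ^ 2) *\<^sub>C b = q ^ n *\<^sub>C (q *\<^sub>C (B * A) - qi *\<^sub>C (A * B)) + t *\<^sub>C 1"
  proof -
    have q2: "q ^ 2 * (q ^ n * qi) = q ^ n * q" using h0 by (simp add: field_simps power2_eq_square)
    have "(1 + q ^ 2) *\<^sub>C b = (b + q ^ 2 *\<^sub>C c) - q ^ 2 *\<^sub>C (c - b)" by (simp add: scC_add_left scC_diff_right)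
    then show ?thesis unfolding bc cb' t_def scC_scC q2 by (simp add: calg_simps)
  qed
  show ?thesis using b c unfolding A_def B_def b_def c_def by blast
qed

text \<open>The commutator of \<open>\<W>\<^sub>0\<close> with the first coefficient of \<open>X\<close> can be evaluated in two ways: through the first
  coefficient of \<open>b\<close> and through that of \<open>Y\<close>. Comparing the results gives a cubic relation of
  Dolan-Grady type.\<close>

lemma dolan_grady:
  "\<exists>t s. Wa n * (Wa n * (Wa n * Wb n)) = t *\<^sub>C (Wa n * (Wa n * (Wb n * Wa n))) - t *\<^sub>C (Wa n * (Wb n * (Wa n * Wa n)))
     + Wb n * (Wa n * (Wa n * Wa n)) + s *\<^sub>C (Wa n * Wb n) - s *\<^sub>C (Wb n * Wa n)"
proof -
  define A B where "A = Wa n" and "B = Wb n"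
  obtain s where E: "(1 + q ^ 2) *\<^sub>C (km *\<^sub>C BP $ 1) = q ^ n *\<^sub>C (q *\<^sub>C (B * A) - qi *\<^sub>C (A * B)) + s *\<^sub>C 1"
    using first_coeffs unfolding A_def B_def by blast
  (* E' is, up to a scalar, a q-commutator of A and B, and T, proportional to the first coefficient
     of X, is a q-commutator of A and E'. The relation between X and Y evaluates [T, A]. *)
  define E' where "E' = (1 + q ^ 2) *\<^sub>C (km *\<^sub>C BP $ 1)"
  have T: "((1 + q ^ 2) * km * kp) *\<^sub>C XP $ 1 = q *\<^sub>C (A * E') - qi *\<^sub>C (E' * A)"
    using arg_cong[OF G1[of 1], of "\<lambda>x. ((1 + q ^ 2) * km) *\<^sub>C x"]
    by (simp add: A_def E'_def scC_diff_right mult_ac)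
  define T where "T = q *\<^sub>C (A * E') - qi *\<^sub>C (E' * A)"
  define r where "r = (1 + q ^ 2) * km * kp * qi * ((q + qi) * q ^ n)"
  have TA: "T * A - A * T = r *\<^sub>C (A * B - B * A)"
  proof -
    have "q *\<^sub>C (XP $ 1 * A - A * XP $ 1) = ((q + qi) * q ^ n) *\<^sub>C (A * B - B * A)"
      using G4[of 1] by (simp add: XY_top A_def B_def scC_diff_right)
    from arg_cong[OF this, of "\<lambda>x. ((1 + q ^ 2) * km * kp * qi) *\<^sub>C x"]
    have "((1 + q ^ 2) * km * kp * qi * q) *\<^sub>C (XP $ 1 * A - A * XP $ 1) = r *\<^sub>C (A * B - B * A)"
      unfolding scC_scC r_def .
    moreover have "(1 + q ^ 2) * km * kp * qi * q = (1 + q ^ 2) * km * kp" using h0 by (simp add: field_simps)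
    ultimately have "((1 + q ^ 2) * km * kp) *\<^sub>C (XP $ 1 * A - A * XP $ 1) = r *\<^sub>C (A * B - B * A)" by simp
    then show ?thesis unfolding T_def T[symmetric] by (simp add: scC_diff_right)
  qed
  define t where "t = q * q + 1 + qi * qi"
  have hh: "h * (inverse h * y) = y" "h * inverse h = 1" for y using h0 by simp_all
  have "T * A - A * T = q ^ n *\<^sub>C (A * (A * (A * B)) - t *\<^sub>C (A * (A * (B * A))) + t *\<^sub>C (A * (B * (A * A))) - B * (A * (A * A)))"
    unfolding T_def E'_def E t_def by (simp add: calg_simps hh)
  with TA have "q ^ n *\<^sub>C (A * (A * (A * B)) - t *\<^sub>C (A * (A * (B * A))) + t *\<^sub>C (A * (B * (A * A))) - B * (A * (A * A))) = r *\<^sub>C (A * B - B * A)"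
    by simp
  from arg_cong[OF this, of "\<lambda>x. inverse (q ^ n) *\<^sub>C x"]
  have "A * (A * (A * B)) - t *\<^sub>C (A * (A * (B * A))) + t *\<^sub>C (A * (B * (A * A))) - B * (A * (A * A)) = (inverse (q ^ n) * r) *\<^sub>C (A * B - B * A)"
  proof -
    have "inverse (q ^ n) * q ^ n = 1" using h0 by simp
    then show "inverse (q ^ n) *\<^sub>C q ^ n *\<^sub>C (A * (A * (A * B)) - t *\<^sub>C (A * (A * (B * A))) + t *\<^sub>C (A * (B * (A * A))) - B * (A * (A * A)))
       = inverse (q ^ n) *\<^sub>C r *\<^sub>C (A * B - B * A) \<Longrightarrow> ?thesis"
      by (simp only: scC_scC scC_one)
  qed
  then have "A * (A * (A * B)) = t *\<^sub>C (A * (A * (B * A))) - t *\<^sub>C (A * (B * (A * A)))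
     + B * (A * (A * A)) + (inverse (q ^ n) * r) *\<^sub>C (A * B) - (inverse (q ^ n) * r) *\<^sub>C (B * A)"
    by (simp add: scC_diff_right algebra_simps)
  then show ?thesis unfolding A_def B_def by blast
qed

end
end

section \<open>States with finitely many tensor slots\<close>

text \<open>A state assigns a vector, given by its components, to a configuration of numbered slots. Slots
  replace the bookkeeping of tensor positions: an operator acts on one or two slots, whatever their
  dimensions are, and operators on disjoint slots commute.\<close>

type_synonym 'r state = "(nat \<Rightarrow> nat) \<Rightarrow> 'r"

definition op1 :: "nat \<Rightarrow> nat \<Rightarrow> (nat \<Rightarrow> nat \<Rightarrow> 'r::calg) \<Rightarrow> 'r state \<Rightarrow> 'r state" where
  "op1 i d M \<psi> c = (if c i < d then \<Sum>a<d. M (c i) a * \<psi> (c(i := a)) else 0)"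

definition op2 :: "nat \<Rightarrow> nat \<Rightarrow> nat \<Rightarrow> nat \<Rightarrow> (nat \<Rightarrow> nat \<Rightarrow> nat \<Rightarrow> nat \<Rightarrow> complex) \<Rightarrow> 'r::calg state \<Rightarrow> 'r state" where
  "op2 i di j dj M \<psi> c = (if c i < di \<and> c j < dj
     then \<Sum>a<di. \<Sum>b<dj. M (c i) (c j) a b *\<^sub>C \<psi> (c(i := a, j := b)) else 0)"

text \<open>The fusion map in the rescaled basis: slot \<open>i\<close> of dimension \<open>S + 1\<close> is split into slot \<open>i\<close> of
  dimension \<open>2\<close> and slot \<open>i'\<close> of dimension \<open>S\<close>, the value depending only on the sum of the two indices.\<close>

definition spl :: "nat \<Rightarrow> nat \<Rightarrow> nat \<Rightarrow> 'r::calg state \<Rightarrow> 'r state" where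
  "spl i i' S \<psi> c = (if c i < 2 \<and> c i' < S then \<psi> (c(i := c i + c i', i' := 0)) else 0)"

lemma op2_flip: "i \<noteq> j \<Longrightarrow> op2 j dj i di (\<lambda>b a b' a'. M a b a' b') \<psi> = op2 i di j dj M \<psi>"
  unfolding op2_def by (rule ext) (auto simp: fun_upd_twist intro: sum.swap)

lemma sum_swap3:
  "(\<Sum>a\<in>A. \<Sum>b\<in>B. \<Sum>x\<in>C. g a b x) = (\<Sum>x\<in>C. \<Sum>a\<in>A. \<Sum>b\<in>B. (g a b x :: 'a::comm_monoid_add))"
proof -
  have "(\<Sum>a\<in>A. \<Sum>b\<in>B. \<Sum>x\<in>C. g a b x) = (\<Sum>a\<in>A. \<Sum>x\<in>C. \<Sum>b\<in>B. g a b x)"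
    by (intro sum.cong refl sum.swap)
  also have "\<dots> = (\<Sum>x\<in>C. \<Sum>a\<in>A. \<Sum>b\<in>B. g a b x)" by (rule sum.swap)
  finally show ?thesis .
qed

lemma op2_op2:
  assumes "i \<noteq> k" "i \<noteq> l" "j \<noteq> k" "j \<noteq> l"
  shows "op2 i di j dj M (op2 k dk l dl M' \<psi>) = op2 k dk l dl M' (op2 i di j dj M \<psi>)"
proof (rule ext)
  fix c :: "nat \<Rightarrow> nat"
  have *: "c(i := a, j := b, k := x, l := y) = c(k := x, l := y, i := a, j := b)" for a b x y
    using assms by (auto simp: fun_eq_iff)
  have "(\<Sum>a<di. \<Sum>b<dj. \<Sum>x<dk. \<Sum>y<dl. (M (c i) (c j) a b * M' (c k) (c l) x y) *\<^sub>C \<psi> (c(i := a, j := b, k := x, l := y)))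
     = (\<Sum>x<dk. \<Sum>y<dl. \<Sum>a<di. \<Sum>b<dj. (M (c i) (c j) a b * M' (c k) (c l) x y) *\<^sub>C \<psi> (c(i := a, j := b, k := x, l := y)))"
    by (subst sum_swap3, intro sum.cong refl sum_swap3)
  then show "op2 i di j dj M (op2 k dk l dl M' \<psi>) c = op2 k dk l dl M' (op2 i di j dj M \<psi>) c"
    using assms by (auto simp: op2_def scC_sum_right * mult.commute)
qed

lemma op2_op1:
  assumes "i \<noteq> k" "j \<noteq> k"
  shows "op2 i di j dj M (op1 k dk M' \<psi>) = op1 k dk M' (op2 i di j dj M \<psi>)"
proof (rule ext)
  fix c :: "nat \<Rightarrow> nat"
  have *: "c(i := a, j := b, k := x) = c(k := x, i := a, j := b)" for a b x
    using assms by (auto simp: fun_eq_iff)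
  have "(\<Sum>a<di. \<Sum>b<dj. \<Sum>x<dk. M (c i) (c j) a b *\<^sub>C (M' (c k) x * \<psi> (c(i := a, j := b, k := x))))
     = (\<Sum>x<dk. \<Sum>a<di. \<Sum>b<dj. M (c i) (c j) a b *\<^sub>C (M' (c k) x * \<psi> (c(i := a, j := b, k := x))))"
    by (rule sum_swap3)
  then show "op2 i di j dj M (op1 k dk M' \<psi>) c = op1 k dk M' (op2 i di j dj M \<psi>) c"
    using assms by (auto simp: op2_def op1_def scC_sum_right sum_distrib_left *)
qed

lemma spl_op2:
  assumes "i \<noteq> k" "i \<noteq> l" "i' \<noteq> k" "i' \<noteq> l"
  shows "spl i i' S (op2 k dk l dl M \<psi>) = op2 k dk l dl M (spl i i' S \<psi>)"
proof (rule ext)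
  fix c :: "nat \<Rightarrow> nat"
  have "c(i := z, i' := 0, k := a, l := b) = c(k := a, l := b, i := z, i' := 0)" for a b z
    using assms by (auto simp: fun_eq_iff)
  then show "spl i i' S (op2 k dk l dl M \<psi>) c = op2 k dk l dl M (spl i i' S \<psi>) c"
    using assms by (auto simp: spl_def op2_def)
qed

lemma spl_op1:
  assumes "i \<noteq> k" "i' \<noteq> k"
  shows "spl i i' S (op1 k dk M \<psi>) = op1 k dk M (spl i i' S \<psi>)"
proof (rule ext)
  fix c :: "nat \<Rightarrow> nat"
  have "c(i := z, i' := 0, k := a) = c(k := a, i := z, i' := 0)" for a z
    using assms by (auto simp: fun_eq_iff)
  then show "spl i i' S (op1 k dk M \<psi>) c = op1 k dk M (spl i i' S \<psi>) c"
    using assms by (auto simp: spl_def op1_def)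
qed

lemma spl_spl:
  assumes "i \<noteq> k" "i \<noteq> k'" "i' \<noteq> k" "i' \<noteq> k'"
  shows "spl i i' S (spl k k' S' \<psi>) = spl k k' S' (spl i i' S \<psi>)"
proof (rule ext)
  fix c :: "nat \<Rightarrow> nat"
  have "c(i := z, i' := 0, k := a, k' := 0) = c(k := a, k' := 0, i := z, i' := 0)" for a z
    using assms by (auto simp: fun_eq_iff)
  then show "spl i i' S (spl k k' S' \<psi>) c = spl k k' S' (spl i i' S \<psi>) c"
    using assms by (auto simp: spl_def)
qed

section \<open>Locality and support\<close>

text \<open>An operator is local away from slot \<open>k\<close> if it treats the index there as a parameter. Such an operator
  is determined by its values at configurations that have \<open>0\<close> in slot \<open>k\<close>.\<close>

definition loc :: "nat \<Rightarrow> ('r state \<Rightarrow> 'r state) \<Rightarrow> bool" where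
  "loc k A \<longleftrightarrow> (\<forall>\<psi> w c. A \<psi> (c(k := w)) = A (\<lambda>d. \<psi> (d(k := w))) c)"

lemma loc_id: "loc k (\<lambda>\<psi>. \<psi>)" by (simp add: loc_def)
lemma loc_op1: "i \<noteq> k \<Longrightarrow> loc k A \<Longrightarrow> loc k (\<lambda>\<psi>. op1 i d M (A \<psi>))"
  unfolding loc_def
proof (intro allI)
  fix \<psi> and w :: nat and c :: "nat \<Rightarrow> nat" assume "i \<noteq> k" and A: "\<forall>\<psi> w c. A \<psi> (c(k := w)) = A (\<lambda>d. \<psi> (d(k := w))) c"
  then have "c(k := w, i := a) = c(i := a, k := w)" for a by auto
  then show "op1 i d M (A \<psi>) (c(k := w)) = op1 i d M (A (\<lambda>d. \<psi> (d(k := w)))) c"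
    using \<open>i \<noteq> k\<close> A by (simp add: op1_def)
qed
lemma loc_op2: "i \<noteq> k \<Longrightarrow> j \<noteq> k \<Longrightarrow> loc k A \<Longrightarrow> loc k (\<lambda>\<psi>. op2 i di j dj M (A \<psi>))"
  unfolding loc_def
proof (intro allI)
  fix \<psi> and w :: nat and c :: "nat \<Rightarrow> nat" assume "i \<noteq> k" "j \<noteq> k" and A: "\<forall>\<psi> w c. A \<psi> (c(k := w)) = A (\<lambda>d. \<psi> (d(k := w))) c"
  then have "c(k := w, i := a, j := b) = c(i := a, j := b, k := w)" for a b by auto
  then show "op2 i di j dj M (A \<psi>) (c(k := w)) = op2 i di j dj M (A (\<lambda>d. \<psi> (d(k := w)))) c"
    using \<open>i \<noteq> k\<close> \<open>j \<noteq> k\<close> A by (simp add: op2_def)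
qed
lemma loc_spl: "i \<noteq> k \<Longrightarrow> i' \<noteq> k \<Longrightarrow> loc k A \<Longrightarrow> loc k (\<lambda>\<psi>. spl i i' S (A \<psi>))"
  unfolding loc_def
proof (intro allI)
  fix \<psi> and w :: nat and c :: "nat \<Rightarrow> nat" assume "i \<noteq> k" "i' \<noteq> k" and A: "\<forall>\<psi> w c. A \<psi> (c(k := w)) = A (\<lambda>d. \<psi> (d(k := w))) c"
  then have "c(k := w, i := a, i' := b) = c(i := a, i' := b, k := w)" for a b by auto
  then show "spl i i' S (A \<psi>) (c(k := w)) = spl i i' S (A (\<lambda>d. \<psi> (d(k := w)))) c"
    using \<open>i \<noteq> k\<close> \<open>i' \<noteq> k\<close> A by (simp add: spl_def)
qed
lemmas loc_intros = loc_id loc_op1 loc_op2 loc_spl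

lemma loc_eqI:
  assumes "loc k A" "loc k B" "\<And>\<psi> c. c k = 0 \<Longrightarrow> A \<psi> c = B \<psi> c" shows "A \<psi> = B \<psi>"
proof
  fix c :: "nat \<Rightarrow> nat"
  have "A \<psi> c = A (\<lambda>d. \<psi> (d(k := c k))) (c(k := 0))"
    using assms(1)[unfolded loc_def, rule_format, of \<psi> "c(k := 0)" "c k"] by simp
  also have "\<dots> = B (\<lambda>d. \<psi> (d(k := c k))) (c(k := 0))" by (rule assms(3)) simp
  also have "\<dots> = B \<psi> c"
    using assms(2)[unfolded loc_def, rule_format, of \<psi> "c(k := 0)" "c k"] by simp
  finally show "A \<psi> c = B \<psi> c" .
qed

text \<open>Every index of the fused slot is the total of a pair of split indices, so fusion loses nothing.\<close>

lemma spl_inject: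
  assumes spl: "\<And>\<psi>. spl i i' S (P \<psi>) = spl i i' S (Q \<psi>)" and loc: "loc i' P" "loc i' Q"
    and supp: "\<And>\<psi> c. c i > S \<Longrightarrow> P \<psi> c = 0" "\<And>\<psi> c. c i > S \<Longrightarrow> Q \<psi> c = 0"
    and "S \<ge> 1" "i \<noteq> i'"
  shows "P \<psi> = Q \<psi>"
proof (rule loc_eqI[OF loc])
  fix \<psi> and c :: "nat \<Rightarrow> nat" assume c: "c i' = (0::nat)"
  show "P \<psi> c = Q \<psi> c"
  proof (cases "c i > S")
    case False
    define a where "a = (if c i < S then 0 else 1::nat)"
    define c' where "c' = c(i := a, i' := c i - a)"
    have "c'(i := c' i + c' i', i' := 0) = c"
      unfolding c'_def a_def using False assms(6,7) c by (auto simp: fun_eq_iff)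
    moreover have "c' i < 2" "c' i' < S" unfolding c'_def a_def using False assms(6,7) by auto
    ultimately show ?thesis using fun_cong[OF spl[of \<psi>], of c'] by (simp add: spl_def)
  qed (simp add: supp)
qed

section \<open>Fusion\<close>

text \<open>A left inverse of the splitting: the two ways of writing the total index \<open>s\<close> as \<open>0 + s\<close> and
  \<open>1 + (s - 1)\<close> are averaged with weights \<open>w s\<close> and \<open>1 - w s\<close>.\<close>

definition fus :: "nat \<Rightarrow> nat \<Rightarrow> nat \<Rightarrow> (nat \<Rightarrow> complex) \<Rightarrow> 'r::calg state \<Rightarrow> 'r state" where
  "fus i i' S w g c = (if c i \<le> S then w (c i) *\<^sub>C g (c(i := 0, i' := c i))
     + (1 - w (c i)) *\<^sub>C g (c(i := 1, i' := c i - 1)) else 0)"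

text \<open>A function of the pair of indices that is symmetric, in the sense that only their total matters, is
  recovered from its fused image whatever the weights are. Of the entries of \<open>\<F>\<close> only the fact that the
  two weights in a row add up to one matters.\<close>

lemma fusion_step:
  assumes A: "\<And>\<psi> c. c i' = 0 \<Longrightarrow> A \<psi> c = fus i i' S w (B \<psi>) c"
    and w: "w 0 = 1" "w S = 0" and "i \<noteq> i'" "S \<ge> 1"
    and supp: "\<And>\<psi> c. \<not> (c i < 2 \<and> c i' < S) \<Longrightarrow> B \<psi> c = 0"
    and sym: "\<And>m. m + 1 < S \<Longrightarrow> B \<psi> (c(i := 0, i' := m + 1)) = B \<psi> (c(i := 1, i' := m))"
  shows "spl i i' S (A \<psi>) c = B \<psi> c"
proof -
  show "spl i i' S (A \<psi>) c = B \<psi> c"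
  proof (cases "c i < 2 \<and> c i' < S")
    case True
    define r where "r = c i + c i'"
    have r: "r \<le> S" using True by (simp add: r_def)
    have "spl i i' S (A \<psi>) c = A \<psi> (c(i := r, i' := 0))" using True by (simp add: spl_def r_def)
    also have "\<dots> = w r *\<^sub>C B \<psi> (c(i := 0, i' := r)) + (1 - w r) *\<^sub>C B \<psi> (c(i := 1, i' := r - 1))"
      using assms(4) r by (simp add: A fus_def fun_upd_twist)
    also have "\<dots> = B \<psi> c"
    proof -
      consider "r = 0" | "r = S" "r \<noteq> 0" | "0 < r" "r < S" using r by linarith
      then show ?thesis
      proof cases
        case 1
        then have "c(i := 0, i' := 0) = c" using assms(4) by (auto simp: r_def fun_eq_iff)
        then show ?thesis using 1 by (simp add: w)
      next
        case 2
        then have "c(i := 1, i' := S - 1) = c" using True assms(4) by (auto simp: r_def fun_eq_iff less_2_cases_iff)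
        then show ?thesis using 2 by (simp add: w)
      next
        case 3
        then have *: "B \<psi> (c(i := 0, i' := r)) = B \<psi> (c(i := 1, i' := r - 1))"
          using sym[of "r - 1"] by simp
        have "B \<psi> (c(i := 0, i' := r)) = B \<psi> c"
        proof (cases "c i = 0")
          case True
          then have "c(i := 0, i' := r) = c" using assms(4) by (auto simp: r_def fun_eq_iff)
          then show ?thesis by simp
        next
          case False
          then have "c i = 1" using True by auto
          then have "c(i := 1, i' := r - 1) = c" using assms(4) by (auto simp: r_def fun_eq_iff)
          then show ?thesis using * by simp
        qed
        then show ?thesis using * by (simp add: scC_add_left[symmetric])
      qed
    qed
    finally show ?thesis .
  next
    case False
    show ?thesis by (simp only: spl_def False if_False supp[OF False])
  qed
qed

text \<open>The part of symmetry that concerns two slots of dimension \<open>2\<close>; the other two configurations are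
  fixed by the exchange.\<close>

definition swapsym :: "nat \<Rightarrow> nat \<Rightarrow> 'r state \<Rightarrow> bool" where
  "swapsym i j f \<longleftrightarrow> (\<forall>c. f (c(i := 0, j := 1)) = f (c(i := 1, j := 0)))"

lemma swapsym_op2:
  assumes "swapsym i j f" "i \<noteq> k" "i \<noteq> l" "j \<noteq> k" "j \<noteq> l"
  shows "swapsym i j (op2 k dk l dl M f)"
  unfolding swapsym_def
proof
  fix c :: "nat \<Rightarrow> nat"
  have "c(i := x, j := y, k := a, l := b) = c(k := a, l := b, i := x, j := y)" for a b x y
    using assms(2-5) by (auto simp: fun_eq_iff)
  then show "op2 k dk l dl M f (c(i := 0, j := 1)) = op2 k dk l dl M f (c(i := 1, j := 0))"
    using assms by (simp add: op2_def swapsym_def)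
qed
lemma swapsym_op1:
  assumes "swapsym i j f" "i \<noteq> k" "j \<noteq> k"
  shows "swapsym i j (op1 k dk M f)"
  unfolding swapsym_def
proof
  fix c :: "nat \<Rightarrow> nat"
  have "c(i := x, j := y, k := a) = c(k := a, i := x, j := y)" for a x y
    using assms(2-3) by (auto simp: fun_eq_iff)
  then show "op1 k dk M f (c(i := 0, j := 1)) = op1 k dk M f (c(i := 1, j := 0))"
    using assms by (simp add: op1_def swapsym_def)
qed
lemma swapsym_spl_spl:
  assumes "i \<noteq> j" "i \<noteq> k" "j \<noteq> k" "T \<ge> 2"
  shows "swapsym i j (spl j k (T - 1) (spl i j T \<psi>))"
  unfolding swapsym_def
proof
  fix c :: "nat \<Rightarrow> nat"
  have "c(i := a, j := b, k := 0, i := z, j := 0) = c(i := z, j := 0, k := 0)" for a b z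
    using assms by (auto simp: fun_eq_iff)
  then show "spl j k (T - 1) (spl i j T \<psi>) (c(i := 0, j := 1)) = spl j k (T - 1) (spl i j T \<psi>) (c(i := 1, j := 0))"
    using assms by (auto simp: spl_def)
qed
lemma swapsym_spl:
  assumes "i \<noteq> j" 
  shows "swapsym i j (spl i j 2 \<psi>)"
  unfolding swapsym_def
proof
  fix c :: "nat \<Rightarrow> nat"
  have "c(i := a, j := b, i := z, j := 0) = c(i := z, j := 0)" for a b z
    using assms by (auto simp: fun_eq_iff)
  then show "spl i j 2 \<psi> (c(i := 0, j := 1)) = spl i j 2 \<psi> (c(i := 1, j := 0))"
    using assms by (auto simp: spl_def)
qed

text \<open>Splitting the second slot once more turns the passage from \<open>(0, m + 1)\<close> to \<open>(1, m)\<close> into the exchange of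
  two spins one half.\<close>

lemma sym_of_swapsym:
  assumes "swapsym i j (spl j k (T - 1) g)" "i \<noteq> j" "i \<noteq> k" "j \<noteq> k" "c k = 0" "m + 1 < T"
  shows "g (c(i := 0, j := m + 1)) = g (c(i := 1, j := m))"
proof -
  have e: "c(i := a, j := b, k := m, j := z, k := 0) = c(i := a, j := z)" for a b z
    using assms(2-5) by (auto simp: fun_eq_iff)
  have v: "spl j k (T - 1) g (c(i := a, j := b, k := m)) = g (c(i := a, j := b + m))" if "b < 2" for a b
  proof -
    have "m < T - 1" using assms(6) by linarith
    then show ?thesis using that assms(2-4) e[of a b "b + m"] by (simp add: spl_def)
  qed
  have w: "c(k := m, i := a, j := b) = c(i := a, j := b, k := m)" for a b
    using assms(2-4) by (auto simp: fun_eq_iff)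
  have "spl j k (T - 1) g (c(k := m, i := 0, j := 1)) = spl j k (T - 1) g (c(k := m, i := 1, j := 0))"
    using assms(1) unfolding swapsym_def by blast
  then show ?thesis unfolding w using v[of 1 0] v[of 0 1] by (simp add: add.commute)
qed

section \<open>The R-matrix with spin 1/2 in the first space\<close>

definition cf' :: "complex \<Rightarrow> complex" where "cf' x = x - inverse x"

definition pf :: "complex \<Rightarrow> nat \<Rightarrow> complex \<Rightarrow> complex" where
  "pf h J u = (\<Prod>k<J - 1. cf' (u * h powi (int J - 1 - 2 * int k)))"

text \<open>The R-matrix with spin one half in the first space, in the rescaled basis. The square roots in the
  matrices of the spin operators disappear.\<close>

definition R1 :: "complex \<Rightarrow> nat \<Rightarrow> complex \<Rightarrow> nat \<Rightarrow> nat \<Rightarrow> nat \<Rightarrow> nat \<Rightarrow> complex" where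
  "R1 h J u a k a' k' = pf h J u *
     (if a = 0 \<and> a' = 0 \<and> k' = k then cf' (u * h powi (int J + 1 - 2 * int k))
      else if a = 1 \<and> a' = 1 \<and> k' = k then cf' (u * h powi (1 - int J + 2 * int k))
      else if a = 0 \<and> a' = 1 \<and> k = k' + 1 then cf' (h powi (2 * int k))
      else if a = 1 \<and> a' = 0 \<and> k' = k + 1 then cf' (h powi (2 * (int J - int k))) else 0)"

lemma R1_apply:
  assumes "i \<noteq> j" "J \<ge> 1"
  shows "op2 i 2 j (J + 1) (R1 h J u) \<psi> c =
    (if c j \<le> J then
       if c i = 0 then pf h J u *\<^sub>C (cf' (u * h powi (int J + 1 - 2 * int (c j))) *\<^sub>C \<psi> (c(i := 0, j := c j))
          + cf' (h powi (2 * int (c j))) *\<^sub>C \<psi> (c(i := 1, j := c j - 1)))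
       else if c i = 1 then pf h J u *\<^sub>C (cf' (u * h powi (1 - int J + 2 * int (c j))) *\<^sub>C \<psi> (c(i := 1, j := c j))
          + cf' (h powi (2 * (int J - int (c j)))) *\<^sub>C \<psi> (c(i := 0, j := c j + 1)))
       else 0 else 0)"
proof -
  define k where "k = c j"
  have s2: "{..<2::nat} = {0, 1}" by auto
  have "(\<Sum>b<J+1. R1 h J u 0 k 0 b *\<^sub>C \<psi> (c(i := 0, j := b))) = (pf h J u * cf' (u * h powi (int J + 1 - 2 * int k))) *\<^sub>C \<psi> (c(i := 0, j := k))" if "k \<le> J"
  proof -
    have "(\<Sum>b<J+1. R1 h J u 0 k 0 b *\<^sub>C \<psi> (c(i := 0, j := b))) = (\<Sum>b<J+1. if b = k then (pf h J u * cf' (u * h powi (int J + 1 - 2 * int k))) *\<^sub>C \<psi> (c(i := 0, j := k)) else 0)"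
      by (rule sum.cong) (auto simp: R1_def)
    then show ?thesis using that by (simp add: sum.delta)
  qed
  moreover have "(\<Sum>b<J+1. R1 h J u 1 k 1 b *\<^sub>C \<psi> (c(i := 1, j := b))) = (pf h J u * cf' (u * h powi (1 - int J + 2 * int k))) *\<^sub>C \<psi> (c(i := 1, j := k))" if "k \<le> J"
  proof -
    have "(\<Sum>b<J+1. R1 h J u 1 k 1 b *\<^sub>C \<psi> (c(i := 1, j := b))) = (\<Sum>b<J+1. if b = k then (pf h J u * cf' (u * h powi (1 - int J + 2 * int k))) *\<^sub>C \<psi> (c(i := 1, j := k)) else 0)"
      by (rule sum.cong) (auto simp: R1_def)
    then show ?thesis using that by (simp add: sum.delta)
  qed
  moreover have "(\<Sum>b<J+1. R1 h J u 0 k 1 b *\<^sub>C \<psi> (c(i := 1, j := b))) = (pf h J u * cf' (h powi (2 * int k))) *\<^sub>C \<psi> (c(i := 1, j := k - 1))" if "k \<le> J"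
  proof -
    have "(\<Sum>b<J+1. R1 h J u 0 k 1 b *\<^sub>C \<psi> (c(i := 1, j := b))) = (\<Sum>b<J+1. if b = k - 1 then (pf h J u * cf' (h powi (2 * int k))) *\<^sub>C \<psi> (c(i := 1, j := k - 1)) else 0)"
      by (rule sum.cong) (cases k; auto simp: R1_def cf'_def)+
    then show ?thesis using that assms(2) by (cases k) (auto simp: sum.delta)
  qed
  moreover have "(\<Sum>b<J+1. R1 h J u 1 k 0 b *\<^sub>C \<psi> (c(i := 0, j := b))) = (pf h J u * cf' (h powi (2 * (int J - int k)))) *\<^sub>C \<psi> (c(i := 0, j := k + 1))" if "k \<le> J"
  proof -
    have "(\<Sum>b<J+1. R1 h J u 1 k 0 b *\<^sub>C \<psi> (c(i := 0, j := b))) = (\<Sum>b<J+1. if b = k + 1 then (pf h J u * cf' (h powi (2 * (int J - int k)))) *\<^sub>C \<psi> (c(i := 0, j := k + 1)) else 0)"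
      by (rule sum.cong) (auto simp: R1_def)
    also have "\<dots> = (if k + 1 < J + 1 then (pf h J u * cf' (h powi (2 * (int J - int k)))) *\<^sub>C \<psi> (c(i := 0, j := k + 1)) else 0)"
      by (simp add: sum.delta)
    also have "\<dots> = (pf h J u * cf' (h powi (2 * (int J - int k)))) *\<^sub>C \<psi> (c(i := 0, j := k + 1))"
      using that by (cases "k = J") (auto simp: cf'_def)
    finally show ?thesis .
  qed
  ultimately show ?thesis
    unfolding op2_def k_def[symmetric] s2 by (auto simp: scC_add_right less_2_cases_iff add.commute)
qed

lemma scC_cplx [simp]: "a *\<^sub>C (x::complex) = a * x" by (simp add: scC_complex_def)

lemma powi_split:
  assumes "h \<noteq> (0::complex)"
  shows "h powi (a + b) = h powi a * h powi b" "h powi (a - b) = h powi a / h powi b"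
    "h powi (2 * a) = h powi a * h powi a" "h powi (- a) = inverse (h powi a)"
    "h powi (a * 2) = h powi a * h powi a"
proof -
  show *: "h powi (a + b) = h powi a * h powi b" for a b using assms by (intro power_int_add) simp
  show "h powi (a - b) = h powi a / h powi b" using assms by (intro power_int_diff) simp
  show "h powi (2 * a) = h powi a * h powi a" unfolding mult_2 by (rule *)
  show "h powi (- a) = inverse (h powi a)" by (rule power_int_minus)
  show "h powi (a * 2) = h powi a * h powi a" unfolding mult_2_right by (rule *)
qed

section \<open>Exchange relation and fusion in the second space\<close>

definition Rop where "Rop h J u i j = op2 i 2 j (J + 1) (R1 h J u)"

definition rA where "rA h J x k = cf' (x * h powi (int J + 1 - 2 * int k))"
definition rB where "rB h J x k = cf' (x * h powi (1 - int J + 2 * int k))"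
definition rp where "rp h J k = cf' (h powi (2 * (int J - int k)))"
definition rm where "rm h k = cf' (h powi (2 * int k))"

lemma Rop_apply:
  assumes "i \<noteq> j" "J \<ge> 1"
  shows "c i = 0 \<Longrightarrow> c j \<le> J \<Longrightarrow> Rop h J u i j \<psi> c = pf h J u *\<^sub>C (rA h J u (c j) *\<^sub>C \<psi> (c(i := 0, j := c j)) + rm h (c j) *\<^sub>C \<psi> (c(i := 1, j := c j - 1)))"
    and "c i = 1 \<Longrightarrow> c j \<le> J \<Longrightarrow> Rop h J u i j \<psi> c = pf h J u *\<^sub>C (rB h J u (c j) *\<^sub>C \<psi> (c(i := 1, j := c j)) + rp h J (c j) *\<^sub>C \<psi> (c(i := 0, j := c j + 1)))"
    and "\<not> (c i < 2 \<and> c j \<le> J) \<Longrightarrow> Rop h J u i j \<psi> c = 0"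
  unfolding Rop_def rA_def rB_def rp_def rm_def R1_apply[OF assms] by auto

lemma small_powers: "(x::complex) ^ 3 = x * x * x" "x ^ 4 = x * x * x * x" "x ^ 5 = x * x * x * x * x"
  "x ^ 6 = x * x * x * x * x * x"
  by (simp_all add: eval_nat_numeral)

text \<open>At the fusion point \<open>y = u q\<close> two adjacent R-matrices preserve the symmetric subspace of the two spins
  one half.\<close>

lemma exch:
  fixes f :: "'r::calg state"
  assumes "i \<noteq> i'" "i \<noteq> j" "i' \<noteq> j" "J \<ge> 1" and h: "h \<noteq> 0" and u: "u \<noteq> 0" and y: "y = u * h ^ 2"
    and f: "swapsym i i' f"
  shows "swapsym i i' (op2 i 2 j (J + 1) (R1 h J u) (op2 i' 2 j (J + 1) (R1 h J y) f))"
  unfolding swapsym_def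
proof
  fix c :: "nat \<Rightarrow> nat"
  define k where "k = c j"
  define F where "F a b m = f (c(i := a, i' := b, j := m))" for a b m
  have e: "f (c(i := a1, i' := b1, i := a, j := m1, i' := b, j := m)) = F a b m" for a1 b1 a b m1 m
    unfolding F_def using assms(1-3) by (intro arg_cong[where f = f]) (auto simp: fun_eq_iff)
  have F: "F 0 1 m = F 1 0 m" for m
  proof -
    have "c(i := a, i' := b, j := m) = c(j := m, i := a, i' := b)" for a b using assms(1-3) by (auto simp: fun_eq_iff)
    then show ?thesis using f unfolding F_def swapsym_def by simp
  qed
  have hk: "h powi z \<noteq> 0" for z using h by simp
  show "op2 i 2 j (J + 1) (R1 h J u) (op2 i' 2 j (J + 1) (R1 h J y) f) (c(i := 0, i' := 1)) =
    op2 i 2 j (J + 1) (R1 h J u) (op2 i' 2 j (J + 1) (R1 h J y) f) (c(i := 1, i' := 0))"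
    unfolding Rop_def[symmetric]
  proof (cases "k \<le> J")
    case False
    then show "Rop h J u i j (Rop h J y i' j f) (c(i := 0, i' := 1)) = Rop h J u i j (Rop h J y i' j f) (c(i := 1, i' := 0))"
      using assms(1-4) by (simp add: Rop_def op2_def k_def)
  next
    case True
    define A B where "A = rA h J" and "B = rB h J"
    define p m where "p = rp h J" and "m = rm h"
    have m0: "m 0 = 0" "p J = 0" by (simp_all add: m_def p_def rm_def rp_def cf'_def)
    have FF: "f (c(i := a, i' := b, j := m)) = F a b m" for a b m by (simp add: F_def)
    have L: "Rop h J u i j (Rop h J y i' j f) (c(i := 0, i' := 1)) =
       (pf h J u * pf h J y) *\<^sub>C (A u k *\<^sub>C (B y k *\<^sub>C F 0 1 k + p k *\<^sub>C F 0 0 (k + 1))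
         + m k *\<^sub>C (B y (k - 1) *\<^sub>C F 1 1 (k - 1) + p (k - 1) *\<^sub>C F 1 0 (k - 1 + 1)))"
      using assms(1-4) True le_trans[OF diff_le_self True, of 1]
      by (simp add: Rop_apply k_def[symmetric] A_def B_def p_def m_def scC_add_right mult_ac FF FF[simplified])
    have R: "Rop h J u i j (Rop h J y i' j f) (c(i := 1, i' := 0)) =
       (pf h J u * pf h J y) *\<^sub>C (B u k *\<^sub>C (A y k *\<^sub>C F 1 0 k + m k *\<^sub>C F 1 1 (k - 1))
         + p k *\<^sub>C (A y (k + 1) *\<^sub>C F 0 0 (k + 1) + m (k + 1) *\<^sub>C F 0 1 k))"
    proof (cases "k = J")
      case True
      then show ?thesis
        using assms(1-4) m0(2) by (simp add: Rop_apply k_def[symmetric] A_def B_def p_def m_def scC_add_right mult_ac FF FF[simplified])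
    next
      case False
      then have "Suc k \<le> J" using True by simp
      then show ?thesis
        using assms(1-4) True by (simp add: Rop_apply k_def[symmetric] A_def B_def p_def m_def scC_add_right mult_ac FF FF[simplified])
    qed
    have 1: "A u k * p k = p k * A y (k + 1)"
      unfolding A_def p_def rA_def rp_def y using h u hk by (simp add: cf'_def powi_split power2_eq_square field_simps small_powers)
    have 2: "m k * B y (k - 1) = B u k * m k"
    proof (cases "k = 0")
      case False
      then show ?thesis unfolding B_def m_def rB_def rm_def y using h u hk
        by (cases k) (simp_all add: cf'_def powi_split power2_eq_square field_simps small_powers)
    qed (simp add: m0)
    have 3: "A u k * B y k + m k * p (k - 1) = B u k * A y k + p k * m (k + 1)"
    proof (cases "k = 0")
      case True
      have "A u 0 * B y 0 = B u 0 * A y 0 + p 0 * m 1"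
        unfolding A_def B_def p_def m_def rA_def rB_def rp_def rm_def y using h u hk by (simp add: cf'_def powi_split power2_eq_square field_simps small_powers)
      then show ?thesis using True by (simp add: m0)
    next
      case False
      then obtain l where l: "k = Suc l" by (cases k) auto
      show ?thesis
        unfolding A_def B_def p_def m_def rA_def rB_def rp_def rm_def y l using h u hk
        by (simp add: cf'_def powi_split power2_eq_square field_simps small_powers)
    qed
    have 4: "(m k * p (k - 1)) *\<^sub>C F 1 0 (k - 1 + 1) = (m k * p (k - 1)) *\<^sub>C F 1 0 k"
      by (cases k) (simp_all add: m0)
    have "A u k *\<^sub>C (B y k *\<^sub>C F 0 1 k + p k *\<^sub>C F 0 0 (k + 1)) + m k *\<^sub>C (B y (k - 1) *\<^sub>C F 1 1 (k - 1) + p (k - 1) *\<^sub>C F 1 0 (k - 1 + 1))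
       = (A u k * B y k + m k * p (k - 1)) *\<^sub>C F 1 0 k + (A u k * p k) *\<^sub>C F 0 0 (k + 1) + (m k * B y (k - 1)) *\<^sub>C F 1 1 (k - 1)"
      unfolding scC_add_right scC_scC 4 F scC_add_left by (simp only: add_ac)
    also have "\<dots> = B u k *\<^sub>C (A y k *\<^sub>C F 1 0 k + m k *\<^sub>C F 1 1 (k - 1)) + p k *\<^sub>C (A y (k + 1) *\<^sub>C F 0 0 (k + 1) + m (k + 1) *\<^sub>C F 0 1 k)"
      unfolding 1 2 3 scC_add_right scC_scC F scC_add_left by (simp only: add_ac)
    finally show "Rop h J u i j (Rop h J y i' j f) (c(i := 0, i' := 1)) = Rop h J u i j (Rop h J y i' j f) (c(i := 1, i' := 0))"
      unfolding L R by simp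
  qed
qed

lemma pf_Suc:
  assumes "J \<ge> 2" "h \<noteq> 0"
  shows "pf h J u = pf h (J - 1) (u * h) * cf' (u * h powi (3 - int J))" "pf h (Suc 0) u = 1"
proof -
  obtain m where J: "J = Suc (Suc m)" using assms(1) by (metis Suc_le_D numeral_2_eq_2 Suc_le_mono)
  have "(\<Prod>k<m. cf' (u * h powi (int J - 1 - 2 * int k))) = (\<Prod>k<m. cf' (u * h * h powi (int (J - 1) - 1 - 2 * int k)))"
    using assms(2) J by (intro prod.cong refl) (simp add: powi_split field_simps)
  moreover have "int J - 1 - 2 * int m = 3 - int J" using J by simp
  ultimately show "pf h J u = pf h (J - 1) (u * h) * cf' (u * h powi (3 - int J))"
    unfolding pf_def using J by (simp add: mult.commute)
qed (simp add: pf_def)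

text \<open>Fusion in the second space, where the R-matrix is explicit: all components can be compared
  directly.\<close>

lemma beta:
  fixes \<psi> :: "complex state"
  assumes "i \<noteq> j" "i \<noteq> j'" "j \<noteq> j'" "J \<ge> 2" and h: "h \<noteq> 0" and u: "u \<noteq> 0"
  shows "spl j j' J (op2 i 2 j (J + 1) (R1 h J u) \<psi>) =
    op2 i 2 j 2 (R1 h 1 (u * h powi (1 - int J))) (op2 i 2 j' J (R1 h (J - 1) (u * h)) (spl j j' J \<psi>))"
proof
  fix c :: "nat \<Rightarrow> nat"
  define m where "m = c j'"
  define F where "F a b = \<psi> (c(i := a, j := b, j' := 0))" for a b
  define x y where "x = u * h powi (1 - int J)" and "y = u * h"
  have hk: "h powi z \<noteq> 0" for z using h by simp
  have J1: "J - 1 \<ge> 1" "J \<ge> 1" "op2 i 2 j' J = op2 i 2 j' (J - 1 + 1)" using assms(4) by simp_all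
  have Rops: "op2 i 2 j 2 (R1 h 1 x) = Rop h 1 x i j" "op2 i 2 j' J (R1 h (J - 1) y) = Rop h (J - 1) y i j'"
    "op2 i 2 j (J + 1) (R1 h J u) = Rop h J u i j"
    using assms(4) by (simp_all add: Rop_def numeral_2_eq_2)
  have pf: "pf h J u = pf h (J - 1) y * cf' (u * h powi (3 - int J))" "pf h 1 x = 1"
    unfolding y_def using pf_Suc[OF assms(4) h] by (simp_all add: pf_def)
  note app = Rop_apply[OF assms(1) order_refl] Rop_apply[OF assms(2) J1(1)] Rop_apply[OF assms(1) J1(2)]
  show "spl j j' J (op2 i 2 j (J + 1) (R1 h J u) \<psi>) c =
    op2 i 2 j 2 (R1 h 1 (u * h powi (1 - int J))) (op2 i 2 j' J (R1 h (J - 1) (u * h)) (spl j j' J \<psi>)) c"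
    unfolding x_def[symmetric] y_def[symmetric]
  proof (cases "c i < 2 \<and> c j < 2 \<and> m < J")
    case False
    then show "spl j j' J (op2 i 2 j (J + 1) (R1 h J u) \<psi>) c = op2 i 2 j 2 (R1 h 1 x) (op2 i 2 j' J (R1 h (J - 1) y) (spl j j' J \<psi>)) c"
      using assms by (auto simp: spl_def op2_def m_def)
  next
    case True
    define P where "P = pf h (J - 1) y"
    define s where "s = cf' (u * h powi (3 - int J))"
    have ci: "c i = 0 \<or> c i = 1" and cj: "c j = 0 \<or> c j = 1" and mJ: "m \<le> J - 1" "m < J" using True by auto
    have mJ': "int (J - 1) = int J - 1" using assms(4) by simp
    have lhs: "spl j j' J (op2 i 2 j (J + 1) (R1 h J u) \<psi>) c = Rop h J u i j \<psi> (c(j := c j + m, j' := 0))"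
      unfolding Rops using True by (simp add: spl_def m_def)
    have eF: "\<psi> (c(j := b, j' := 0, i := a, j := b')) = F a b'" for a b b'
      unfolding F_def using assms(1-3) by (intro arg_cong[where f = \<psi>]) (auto simp: fun_eq_iff)
    have eF2: "\<psi> (c(j' := 0, i := a, j := b')) = F a b'" for a b'
      unfolding F_def using assms(1-3) by (intro arg_cong[where f = \<psi>]) (auto simp: fun_eq_iff)
    have l0: "Rop h J u i j \<psi> (c(j := k, j' := 0)) = (P * s) *\<^sub>C (rA h J u k *\<^sub>C F 0 k + rm h k *\<^sub>C F 1 (k - 1))" if "c i = 0" "k \<le> J" for k
      by (subst app(7)) (use that assms(1-4) in \<open>simp_all add: eF eF2 pf P_def s_def\<close>)
    have l1: "Rop h J u i j \<psi> (c(j := k, j' := 0)) = (P * s) *\<^sub>C (rB h J u k *\<^sub>C F 1 k + rp h J k *\<^sub>C F 0 (k + 1))" if "c i = 1" "k \<le> J" for k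
      by (subst app(8)) (use that assms(1-4) in \<open>simp_all add: eF eF2 pf P_def s_def\<close>)
    define g where "g = Rop h (J - 1) y i j' (spl j j' J \<psi>)"
    have sF: "spl j j' J \<psi> (c(i := a1, j := b, i := a, j' := n)) = (if n < J then F a (b + n) else 0)" if "b < 2" for a1 b a n
    proof -
      have "c(i := a1, j := b, i := a, j' := n, j := z, j' := 0) = c(i := a, j := z, j' := 0)" for z
        using assms(1-3) by (auto simp: fun_eq_iff)
      then show ?thesis using that assms(1-3) by (simp add: spl_def F_def)
    qed
    have sF2: "spl j j' J \<psi> (c(j := b, i := a, j' := n)) = (if n < J then F a (b + n) else 0)" if "b < 2" for b a n
    proof -
      have "c(i := 0, j := b, i := a, j' := n) = c(j := b, i := a, j' := n)"
        using assms(1-3) by (auto simp: fun_eq_iff)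
      then show ?thesis using sF[OF that, of 0 a n] by simp
    qed
    have g0: "g (c(i := 0, j := b)) = P *\<^sub>C (rA h (J - 1) y m *\<^sub>C F 0 (b + m) + rm h m *\<^sub>C F 1 (b + (m - 1)))" if "b < 2" for b
      unfolding g_def by (subst app(4)) (use that assms(1-4) mJ in \<open>simp_all add: sF sF2 m_def[symmetric] P_def\<close>)
    have g1: "g (c(i := 1, j := b)) = P *\<^sub>C (rB h (J - 1) y m *\<^sub>C F 1 (b + m) + rp h (J - 1) m *\<^sub>C F 0 (b + (m + 1)))" if "b < 2" for b
    proof (cases "m = J - 1")
      case True
      then have "rp h (J - 1) m = 0" by (simp add: rp_def cf'_def)
      then show ?thesis unfolding g_def by (subst app(5)) (use that assms(1-4) mJ in \<open>simp_all add: sF sF2 m_def[symmetric] P_def\<close>)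
    next
      case False
      then have "m + 1 < J" using mJ by simp
      then show ?thesis unfolding g_def by (subst app(5)) (use that assms(1-4) mJ in \<open>simp_all add: sF sF2 m_def[symmetric] P_def\<close>)
    qed
    have rhs0: "Rop h 1 x i j g c = rA h 1 x (c j) *\<^sub>C g (c(i := 0, j := c j)) + rm h (c j) *\<^sub>C g (c(i := 1, j := c j - 1))" if "c i = 0"
      by (subst app(1)) (use that cj pf in auto)
    have rhs1: "Rop h 1 x i j g c = rB h 1 x (c j) *\<^sub>C g (c(i := 1, j := c j)) + rp h 1 (c j) *\<^sub>C g (c(i := 0, j := c j + 1))" if "c i = 1"
      by (subst app(2)) (use that cj pf in auto)
    have rm0: "rm h 0 = 0" "rp h 1 1 = 0" by (simp_all add: rm_def rp_def cf'_def)
    have "Rop h J u i j \<psi> (c(j := c j + m, j' := 0)) = Rop h 1 x i j g c"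
      using ci cj
    proof (elim disjE)
      assume c0: "c i = 0" "c j = 0"
      have s1: "rA h 1 x 0 = s" unfolding rA_def x_def s_def using h by (simp add: powi_split field_simps power2_eq_square small_powers)
      have s2: "rA h (J - 1) y m = rA h J u m"
        unfolding rA_def y_def mJ' using h by (simp add: powi_split field_simps)
      show ?thesis unfolding rhs0[OF c0(1)] c0(2) using l0[of m] c0 g0[of 0] mJ rm0 s1 s2 by (simp add: algebra_simps)
    next
      assume c0: "c i = 0" "c j = 1"
      have s1: "rA h 1 x 1 * rA h (J - 1) y m + rm h 1 * rp h (J - 1) m = s * rA h J u (1 + m)"
        "rA h 1 x 1 * rm h m + rm h 1 * rB h (J - 1) y m = s * rm h (1 + m)"
        unfolding rA_def rB_def rm_def rp_def x_def y_def s_def mJ' cf'_def using h u hk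
        by (simp_all add: powi_split field_simps power2_eq_square small_powers)
      have s2: "rm h m * F 1 (1 + (m - 1)) = rm h m * F 1 m" by (cases m) (simp_all add: rm0)
      have "rA h 1 x 1 * (P * (rA h (J - 1) y m * F 0 (1 + m) + rm h m * F 1 (1 + (m - 1)))) + rm h 1 * (P * (rB h (J - 1) y m * F 1 (0 + m) + rp h (J - 1) m * F 0 (0 + (m + 1))))
         = P * ((rA h 1 x 1 * rA h (J - 1) y m + rm h 1 * rp h (J - 1) m) * F 0 (1 + m) + (rA h 1 x 1 * rm h m + rm h 1 * rB h (J - 1) y m) * F 1 m)"
        unfolding s2 by (simp add: algebra_simps)
      also have "\<dots> = (P * s) * (rA h J u (1 + m) * F 0 (1 + m) + rm h (1 + m) * F 1 (1 + m - 1))"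
        unfolding s1 by (simp add: algebra_simps)
      finally show ?thesis unfolding rhs0[OF c0(1)] c0(2) using l0[of "1 + m"] c0 g0[of 1] g1[of 0] mJ by simp
    next
      assume c0: "c i = 1" "c j = 0"
      have s1: "rB h 1 x 0 * rB h (J - 1) y m + rp h 1 0 * rm h m = s * rB h J u m"
        "rB h 1 x 0 * rp h (J - 1) m + rp h 1 0 * rA h (J - 1) y m = s * rp h J m"
        unfolding rA_def rB_def rm_def rp_def x_def y_def s_def mJ' cf'_def using h u hk
        by (simp_all add: powi_split field_simps power2_eq_square small_powers)
      have s2: "rm h m * F 1 (1 + (m - 1)) = rm h m * F 1 m" by (cases m) (simp_all add: rm0)
      have "rB h 1 x 0 * (P * (rB h (J - 1) y m * F 1 (0 + m) + rp h (J - 1) m * F 0 (0 + (m + 1)))) + rp h 1 0 * (P * (rA h (J - 1) y m * F 0 (1 + m) + rm h m * F 1 (1 + (m - 1))))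
         = P * ((rB h 1 x 0 * rB h (J - 1) y m + rp h 1 0 * rm h m) * F 1 m + (rB h 1 x 0 * rp h (J - 1) m + rp h 1 0 * rA h (J - 1) y m) * F 0 (m + 1))"
        unfolding s2 by (simp add: algebra_simps)
      also have "\<dots> = (P * s) * (rB h J u m * F 1 m + rp h J m * F 0 (m + 1))"
        unfolding s1 by (simp add: algebra_simps)
      finally show ?thesis unfolding rhs1[OF c0(1)] c0(2) using l1[of m] c0 g0[of 1] g1[of 0] mJ by simp
    next
      assume c0: "c i = 1" "c j = 1"
      have s1: "rB h 1 x 1 = s" unfolding rB_def x_def s_def using h by (simp add: powi_split field_simps power2_eq_square small_powers)
      have s2: "rB h (J - 1) y m = rB h J u (1 + m)" "rp h (J - 1) m = rp h J (1 + m)"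
        unfolding rB_def rp_def y_def mJ' using h by (simp_all add: powi_split field_simps power2_eq_square small_powers)
      show ?thesis unfolding rhs1[OF c0(1)] c0(2) using l1[of "1 + m"] c0 g1[of 1] mJ rm0 s1 s2 by (simp add: algebra_simps)
    qed
    then show "spl j j' J (op2 i 2 j (J + 1) (R1 h J u) \<psi>) c = op2 i 2 j 2 (R1 h 1 x) (op2 i 2 j' J (R1 h (J - 1) y) (spl j j' J \<psi>)) c"
      unfolding lhs unfolding Rops g_def .
  qed
qed

section \<open>Fusion in the first space\<close>

lemma op2_cong:
  assumes "\<And>a b a' b'. a < di \<Longrightarrow> b < dj \<Longrightarrow> a' < di \<Longrightarrow> b' < dj \<Longrightarrow> M a b a' b' = M' a b a' b'"
  shows "op2 i di j dj M \<psi> = op2 i di j dj M' \<psi>"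
  unfolding op2_def by (rule ext) (auto simp: assms intro!: sum.cong)

lemma fresh_slot: "\<exists>k::nat. k \<notin> {a, b, c, d}"
  by (rule ex_new_if_finite) auto

definition ZR :: "complex \<Rightarrow> (nat \<Rightarrow> nat \<Rightarrow> complex \<Rightarrow> nat \<Rightarrow> nat \<Rightarrow> nat \<Rightarrow> nat \<Rightarrow> complex) \<Rightarrow>
    nat \<Rightarrow> nat \<Rightarrow> complex \<Rightarrow> nat \<Rightarrow> nat \<Rightarrow> nat \<Rightarrow> nat \<Rightarrow> nat \<Rightarrow> complex" where
  "ZR h RG S J u a m k n l = (if m < S then \<Sum>b<2. \<Sum>p<S. if b + p = n then
     \<Sum>k'<J+1. R1 h J (u * h powi (1 - int S)) a k b k' * RG (S - 1) J (u * h) m k' p l else 0 else 0)"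

lemma sum_by_total:
  fixes X :: "nat \<Rightarrow> nat \<Rightarrow> 'b::comm_ring_1"
  shows "(\<Sum>n<S+1. (\<Sum>b<2. \<Sum>p<S. if b + p = n then X b p else 0) * Y n) = (\<Sum>b<2. \<Sum>p<S. X b p * Y (b + p))"
proof -
  have "(\<Sum>n<S+1. (\<Sum>b<2. \<Sum>p<S. if b + p = n then X b p else 0) * Y n)
     = (\<Sum>n<S+1. \<Sum>b<2. \<Sum>p<S. if b + p = n then X b p * Y n else 0)"
    by (simp add: sum_distrib_right if_distrib[of "\<lambda>x. x * _"] cong: if_cong)
  also have "\<dots> = (\<Sum>b<2. \<Sum>p<S. \<Sum>n<S+1. if b + p = n then X b p * Y n else 0)"
    by (rule sum_swap3[symmetric])
  also have "\<dots> = (\<Sum>b<2. \<Sum>p<S. X b p * Y (b + p))"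
    by (intro sum.cong refl) (auto simp: sum.delta)
  finally show ?thesis .
qed

text \<open>What is needed of the recursive definition of the fused R-matrices: each is the fusion, with some
  weights that are \<open>1\<close> and \<open>0\<close> at the ends, of a spin one half factor and a factor of the next lower spin.\<close>

locale fusedR =
  fixes h :: complex and RG :: "nat \<Rightarrow> nat \<Rightarrow> complex \<Rightarrow> nat \<Rightarrow> nat \<Rightarrow> nat \<Rightarrow> nat \<Rightarrow> complex"
    and w :: "nat \<Rightarrow> nat \<Rightarrow> complex"
  assumes h0: "h \<noteq> 0"
    and w: "\<And>S. S \<ge> 2 \<Longrightarrow> w S 0 = 1" "\<And>S. S \<ge> 2 \<Longrightarrow> w S S = 0"
    and RG1: "\<And>J u a k a' k'. J \<ge> 1 \<Longrightarrow> a < 2 \<Longrightarrow> a' < 2 \<Longrightarrow> k < J + 1 \<Longrightarrow> k' < J + 1 \<Longrightarrow>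
      RG (Suc 0) J u a k a' k' = R1 h J u a k a' k'"
    and RGS: "\<And>S J u s k n l. S \<ge> 2 \<Longrightarrow> J \<ge> 1 \<Longrightarrow> s < S + 1 \<Longrightarrow> k < J + 1 \<Longrightarrow> n < S + 1 \<Longrightarrow> l < J + 1 \<Longrightarrow>
      RG S J u s k n l = w S s * ZR h RG S J u 0 s k n l + (1 - w S s) * ZR h RG S J u 1 (s - 1) k n l"
begin

lemma RG_fus:
  fixes \<psi> :: "complex state"
  assumes S: "S \<ge> 2" and J: "J \<ge> 1" and d: "s \<noteq> s'" "s \<noteq> j" "s' \<noteq> j" and c: "c s' = 0"
  shows "op2 s (S + 1) j (J + 1) (RG S J u) \<psi> c =
    fus s s' S (w S) (op2 s 2 j (J + 1) (R1 h J (u * h powi (1 - int S)))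
       (op2 s' S j (J + 1) (RG (S - 1) J (u * h)) (spl s s' S \<psi>))) c"
    (is "_ = fus s s' S (w S) ?B c")
proof -
  define k where "k = c j"
  define F where "F n l = \<psi> (c(s := n, s' := 0, j := l))" for n l
  have F: "\<psi> (c(s := n, j := l)) = F n l" for n l
    unfolding F_def using d c by (intro arg_cong[where f = \<psi>]) (auto simp: fun_eq_iff)
  have B: "?B (c(s := a, s' := m)) = (\<Sum>n<S+1. \<Sum>l<J+1. ZR h RG S J u a m k n l * F n l)" if "a < 2" "k < J + 1" for a m
  proof (cases "m < S")
    case True
    have e: "\<psi> (c(s := a, s' := m, s := b, j := k', s' := p, j := l, s := z, s' := 0)) = F z l" for b k' p l z
      unfolding F_def using d by (intro arg_cong[where f = \<psi>]) (auto simp: fun_eq_iff)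
    have e': "\<psi> (c(j := l, s := z, s' := 0)) = F z l" for l z
      unfolding F_def using d by (intro arg_cong[where f = \<psi>]) (auto simp: fun_eq_iff)
    have "?B (c(s := a, s' := m)) = (\<Sum>b<2. \<Sum>k'<J+1. R1 h J (u * h powi (1 - int S)) a k b k' *
        (\<Sum>p<S. \<Sum>l<J+1. RG (S - 1) J (u * h) m k' p l * F (b + p) l))"
      using d that True by (simp add: op2_def spl_def e e' k_def[symmetric] del: sum.lessThan_Suc)
    also have "\<dots> = (\<Sum>b<2. \<Sum>p<S. (\<Sum>l<J+1. (\<Sum>k'<J+1. R1 h J (u * h powi (1 - int S)) a k b k' * RG (S - 1) J (u * h) m k' p l) * F (b + p) l))"
    proof (rule sum.cong[OF refl])
      fix b :: nat
      have "(\<Sum>k'<J+1. R1 h J (u * h powi (1 - int S)) a k b k' * (\<Sum>p<S. \<Sum>l<J+1. RG (S - 1) J (u * h) m k' p l * F (b + p) l))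
        = (\<Sum>k'<J+1. \<Sum>p<S. \<Sum>l<J+1. (R1 h J (u * h powi (1 - int S)) a k b k' * RG (S - 1) J (u * h) m k' p l) * F (b + p) l)"
        by (simp only: sum_distrib_left mult.assoc)
      also have "\<dots> = (\<Sum>p<S. \<Sum>l<J+1. \<Sum>k'<J+1. (R1 h J (u * h powi (1 - int S)) a k b k' * RG (S - 1) J (u * h) m k' p l) * F (b + p) l)"
        by (rule sum_swap3[symmetric])
      finally show "(\<Sum>k'<J+1. R1 h J (u * h powi (1 - int S)) a k b k' * (\<Sum>p<S. \<Sum>l<J+1. RG (S - 1) J (u * h) m k' p l * F (b + p) l))
         = (\<Sum>p<S. (\<Sum>l<J+1. (\<Sum>k'<J+1. R1 h J (u * h powi (1 - int S)) a k b k' * RG (S - 1) J (u * h) m k' p l) * F (b + p) l))"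
        by (simp only: sum_distrib_right)
    qed
    also have "\<dots> = (\<Sum>l<J+1. \<Sum>b<2. \<Sum>p<S. (\<Sum>k'<J+1. R1 h J (u * h powi (1 - int S)) a k b k' * RG (S - 1) J (u * h) m k' p l) * F (b + p) l)"
      by (rule sum_swap3)
    also have "\<dots> = (\<Sum>l<J+1. \<Sum>n<S+1. ZR h RG S J u a m k n l * F n l)"
      using True by (simp only: ZR_def sum_by_total if_True)
    also have "\<dots> = (\<Sum>n<S+1. \<Sum>l<J+1. ZR h RG S J u a m k n l * F n l)" by (rule sum.swap)
    finally show ?thesis .
  next
    case False
    then show ?thesis using d by (simp add: op2_def ZR_def)
  qed
  show ?thesis
  proof (cases "c s < S + 1 \<and> k < J + 1")
    case True
    have "op2 s (S + 1) j (J + 1) (RG S J u) \<psi> c = (\<Sum>n<S+1. \<Sum>l<J+1. RG S J u (c s) k n l * F n l)"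
      using d True by (simp add: op2_def F k_def[symmetric] del: sum.lessThan_Suc)
    also have "\<dots> = (\<Sum>n<S+1. \<Sum>l<J+1. w S (c s) * (ZR h RG S J u 0 (c s) k n l * F n l) + (1 - w S (c s)) * (ZR h RG S J u 1 (c s - 1) k n l * F n l))"
      using S J True by (intro sum.cong refl) (auto simp: RGS algebra_simps)
    also have "\<dots> = w S (c s) * ?B (c(s := 0, s' := c s)) + (1 - w S (c s)) * ?B (c(s := 1, s' := c s - 1))"
    proof -
      have kJ: "k < J + 1" using True by simp
      have b0: "?B (c(s := 0, s' := c s)) = (\<Sum>n<S+1. \<Sum>l<J+1. ZR h RG S J u 0 (c s) k n l * F n l)"
        by (rule B) (use kJ in auto)
      have b1: "?B (c(s := 1, s' := c s - 1)) = (\<Sum>n<S+1. \<Sum>l<J+1. ZR h RG S J u 1 (c s - 1) k n l * F n l)"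
        by (rule B) (use kJ in auto)
      show ?thesis unfolding b0 b1 by (simp only: sum.distrib sum_distrib_left)
    qed
    also have "\<dots> = fus s s' S (w S) ?B c" using True by (simp add: fus_def)
    finally show ?thesis .
  next
    case False
    then show ?thesis using d by (auto simp: op2_def fus_def k_def)
  qed
qed

text \<open>Fusion in the first space. The induction on \<open>S\<close> supplies the splitting of the second factor, so that the
  required symmetry reduces to the exchange of two spins one half.\<close>

lemma RG_split:
  fixes \<psi> :: "complex state"
  assumes "S \<ge> 2" "J \<ge> 1" "s \<noteq> s'" "s \<noteq> j" "s' \<noteq> j" "u \<noteq> 0"
  shows "spl s s' S (op2 s (S + 1) j (J + 1) (RG S J u) \<psi>) =
    op2 s 2 j (J + 1) (R1 h J (u * h powi (1 - int S))) (op2 s' S j (J + 1) (RG (S - 1) J (u * h)) (spl s s' S \<psi>))"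
  using assms
proof (induction S arbitrary: s s' u \<psi> rule: less_induct)
  case (less S)
  define A where "A = (\<lambda>\<psi>::complex state. op2 s (S + 1) j (J + 1) (RG S J u) \<psi>)"
  define B where "B = (\<lambda>\<psi>::complex state. op2 s 2 j (J + 1) (R1 h J (u * h powi (1 - int S))) (op2 s' S j (J + 1) (RG (S - 1) J (u * h)) (spl s s' S \<psi>)))"
  obtain s'' where s'': "s'' \<notin> {s, s', j, j}" using fresh_slot by blast
  have x0: "u * h powi (1 - int S) \<noteq> 0" "u * h \<noteq> 0" using less.prems(6) h0 by simp_all
  have xy: "u * h * h powi (1 - int (S - 1)) = u * h powi (1 - int S) * h ^ 2"
  proof -
    have "1 - int (S - 1) = 1 - int S + 1" using less.prems(1) by simp
    then show ?thesis using h0 by (simp only: powi_split(1)[OF h0]) (simp add: power2_eq_square)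
  qed
  have "spl s s' S (A \<psi>) = B \<psi>"
  proof (rule loc_eqI[of s'' "\<lambda>\<psi>. spl s s' S (A \<psi>)" B])
    show "loc s'' (\<lambda>\<psi>. spl s s' S (A \<psi>))" unfolding A_def using s'' by (intro loc_intros) auto
    show "loc s'' B" unfolding B_def using s'' by (intro loc_intros) auto
    fix \<psi> :: "complex state" and c :: "nat \<Rightarrow> nat" assume c: "c s'' = 0"
    show "spl s s' S (A \<psi>) c = B \<psi> c"
    proof (rule fusion_step[where A = A and B = B and w = "w S" and i = s and i' = s'])
      show "A \<psi> c = fus s s' S (w S) (B \<psi>) c" if "c s' = 0" for \<psi> c
        unfolding A_def B_def by (rule RG_fus) (use less.prems that in auto)
      show "w S 0 = 1" "w S S = 0" "s \<noteq> s'" "1 \<le> S" using less.prems w by auto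
      show "B \<psi> c = 0" if "\<not> (c s < 2 \<and> c s' < S)" for \<psi> c
        using that less.prems(3-5) by (auto simp: B_def op2_def)
      fix m assume m: "m + 1 < S"
      show "B \<psi> (c(s := 0, s' := m + 1)) = B \<psi> (c(s := 1, s' := m))"
      proof (cases "S = 2")
        case True
        have "B \<psi> = op2 s 2 j (J + 1) (R1 h J (u * h powi (1 - int S))) (op2 s' 2 j (J + 1) (R1 h J (u * h)) (spl s s' S \<psi>))"
        proof -
          have one: "2 - 1 = Suc 0" by simp
          have "op2 s' 2 j (J + 1) (RG (Suc 0) J (u * h)) \<phi> = op2 s' 2 j (J + 1) (R1 h J (u * h)) \<phi>" for \<phi> :: "complex state"
            by (rule op2_cong) (rule RG1[OF less.prems(2)])
          then show ?thesis unfolding B_def True one by simp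
        qed
        moreover have "swapsym s s' \<dots>"
        proof (rule exch[OF _ _ _ less.prems(2) h0 x0(1)])
          show "u * h = u * h powi (1 - int S) * h\<^sup>2" using xy True by simp
          show "swapsym s s' (spl s s' S \<psi>)" unfolding True using less.prems by (intro swapsym_spl)
        qed (use less.prems in auto)
        ultimately show ?thesis using m True by (simp add: swapsym_def)
      next
        case False
        then have S3: "S - 1 \<ge> 2" "S - 1 < S" "S - 1 + 1 = S" using less.prems(1) by auto
        have "spl s' s'' (S - 1) (B \<psi>) = op2 s 2 j (J + 1) (R1 h J (u * h powi (1 - int S)))
           (spl s' s'' (S - 1) (op2 s' S j (J + 1) (RG (S - 1) J (u * h)) (spl s s' S \<psi>)))"
          unfolding B_def using less.prems s'' by (intro spl_op2) auto
        also have "spl s' s'' (S - 1) (op2 s' S j (J + 1) (RG (S - 1) J (u * h)) (spl s s' S \<psi>)) =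
           op2 s' 2 j (J + 1) (R1 h J (u * h * h powi (1 - int (S - 1))))
             (op2 s'' (S - 1) j (J + 1) (RG (S - 1 - 1) J (u * h * h)) (spl s' s'' (S - 1) (spl s s' S \<psi>)))"
          using less.IH[OF S3(2,1) less.prems(2), of s' s'' "u * h"] less.prems s'' x0(2) unfolding S3(3) by auto
        finally have eq: "spl s' s'' (S - 1) (B \<psi>) = op2 s 2 j (J + 1) (R1 h J (u * h powi (1 - int S)))
           (op2 s' 2 j (J + 1) (R1 h J (u * h * h powi (1 - int (S - 1))))
             (op2 s'' (S - 1) j (J + 1) (RG (S - 1 - 1) J (u * h * h)) (spl s' s'' (S - 1) (spl s s' S \<psi>))))" .
        have "swapsym s s' (spl s' s'' (S - 1) (B \<psi>))"
          unfolding eq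
        proof (rule exch[OF _ _ _ less.prems(2) h0 x0(1) xy])
          show "swapsym s s' (op2 s'' (S - 1) j (J + 1) (RG (S - 1 - 1) J (u * h * h)) (spl s' s'' (S - 1) (spl s s' S \<psi>)))"
            using less.prems s'' by (intro swapsym_op2 swapsym_spl_spl) auto
        qed (use less.prems in auto)
        then show ?thesis by (rule sym_of_swapsym) (use less.prems s'' c m in auto)
      qed
    qed
  qed
  then show ?case unfolding A_def B_def .
qed

lemma R1_flip: "op2 s 2 j 2 (R1 h 1 x) \<psi> = op2 j 2 s 2 (R1 h 1 x) (\<psi> :: 'r::calg state)" if "s \<noteq> j"
proof -
  have "op2 j 2 s 2 (R1 h 1 x) \<psi> = op2 s 2 j 2 (\<lambda>b a b' a'. R1 h 1 x a b a' b') \<psi>"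
    by (rule op2_flip[symmetric]) (use that in auto)
  also have "\<dots> = op2 s 2 j 2 (R1 h 1 x) \<psi>"
    by (rule op2_cong) (auto simp: R1_def less_2_cases_iff pf_def)
  finally show ?thesis by simp
qed

text \<open>An R-matrix of spins \<open>S/2\<close> and \<open>1/2\<close> agrees with the one with the two spaces interchanged: both split
  in the same way, and they coincide when both spins are one half.\<close>

lemma RG_one:
  fixes \<psi> :: "complex state"
  assumes "S \<ge> 1" "s \<noteq> j" "u \<noteq> 0"
  shows "op2 s (S + 1) j 2 (RG S 1 u) \<psi> = op2 j 2 s (S + 1) (R1 h S u) \<psi>"
  using assms
proof (induction S arbitrary: s u \<psi>)
  case 0 then show ?case by simp
next
  case (Suc T)
  show ?case
  proof (cases "T = 0")
    case True
    have n: "Suc 0 + 1 = 2" by simp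
    have "op2 s 2 j 2 (RG (Suc 0) 1 u) \<psi> = op2 s 2 j 2 (R1 h 1 u) \<psi>"
      by (rule op2_cong) (rule RG1; simp)
    also have "\<dots> = op2 j 2 s 2 (R1 h 1 u) \<psi>" by (rule R1_flip) (use Suc.prems in auto)
    finally show ?thesis unfolding True by (simp add: numeral_2_eq_2)
  next
    case False
    define S where "S = Suc T"
    have S: "S \<ge> 2" "S - 1 = T" "T + 1 = S" using False by (auto simp: S_def)
    obtain s' where s': "s' \<notin> {s, j, j, j}" using fresh_slot by blast
    show ?thesis unfolding S_def[symmetric]
    proof (rule spl_inject[of s s' S "\<lambda>\<psi>. op2 s (S + 1) j 2 (RG S 1 u) \<psi>" "\<lambda>\<psi>. op2 j 2 s (S + 1) (R1 h S u) \<psi>"])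
      fix \<psi> :: "complex state"
      have "spl s s' S (op2 s (S + 1) j 2 (RG S 1 u) \<psi>) = op2 s 2 j 2 (R1 h 1 (u * h powi (1 - int S)))
         (op2 s' S j 2 (RG (S - 1) 1 (u * h)) (spl s s' S \<psi>))"
        using RG_split[OF S(1), of 1 s s' j u \<psi>] Suc.prems s' by (simp add: numeral_2_eq_2)
      also have "\<dots> = op2 j 2 s 2 (R1 h 1 (u * h powi (1 - int S))) (op2 s' S j 2 (RG (S - 1) 1 (u * h)) (spl s s' S \<psi>))"
        by (rule R1_flip) (use Suc.prems in auto)
      also have "op2 s' S j 2 (RG (S - 1) 1 (u * h)) (spl s s' S \<psi>) = op2 j 2 s' S (R1 h (S - 1) (u * h)) (spl s s' S \<psi>)"
        using Suc.IH[of s' "u * h" "spl s s' S \<psi>"] False s' Suc.prems h0 unfolding S by auto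
      also have "op2 j 2 s 2 (R1 h 1 (u * h powi (1 - int S))) \<dots> = spl s s' S (op2 j 2 s (S + 1) (R1 h S u) \<psi>)"
        by (rule beta[symmetric]) (use S Suc.prems s' h0 in auto)
      finally show "spl s s' S (op2 s (S + 1) j 2 (RG S 1 u) \<psi>) = spl s s' S (op2 j 2 s (S + 1) (R1 h S u) \<psi>)" .
    qed (use s' Suc.prems S in \<open>auto intro!: loc_intros simp: op2_def\<close>)
  qed
qed

text \<open>Fusion in the second space for arbitrary first spin, by splitting the first space into spins one
  half and using \<open>beta\<close> for each of them.\<close>

lemma RG_beta:
  fixes \<psi> :: "complex state"
  assumes "S \<ge> 1" "J \<ge> 2" "s \<noteq> j" "s \<noteq> j'" "j \<noteq> j'" "u \<noteq> 0"
  shows "spl j j' J (op2 s (S + 1) j (J + 1) (RG S J u) \<psi>) =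
    op2 s (S + 1) j 2 (RG S 1 (u * h powi (1 - int J))) (op2 s (S + 1) j' J (RG S (J - 1) (u * h)) (spl j j' J \<psi>))"
  using assms
proof (induction S arbitrary: s u \<psi>)
  case 0 then show ?case by simp
next
  case (Suc T)
  have J: "J - 1 \<ge> 1" "J - 1 + 1 = J" "J \<ge> 1" using Suc.prems by auto
  show ?case
  proof (cases "T = 0")
    case True
    have 1: "op2 s 2 j (J + 1) (RG (Suc 0) J u) \<psi> = op2 s 2 j (J + 1) (R1 h J u) \<psi>" for \<psi> :: "complex state"
      by (rule op2_cong) (rule RG1[OF J(3)])
    have 2: "op2 s 2 j' J (RG (Suc 0) (J - 1) (u * h)) \<psi> = op2 s 2 j' J (R1 h (J - 1) (u * h)) \<psi>" for \<psi> :: "complex state"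
      by (rule op2_cong) (rule RG1[OF J(1)]; simp add: J(2))
    have 3: "op2 s 2 j 2 (RG (Suc 0) 1 x) \<psi> = op2 s 2 j 2 (R1 h 1 x) \<psi>" for x and \<psi> :: "complex state"
      by (rule op2_cong) (rule RG1; simp)
    have n: "Suc 0 + 1 = 2" by simp
    show ?thesis unfolding True n 1 2 3 by (rule beta[OF Suc.prems(3,4,5,2) h0 Suc.prems(6)])
  next
    case False
    define S where "S = Suc T"
    have S: "S \<ge> 2" "S - 1 = T" "T + 1 = S" using False by (auto simp: S_def)
    obtain s' where s': "s' \<notin> {s, j, j', j}" using fresh_slot by blast
    define x y z where "x = u * h powi (1 - int J)" and "y = u * h" and "z = u * h powi (1 - int S)"
    have xyz: "x * h = u * h * h powi (1 - int J)" "z * h powi (1 - int J) = x * h powi (1 - int S)"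
      "z * h = y * h powi (1 - int S)"
      by (simp_all add: x_def y_def z_def)
    have nz: "x \<noteq> 0" "y \<noteq> 0" "z \<noteq> 0" using Suc.prems h0 by (simp_all add: x_def y_def z_def)
    show ?thesis unfolding S_def[symmetric] x_def[symmetric] y_def[symmetric]
    proof (rule spl_inject[of s s' S "\<lambda>\<psi>. spl j j' J (op2 s (S + 1) j (J + 1) (RG S J u) \<psi>)"
          "\<lambda>\<psi>. op2 s (S + 1) j 2 (RG S 1 x) (op2 s (S + 1) j' J (RG S (J - 1) y) (spl j j' J \<psi>))"])
      fix \<psi> :: "complex state"
      let ?E = "spl j j' J (spl s s' S \<psi>)"
      have "spl s s' S (spl j j' J (op2 s (S + 1) j (J + 1) (RG S J u) \<psi>)) =
         spl j j' J (spl s s' S (op2 s (S + 1) j (J + 1) (RG S J u) \<psi>))"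
        by (rule spl_spl) (use s' Suc.prems in auto)
      also have "\<dots> = spl j j' J (op2 s 2 j (J + 1) (R1 h J z) (op2 s' S j (J + 1) (RG (S - 1) J y) (spl s s' S \<psi>)))"
      proof -
        have "spl s s' S (op2 s (S + 1) j (J + 1) (RG S J u) \<psi>) = op2 s 2 j (J + 1) (R1 h J z) (op2 s' S j (J + 1) (RG (S - 1) J y) (spl s s' S \<psi>))"
          unfolding y_def z_def by (rule RG_split) (use S J s' Suc.prems in auto)
        then show ?thesis by (rule arg_cong)
      qed
      also have "\<dots> = op2 s 2 j 2 (R1 h 1 (z * h powi (1 - int J))) (op2 s 2 j' J (R1 h (J - 1) (z * h))
          (spl j j' J (op2 s' S j (J + 1) (RG (S - 1) J y) (spl s s' S \<psi>))))"
        by (rule beta) (use s' Suc.prems h0 nz in auto)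
      also have "spl j j' J (op2 s' S j (J + 1) (RG (S - 1) J y) (spl s s' S \<psi>)) =
          op2 s' S j 2 (RG (S - 1) 1 (x * h)) (op2 s' S j' J (RG (S - 1) (J - 1) (y * h)) ?E)"
        using Suc.IH[of s' y "spl s s' S \<psi>"] False s' Suc.prems nz unfolding S xyz(1) y_def by auto
      also have "op2 s 2 j' J (R1 h (J - 1) (z * h)) (op2 s' S j 2 (RG (S - 1) 1 (x * h)) (op2 s' S j' J (RG (S - 1) (J - 1) (y * h)) ?E))
         = op2 s' S j 2 (RG (S - 1) 1 (x * h)) (op2 s 2 j' J (R1 h (J - 1) (z * h)) (op2 s' S j' J (RG (S - 1) (J - 1) (y * h)) ?E))"
        by (rule op2_op2) (use s' Suc.prems in auto)
      also have "op2 s 2 j' J (R1 h (J - 1) (z * h)) (op2 s' S j' J (RG (S - 1) (J - 1) (y * h)) ?E) =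
         spl s s' S (op2 s (S + 1) j' J (RG S (J - 1) y) (spl j j' J \<psi>))"
      proof -
        have "?E = spl s s' S (spl j j' J \<psi>)" by (rule spl_spl) (use s' Suc.prems in auto)
        then show ?thesis using RG_split[OF S(1) J(1), of s s' j' y "spl j j' J \<psi>"] s' Suc.prems nz
          unfolding J(2) xyz(3) by auto
      qed
      also have "op2 s 2 j 2 (R1 h 1 (z * h powi (1 - int J))) (op2 s' S j 2 (RG (S - 1) 1 (x * h)) 
           (spl s s' S (op2 s (S + 1) j' J (RG S (J - 1) y) (spl j j' J \<psi>)))) =
         spl s s' S (op2 s (S + 1) j 2 (RG S 1 x) (op2 s (S + 1) j' J (RG S (J - 1) y) (spl j j' J \<psi>)))"
        using RG_split[OF S(1) order_refl, of s s' j x "op2 s (S + 1) j' J (RG S (J - 1) y) (spl j j' J \<psi>)"] s' Suc.prems nz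
        unfolding xyz(2) by (simp add: numeral_2_eq_2)
      finally show "spl s s' S (spl j j' J (op2 s (S + 1) j (J + 1) (RG S J u) \<psi>)) =
         spl s s' S (op2 s (S + 1) j 2 (RG S 1 x) (op2 s (S + 1) j' J (RG S (J - 1) y) (spl j j' J \<psi>)))" .
    qed (use s' Suc.prems S in \<open>auto intro!: loc_intros simp: op2_def spl_def\<close>)
  qed
qed

end

section \<open>From scalar states to operator-valued states\<close>

text \<open>The component form of fusion in the second space. Being an identity between scalars it carries over
  from complex-valued states to states with values in any algebra.\<close>

definition splits :: "nat \<Rightarrow> nat \<Rightarrow> (nat \<Rightarrow> nat \<Rightarrow> nat \<Rightarrow> nat \<Rightarrow> complex) \<Rightarrow> (nat \<Rightarrow> nat \<Rightarrow> nat \<Rightarrow> nat \<Rightarrow> complex) \<Rightarrow>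
    (nat \<Rightarrow> nat \<Rightarrow> nat \<Rightarrow> nat \<Rightarrow> complex) \<Rightarrow> bool" where
  "splits d J M M1 M2 \<longleftrightarrow> (\<forall>a<d. \<forall>b<2. \<forall>m<J. \<forall>a'<d. \<forall>l<J+1. M a (b + m) a' l =
     (\<Sum>x<d. \<Sum>b'<2. \<Sum>p<J. if b' + p = l then M1 a b x b' * M2 x m a' p else 0))"

lemma splitsI:
  assumes "i \<noteq> j" "i \<noteq> j'" "j \<noteq> j'"
    and eq: "\<And>\<psi> :: complex state. spl j j' J (op2 i d j (J + 1) M \<psi>) = op2 i d j 2 M1 (op2 i d j' J M2 (spl j j' J \<psi>))"
  shows "splits d J M M1 M2"
  unfolding splits_def
proof (intro allI impI)
  fix a b m a' l :: nat assume lt: "a < d" "b < 2" "m < J" "a' < d" "l < J + 1"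
  define \<psi> :: "complex state" where "\<psi> = (\<lambda>c. if c i = a' \<and> c j = l then 1 else 0)"
  define c where "c = (\<lambda>_::nat. 0::nat)(i := a, j := b, j' := m)"
  have c: "c i = a" "c j = b" "c j' = m" using assms(1-3) by (simp_all add: c_def)
  have "spl j j' J (op2 i d j (J + 1) M \<psi>) c = (\<Sum>x<d. \<Sum>y<J+1. M a (b + m) x y * (if x = a' \<and> y = l then 1 else 0))"
    using lt assms(1-3) by (simp add: spl_def op2_def c \<psi>_def del: sum.lessThan_Suc)
  also have "\<dots> = (\<Sum>x<d. if x = a' then M a (b + m) x l else 0)"
  proof (rule sum.cong)
    fix x assume "x \<in> {..<d}"
    have "(\<Sum>y<J+1. M a (b + m) x y * (if x = a' \<and> y = l then 1 else 0)) = (\<Sum>y<J+1. if y = l then (if x = a' then M a (b + m) x l else 0) else 0)"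
      by (rule sum.cong) auto
    then show "(\<Sum>y<J+1. M a (b + m) x y * (if x = a' \<and> y = l then 1 else 0)) = (if x = a' then M a (b + m) x l else 0)"
      using lt(5) by (simp add: sum.delta del: sum.lessThan_Suc)
  qed simp
  also have "\<dots> = M a (b + m) a' l" using lt by simp
  finally have L: "spl j j' J (op2 i d j (J + 1) M \<psi>) c = M a (b + m) a' l" .
  have "op2 i d j 2 M1 (op2 i d j' J M2 (spl j j' J \<psi>)) c =
     (\<Sum>x<d. \<Sum>b'<2. M1 a b x b' * (\<Sum>y<d. \<Sum>p<J. M2 x m y p * (if y = a' \<and> b' + p = l then 1 else 0)))"
    using lt assms(1-3) by (simp add: spl_def op2_def c \<psi>_def)
  also have "\<dots> = (\<Sum>x<d. \<Sum>b'<2. \<Sum>p<J. if b' + p = l then M1 a b x b' * M2 x m a' p else 0)"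
  proof (intro sum.cong refl)
    fix x b' :: nat
    have "(\<Sum>y<d. \<Sum>p<J. M2 x m y p * (if y = a' \<and> b' + p = l then 1 else 0)) = (\<Sum>y<d. if y = a' then (\<Sum>p<J. if b' + p = l then M2 x m a' p else 0) else 0)"
      by (intro sum.cong refl) (auto intro!: sum.cong sum.neutral)
    also have "\<dots> = (\<Sum>p<J. if b' + p = l then M2 x m a' p else 0)" using lt by simp
    finally show "M1 a b x b' * (\<Sum>y<d. \<Sum>p<J. M2 x m y p * (if y = a' \<and> b' + p = l then 1 else 0)) = (\<Sum>p<J. if b' + p = l then M1 a b x b' * M2 x m a' p else 0)"
      by (simp add: sum_distrib_left if_distrib[of "\<lambda>z. _ * z"] cong: if_cong)
  qed
  finally show "M a (b + m) a' l = (\<Sum>x<d. \<Sum>b'<2. \<Sum>p<J. if b' + p = l then M1 a b x b' * M2 x m a' p else 0)"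
    using fun_cong[OF eq[of \<psi>], of c] L by simp
qed

lemma scC_sum_by_total:
  fixes Y :: "nat \<Rightarrow> 'r::calg"
  shows "(\<Sum>n<S+1. (\<Sum>b<2. \<Sum>p<S. if b + p = n then X b p else 0) *\<^sub>C Y n) = (\<Sum>b<2. \<Sum>p<S. X b p *\<^sub>C Y (b + p))"
proof -
  have "(\<Sum>n<S+1. (\<Sum>b<2. \<Sum>p<S. if b + p = n then X b p else 0) *\<^sub>C Y n)
     = (\<Sum>n<S+1. \<Sum>b<2. \<Sum>p<S. if b + p = n then X b p *\<^sub>C Y n else 0)"
    by (simp add: scC_sum_left if_distrib[of "\<lambda>x. x *\<^sub>C _"] cong: if_cong)
  also have "\<dots> = (\<Sum>b<2. \<Sum>p<S. \<Sum>n<S+1. if b + p = n then X b p *\<^sub>C Y n else 0)"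
    by (rule sum_swap3[symmetric])
  also have "\<dots> = (\<Sum>b<2. \<Sum>p<S. X b p *\<^sub>C Y (b + p))"
    by (intro sum.cong refl) (auto simp: sum.delta)
  finally show ?thesis .
qed

lemma ring_sum_by_total:
  fixes Y :: "nat \<Rightarrow> 'r::calg"
  shows "(\<Sum>n<S+1. (\<Sum>b<2. \<Sum>p<S. if b + p = n then X b p else 0) * Y n) = (\<Sum>b<2. \<Sum>p<S. X b p * Y (b + p))"
proof -
  have "(\<Sum>n<S+1. (\<Sum>b<2. \<Sum>p<S. if b + p = n then X b p else 0) * Y n)
     = (\<Sum>n<S+1. \<Sum>b<2. \<Sum>p<S. if b + p = n then X b p * Y n else 0)"
    by (simp add: sum_distrib_right if_distrib[of "\<lambda>x. x * _"] cong: if_cong)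
  also have "\<dots> = (\<Sum>b<2. \<Sum>p<S. \<Sum>n<S+1. if b + p = n then X b p * Y n else 0)"
    by (rule sum_swap3[symmetric])
  also have "\<dots> = (\<Sum>b<2. \<Sum>p<S. X b p * Y (b + p))"
    by (intro sum.cong refl) (auto simp: sum.delta)
  finally show ?thesis .
qed

lemma splits_op2:
  fixes \<psi> :: "'r::calg state"
  assumes "splits d J M M1 M2" "i \<noteq> j" "i \<noteq> j'" "j \<noteq> j'"
  shows "spl j j' J (op2 i d j (J + 1) M \<psi>) = op2 i d j 2 M1 (op2 i d j' J M2 (spl j j' J \<psi>))"
proof
  fix c :: "nat \<Rightarrow> nat"
  show "spl j j' J (op2 i d j (J + 1) M \<psi>) c = op2 i d j 2 M1 (op2 i d j' J M2 (spl j j' J \<psi>)) c"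
  proof (cases "c i < d \<and> c j < 2 \<and> c j' < J")
    case True
    define a b m where "a = c i" and "b = c j" and "m = c j'"
    define F where "F x l = \<psi> (c(i := x, j := l, j' := 0))" for x l
    have e1: "\<psi> (c(j := z, j' := 0, i := x, j := l)) = F x l" for z x l
      unfolding F_def using assms(2-4) by (intro arg_cong[where f = \<psi>]) (auto simp: fun_eq_iff)
    have e1': "\<psi> (c(j' := 0, i := x, j := l)) = F x l" for x l
      unfolding F_def using assms(2-4) by (intro arg_cong[where f = \<psi>]) (auto simp: fun_eq_iff)
    have e2: "\<psi> (c(i := x, j := b', i := y, j' := p, j := l, j' := 0)) = F y l" for x b' y p l
      unfolding F_def using assms(2-4) by (intro arg_cong[where f = \<psi>]) (auto simp: fun_eq_iff)
    have e2': "\<psi> (c(i := y, j := l, j' := 0)) = F y l" "\<psi> (c(i := y, j' := 0, j := l)) = F y l"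
       "\<psi> (c(j := b', i := y, j := l, j' := 0)) = F y l" for b' y l
      unfolding F_def using assms(2-4) by (intro arg_cong[where f = \<psi>]; auto simp: fun_eq_iff)+
    have "spl j j' J (op2 i d j (J + 1) M \<psi>) c = (\<Sum>a'<d. \<Sum>l<J+1. M a (b + m) a' l *\<^sub>C F a' l)"
      using True assms(2-4) by (simp add: spl_def op2_def e1 e1' a_def b_def m_def del: sum.lessThan_Suc)
    also have "\<dots> = (\<Sum>a'<d. \<Sum>l<J+1. (\<Sum>x<d. \<Sum>b'<2. \<Sum>p<J. if b' + p = l then M1 a b x b' * M2 x m a' p else 0) *\<^sub>C F a' l)"
      using assms(1) True unfolding splits_def a_def b_def m_def by (intro sum.cong refl) simp
    also have "\<dots> = (\<Sum>a'<d. \<Sum>x<d. \<Sum>b'<2. \<Sum>p<J. (M1 a b x b' * M2 x m a' p) *\<^sub>C F a' (b' + p))"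
    proof (rule sum.cong[OF refl])
      fix a'
      have "(\<Sum>l<J+1. (\<Sum>x<d. \<Sum>b'<2. \<Sum>p<J. if b' + p = l then M1 a b x b' * M2 x m a' p else 0) *\<^sub>C F a' l)
        = (\<Sum>x<d. \<Sum>l<J+1. (\<Sum>b'<2. \<Sum>p<J. if b' + p = l then M1 a b x b' * M2 x m a' p else 0) *\<^sub>C F a' l)"
        unfolding scC_sum_left[of _ "{..<d}"] by (rule sum.swap)
      then show "(\<Sum>l<J+1. (\<Sum>x<d. \<Sum>b'<2. \<Sum>p<J. if b' + p = l then M1 a b x b' * M2 x m a' p else 0) *\<^sub>C F a' l)
        = (\<Sum>x<d. \<Sum>b'<2. \<Sum>p<J. (M1 a b x b' * M2 x m a' p) *\<^sub>C F a' (b' + p))"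
        by (simp only: scC_sum_by_total)
    qed
    also have "\<dots> = (\<Sum>x<d. \<Sum>b'<2. \<Sum>a'<d. \<Sum>p<J. (M1 a b x b' * M2 x m a' p) *\<^sub>C F a' (b' + p))"
      by (subst sum_swap3[symmetric]) (rule refl)
    also have "\<dots> = (\<Sum>x<d. \<Sum>b'<2. M1 a b x b' *\<^sub>C (\<Sum>a'<d. \<Sum>p<J. M2 x m a' p *\<^sub>C F a' (b' + p)))"
      by (simp add: scC_sum_right)
    also have "\<dots> = op2 i d j 2 M1 (op2 i d j' J M2 (spl j j' J \<psi>)) c"
      using True assms(2-4) by (simp add: spl_def op2_def e2 e2' a_def b_def m_def)
    finally show ?thesis .
  next
    case False
    then show ?thesis using assms(2-4) by (auto simp: spl_def op2_def)
  qed
qed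

definition splits1 :: "nat \<Rightarrow> (nat \<Rightarrow> nat \<Rightarrow> 'r::calg) \<Rightarrow> (nat \<Rightarrow> nat \<Rightarrow> 'r) \<Rightarrow> (nat \<Rightarrow> nat \<Rightarrow> 'r) \<Rightarrow> bool" where
  "splits1 J T T1 T2 \<longleftrightarrow> (\<forall>b<2. \<forall>m<J. \<forall>l<J+1. T (b + m) l =
     (\<Sum>b'<2. \<Sum>p<J. if b' + p = l then T1 b b' * T2 m p else 0))"

lemma splits1_op1:
  fixes \<psi> :: "'r::calg state"
  assumes "splits1 J T T1 T2" "j \<noteq> j'"
  shows "spl j j' J (op1 j (J + 1) T \<psi>) = op1 j 2 T1 (op1 j' J T2 (spl j j' J \<psi>))"
proof
  fix c :: "nat \<Rightarrow> nat"
  show "spl j j' J (op1 j (J + 1) T \<psi>) c = op1 j 2 T1 (op1 j' J T2 (spl j j' J \<psi>)) c"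
  proof (cases "c j < 2 \<and> c j' < J")
    case True
    define b m where "b = c j" and "m = c j'"
    define F where "F l = \<psi> (c(j := l, j' := 0))" for l
    have e: "\<psi> (c(j' := 0, j := l)) = F l" "\<psi> (c(j := l, j' := 0)) = F l" "\<psi> (c(j := b', j' := p, j := l, j' := 0)) = F l" for b' p l
      unfolding F_def using assms(2) by (intro arg_cong[where f = \<psi>]; auto simp: fun_eq_iff)+
    have "spl j j' J (op1 j (J + 1) T \<psi>) c = (\<Sum>l<J+1. T (b + m) l * F l)"
      using True assms(2) by (simp add: spl_def op1_def e b_def m_def del: sum.lessThan_Suc)
    also have "\<dots> = (\<Sum>l<J+1. (\<Sum>b'<2. \<Sum>p<J. if b' + p = l then T1 b b' * T2 m p else 0) * F l)"
      using assms(1) True unfolding splits1_def b_def m_def by (intro sum.cong refl) simp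
    also have "\<dots> = (\<Sum>b'<2. \<Sum>p<J. (T1 b b' * T2 m p) * F (b' + p))" by (rule ring_sum_by_total)
    also have "\<dots> = op1 j 2 T1 (op1 j' J T2 (spl j j' J \<psi>)) c"
      using True assms(2) by (simp add: spl_def op1_def e b_def m_def sum_distrib_left mult.assoc)
    finally show ?thesis .
  next
    case False
    then show ?thesis using assms(2) by (auto simp: spl_def op1_def)
  qed
qed

lemma beta_ring:
  fixes \<psi> :: "'r::calg state"
  assumes "i \<noteq> j" "i \<noteq> j'" "j \<noteq> j'" "J \<ge> 2" "h \<noteq> 0" "u \<noteq> 0"
  shows "spl j j' J (op2 i 2 j (J + 1) (R1 h J u) \<psi>) =
    op2 i 2 j 2 (R1 h 1 (u * h powi (1 - int J))) (op2 i 2 j' J (R1 h (J - 1) (u * h)) (spl j j' J \<psi>))"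
  by (rule splits_op2[OF splitsI[OF assms(1-3) beta[OF assms]] assms(1-3)])

section \<open>Products of matrices in the auxiliary space\<close>

definition mmul :: "nat \<Rightarrow> (nat \<Rightarrow> nat \<Rightarrow> 'r::calg) \<Rightarrow> (nat \<Rightarrow> nat \<Rightarrow> 'r) \<Rightarrow> nat \<Rightarrow> nat \<Rightarrow> 'r" where
  "mmul d A B k l = (\<Sum>m<d. A k m * B m l)"

lemma op1_mmul: "op1 i d (mmul d A B) \<psi> = op1 i d A (op1 i d B \<psi>)"
proof
  fix c :: "nat \<Rightarrow> nat"
  show "op1 i d (mmul d A B) \<psi> c = op1 i d A (op1 i d B \<psi>) c"
    by (auto simp: op1_def mmul_def sum_distrib_left sum_distrib_right mult.assoc intro: sum.swap)
qed

lemma op1_op1: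
  assumes "i \<noteq> j" "\<And>a b x y. a < di \<Longrightarrow> b < di \<Longrightarrow> x < dj \<Longrightarrow> y < dj \<Longrightarrow> M a b * M' x y = M' x y * M a b"
  shows "op1 i di M (op1 j dj M' \<psi>) = op1 j dj M' (op1 i di M \<psi>)"
proof
  fix c :: "nat \<Rightarrow> nat"
  have "c(i := a, j := b) = c(j := b, i := a)" for a b using assms(1) by auto
  then have "(\<Sum>a<di. \<Sum>b<dj. M (c i) a * (M' (c j) b * \<psi> (c(i := a, j := b)))) = (\<Sum>b<dj. \<Sum>a<di. M' (c j) b * (M (c i) a * \<psi> (c(j := b, i := a))))"
    if "c i < di" "c j < dj"
    using that assms(2)
    by (subst sum.swap) (intro sum.cong refl, simp add: mult.assoc[symmetric])
  then show "op1 i di M (op1 j dj M' \<psi>) c = op1 j dj M' (op1 i di M \<psi>) c"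
    using assms(1) by (auto simp: op1_def sum_distrib_left)
qed

text \<open>The operators by which one site of the chain acts on the auxiliary space: a family that fuses, with an RLL
  relation for auxiliary spin one half.\<close>

locale siteT =
  fixes h :: complex and T :: "nat \<Rightarrow> complex \<Rightarrow> nat \<Rightarrow> nat \<Rightarrow> 'r::calg"
  assumes h0: "h \<noteq> 0"
    and T_split: "\<And>J u. J \<ge> 2 \<Longrightarrow> u \<noteq> 0 \<Longrightarrow> splits1 J (T J u) (T 1 (u * h powi (1 - int J))) (T (J - 1) (u * h))"
    and T_RLL: "\<And>x y j j' \<psi>. x \<noteq> 0 \<Longrightarrow> y \<noteq> 0 \<Longrightarrow> j \<noteq> j' \<Longrightarrow>
      op1 j' 2 (T 1 x) (op2 j 2 j' 2 (R1 h 1 (x * y)) (op1 j 2 (T 1 y) \<psi>)) =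
      op1 j 2 (T 1 y) (op2 j 2 j' 2 (R1 h 1 (x * y)) (op1 j' 2 (T 1 x) \<psi>))"
begin

text \<open>The auxiliary space of spin \<open>J/2\<close> is split into spin one half and a smaller spin; the factors are then moved
  through one after the other.\<close>

lemma RLL_fused:
  assumes "J \<ge> 1" "x \<noteq> 0" "y \<noteq> 0" "j \<noteq> j'"
  shows "op1 j' (J + 1) (T J x) (op2 j 2 j' (J + 1) (R1 h J (x * y)) (op1 j 2 (T 1 y) \<psi>)) =
      op1 j 2 (T 1 y) (op2 j 2 j' (J + 1) (R1 h J (x * y)) (op1 j' (J + 1) (T J x) \<psi>))"
  using assms
proof (induction J arbitrary: x j' \<psi>)
  case 0 then show ?case by simp
next
  case (Suc K)
  show ?case
  proof (cases "K = 0")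
    case True
    then show ?thesis using T_RLL[OF Suc.prems(2,3,4), of \<psi>] by (simp add: numeral_2_eq_2)
  next
    case False
    define J where "J = Suc K"
    have J: "J \<ge> 2" "J - 1 = K" "K + 1 = J" "K \<ge> 1" using False by (auto simp: J_def)
    obtain l where l: "l \<notin> {j, j', j, j}" using fresh_slot by blast
    define x1 x2 where "x1 = x * h powi (1 - int J)" and "x2 = x * h"
    have nz: "x1 \<noteq> 0" "x2 \<noteq> 0" "x * y \<noteq> 0" using Suc.prems h0 by (simp_all add: x1_def x2_def)
    have xy: "x * y * h powi (1 - int J) = x1 * y" "x * y * h = x2 * y" by (simp_all add: x1_def x2_def)
    let ?R = "op2 j 2 j' (J + 1) (R1 h J (x * y))"
    let ?R1 = "op2 j 2 j' 2 (R1 h 1 (x1 * y))" and ?R2 = "op2 j 2 l J (R1 h K (x2 * y))"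
    let ?T1 = "op1 j' 2 (T 1 x1)" and ?T2 = "op1 l J (T K x2)" and ?Y = "op1 j 2 (T 1 y)"
    have sT: "spl j' l J (op1 j' (J + 1) (T J x) \<phi>) = ?T1 (?T2 (spl j' l J \<phi>))" for \<phi>
      using splits1_op1[OF T_split[OF J(1) Suc.prems(2)], of j' l \<phi>] l unfolding x1_def x2_def J(2) by simp
    have sR: "spl j' l J (?R \<phi>) = ?R1 (?R2 (spl j' l J \<phi>))" for \<phi> :: "'r state"
      using beta_ring[of j j' l J h "x * y" \<phi>] Suc.prems l J h0 nz unfolding xy by simp
    have sY: "spl j' l J (?Y \<phi>) = ?Y (spl j' l J \<phi>)" for \<phi>
      by (rule spl_op1) (use l Suc.prems in auto)
    have c1: "?R1 (?T2 \<phi>) = ?T2 (?R1 \<phi>)" for \<phi> by (rule op2_op1) (use l Suc.prems in auto)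
    have c2: "?R2 (?T1 \<phi>) = ?T1 (?R2 \<phi>)" for \<phi> by (rule op2_op1) (use l Suc.prems in auto)
    have IH: "?T2 (?R2 (?Y \<phi>)) = ?Y (?R2 (?T2 \<phi>))" for \<phi>
      using Suc.IH[OF J(4) nz(2) Suc.prems(3), of l \<phi>] l unfolding J(3) by simp
    have base: "?T1 (?R1 (?Y \<phi>)) = ?Y (?R1 (?T1 \<phi>))" for \<phi>
      by (rule T_RLL) (use nz Suc.prems in auto)
    show ?thesis unfolding J_def[symmetric]
    proof (rule spl_inject[of j' l J "\<lambda>\<psi>. op1 j' (J + 1) (T J x) (?R (?Y \<psi>))" "\<lambda>\<psi>. ?Y (?R (op1 j' (J + 1) (T J x) \<psi>))"])
      fix \<psi>
      show "spl j' l J (op1 j' (J + 1) (T J x) (?R (?Y \<psi>))) = spl j' l J (?Y (?R (op1 j' (J + 1) (T J x) \<psi>)))"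
        unfolding sT sR sY by (simp only: c1[symmetric] IH base c2)
    qed (use l Suc.prems J in \<open>auto intro!: loc_intros simp: op1_def op2_def\<close>)
  qed
qed

end

text \<open>The fusion relation for a family of K-matrices with entries in an algebra.\<close>

definition FusK :: "complex \<Rightarrow> (nat \<Rightarrow> complex \<Rightarrow> nat \<Rightarrow> nat \<Rightarrow> 'r::calg) \<Rightarrow> bool" where
  "FusK h K \<longleftrightarrow> (\<forall>J u j j' \<psi>. J \<ge> 2 \<longrightarrow> u \<noteq> 0 \<longrightarrow> j \<noteq> j' \<longrightarrow> spl j j' J (op1 j (J + 1) (K J u) \<psi>) =
     op1 j 2 (K 1 (u * h powi (1 - int J))) (op2 j 2 j' J (R1 h (J - 1) (u * u * h powi (2 - int J)))
       (op1 j' J (K (J - 1) (u * h)) (spl j j' J \<psi>))))"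

text \<open>After splitting, the factor of the site to the right of \<open>K\<^sub>1\<close> has to be moved through the R-matrix past
  the factor of lower spin, which is the RLL relation at matching arguments.\<close>

lemma FusK_dress:
  fixes K :: "nat \<Rightarrow> complex \<Rightarrow> nat \<Rightarrow> nat \<Rightarrow> 'r::calg"
  assumes "siteT h T" "FusK h K" and v: "v \<noteq> 0"
    and comm: "\<And>J u J' u' a b a' b'. 1 \<le> J \<Longrightarrow> 1 \<le> J' \<Longrightarrow> a < J + 1 \<Longrightarrow> b < J + 1 \<Longrightarrow> a' < J' + 1 \<Longrightarrow> b' < J' + 1 \<Longrightarrow>
      T J u a b * K J' u' a' b' = K J' u' a' b' * T J u a b"
  shows "FusK h (\<lambda>J u. mmul (J + 1) (mmul (J + 1) (T J (u * v)) (K J u)) (T J (u * inverse v)))"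
  unfolding FusK_def
proof (intro allI impI)
  interpret siteT h T by fact
  fix J :: nat and u :: complex and j j' :: nat and \<psi> :: "'r state"
  assume J: "J \<ge> 2" and u: "u \<noteq> 0" and jj: "j \<noteq> j'"
  have J': "1 + 1 = (2::nat)" "J - 1 + 1 = J" "J - 1 \<ge> 1" using J by auto
  define x y where "x = u * v * h" and "y = u * inverse v * h powi (1 - int J)"
  have nz: "u * v \<noteq> 0" "u * inverse v \<noteq> 0" "x \<noteq> 0" "y \<noteq> 0" using u v h0 by (simp_all add: x_def y_def)
  have xy: "x * y = u * u * h powi (2 - int J)"
  proof -
    have "2 - int J = 1 + (1 - int J)" by simp
    then have "h powi (2 - int J) = h * h powi (1 - int J)" by (simp only: powi_split(1)[OF h0]) simp
    then show ?thesis using v by (simp add: x_def y_def)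
  qed
  have p: "u * h powi (1 - int J) * v = u * v * h powi (1 - int J)" "u * h powi (1 - int J) * inverse v = y"
    "u * h * v = x" "u * h * inverse v = u * inverse v * h" by (simp_all add: x_def y_def)
  let ?T1 = "op1 j 2 (T 1 (u * v * h powi (1 - int J)))" and ?T2 = "op1 j' J (T (J - 1) x)"
  let ?S1 = "op1 j 2 (T 1 y)" and ?S2 = "op1 j' J (T (J - 1) (u * inverse v * h))"
  let ?K1 = "op1 j 2 (K 1 (u * h powi (1 - int J)))" and ?K2 = "op1 j' J (K (J - 1) (u * h))"
  let ?R = "op2 j 2 j' J (R1 h (J - 1) (x * y))"
  have sT: "spl j j' J (op1 j (J + 1) (T J (u * v)) \<phi>) = ?T1 (?T2 (spl j j' J \<phi>))"
    "spl j j' J (op1 j (J + 1) (T J (u * inverse v)) \<phi>) = ?S1 (?S2 (spl j j' J \<phi>))" for \<phi>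
    using splits1_op1[OF T_split[OF J nz(1)] jj, of \<phi>] splits1_op1[OF T_split[OF J nz(2)] jj, of \<phi>]
    unfolding x_def y_def by simp_all
  have sK: "spl j j' J (op1 j (J + 1) (K J u) \<phi>) = ?K1 (?R (?K2 (spl j j' J \<phi>)))" for \<phi>
    using assms(2) J u jj unfolding FusK_def xy by blast
  have c1: "?T2 (?K1 \<phi>) = ?K1 (?T2 \<phi>)" for \<phi>
    by (rule op1_op1) (use jj J' comm[of "J - 1" 1] in auto)
  have c2: "?K2 (?S1 \<phi>) = ?S1 (?K2 \<phi>)" for \<phi>
    by (rule op1_op1) (use jj J' comm[of 1 "J - 1"] in auto)
  have rll: "?T2 (?R (?S1 \<phi>)) = ?S1 (?R (?T2 \<phi>))" for \<phi>
    using RLL_fused[OF J'(3) nz(3,4) jj, of \<phi>] unfolding J'(2) .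
  show "spl j j' J (op1 j (J + 1) (mmul (J + 1) (mmul (J + 1) (T J (u * v)) (K J u)) (T J (u * inverse v))) \<psi>) =
     op1 j 2 (mmul (1 + 1) (mmul (1 + 1) (T 1 (u * h powi (1 - int J) * v)) (K 1 (u * h powi (1 - int J)))) (T 1 (u * h powi (1 - int J) * inverse v)))
      (op2 j 2 j' J (R1 h (J - 1) (u * u * h powi (2 - int J)))
       (op1 j' J (mmul (J - 1 + 1) (mmul (J - 1 + 1) (T (J - 1) (u * h * v)) (K (J - 1) (u * h))) (T (J - 1) (u * h * inverse v))) (spl j j' J \<psi>)))"
    unfolding J'(1,2) p xy[symmetric] op1_mmul sT sK by (simp only: c1 c2 rll)
qed

text \<open>One entry of the fusion relation, applied to a basis state. The scalars \<open>X\<close> are entries of the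
  R-matrix; only the form of the right-hand side is used, because it adds up degrees.\<close>

lemma FusK_filt_step:
  fixes K :: "nat \<Rightarrow> complex \<Rightarrow> nat \<Rightarrow> nat \<Rightarrow> 'r::calg"
  assumes "FusK h K" "J \<ge> 2" "u \<noteq> 0" "k < J + 1" "n < J + 1"
  obtains X where "K J u k n = (\<Sum>a1<2. K 1 (u * h powi (1 - int J)) (if k < J then 0 else 1) a1 * 
     (\<Sum>a2<2. \<Sum>m1<J. X a1 a2 m1 *\<^sub>C (\<Sum>m2<J. K (J - 1) (u * h) m1 m2 * (if a2 + m2 = n then 1 else 0))))"
proof -
  define a where "a = (if k < J then 0 else 1::nat)"
  define m where "m = k - a"
  have am: "a < 2" "m < J" "a + m = k" using assms(2,4) by (auto simp: a_def m_def)
  define \<psi> :: "'r state" where "\<psi> = (\<lambda>c. if c 0 = n then 1 else 0)"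
  define c where "c = (\<lambda>_::nat. 0::nat)(0 := a, 1 := m)"
  have c: "c 0 = a" "c 1 = m" "c (Suc 0) = m" by (simp_all add: c_def)
  have "spl 0 1 J (op1 0 (J + 1) (K J u) \<psi>) c = (\<Sum>l<J+1. K J u k l * (if l = n then 1 else 0))"
    using am by (simp add: spl_def op1_def c \<psi>_def del: sum.lessThan_Suc)
  also have "\<dots> = (\<Sum>l<J+1. if l = n then K J u k n else 0)" by (rule sum.cong) auto
  also have "\<dots> = K J u k n" using assms(5) by (simp del: sum.lessThan_Suc)
  finally have "K J u k n = spl 0 1 J (op1 0 (J + 1) (K J u) \<psi>) c" by simp
  also have "\<dots> = op1 0 2 (K 1 (u * h powi (1 - int J))) (op2 0 2 1 J (R1 h (J - 1) (u * u * h powi (2 - int J)))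
       (op1 1 J (K (J - 1) (u * h)) (spl 0 1 J \<psi>))) c"
    using assms(1-3) unfolding FusK_def by simp
  also have "\<dots> = (\<Sum>a1<2. K 1 (u * h powi (1 - int J)) a a1 * 
     (\<Sum>a2<2. \<Sum>m1<J. R1 h (J - 1) (u * u * h powi (2 - int J)) a1 m a2 m1 *\<^sub>C (\<Sum>m2<J. K (J - 1) (u * h) m1 m2 * (if a2 + m2 = n then 1 else 0))))"
    using am by (simp add: op1_def op2_def c spl_def \<psi>_def numeral_2_eq_2)
  finally show ?thesis unfolding a_def by (rule that)
qed

section \<open>Fusion of the scalar K-matrix\<close>

definition Kh :: "complex \<Rightarrow> complex \<Rightarrow> complex \<Rightarrow> complex \<Rightarrow> complex \<Rightarrow> complex \<Rightarrow> nat \<Rightarrow> nat \<Rightarrow> complex" where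
  "Kh h ep em kp km u a b = (if a = 0 \<and> b = 0 then u * ep + inverse u * em
     else if a = 0 then kp * cf' (u ^ 2) / (h ^ 2 - inverse (h ^ 2))
     else if b = 0 then km * cf' (u ^ 2) / (h ^ 2 - inverse (h ^ 2))
     else u * em + inverse u * ep)"

text \<open>The reflection version of \<open>exch\<close>: the two boundary matrices at \<open>x\<close> and \<open>x q\<close> with the R-matrix between
  them preserve the symmetric subspace.\<close>

lemma exch_K:
  fixes f :: "'r::calg state"
  assumes "i \<noteq> i'" and h: "h \<noteq> 0" "h ^ 2 - inverse (h ^ 2) \<noteq> 0" and u: "x \<noteq> 0" and y: "y = x * h ^ 2"
    and f: "swapsym i i' f"
  shows "swapsym i i' (op1 i 2 (\<lambda>a b. Kh h ep em kp km x a b *\<^sub>C 1) (op2 i 2 i' 2 (R1 h 1 (x * y))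
     (op1 i' 2 (\<lambda>a b. Kh h ep em kp km y a b *\<^sub>C 1) f)))"
  unfolding swapsym_def
proof
  fix c :: "nat \<Rightarrow> nat"
  define F where "F a b = f (c(i := a, i' := b))" for a b
  have F: "F 0 1 = F 1 0" using f unfolding swapsym_def F_def by blast
  define l where "l = h ^ 2 - inverse (h ^ 2)"
  define q where "q = h ^ 2"
  have q0: "q \<noteq> 0" using h by (simp add: q_def)
  have l: "l = q - inverse q" "l \<noteq> 0" using h by (simp_all add: l_def q_def)
  define Kx Ky where "Kx = Kh h ep em kp km x" and "Ky = Kh h ep em kp km y"
  define R where "R = R1 h 1 (x * y)"
  define Q where "Q a b a2 b' = (\<Sum>a1<2. \<Sum>b2<2. Kx a a1 * R a1 b a2 b2 * Ky b2 b')" for a b a2 b'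
  have R: "R 0 0 0 0 = cf' (x * x * q * q)" "R 1 1 1 1 = cf' (x * x * q * q)" "R 0 1 0 1 = cf' (x * x * q)" "R 1 0 1 0 = cf' (x * x * q)"
    "R 0 1 1 0 = cf' q" "R 1 0 0 1 = cf' q"
    "R 0 0 0 1 = 0" "R 0 0 1 0 = 0" "R 0 0 1 1 = 0" "R 0 1 0 0 = 0" "R 0 1 1 1 = 0" "R 1 0 0 0 = 0" "R 1 0 1 1 = 0"
    "R 1 1 0 0 = 0" "R 1 1 0 1 = 0" "R 1 1 1 0 = 0"
    unfolding R_def y q_def by (simp_all add: R1_def pf_def power2_eq_square mult_ac)
  have Kx: "Kx 0 0 = x * ep + inverse x * em" "Kx 0 1 = kp * cf' (x * x) / l" "Kx 1 0 = km * cf' (x * x) / l" "Kx 1 1 = x * em + inverse x * ep"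
    unfolding Kx_def Kh_def l_def by (simp_all add: power2_eq_square)
  have Ky: "Ky 0 0 = x * q * ep + inverse (x * q) * em" "Ky 0 1 = kp * cf' (x * q * x * q) / l" "Ky 1 0 = km * cf' (x * q * x * q) / l" "Ky 1 1 = x * q * em + inverse (x * q) * ep"
    unfolding Ky_def Kh_def l_def y q_def by (simp_all add: power2_eq_square mult.assoc)
  have s2: "{..<2::nat} = {0, 1}" by auto
  note sm = s2 sum.insert finite.emptyI finite.insertI
  have 1: "Q 0 1 0 0 = Q 1 0 0 0"
    unfolding Q_def s2 using u q0 l(2) by (simp add: R[simplified] Kx[simplified] Ky[simplified]) (simp add: cf'_def field_simps)
  have 2: "Q 0 1 1 1 = Q 1 0 1 1"
    unfolding Q_def s2 using u q0 l(2) by (simp add: R[simplified] Kx[simplified] Ky[simplified]) (simp add: cf'_def field_simps)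
  have 3: "Q 0 1 0 1 + Q 0 1 1 0 = Q 1 0 0 1 + Q 1 0 1 0"
    unfolding Q_def s2 using u q0 l(2) by (simp add: R[simplified] Kx[simplified] Ky[simplified]) (simp add: cf'_def field_simps)
  have e: "f (c(i := a, i' := b, i := a1, i := a2, i' := b2, i' := b')) = F a2 b'" for a b a1 a2 b2 b'
    unfolding F_def using assms(1) by (intro arg_cong[where f = f]) (auto simp: fun_eq_iff)
  have val: "op1 i 2 (\<lambda>a b. Kx a b *\<^sub>C 1) (op2 i 2 i' 2 R (op1 i' 2 (\<lambda>a b. Ky a b *\<^sub>C 1) f)) (c(i := a, i' := b)) =
     (\<Sum>a2<2. \<Sum>b'<2. Q a b a2 b' *\<^sub>C F a2 b')" if "a < 2" "b < 2" for a b
  proof -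
    have "op1 i 2 (\<lambda>a b. Kx a b *\<^sub>C 1) (op2 i 2 i' 2 R (op1 i' 2 (\<lambda>a b. Ky a b *\<^sub>C 1) f)) (c(i := a, i' := b)) =
      (\<Sum>a1<2. Kx a a1 *\<^sub>C (\<Sum>a2<2. \<Sum>b2<2. R a1 b a2 b2 *\<^sub>C (\<Sum>b'<2. Ky b2 b' *\<^sub>C f (c(i := a, i' := b, i := a1, i := a2, i' := b2, i' := b')))))"
      using that assms(1) by (simp add: op1_def op2_def)
    also have "\<dots> = (\<Sum>a1<2. \<Sum>a2<2. \<Sum>b2<2. \<Sum>b'<2. (Kx a a1 * R a1 b a2 b2 * Ky b2 b') *\<^sub>C F a2 b')"
      by (simp only: e scC_sum_right scC_scC mult.assoc)
    also have "\<dots> = (\<Sum>a2<2. \<Sum>b'<2. Q a b a2 b' *\<^sub>C F a2 b')"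
      unfolding Q_def scC_sum_left s2 by (simp add: add_ac)
    finally show ?thesis .
  qed
  show "op1 i 2 (\<lambda>a b. Kh h ep em kp km x a b *\<^sub>C 1) (op2 i 2 i' 2 (R1 h 1 (x * y)) (op1 i' 2 (\<lambda>a b. Kh h ep em kp km y a b *\<^sub>C 1) f)) (c(i := 0, i' := 1)) =
    op1 i 2 (\<lambda>a b. Kh h ep em kp km x a b *\<^sub>C 1) (op2 i 2 i' 2 (R1 h 1 (x * y)) (op1 i' 2 (\<lambda>a b. Kh h ep em kp km y a b *\<^sub>C 1) f)) (c(i := 1, i' := 0))"
  proof -
    have "(\<Sum>a2<2. \<Sum>b'<2. Q 0 1 a2 b' *\<^sub>C F a2 b') = Q 0 1 0 0 *\<^sub>C F 0 0 + (Q 0 1 0 1 + Q 0 1 1 0) *\<^sub>C F 1 0 + Q 0 1 1 1 *\<^sub>C F 1 1"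
      unfolding s2 using F by (simp add: scC_add_left add_ac)
    also have "\<dots> = (\<Sum>a2<2. \<Sum>b'<2. Q 1 0 a2 b' *\<^sub>C F a2 b')"
      unfolding 1 2 3 unfolding s2 using F by (simp add: scC_add_left add_ac)
    finally have fin: "(\<Sum>a2<2. \<Sum>b'<2. Q 0 1 a2 b' *\<^sub>C F a2 b') = (\<Sum>a2<2. \<Sum>b'<2. Q 1 0 a2 b' *\<^sub>C F a2 b')" .
    have v: "(0::nat) < 2" "(1::nat) < 2" by simp_all
    show ?thesis unfolding Kx_def[symmetric] Ky_def[symmetric] R_def[symmetric] val[OF v] val[OF v(2,1)] by (rule fin)
  qed
qed

definition ZK :: "complex \<Rightarrow> (nat \<Rightarrow> complex \<Rightarrow> nat \<Rightarrow> nat \<Rightarrow> complex) \<Rightarrow> nat \<Rightarrow> complex \<Rightarrow> nat \<Rightarrow> nat \<Rightarrow> nat \<Rightarrow> complex" where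
  "ZK h KG S u a m n = (if m < S then \<Sum>b<2. \<Sum>p<S. if b + p = n then
     (\<Sum>a1<2. \<Sum>m1<S. KG 1 (u * h powi (1 - int S)) a a1 * R1 h (S - 1) (u * u * h powi (2 - int S)) a1 m b m1 * KG (S - 1) (u * h) m1 p) else 0 else 0)"

text \<open>The recursive definition of the K-matrices in the same form as \<open>fusedR\<close>.\<close>

locale fusedK =
  fixes h ep em kp km :: complex and KG :: "nat \<Rightarrow> complex \<Rightarrow> nat \<Rightarrow> nat \<Rightarrow> complex" and w :: "nat \<Rightarrow> nat \<Rightarrow> complex"
  assumes h0: "h \<noteq> 0" "h ^ 2 - inverse (h ^ 2) \<noteq> 0"
    and w: "\<And>S. S \<ge> 2 \<Longrightarrow> w S 0 = 1" "\<And>S. S \<ge> 2 \<Longrightarrow> w S S = 0"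
    and KG1: "\<And>u a b. a < 2 \<Longrightarrow> b < 2 \<Longrightarrow> KG (Suc 0) u a b = Kh h ep em kp km u a b"
    and KGS: "\<And>S u s n. S \<ge> 2 \<Longrightarrow> u \<noteq> 0 \<Longrightarrow> s < S + 1 \<Longrightarrow> n < S + 1 \<Longrightarrow>
      KG S u s n = w S s * ZK h KG S u 0 s n + (1 - w S s) * ZK h KG S u 1 (s - 1) n"
begin

abbreviation "KR S u \<equiv> \<lambda>a b. KG S u a b *\<^sub>C (1::'r::calg)"

lemma KG_fus:
  fixes \<psi> :: "'r::calg state"
  assumes S: "S \<ge> 2" and u: "u \<noteq> 0" and d: "s \<noteq> s'" and c: "c s' = 0"
  shows "op1 s (S + 1) (KR S u) \<psi> c =
    fus s s' S (w S) (op1 s 2 (KR 1 (u * h powi (1 - int S))) (op2 s 2 s' S (R1 h (S - 1) (u * u * h powi (2 - int S)))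
       (op1 s' S (KR (S - 1) (u * h)) (spl s s' S \<psi>)))) c"
    (is "_ = fus s s' S (w S) ?B c")
proof -
  define F where "F n = \<psi> (c(s := n, s' := 0))" for n
  have F: "\<psi> (c(s := n)) = F n" for n
    unfolding F_def using d c by (intro arg_cong[where f = \<psi>]) (auto simp: fun_eq_iff)
  have e: "\<psi> (c(s := a, s' := m, s := a1, s := b, s' := m1, s' := p, s := z, s' := 0)) = F z" for a m a1 b m1 p z
    unfolding F_def using d by (intro arg_cong[where f = \<psi>]) (auto simp: fun_eq_iff)
  have e': "\<psi> (c(s := z, s' := 0)) = F z" for z by (simp add: F_def)
  have B: "?B (c(s := a, s' := m)) = (\<Sum>n<S+1. ZK h KG S u a m n *\<^sub>C F n)" if "a < 2" for a m
  proof (cases "m < S")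
    case True
    have "?B (c(s := a, s' := m)) = (\<Sum>a1<2. KG 1 (u * h powi (1 - int S)) a a1 *\<^sub>C (\<Sum>b<2. \<Sum>m1<S.
       R1 h (S - 1) (u * u * h powi (2 - int S)) a1 m b m1 *\<^sub>C (\<Sum>p<S. KG (S - 1) (u * h) m1 p *\<^sub>C F (b + p))))"
      using d that True by (simp add: op1_def op2_def spl_def e e')
    also have "\<dots> = (\<Sum>a1<2. \<Sum>b<2. \<Sum>m1<S. \<Sum>p<S. (KG 1 (u * h powi (1 - int S)) a a1 *
       R1 h (S - 1) (u * u * h powi (2 - int S)) a1 m b m1 * KG (S - 1) (u * h) m1 p) *\<^sub>C F (b + p))"
      by (simp add: scC_sum_right mult.assoc)
    also have "\<dots> = (\<Sum>b<2. \<Sum>a1<2. \<Sum>m1<S. \<Sum>p<S. (KG 1 (u * h powi (1 - int S)) a a1 *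
       R1 h (S - 1) (u * u * h powi (2 - int S)) a1 m b m1 * KG (S - 1) (u * h) m1 p) *\<^sub>C F (b + p))"
      by (rule sum.swap)
    also have "\<dots> = (\<Sum>b<2. \<Sum>p<S. \<Sum>a1<2. \<Sum>m1<S. (KG 1 (u * h powi (1 - int S)) a a1 *
       R1 h (S - 1) (u * u * h powi (2 - int S)) a1 m b m1 * KG (S - 1) (u * h) m1 p) *\<^sub>C F (b + p))"
      by (rule sum.cong[OF refl], rule sum_swap3)
    also have "\<dots> = (\<Sum>n<S+1. ZK h KG S u a m n *\<^sub>C F n)"
      using True unfolding ZK_def if_P[OF True] scC_sum_by_total by (simp add: scC_sum_left)
    finally show ?thesis .
  next
    case False
    then show ?thesis using d by (simp add: op1_def op2_def ZK_def)
  qed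
  show ?thesis
  proof (cases "c s < S + 1")
    case True
    have "op1 s (S + 1) (KR S u) \<psi> c = (\<Sum>n<S+1. KG S u (c s) n *\<^sub>C F n)"
      using d True by (simp add: op1_def F del: sum.lessThan_Suc)
    also have "\<dots> = (\<Sum>n<S+1. w S (c s) *\<^sub>C (ZK h KG S u 0 (c s) n *\<^sub>C F n) + (1 - w S (c s)) *\<^sub>C (ZK h KG S u 1 (c s - 1) n *\<^sub>C F n))"
      using S u True by (intro sum.cong refl) (auto simp: KGS scC_add_left)
    also have "\<dots> = w S (c s) *\<^sub>C ?B (c(s := 0, s' := c s)) + (1 - w S (c s)) *\<^sub>C ?B (c(s := 1, s' := c s - 1))"
    proof -
      have b0: "?B (c(s := 0, s' := c s)) = (\<Sum>n<S+1. ZK h KG S u 0 (c s) n *\<^sub>C F n)" by (rule B) simp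
      have b1: "?B (c(s := 1, s' := c s - 1)) = (\<Sum>n<S+1. ZK h KG S u 1 (c s - 1) n *\<^sub>C F n)" by (rule B) simp
      show ?thesis unfolding b0 b1 by (simp only: sum.distrib scC_sum_right)
    qed
    also have "\<dots> = fus s s' S (w S) ?B c" using True by (simp add: fus_def)
    finally show ?thesis .
  next
    case False
    then show ?thesis using d by (auto simp: op1_def fus_def)
  qed
qed

lemma op1_cong:
  assumes "\<And>a b. a < d \<Longrightarrow> b < d \<Longrightarrow> M a b = M' a b" shows "op1 i d M \<psi> = op1 i d M' (\<psi> :: 'r::calg state)"
  unfolding op1_def by (rule ext) (auto simp: assms intro!: sum.cong)

text \<open>As for the R-matrices, the second factor is split by the induction hypothesis and the R-matrix between
  the two factors by \<open>beta\<close>; the required symmetry is then \<open>exch_K\<close> applied to a state that is symmetric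
  by \<open>exch\<close>.\<close>

lemma FusK_KG: "FusK h (\<lambda>S u a b. KG S u a b *\<^sub>C (1::'r::calg))"
proof -
  have "spl s s' S (op1 s (S + 1) (KR S u) \<psi>) = op1 s 2 (KR 1 (u * h powi (1 - int S))) (op2 s 2 s' S (R1 h (S - 1) (u * u * h powi (2 - int S)))
       (op1 s' S (KR (S - 1) (u * h)) (spl s s' S \<psi>)))" if "S \<ge> 2" "u \<noteq> 0" "s \<noteq> s'" for S u s s' and \<psi> :: "'r state"
    using that
  proof (induction S arbitrary: s s' u \<psi> rule: less_induct)
    case (less S)
    define A where "A = (\<lambda>\<psi>::'r state. op1 s (S + 1) (KR S u) \<psi>)"
    define B where "B = (\<lambda>\<psi>::'r state. op1 s 2 (KR 1 (u * h powi (1 - int S))) (op2 s 2 s' S (R1 h (S - 1) (u * u * h powi (2 - int S)))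
       (op1 s' S (KR (S - 1) (u * h)) (spl s s' S \<psi>))))"
    obtain s'' where s'': "s'' \<notin> {s, s', s, s}" using fresh_slot by blast
    define x where "x = u * h powi (1 - int S)"
    have x0: "x \<noteq> 0" "u * h \<noteq> 0" "u * u * h powi (2 - int S) \<noteq> 0" using less.prems h0 by (simp_all add: x_def)
    have K1: "op1 i 2 (KR 1 z) \<phi> = op1 i 2 (\<lambda>a b. Kh h ep em kp km z a b *\<^sub>C 1) \<phi>" for i z and \<phi> :: "'r state"
      by (rule op1_cong) (simp add: KG1)
    have "spl s s' S (A \<psi>) = B \<psi>"
    proof (rule loc_eqI[of s'' "\<lambda>\<psi>. spl s s' S (A \<psi>)" B])
      show "loc s'' (\<lambda>\<psi>. spl s s' S (A \<psi>))" unfolding A_def using s'' by (intro loc_intros) auto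
      show "loc s'' B" unfolding B_def using s'' by (intro loc_intros) auto
      fix \<psi> :: "'r state" and c :: "nat \<Rightarrow> nat" assume c: "c s'' = 0"
      show "spl s s' S (A \<psi>) c = B \<psi> c"
      proof (rule fusion_step[where A = A and B = B and w = "w S" and i = s and i' = s'])
        show "A \<psi> c = fus s s' S (w S) (B \<psi>) c" if "c s' = 0" for \<psi> c
          unfolding A_def B_def by (rule KG_fus) (use less.prems that in auto)
        show "w S 0 = 1" "w S S = 0" "s \<noteq> s'" "1 \<le> S" using less.prems w by auto
        show "B \<psi> c = 0" if "\<not> (c s < 2 \<and> c s' < S)" for \<psi> c
          using that less.prems(3) by (auto simp: B_def op1_def op2_def)
        fix m assume m: "m + 1 < S"
        show "B \<psi> (c(s := 0, s' := m + 1)) = B \<psi> (c(s := 1, s' := m))"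
        proof (cases "S = 2")
          case True
          have one: "2 - 1 = (1::nat)" by simp
          have p: "u * u * h powi (2 - int S) = x * (u * h)" "u * h = x * h ^ 2"
            unfolding x_def True using h0 by (simp_all add: power2_eq_square power_int_minus field_simps)
          have "B \<psi> = op1 s 2 (\<lambda>a b. Kh h ep em kp km x a b *\<^sub>C 1) (op2 s 2 s' 2 (R1 h 1 (x * (u * h)))
             (op1 s' 2 (\<lambda>a b. Kh h ep em kp km (u * h) a b *\<^sub>C 1) (spl s s' S \<psi>)))"
            unfolding B_def x_def[symmetric] p(1) unfolding True one K1 ..
          moreover have "swapsym s s' \<dots>"
            by (rule exch_K[OF less.prems(3) h0 x0(1) p(2)]) (use less.prems True in \<open>simp add: swapsym_spl\<close>)
          ultimately show ?thesis using m True by (simp add: swapsym_def)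
        next
          case False
          then have S3: "S - 1 \<ge> 2" "S - 1 < S" "S - 1 + 1 = S" "S - 1 - 1 + 1 = S - 1" "S - 1 - 1 \<ge> 1" using less.prems(1) by auto
          define y where "y = u * h * h powi (1 - int (S - 1))"
          define g where "g = spl s' s'' (S - 1) (spl s s' S \<psi>)"
          have y: "y = x * h ^ 2"
          proof -
            have "1 - int (S - 1) = 1 - int S + 1" using less.prems(1) by simp
            then show ?thesis unfolding x_def y_def using h0 by (simp only: powi_split(1)[OF h0(1)]) (simp add: power2_eq_square)
          qed
          define z where "z = u * u * h powi (2 - int S)"
          define t where "t = z * h powi (1 - int (S - 1))"
          have int1: "int (S - 1) = int S - 1" using less.prems(1) by simp
          have zs: "u * h * (u * h) * h powi (2 - int (S - 1)) = z * h * h ^ 2"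
          proof -
            have "2 - int (S - 1) = (2 - int S) + 1" using int1 by simp
            then show ?thesis unfolding z_def by (simp only: powi_split(1)[OF h0(1)]) (simp add: power2_eq_square)
          qed
          have t: "t = x * y"
          proof -
            have "(2 - int S) + (1 - int (S - 1)) = (1 - int S) + (1 + (1 - int (S - 1)))" using int1 by simp
            then have "h powi (2 - int S) * h powi (1 - int (S - 1)) = h powi (1 - int S) * (h * h powi (1 - int (S - 1)))"
              by (metis powi_split(1)[OF h0(1)] power_int_1_right)
            then show ?thesis unfolding t_def z_def x_def y_def by (simp add: mult_ac)
          qed
          have z0: "z \<noteq> 0" "t \<noteq> 0" "z * h \<noteq> 0" using x0 h0 by (simp_all add: z_def t_def)
          have "spl s' s'' (S - 1) (B \<psi>) = op1 s 2 (KR 1 x) (spl s' s'' (S - 1) (op2 s 2 s' S (R1 h (S - 1) z)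
             (op1 s' S (KR (S - 1) (u * h)) (spl s s' S \<psi>))))"
            unfolding B_def x_def z_def using less.prems s'' by (intro spl_op1) auto
          also have "spl s' s'' (S - 1) (op2 s 2 s' S (R1 h (S - 1) z) (op1 s' S (KR (S - 1) (u * h)) (spl s s' S \<psi>))) =
             op2 s 2 s' 2 (R1 h 1 t) (op2 s 2 s'' (S - 1) (R1 h (S - 1 - 1) (z * h)) (spl s' s'' (S - 1) (op1 s' S (KR (S - 1) (u * h)) (spl s s' S \<psi>))))"
            using beta_ring[of s s' s'' "S - 1" h z "op1 s' S (KR (S - 1) (u * h)) (spl s s' S \<psi>)"] less.prems s'' S3 h0 z0 unfolding t_def by simp
          also have "spl s' s'' (S - 1) (op1 s' S (KR (S - 1) (u * h)) (spl s s' S \<psi>)) =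
             op1 s' 2 (KR 1 y) (op2 s' 2 s'' (S - 1) (R1 h (S - 1 - 1) (z * h * h ^ 2)) (op1 s'' (S - 1) (KR (S - 1 - 1) (u * h * h)) g))"
            using less.IH[OF S3(2,1) x0(2), of s' s'' "spl s s' S \<psi>"] s'' unfolding S3(3) y_def g_def zs by auto
          also have "op2 s 2 s'' (S - 1) (R1 h (S - 1 - 1) (z * h)) (op1 s' 2 (KR 1 y) (op2 s' 2 s'' (S - 1) (R1 h (S - 1 - 1) (z * h * h ^ 2)) (op1 s'' (S - 1) (KR (S - 1 - 1) (u * h * h)) g)))
            = op1 s' 2 (KR 1 y) (op2 s 2 s'' (S - 1) (R1 h (S - 1 - 1) (z * h)) (op2 s' 2 s'' (S - 1) (R1 h (S - 1 - 1) (z * h * h ^ 2)) (op1 s'' (S - 1) (KR (S - 1 - 1) (u * h * h)) g)))"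
            by (rule op2_op1) (use less.prems s'' in auto)
          finally have eq: "spl s' s'' (S - 1) (B \<psi>) = op1 s 2 (KR 1 x) (op2 s 2 s' 2 (R1 h 1 (x * y)) (op1 s' 2 (KR 1 y)
            (op2 s 2 s'' (S - 1) (R1 h (S - 1 - 1) (z * h)) (op2 s' 2 s'' (S - 1) (R1 h (S - 1 - 1) (z * h * h ^ 2)) (op1 s'' (S - 1) (KR (S - 1 - 1) (u * h * h)) g)))))"
            unfolding t .
          have sg: "swapsym s s' (op1 s'' (S - 1) (KR (S - 1 - 1) (u * h * h)) g)"
            unfolding g_def using less.prems s'' by (intro swapsym_op1 swapsym_spl_spl) auto
          have sR: "swapsym s s' (op2 s 2 s'' (S - 1) (R1 h (S - 1 - 1) (z * h)) (op2 s' 2 s'' (S - 1) (R1 h (S - 1 - 1) (z * h * h ^ 2)) (op1 s'' (S - 1) (KR (S - 1 - 1) (u * h * h)) g)))"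
            using exch[OF less.prems(3) _ _ S3(5) h0(1) z0(3) refl sg] s'' unfolding S3(4) by auto
          have "swapsym s s' (spl s' s'' (S - 1) (B \<psi>))"
            unfolding eq K1 by (rule exch_K[OF less.prems(3) h0 x0(1) y sR])
          then show ?thesis by (rule sym_of_swapsym) (use less.prems s'' c m in auto)
        qed
      qed
    qed
    then show ?case unfolding A_def B_def .
  qed
  then show ?thesis unfolding FusK_def by blast
qed

end

section \<open>A ring of operators\<close>

text \<open>Linear maps on sequences, a ring that contains the matrices of all sizes.\<close>

typedef lop = "{f :: (nat \<Rightarrow> complex) \<Rightarrow> nat \<Rightarrow> complex.
   (\<forall>x y. f (\<lambda>i. x i + y i) = (\<lambda>i. f x i + f y i)) \<and> (\<forall>a x. f (\<lambda>i. a * x i) = (\<lambda>i. a * f x i))}"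
  morphisms app Abs_lop
  by (rule exI[of _ "\<lambda>x. x"]) auto

setup_lifting type_definition_lop

instantiation lop :: calg
begin
lift_definition zero_lop :: lop is "\<lambda>x i. 0" by auto
lift_definition one_lop :: lop is "\<lambda>x. x" by auto
lift_definition plus_lop :: "lop \<Rightarrow> lop \<Rightarrow> lop" is "\<lambda>f g x i. f x i + g x i" by (auto simp: algebra_simps)
lift_definition minus_lop :: "lop \<Rightarrow> lop \<Rightarrow> lop" is "\<lambda>f g x i. f x i - g x i" by (auto simp: algebra_simps)
lift_definition uminus_lop :: "lop \<Rightarrow> lop" is "\<lambda>f x i. - f x i" by auto
lift_definition times_lop :: "lop \<Rightarrow> lop \<Rightarrow> lop" is "\<lambda>f g x. f (g x)" by auto
lift_definition scC_lop :: "complex \<Rightarrow> lop \<Rightarrow> lop" is "\<lambda>a f x i. a * f x i" by (auto simp: algebra_simps)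
instance
proof
  fix a b c :: lop and z w :: complex
  show "(0::lop) \<noteq> 1"
  proof
    assume "(0::lop) = 1"
    then have "app 0 (\<lambda>_. 1) 0 = app 1 (\<lambda>_. 1) 0" by simp
    then show False by (simp add: zero_lop.rep_eq one_lop.rep_eq)
  qed
qed (transfer; auto simp: algebra_simps fun_eq_iff)+
end

lemma lop_eqI: "(\<And>x i. app f x i = app g x i) \<Longrightarrow> f = g"
  by (metis app_inject ext)

lemma app_sum: "app (sum f S) x i = (\<Sum>a\<in>S. app (f a) x i)"
  by (induction S rule: infinite_finite_induct) (auto simp: zero_lop.rep_eq plus_lop.rep_eq)

text \<open>A matrix of size \<open>D\<close> acts on each block of \<open>D\<close> consecutive components. Tensoring with an identity on
  the left does not change the operator, so that operators of chains of different length are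
  compatible.\<close>

lift_definition pm :: "nat \<Rightarrow> complex mat \<Rightarrow> lop" is
  "\<lambda>D A x i. \<Sum>j<D. A $$ (i mod D, j) * x (i div D * D + j)"
  by (auto simp: sum.distrib algebra_simps sum_distrib_left)

lemma pm_add: "A \<in> carrier_mat D D \<Longrightarrow> B \<in> carrier_mat D D \<Longrightarrow> D > 0 \<Longrightarrow> pm D (A + B) = pm D A + pm D B"
  by (rule lop_eqI) (simp add: pm.rep_eq plus_lop.rep_eq sum.distrib algebra_simps)

lemma pm_smult: "A \<in> carrier_mat D D \<Longrightarrow> D > 0 \<Longrightarrow> pm D (a \<cdot>\<^sub>m A) = a *\<^sub>C pm D A"
  by (rule lop_eqI) (simp add: pm.rep_eq scC_lop.rep_eq sum_distrib_left algebra_simps)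

lemma pm_one: "D > 0 \<Longrightarrow> pm D (1\<^sub>m D) = 1"
proof (rule lop_eqI)
  fix x i assume D: "D > 0"
  have "app (pm D (1\<^sub>m D)) x i = (\<Sum>j<D. if j = i mod D then x (i div D * D + j) else 0)"
    unfolding pm.rep_eq using D by (intro sum.cong) auto
  also have "\<dots> = x i" using D by simp
  finally show "app (pm D (1\<^sub>m D)) x i = app 1 x i" by (simp add: one_lop.rep_eq)
qed

lemma pm_mult:
  assumes "A \<in> carrier_mat D D" "B \<in> carrier_mat D D" "D > 0" shows "pm D (A * B) = pm D A * pm D B"
proof (rule lop_eqI)
  fix x i
  have "app (pm D (A * B)) x i = (\<Sum>j<D. (\<Sum>l<D. A $$ (i mod D, l) * B $$ (l, j)) * x (i div D * D + j))"
    unfolding pm.rep_eq using assms by (intro sum.cong) (auto simp: scalar_prod_def atLeast0LessThan)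
  also have "\<dots> = (\<Sum>j<D. \<Sum>l<D. A $$ (i mod D, l) * B $$ (l, j) * x (i div D * D + j))"
    by (simp add: sum_distrib_right)
  also have "\<dots> = (\<Sum>l<D. \<Sum>j<D. A $$ (i mod D, l) * B $$ (l, j) * x (i div D * D + j))" by (rule sum.swap)
  also have "\<dots> = app (pm D A * pm D B) x i"
    using assms(3) by (simp add: times_lop.rep_eq pm.rep_eq sum_distrib_left mult.assoc)
  finally show "app (pm D (A * B)) x i = app (pm D A * pm D B) x i" .
qed

lemma pm_inject:
  assumes "A \<in> carrier_mat D D" "B \<in> carrier_mat D D" "pm D A = pm D B" shows "A = B"
proof (rule eq_matI)
  fix i j assume "i < dim_row B" "j < dim_col B"
  then have ij: "i < D" "j < D" using assms by auto
  have v: "app (pm D M) (\<lambda>l. if l = j then 1 else 0) i = M $$ (i, j)" for M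
    unfolding pm.rep_eq using ij by (simp add: if_distrib[of "\<lambda>z. _ * z"] cong: if_cong)
  show "A $$ (i, j) = B $$ (i, j)" using v[of A] v[of B] assms(3) by simp
qed (use assms in auto)

section \<open>Kronecker products\<close>

lemma kron_carrier: "A \<in> carrier_mat m n \<Longrightarrow> B \<in> carrier_mat k l \<Longrightarrow> kron A B \<in> carrier_mat (m * k) (n * l)"
  by (auto simp: kron_def)

lemma kron_index:
  "A \<in> carrier_mat m n \<Longrightarrow> B \<in> carrier_mat k l \<Longrightarrow> i < m * k \<Longrightarrow> j < n * l \<Longrightarrow>
   kron A B $$ (i, j) = A $$ (i div k, j div l) * B $$ (i mod k, j mod l)"
  by (auto simp: kron_def)

lemma index_bound: "a < D \<Longrightarrow> b < d \<Longrightarrow> a * d + b < D * (d::nat)"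
proof -
  assume a: "a < D" "b < d"
  have "a * d + b < Suc a * d" using a by simp
  also have "\<dots> \<le> D * d" by (rule mult_le_mono1) (use a in simp)
  finally show ?thesis .
qed

lemma sum_prod_index:
  fixes f :: "nat \<Rightarrow> 'a::comm_monoid_add"
  shows "(\<Sum>n<D*d. f n) = (\<Sum>a<D. \<Sum>b<d. f (a * d + b))"
proof (cases "d = 0")
  case False
  have "(\<Sum>a<D. \<Sum>b<d. f (a * d + b)) = (\<Sum>(a,b)\<in>{..<D}\<times>{..<d}. f (a * d + b))"
    by (simp add: sum.cartesian_product)
  also have "\<dots> = (\<Sum>n<D*d. f n)"
    by (rule sum.reindex_bij_witness[of _ "\<lambda>n. (n div d, n mod d)" "\<lambda>(a,b). a * d + b"])
      (use False in \<open>auto simp: less_mult_imp_div_less index_bound\<close>)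
  finally show ?thesis by simp
qed simp

lemma pm_kron_one:
  assumes "B \<in> carrier_mat D D" "D > 0" "m > 0" shows "pm (m * D) (kron (1\<^sub>m m) B) = pm D B"
proof (rule lop_eqI)
  fix x i
  let ?i = "i mod (m * D)"
  have i: "?i < m * D" using assms by simp
  have id: "?i div D = i div D mod m" "?i mod D = i mod D" 
    by (simp_all add: mod_mult2_eq mult.commute[of m] assms)
  have idx: "i div (m * D) * (m * D) + (i div D mod m) * D = i div D * D"
  proof -
    have "i div (m * D) = i div D div m" by (metis div_mult2_eq mult.commute)
    then have "i div (m * D) * (m * D) + (i div D mod m) * D = (i div D div m * m + i div D mod m) * D"
      by (simp only: distrib_right mult.assoc)
    then show ?thesis by simp
  qed
  have "app (pm (m * D) (kron (1\<^sub>m m) B)) x i = (\<Sum>a<m. \<Sum>b<D. kron (1\<^sub>m m) B $$ (?i, a * D + b) * x (i div (m * D) * (m * D) + (a * D + b)))"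
    unfolding pm.rep_eq by (rule sum_prod_index)
  also have "\<dots> = (\<Sum>a<m. \<Sum>b<D. (if a = i div D mod m then B $$ (i mod D, b) * x (i div (m * D) * (m * D) + (a * D + b)) else 0))"
  proof (intro sum.cong refl)
    fix a b assume "a \<in> {..<m}" "b \<in> {..<D}"
    then have ab: "a < m" "b < D" "a * D + b < m * D" using index_bound by auto
    have "kron (1\<^sub>m m) B $$ (?i, a * D + b) = 1\<^sub>m m $$ (?i div D, (a * D + b) div D) * B $$ (?i mod D, (a * D + b) mod D)"
      by (rule kron_index[OF one_carrier_mat assms(1) i ab(3)])
    then show "kron (1\<^sub>m m) B $$ (?i, a * D + b) * x (i div (m * D) * (m * D) + (a * D + b)) =
      (if a = i div D mod m then B $$ (i mod D, b) * x (i div (m * D) * (m * D) + (a * D + b)) else 0)"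
      using ab assms unfolding id by auto
  qed
  also have "\<dots> = (\<Sum>b<D. B $$ (i mod D, b) * x (i div (m * D) * (m * D) + ((i div D mod m) * D + b)))"
    using assms(3) by (subst sum.swap) simp
  also have "\<dots> = app (pm D B) x i"
    unfolding pm.rep_eq by (simp add: add.assoc[symmetric] idx)
  finally show "app (pm (m * D) (kron (1\<^sub>m m) B)) x i = app (pm D B) x i" .
qed

lemma kron_mult:
  assumes "A \<in> carrier_mat m m" "C \<in> carrier_mat m m" "B \<in> carrier_mat n n" "E \<in> carrier_mat n n"
  shows "kron A B * kron C E = kron (A * C) (B * E)"
proof (rule eq_matI)
  fix i j assume "i < dim_row (kron (A * C) (B * E))" "j < dim_col (kron (A * C) (B * E))"
  then have ij: "i < m * n" "j < m * n" using assms by (auto simp: kron_def)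
  then have n0: "n > 0" by (cases n) auto
  have b: "i div n < m" "j div n < m" "i mod n < n" "j mod n < n"
    using ij n0 by (auto simp: less_mult_imp_div_less)
  have "(kron A B * kron C E) $$ (i, j) = (\<Sum>k<m*n. kron A B $$ (i, k) * kron C E $$ (k, j))"
    using ij kron_carrier[OF assms(1,3)] kron_carrier[OF assms(2,4)] by (auto simp: scalar_prod_def atLeast0LessThan)
  also have "\<dots> = (\<Sum>k<m*n. (A $$ (i div n, k div n) * B $$ (i mod n, k mod n)) * (C $$ (k div n, j div n) * E $$ (k mod n, j mod n)))"
    using ij by (intro sum.cong refl) (simp add: kron_index[OF assms(1,3)] kron_index[OF assms(2,4)])
  also have "\<dots> = (\<Sum>a<m. \<Sum>b<n. (A $$ (i div n, a) * B $$ (i mod n, b)) * (C $$ (a, j div n) * E $$ (b, j mod n)))"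
    unfolding sum_prod_index by (intro sum.cong refl) auto
  also have "\<dots> = (\<Sum>a<m. A $$ (i div n, a) * C $$ (a, j div n)) * (\<Sum>b<n. B $$ (i mod n, b) * E $$ (b, j mod n))"
    by (simp add: sum_product mult_ac)
  also have "\<dots> = kron (A * C) (B * E) $$ (i, j)"
    using ij b assms kron_index[of "A * C" m m "B * E" n n i j] by (simp add: scalar_prod_def atLeast0LessThan)
  finally show "(kron A B * kron C E) $$ (i, j) = kron (A * C) (B * E) $$ (i, j)" .
qed (use assms in \<open>auto simp: kron_def\<close>)

lemma kron_add_left:
  assumes "A \<in> carrier_mat m m" "C \<in> carrier_mat m m" "B \<in> carrier_mat n n"
  shows "kron (A + C) B = kron A B + kron C B"
proof (rule eq_matI)
  fix i j assume "i < dim_row (kron A B + kron C B)" "j < dim_col (kron A B + kron C B)"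
  then have ij: "i < m * n" "j < m * n" using assms by (auto simp: kron_def)
  then have n0: "n > 0" by (cases n) auto
  have b: "i div n < m" "j div n < m" using ij by (auto simp: less_mult_imp_div_less)
  show "kron (A + C) B $$ (i, j) = (kron A B + kron C B) $$ (i, j)"
    using ij b assms kron_carrier[OF assms(2,3)] by (auto simp: kron_index[of _ m m B n n] algebra_simps)
qed (use assms in \<open>auto simp: kron_def\<close>)

lemma kron_smult_left:
  assumes "A \<in> carrier_mat m m" "B \<in> carrier_mat n n"
  shows "kron (a \<cdot>\<^sub>m A) B = a \<cdot>\<^sub>m kron A B"
proof (rule eq_matI)
  fix i j assume "i < dim_row (a \<cdot>\<^sub>m kron A B)" "j < dim_col (a \<cdot>\<^sub>m kron A B)"
  then have ij: "i < m * n" "j < m * n" using assms by (auto simp: kron_def)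
  have b: "i div n < m" "j div n < m" using ij by (auto simp: less_mult_imp_div_less)
  show "kron (a \<cdot>\<^sub>m A) B $$ (i, j) = (a \<cdot>\<^sub>m kron A B) $$ (i, j)"
    using ij b assms kron_carrier[OF assms] by (auto simp: kron_index[of _ m m B n n] algebra_simps)
qed (use assms in \<open>auto simp: kron_def\<close>)

lemma kron_one_one: "kron (1\<^sub>m m) (1\<^sub>m n) = 1\<^sub>m (m * n)"
proof (rule eq_matI)
  fix i j assume "i < dim_row (1\<^sub>m (m * n))" "j < dim_col (1\<^sub>m (m * n))"
  then have ij: "i < m * n" "j < m * n" by auto
  then have n0: "n > 0" by (cases n) auto
  have b: "i div n < m" "j div n < m" "i mod n < n" "j mod n < n" using ij n0 by (auto simp: less_mult_imp_div_less)
  have "i = j" if "i div n = j div n" "i mod n = j mod n" using that by (metis div_mult_mod_eq)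
  then show "kron (1\<^sub>m m) (1\<^sub>m n) $$ (i, j) = 1\<^sub>m (m * n) $$ (i, j)"
    using ij b by (auto simp: kron_index[OF one_carrier_mat one_carrier_mat])
qed (auto simp: kron_def)

section \<open>Blocks with respect to the last tensor factor\<close>

definition blk :: "nat \<Rightarrow> nat \<Rightarrow> complex mat \<Rightarrow> nat \<Rightarrow> nat \<Rightarrow> complex mat" where
  "blk D d X k l = mat D D (\<lambda>(i, j). X $$ (i * d + k, j * d + l))"
lemma blk_carrier [simp]: "blk D d X k l \<in> carrier_mat D D" by (simp add: blk_def)

text \<open>A matrix on \<open>V \<otimes> W\<close> is read as a matrix over the operators on \<open>V\<close>, with indices in the last factor.\<close>

definition bk :: "nat \<Rightarrow> nat \<Rightarrow> complex mat \<Rightarrow> nat \<Rightarrow> nat \<Rightarrow> lop" where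
  "bk D d X k l = pm D (blk D d X k l)"

lemma bk_mult:
  assumes "X \<in> carrier_mat (D * d) (D * d)" "Y \<in> carrier_mat (D * d) (D * d)" "D > 0" "k < d" "l < d"
  shows "bk D d (X * Y) k l = mmul d (bk D d X) (bk D d Y) k l"
proof (rule lop_eqI)
  fix x i
  have im: "i mod D < D" using assms by simp
  have "app (bk D d (X * Y) k l) x i = (\<Sum>j<D. (\<Sum>n<D*d. X $$ (i mod D * d + k, n) * Y $$ (n, j * d + l)) * x (i div D * D + j))"
    unfolding bk_def pm.rep_eq
  proof (rule sum.cong[OF refl])
    fix j assume "j \<in> {..<D}"
    then have "i mod D * d + k < D * d" "j * d + l < D * d" using im assms index_bound by auto
    then have "(X * Y) $$ (i mod D * d + k, j * d + l) = (\<Sum>n<D*d. X $$ (i mod D * d + k, n) * Y $$ (n, j * d + l))"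
      using assms by (auto simp: scalar_prod_def atLeast0LessThan)
    then show "blk D d (X * Y) k l $$ (i mod D, j) * x (i div D * D + j) = (\<Sum>n<D*d. X $$ (i mod D * d + k, n) * Y $$ (n, j * d + l)) * x (i div D * D + j)"
      using \<open>j \<in> _\<close> im by (simp add: blk_def)
  qed
  also have "\<dots> = (\<Sum>j<D. \<Sum>a<D. \<Sum>m<d. X $$ (i mod D * d + k, a * d + m) * Y $$ (a * d + m, j * d + l) * x (i div D * D + j))"
    unfolding sum_prod_index by (simp add: sum_distrib_right)
  also have "\<dots> = (\<Sum>m<d. \<Sum>j<D. \<Sum>a<D. X $$ (i mod D * d + k, a * d + m) * Y $$ (a * d + m, j * d + l) * x (i div D * D + j))"
    by (rule sum_swap3)
  also have "\<dots> = (\<Sum>m<d. \<Sum>a<D. \<Sum>j<D. X $$ (i mod D * d + k, a * d + m) * Y $$ (a * d + m, j * d + l) * x (i div D * D + j))"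
    by (rule sum.cong[OF refl], rule sum.swap)
  also have "\<dots> = app (mmul d (bk D d X) (bk D d Y) k l) x i"
    unfolding mmul_def app_sum bk_def times_lop.rep_eq pm.rep_eq using im assms(3)
    by (auto simp: blk_def sum_distrib_left mult.assoc intro!: sum.cong)
  finally show "app (bk D d (X * Y) k l) x i = app (mmul d (bk D d X) (bk D d Y) k l) x i" .
qed

lemma bk_kron_one:
  assumes "K \<in> carrier_mat d d" "D > 0" "k < d" "l < d"
  shows "bk D d (kron (1\<^sub>m D) K) k l = K $$ (k, l) *\<^sub>C 1"
proof -
  have "blk D d (kron (1\<^sub>m D) K) k l = K $$ (k, l) \<cdot>\<^sub>m 1\<^sub>m D"
  proof (rule eq_matI)
    fix i j assume "i < dim_row (K $$ (k, l) \<cdot>\<^sub>m 1\<^sub>m D)" "j < dim_col (K $$ (k, l) \<cdot>\<^sub>m 1\<^sub>m D)"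
    then have ij: "i < D" "j < D" "i * d + k < D * d" "j * d + l < D * d" using index_bound assms by auto
    show "blk D d (kron (1\<^sub>m D) K) k l $$ (i, j) = (K $$ (k, l) \<cdot>\<^sub>m 1\<^sub>m D) $$ (i, j)"
      using ij assms by (simp add: blk_def kron_index[OF one_carrier_mat assms(1) ij(3,4)])
  qed (auto simp: blk_def)
  then show ?thesis using assms(2) by (simp add: bk_def pm_smult pm_one)
qed

lemma pm_ptrace:
  assumes "D > 0" shows "pm D (ptrace D d A) = (\<Sum>k<d. bk D d A k k)"
proof (rule lop_eqI)
  fix x i
  have im: "i mod D < D" using assms by simp
  have "app (pm D (ptrace D d A)) x i = (\<Sum>j<D. \<Sum>k<d. A $$ (i mod D * d + k, j * d + k) * x (i div D * D + j))"
    unfolding pm.rep_eq using im by (simp add: ptrace_def sum_distrib_right)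
  also have "\<dots> = (\<Sum>k<d. \<Sum>j<D. A $$ (i mod D * d + k, j * d + k) * x (i div D * D + j))" by (rule sum.swap)
  also have "\<dots> = app (\<Sum>k<d. bk D d A k k) x i"
    unfolding app_sum bk_def pm.rep_eq using im by (simp add: blk_def)
  finally show "app (pm D (ptrace D d A)) x i = app (\<Sum>k<d. bk D d A k k) x i" .
qed

lemma emb13_carrier: "emb13 d1 d2 d3 A \<in> carrier_mat (d1 * d2 * d3) (d1 * d2 * d3)"
  by (simp add: emb13_def)

lemma bk_site:
  assumes "m > 0" "n > 0" "low > 0" "k < d" "l < d"
  shows "bk (m * (n * low)) d (kron (1\<^sub>m m) (emb13 n low d A)) k l = pm (n * low) (kron (blk n d A k l) (1\<^sub>m low))"
proof -
  have "blk (m * (n * low)) d (kron (1\<^sub>m m) (emb13 n low d A)) k l = kron (1\<^sub>m m) (kron (blk n d A k l) (1\<^sub>m low))"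
    (is "?L = ?R")
  proof (rule eq_matI)
    have RC: "kron (blk n d A k l) (1\<^sub>m low) \<in> carrier_mat (n * low) (n * low)" by (rule kron_carrier) auto
    fix i j assume "i < dim_row ?R" "j < dim_col ?R"
    then have ij: "i < m * (n * low)" "j < m * (n * low)" by (auto simp: kron_def blk_def)
    define D where "D = n * low"
    have D: "D > 0" using assms by (simp add: D_def)
    have ij': "i mod D < n * low" "j mod D < n * low" using D by (simp_all add: D_def)
    have bd: "i * d + k < m * (n * low * d)" "j * d + l < m * (n * low * d)"
      using index_bound[OF ij(1) assms(4)] index_bound[OF ij(2) assms(5)] by (simp_all add: mult.assoc)
    have q: "(x * d + y) div (D * d) = x div D" "(x * d + y) mod (D * d) = (x mod D) * d + y" if "y < d" for x y
    proof -
      have "(x * d + y) div (D * d) = (x * d + y) div d div D" by (metis div_mult2_eq mult.commute)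
      then show "(x * d + y) div (D * d) = x div D" using that by simp
      have "(x * d + y) mod (D * d) = d * ((x * d + y) div d mod D) + (x * d + y) mod d"
        by (metis mod_mult2_eq mult.commute)
      then show "(x * d + y) mod (D * d) = (x mod D) * d + y" using that by simp
    qed
    have r: "(x * d + y) div (low * d) = x div low" "(x * d + y) div d = x" "(x * d + y) mod d = y" if "y < d" for x y
    proof -
      have "(x * d + y) div (low * d) = (x * d + y) div d div low" by (metis div_mult2_eq mult.commute)
      then show "(x * d + y) div (low * d) = x div low" using that by simp
    qed (use that in auto)
    have nl: "i mod D div low < n" "j mod D div low < n" "i mod D mod low < low" "j mod D mod low < low"
      using ij' assms by (auto simp: less_mult_imp_div_less)
    have eb: "i mod D * d + k < n * low * d" "j mod D * d + l < n * low * d"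
      using index_bound[OF ij'(1) assms(4)] index_bound[OF ij'(2) assms(5)] by auto
    have "?L $$ (i, j) = kron (1\<^sub>m m) (emb13 n low d A) $$ (i * d + k, j * d + l)"
      using ij by (simp add: blk_def)
    also have "\<dots> = 1\<^sub>m m $$ (i div D, j div D) * emb13 n low d A $$ (i mod D * d + k, j mod D * d + l)"
      using kron_index[OF one_carrier_mat emb13_carrier bd, of A] assms(4,5) unfolding D_def[symmetric] by (simp add: q)
    also have "emb13 n low d A $$ (i mod D * d + k, j mod D * d + l) =
        (if i mod D mod low = j mod D mod low then A $$ (i mod D div low * d + k, j mod D div low * d + l) else 0)"
      using eb assms(4,5) by (simp add: emb13_def r)
    also have "\<dots> = kron (blk n d A k l) (1\<^sub>m low) $$ (i mod D, j mod D)"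
      using kron_index[of "blk n d A k l" n n "1\<^sub>m low" low low, OF _ _ ij'] nl by (simp add: blk_def)
    also have "1\<^sub>m m $$ (i div D, j div D) * \<dots> = ?R $$ (i, j)"
      using kron_index[OF one_carrier_mat RC ij] by (simp add: D_def)
    finally show "?L $$ (i, j) = ?R $$ (i, j)" .
  qed (auto simp: kron_def blk_def)
  then show ?thesis unfolding bk_def
    by (simp add: pm_kron_one[OF kron_carrier[OF blk_carrier one_carrier_mat]] assms)
qed

section \<open>Evaluation of noncommutative polynomials\<close>

lemma nc_word_pm:
  assumes "A \<in> carrier_mat D D" "B \<in> carrier_mat D D" "D > 0"
  shows "nc_word A B w \<in> carrier_mat D D \<and> pm D (nc_word A B w) = wordv (pm D A) (pm D B) w"
proof (induction w)
  case Nil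
  then show ?case using assms by (simp add: nc_word_def prod_mats_def wordv_def pm_one)
next
  case (Cons x w)
  have "nc_word A B (x # w) = (case x of X0 \<Rightarrow> A | X1 \<Rightarrow> B) * nc_word A B w"
    by (simp add: nc_word_def prod_mats_def)
  then show ?case using Cons assms by (cases x) (auto simp: wordv_def pm_mult)
qed

lemma nc_eval_pm:
  assumes "A \<in> carrier_mat D D" "B \<in> carrier_mat D D" "D > 0"
  shows "nc_eval p A B \<in> carrier_mat D D"
    and "pm D (nc_eval p A B) = (\<Sum>w\<in>Poly_Mapping.keys p. Poly_Mapping.lookup p w *\<^sub>C wordv (pm D A) (pm D B) w)"
proof -
  show "nc_eval p A B \<in> carrier_mat D D" using assms by (simp add: nc_eval_def)
  show "pm D (nc_eval p A B) = (\<Sum>w\<in>Poly_Mapping.keys p. Poly_Mapping.lookup p w *\<^sub>C wordv (pm D A) (pm D B) w)"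
  proof (rule lop_eqI)
    fix x i
    have im: "i mod D < D" using assms by simp
    have "app (pm D (nc_eval p A B)) x i = (\<Sum>j<D. \<Sum>w\<in>Poly_Mapping.keys p. Poly_Mapping.lookup p w * nc_word A B w $$ (i mod D, j) * x (i div D * D + j))"
      unfolding pm.rep_eq using im assms by (simp add: nc_eval_def sum_distrib_right)
    also have "\<dots> = (\<Sum>w\<in>Poly_Mapping.keys p. \<Sum>j<D. Poly_Mapping.lookup p w * nc_word A B w $$ (i mod D, j) * x (i div D * D + j))"
      by (rule sum.swap)
    also have "\<dots> = app (\<Sum>w\<in>Poly_Mapping.keys p. Poly_Mapping.lookup p w *\<^sub>C wordv (pm D A) (pm D B) w) x i"
      unfolding app_sum scC_lop.rep_eq using nc_word_pm[OF assms] by (simp add: pm.rep_eq sum_distrib_left mult.assoc flip: nc_word_pm[OF assms, THEN conjunct2])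
    finally show "app (pm D (nc_eval p A B)) x i = app (\<Sum>w\<in>Poly_Mapping.keys p. Poly_Mapping.lookup p w *\<^sub>C wordv (pm D A) (pm D B) w) x i" .
  qed
qed

section \<open>The gauge factors\<close>

locale generic =
  fixes h :: complex
  assumes h0: "h \<noteq> 0" and nonroot: "\<And>n::nat. n > 0 \<Longrightarrow> (h ^ 2) ^ n \<noteq> 1"
begin

abbreviation "lm \<equiv> h ^ 2 - inverse (h ^ 2)"

definition qn :: "int \<Rightarrow> complex" where "qn n = qnum (h ^ 2) n"
definition Bq :: "nat \<Rightarrow> nat \<Rightarrow> complex" where "Bq J p = qB h (int J) (int J - 2 * int p)"
text \<open>The rescaling of the basis vectors of spin \<open>J/2\<close> that turns \<open>\<E>\<close> into a matrix of zeros and ones. In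
  this basis the lowering operator has the matrix elements \<open>[n + 1]\<close>.\<close>

definition G :: "nat \<Rightarrow> nat \<Rightarrow> complex" where "G J n = (\<Prod>p<n. qn (int p + 1) / Bq J p)"

lemma lm0: "lm \<noteq> 0"
proof
  assume "lm = 0"
  then have "(h ^ 2) ^ 2 = 1" using h0 by (simp add: power2_eq_square field_simps)
  then show False using nonroot[of 2] by simp
qed

lemma cf_qn: "cf' (h powi (2 * n)) = lm * qn n"
proof -
  have "h powi (2 * n) = (h ^ 2) powi n" by (simp add: power_int_mult)
  moreover have "inverse ((h ^ 2) powi n) = (h ^ 2) powi (- n)" by (simp add: power_int_minus)
  ultimately show ?thesis using lm0 by (simp add: cf'_def qn_def qnum_def)
qed

lemma qn0: "n \<noteq> 0 \<Longrightarrow> qn n \<noteq> 0"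
proof -
  assume n: "n \<noteq> 0"
  have pos: "qn (int m) \<noteq> 0" if "m > 0" for m
  proof
    assume "qn (int m) = 0"
    then have "(h ^ 2) ^ m = inverse ((h ^ 2) ^ m)" using lm0 by (simp add: qn_def qnum_def power_int_minus)
    then have "(h ^ 2) ^ (m + m) = 1" unfolding power_add using h0 by (simp add: field_simps)
    then show False using nonroot[of "m + m"] that by simp
  qed
  have neg: "qn (- x) = - qn x" for x by (simp add: qn_def qnum_def divide_simps)
  show ?thesis
  proof (cases "n > 0")
    case True then show ?thesis using pos[of "nat n"] by simp
  next
    case False
    then have "qn (- n) \<noteq> 0" using pos[of "nat (- n)"] n by simp
    then show ?thesis unfolding neg by simp
  qed
qed

lemma Bq_sq: "p \<le> J \<Longrightarrow> Bq J p * Bq J p = qn (int J - int p) * qn (int p + 1)"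
proof -
  have a: "(int J + (int J - 2 * int p)) div 2 = int J - int p" "(int J - (int J - 2 * int p)) div 2 + 1 = int p + 1" by simp_all
  show ?thesis unfolding Bq_def qB_def a qn_def[symmetric] power2_eq_square[symmetric] by (rule power2_csqrt)
qed

lemma Bq0: "p < J \<Longrightarrow> Bq J p \<noteq> 0"
  using Bq_sq[of p J] qn0[of "int J - int p"] qn0[of "int p + 1"] by auto

lemma G_0 [simp]: "G J 0 = 1" by (simp add: G_def)
lemma G_Suc: "G J (Suc n) = G J n * (qn (int n + 1) / Bq J n)" by (simp add: G_def)
lemma G0: "n \<le> J \<Longrightarrow> G J n \<noteq> 0"
  by (simp add: G_def Bq0 qn0)

lemma G_up: "n < J \<Longrightarrow> G J (Suc n) * Bq J n = G J n * qn (int n + 1)"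
  using Bq0[of n J] by (simp add: G_Suc)
lemma G_down: "n < J \<Longrightarrow> G J n * Bq J n = G J (Suc n) * qn (int J - int n)"
proof -
  assume n: "n < J"
  have "G J n * Bq J n * qn (int n + 1) = G J (Suc n) * (Bq J n * Bq J n)"
    using G_up[OF n] by (simp add: mult_ac)
  also have "\<dots> = G J (Suc n) * qn (int J - int n) * qn (int n + 1)" using Bq_sq[of n J] n by simp
  finally show ?thesis using qn0[of "int n + 1"] by simp
qed

lemma qn_1: "qn 1 = 1" using lm0 by (simp add: qn_def qnum_def power_int_minus)
lemma G_1 [simp]: "G (Suc 0) (Suc 0) = 1"
proof -
  have "Bq (Suc 0) 0 = 1" by (simp add: Bq_def qB_def qn_def[symmetric] qn_1)
  then show ?thesis unfolding G_Suc by (simp add: qn_1)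
qed

section \<open>The matrices of the fusion maps\<close>

lemma E_diag_G: "m < S \<Longrightarrow> E_diag h S (Suc m) = G S m / G (S - 1) m"
proof -
  assume m: "m < S"
  have b: "Bq (S - 1) p = qB h (int S - 1) (int S - 2 * int p - 1)" for p
    unfolding Bq_def using m by (simp add: algebra_simps of_nat_diff)
  have "G S m / G (S - 1) m = (\<Prod>p<m. (qn (int p + 1) / Bq S p) / (qn (int p + 1) / Bq (S - 1) p))"
    by (simp only: G_def prod_dividef)
  also have "\<dots> = (\<Prod>p<m. Bq (S - 1) p / Bq S p)"
  proof (intro prod.cong refl)
    fix p :: nat
    have "qn (int p + 1) \<noteq> 0" by (rule qn0) simp
    then show "(qn (int p + 1) / Bq S p) / (qn (int p + 1) / Bq (S - 1) p) = Bq (S - 1) p / Bq S p" by simp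
  qed
  also have "\<dots> = E_diag h S (Suc m)" unfolding E_diag_def b unfolding Bq_def by simp
  finally show ?thesis by simp
qed

lemma E_off_G: "m < S \<Longrightarrow> qnum (h ^ 2) (int (Suc m)) * E_diag h S (Suc m) / Bq S m = G S (Suc m) / G (S - 1) m"
  by (simp add: E_diag_G G_Suc qn_def[symmetric] add.commute mult_ac)

lemma E_mat_index:
  assumes "a < 2" "m < S" "n < S + 1"
  shows "E_mat h S $$ (a * S + m, n) = (if a + m = n then G S n / G (S - 1) m else 0)"
proof -
  have i: "a * S + m < 2 * S" using index_bound[OF assms(1,2)] .
  have "E_mat h S $$ (a * S + m, n) = E_entry h S (a * S + m + 1) (n + 1)"
    using i assms by (simp add: E_mat_def mat1_def)
  also have "\<dots> = (if a + m = n then G S n / G (S - 1) m else 0)"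
  proof (cases "a = 0")
    case True
    then show ?thesis using assms by (auto simp: E_entry_def E_diag_G)
  next
    case False
    then have a: "a = 1" using assms by simp
    have s: "int S + 2 - 2 * int (Suc m) = int S - 2 * int m" by simp
    have "E_entry h S (S + m + 1) (n + 1) = (if Suc m = n then qnum (h ^ 2) (int (Suc m)) * E_diag h S (Suc m) / qB h (int S) (int S + 2 - 2 * int (Suc m)) else 0)"
      using assms by (auto simp: E_entry_def)
    also have "\<dots> = (if Suc m = n then G S n / G (S - 1) m else 0)"
      unfolding s Bq_def[symmetric] E_off_G[OF assms(2)] by simp
    finally show ?thesis using a by simp
  qed
  finally show ?thesis .
qed

text \<open>The weight of the first of the two nonzero entries in a row of \<open>\<F>\<close>, in the rescaled basis. The second
  entry has the complementary weight because \<open>\<F>\<close> is a left inverse of \<open>\<E>\<close>.\<close>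

definition wF :: "nat \<Rightarrow> nat \<Rightarrow> complex" where
  "wF S s = (if s = 0 then 1 else if s = S then 0 else 1 - F_off h S (Suc s) * (G S s / G (S - 1) (s - 1)))"

lemma F_mat_index:
  assumes "S \<ge> 2" "a < 2" "m < S" "s < S + 1"
  shows "F_mat h S $$ (s, a * S + m) = (if a + m = s then (if a = 0 then wF S s else 1 - wF S s) * (G (S - 1) m / G S s) else 0)"
proof -
  have i: "a * S + m < 2 * S" using index_bound[OF assms(2,3)] .
  define r c where "r = s + 1" and "c = a * S + m + 1"
  have E0: "E_entry h S r r = G S s / G (S - 1) s" if "s < S"
    using that by (simp add: E_entry_def r_def E_diag_G)
  have E1: "E_entry h S (r + S - 1) r = G S s / G (S - 1) (s - 1)" if "1 \<le> s"
  proof -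
    define t where "t = s - 1"
    have t: "s = Suc t" using that by (simp add: t_def)
    have e: "int S + 2 - 2 * int (Suc t) = int S - 2 * int t" by simp
    have "E_entry h S (r + S - 1) r = qnum (h ^ 2) (int (Suc t)) * E_diag h S (Suc t) / qB h (int S) (int S + 2 - 2 * int (Suc t))"
      using assms by (auto simp: E_entry_def r_def t)
    also have "\<dots> = G S s / G (S - 1) (s - 1)"
      unfolding e Bq_def[symmetric] using E_off_G[of t S] assms t by simp
    finally show ?thesis .
  qed
  have F: "F_mat h S $$ (s, a * S + m) = (if r = 1 \<and> c = 1 then 1
      else if 2 \<le> r \<and> r \<le> S \<and> c = r + S - 1 then F_off h S r
      else if 2 \<le> r \<and> r \<le> S \<and> c = r
        then (1 - F_off h S r * E_entry h S (r + S - 1) r) / E_entry h S r r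
      else if r = S + 1 \<and> c = 2 * S then inverse (E_entry h S (2 * S) (S + 1))
      else 0)"
    using i assms(4) unfolding r_def c_def by (simp add: F_mat_def mat1_def)
  consider "s = 0" | "1 \<le> s" "s < S" | "s = S" using assms(4) by linarith
  then show ?thesis
  proof cases
    case 1
    then show ?thesis unfolding F r_def c_def using assms by (auto simp: wF_def)
  next
    case 2
    have g: "G S s \<noteq> 0" "G (S - 1) s \<noteq> 0" "G (S - 1) (s - 1) \<noteq> 0" using 2 by (auto intro!: G0)
    consider "a = 0" | "a = 1" using assms(2) by linarith
    then show ?thesis
    proof cases
      case 1
      then have "c \<noteq> r + S - 1" "c = r \<longleftrightarrow> m = s" "r \<noteq> 1" "r \<noteq> S + 1" "2 \<le> r" "r \<le> S" using 2 assms by (auto simp: c_def r_def)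
      note f = this
      have w: "wF S s = 1 - F_off h S r * E_entry h S (r + S - 1) r"
        using 2 unfolding E1[OF 2(1)] by (simp add: wF_def r_def)
      show ?thesis
      proof (cases "m = s")
        case True
        have "F_mat h S $$ (s, a * S + m) = (1 - F_off h S r * E_entry h S (r + S - 1) r) / E_entry h S r r"
          unfolding F using f True by simp
        also have "\<dots> = wF S s * (G (S - 1) m / G S s)" unfolding w[symmetric] E0[OF 2(2)] True by simp
        finally show ?thesis using 1 True by simp
      next
        case False
        then show ?thesis unfolding F using f 1 by simp
      qed
    next
      case 12: 2
      then have "c = r + S - 1 \<longleftrightarrow> Suc m = s" "c \<noteq> r" "r \<noteq> 1" "r \<noteq> S + 1" "2 \<le> r" "r \<le> S" using 2 assms by (auto simp: c_def r_def)
      note f = this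
      have w: "1 - wF S s = F_off h S r * (G S s / G (S - 1) (s - 1))"
        using 2 by (simp add: wF_def r_def)
      show ?thesis
      proof (cases "Suc m = s")
        case True
        then have m: "m = s - 1" by simp
        have "F_mat h S $$ (s, a * S + m) = F_off h S r" unfolding F using f True by simp
        also have "\<dots> = (1 - wF S s) * (G (S - 1) m / G S s)" unfolding w m using g by simp
        finally show ?thesis using 12 True by simp
      next
        case False
        then show ?thesis unfolding F using f 12 by simp
      qed
    qed
  next
    case 3
    have c: "c = 2 * S \<longleftrightarrow> a = 1 \<and> Suc m = s"
    proof (cases "a = 0")
      case True then show ?thesis using assms(3) by (auto simp: c_def)
    next
      case False
      then have "a = 1" using assms(2) by simp
      then show ?thesis using 3 by (auto simp: c_def)
    qed
    have "E_entry h S (2 * S) (S + 1) = G S s / G (S - 1) (s - 1)"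
      using E1 3 assms(1) unfolding r_def by (simp add: mult_2)
    moreover have "s - 1 = m" if "Suc m = s" using that by simp
    ultimately show ?thesis unfolding F using 3 assms c
      by (auto simp: r_def wF_def less_2_cases_iff)
  qed
qed

section \<open>R-matrices and K-matrices in the gauge basis\<close>

lemma R_half_index:
  assumes "J \<ge> 1" "a < 2" "b < 2" "k < J + 1" "l < J + 1"
  shows "R_half h J u $$ (a * (J + 1) + k, b * (J + 1) + l) = R1 h J u a k b l * (G J l / G J k)"
proof -
  define e where "e = J + 1"
  have e: "k < e" "l < e" "e > 0" using assms by (simp_all add: e_def)
  have i: "a * e + k < 2 * e" "b * e + l < 2 * e" using index_bound assms e by auto
  have d: "(a * e + k) div e = a" "(a * e + k) mod e = k" "(b * e + l) div e = b" "(b * e + l) mod e = l" using e by simp_all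
  have C: "sigma_p \<in> carrier_mat 2 2" "sigma_m \<in> carrier_mat 2 2" "S_minus h J \<in> carrier_mat e e" "S_plus h J \<in> carrier_mat e e"
    by (simp_all add: sigma_p_def sigma_m_def S_minus_def S_plus_def mat1_def e_def)
  have P: "pow_I_sz_S3 x J \<in> carrier_mat (2 * e) (2 * e)" for x by (simp add: pow_I_sz_S3_def e_def)
  note K1 = kron_index[OF C(1,3) i, unfolded d] and K2 = kron_index[OF C(2,4) i, unfolded d]
  note KC = kron_carrier[OF C(1,3)] kron_carrier[OF C(2,4)]
  have sp: "sigma_p $$ (a, b) = (if a = 0 \<and> b = 1 then 1 else 0)" "sigma_m $$ (a, b) = (if a = 1 \<and> b = 0 then 1 else 0)"
    using assms by (auto simp: sigma_p_def sigma_m_def mat1_def)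
  have Sm: "S_minus h J $$ (k, l) = (if k = l + 1 then Bq J l else 0)"
    using assms by (auto simp: S_minus_def mat1_def Bq_def algebra_simps)
  have Sp: "S_plus h J $$ (k, l) = (if l = k + 1 then Bq J k else 0)"
    using assms by (auto simp: S_plus_def mat1_def Bq_def algebra_simps)
  have ii: "a * e + k = b * e + l \<longleftrightarrow> a = b \<and> k = l" using d by metis
  have PI: "pow_I_sz_S3 x J $$ (a * e + k, b * e + l) = (if a = b \<and> k = l then x powi (1 + (if a = 0 then 1 else -1) * (int J - 2 * int k)) else 0)" for x
    using i d ii unfolding pow_I_sz_S3_def S3_eig_def e_def[symmetric] by (auto simp: algebra_simps)
  have "R_half h J u $$ (a * e + k, b * e + l) = pf h J u * (lm * (sigma_p $$ (a, b) * S_minus h J $$ (k, l) + sigma_m $$ (a, b) * S_plus h J $$ (k, l))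
     + u * pow_I_sz_S3 h J $$ (a * e + k, b * e + l) - inverse u * pow_I_sz_S3 (inverse h) J $$ (a * e + k, b * e + l))"
    using assms(1) i P[of h] P[of "inverse h"] KC unfolding R_half_def
    by (simp add: K1 K2 pf_def cfun_def cf'_def)
  also have "\<dots> = R1 h J u a k b l * (G J l / G J k)"
  proof -
    have g: "G J k \<noteq> 0" "G J l \<noteq> 0" using assms by (auto intro!: G0)
    consider "a = b" | "a = 0" "b = 1" | "a = 1" "b = 0" using assms by linarith
    then show ?thesis
    proof cases
      case 1
      show ?thesis
      proof (cases "k = l")
        case True
        have x: "int J + 1 - 2 * int l = 1 + (int J - 2 * int l)" "1 - int J + 2 * int l = 1 + (2 * int l - int J)" by simp_all
        consider "a = 0" | "a = 1" using assms by linarith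
        then show ?thesis unfolding sp PI
          by cases (use 1 True g h0 assms in \<open>simp_all add: R1_def cf'_def x power_int_inverse\<close>)
      next
        case False
        then show ?thesis unfolding sp PI using 1 assms by (auto simp: R1_def less_2_cases_iff)
      qed
    next
      case 2
      show ?thesis
      proof (cases "k = l + 1")
        case True
        have "lm * Bq J l = lm * qn (int l + 1) * (G J l / G J k)"
          using G_up[of l J] g True assms by (simp add: field_simps)
        moreover have "(lm * (sigma_p $$ (a, b) * S_minus h J $$ (k, l) + sigma_m $$ (a, b) * S_plus h J $$ (k, l))
            + u * pow_I_sz_S3 h J $$ (a * e + k, b * e + l) - inverse u * pow_I_sz_S3 (inverse h) J $$ (a * e + k, b * e + l)) = lm * Bq J l"
          unfolding sp Sm PI using 2 True by simp
        moreover have "R1 h J u a k b l = pf h J u * (lm * qn (int l + 1))"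
        proof -
          have "R1 h J u a k b l = pf h J u * cf' (h powi (2 * int k))" unfolding R1_def using 2 True by simp
          moreover have "2 * int k = 2 * (int l + 1)" using True by simp
          ultimately show ?thesis by (simp only: cf_qn)
        qed
        ultimately show ?thesis by (simp only: mult.assoc)
      next
        case False
        then show ?thesis unfolding sp Sm PI using 2 by (simp add: R1_def)
      qed
    next
      case 3
      show ?thesis
      proof (cases "l = k + 1")
        case True
        have "lm * Bq J k = lm * qn (int J - int k) * (G J l / G J k)"
          using G_down[of k J] g True assms by (simp add: field_simps)
        moreover have "(lm * (sigma_p $$ (a, b) * S_minus h J $$ (k, l) + sigma_m $$ (a, b) * S_plus h J $$ (k, l))
            + u * pow_I_sz_S3 h J $$ (a * e + k, b * e + l) - inverse u * pow_I_sz_S3 (inverse h) J $$ (a * e + k, b * e + l)) = lm * Bq J k"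
          unfolding sp Sp PI using 3 True by simp
        moreover have "R1 h J u a k b l = pf h J u * (lm * qn (int J - int k))"
          unfolding cf_qn[symmetric] R1_def using 3 True by simp
        ultimately show ?thesis by (simp only: mult.assoc)
      next
        case False
        then show ?thesis unfolding sp Sp PI using 3 by (simp add: R1_def)
      qed
    qed
  qed
  finally show ?thesis unfolding e_def .
qed

definition RG :: "nat \<Rightarrow> nat \<Rightarrow> complex \<Rightarrow> nat \<Rightarrow> nat \<Rightarrow> nat \<Rightarrow> nat \<Rightarrow> complex" where
  "RG S J u s k n l = (G S s * G J k) / (G S n * G J l) * R_mat h S J u $$ (s * (J + 1) + k, n * (J + 1) + l)"

definition KG :: "bparams \<Rightarrow> nat \<Rightarrow> complex \<Rightarrow> nat \<Rightarrow> nat \<Rightarrow> complex" where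
  "KG \<beta> J u k l = G J k / G J l * K_mat h \<beta> J u $$ (k, l)"

lemma R_half_carrier: "R_half h J u \<in> carrier_mat (2 * (J + 1)) (2 * (J + 1))"
proof (cases "J = 0")
  case False
  have "kron sigma_p (S_minus h J) \<in> carrier_mat (2 * (J + 1)) (2 * (J + 1))" "kron sigma_m (S_plus h J) \<in> carrier_mat (2 * (J + 1)) (2 * (J + 1))"
    by (intro kron_carrier; simp add: sigma_p_def sigma_m_def S_minus_def S_plus_def mat1_def)+
  moreover have "pow_I_sz_S3 x J \<in> carrier_mat (2 * (J + 1)) (2 * (J + 1))" for x by (simp add: pow_I_sz_S3_def)
  ultimately show ?thesis using False unfolding R_half_def by (metis (no_types, lifting) add_carrier_mat minus_carrier_mat smult_carrier_mat)
qed (simp add: R_half_def)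

lemma EF_carrier: "E_mat h S \<in> carrier_mat (2 * S) (S + 1)" "F_mat h S \<in> carrier_mat (S + 1) (2 * S)"
  by (simp_all add: E_mat_def F_mat_def mat1_def)

lemma R_mat_carrier: "R_mat h S J u \<in> carrier_mat ((S + 1) * (J + 1)) ((S + 1) * (J + 1))"
proof (induction S J u rule: R_mat.induct[where h = h])
  case (1 J2 u) then show ?case by simp
next
  case (2 J2 u) then show ?case using R_half_carrier[of J2 u] by (simp add: numeral_2_eq_2)
next
  case (3 m J2 u)
  have "kron (F_mat h (m + 2)) (1\<^sub>m (J2 + 1)) \<in> carrier_mat ((m + 2 + 1) * (J2 + 1)) (2 * (m + 2) * (J2 + 1))"
    "kron (E_mat h (m + 2)) (1\<^sub>m (J2 + 1)) \<in> carrier_mat (2 * (m + 2) * (J2 + 1)) ((m + 2 + 1) * (J2 + 1))"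
    by (intro kron_carrier EF_carrier one_carrier_mat)+
  note d = carrier_matD(1)[OF this(1)] carrier_matD(2)[OF this(2)]
  have e: "(m + 2 + 1) * (J2 + 1) = (Suc (Suc m) + 1) * (J2 + 1)" by simp
  show ?case unfolding R_mat.simps by (intro carrier_matI) (simp_all only: index_mult_mat d e)
qed

lemma K_half_carrier: "K_half h \<beta> u \<in> carrier_mat 2 2"
proof -
  have c: "mat_of_rows_list 2 [[a, b], [c, d]] \<in> carrier_mat 2 2" for a b c d :: complex
    by (rule carrier_matI) (simp_all add: mat_of_rows_list_def)
  show ?thesis by (cases \<beta> rule: prod_cases4) (simp only: K_half_def prod.case c)
qed

lemma K_mat_carrier: "K_mat h \<beta> J u \<in> carrier_mat (J + 1) (J + 1)"
proof (induction \<beta> J u rule: K_mat.induct[where h = h])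
  case (2 \<beta> u) then show ?case using K_half_carrier by (simp add: numeral_2_eq_2)
next
  case (3 \<beta> m u)
  have e: "m + 2 + 1 = Suc (Suc m) + 1" by simp
  show ?case unfolding K_mat.simps
    by (intro carrier_matI) (simp_all only: index_mult_mat carrier_matD[OF EF_carrier(1)] carrier_matD[OF EF_carrier(2)] e)
qed simp

lemma mat_mult_index2:
  assumes "X \<in> carrier_mat r (D * d)" "Y \<in> carrier_mat (D * d) c" "i < r" "j < c"
  shows "(X * Y) $$ (i, j) = (\<Sum>a<D. \<Sum>b<d. X $$ (i, a * d + b) * Y $$ (a * d + b, j))"
proof -
  have "(X * Y) $$ (i, j) = (\<Sum>x<D*d. X $$ (i, x) * Y $$ (x, j))"
    using assms by (auto simp: scalar_prod_def atLeast0LessThan)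
  then show ?thesis by (simp add: sum_prod_index)
qed

lemma kron_index2:
  assumes "A \<in> carrier_mat m n" "B \<in> carrier_mat k l" "a < m" "b < k" "c < n" "d < l"
  shows "kron A B $$ (a * k + b, c * l + d) = A $$ (a, c) * B $$ (b, d)"
proof -
  have "a * k + b < m * k" "c * l + d < n * l" using index_bound assms by auto
  from kron_index[OF assms(1,2) this] show ?thesis using assms by simp
qed

lemma emb13_index2:
  assumes "a < d1" "m < d2" "k < d3" "b < d1" "p < d2" "l < d3"
  shows "emb13 d1 d2 d3 A $$ ((a * d2 + m) * d3 + k, (b * d2 + p) * d3 + l) = (if m = p then A $$ (a * d3 + k, b * d3 + l) else 0)"
proof -
  have i: "(a * d2 + m) * d3 + k < d1 * d2 * d3" "(b * d2 + p) * d3 + l < d1 * d2 * d3" using index_bound assms by auto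
  have r: "((x * d2 + y) * d3 + z) div (d2 * d3) = x" "((x * d2 + y) * d3 + z) div d3 mod d2 = y" "((x * d2 + y) * d3 + z) mod d3 = z"
    if "y < d2" "z < d3" for x y z
  proof -
    have "((x * d2 + y) * d3 + z) div (d2 * d3) = ((x * d2 + y) * d3 + z) div d3 div d2" by (metis div_mult2_eq mult.commute)
    then show "((x * d2 + y) * d3 + z) div (d2 * d3) = x" using that by simp
  qed (use that in auto)
  show ?thesis using i assms by (simp add: emb13_def r)
qed

lemma R_mat_rec:
  assumes "S \<ge> 2" "s < S + 1" "k < J + 1" "n < S + 1" "l < J + 1"
  shows "R_mat h S J u $$ (s * (J + 1) + k, n * (J + 1) + l) =
    (\<Sum>a<2. \<Sum>m<S. F_mat h S $$ (s, a * S + m) * (\<Sum>b<2. \<Sum>k'<J+1. R_half h J (u * h powi (1 - int S)) $$ (a * (J + 1) + k, b * (J + 1) + k') *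
       (\<Sum>p<S. R_mat h (S - 1) J (u * h) $$ (m * (J + 1) + k', p * (J + 1) + l) * E_mat h S $$ (b * S + p, n))))"
proof -
  define e where "e = J + 1"
  obtain S' where S': "S = Suc (Suc S')" by (rule that[of "S - 2"]) (use assms(1) in simp)
  define A where "A = kron (F_mat h S) (1\<^sub>m e)"
  define B where "B = emb13 2 S e (R_half h J (u * h powi (1 - int S)))"
  define C where "C = kron (1\<^sub>m 2) (R_mat h (S - 1) J (u * h))"
  define D where "D = kron (E_mat h S) (1\<^sub>m e)"
  have p: "- int (S' + 1) = 1 - int S" "S' + 2 = S" "Suc S' = S - 1" unfolding S' by simp_all
  have S1: "S - 1 + 1 = S" using assms(1) by simp
  have Rc: "R_mat h (S - 1) J (u * h) \<in> carrier_mat (S * e) (S * e)" using R_mat_carrier[of "S - 1" J "u * h"] unfolding S1 e_def .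
  have cA: "A \<in> carrier_mat ((S + 1) * e) (2 * S * e)" unfolding A_def by (intro kron_carrier EF_carrier one_carrier_mat)
  have cB: "B \<in> carrier_mat (2 * S * e) (2 * S * e)" unfolding B_def by (rule emb13_carrier)
  have cC: "C \<in> carrier_mat (2 * S * e) (2 * S * e)" unfolding C_def mult.assoc by (intro kron_carrier Rc one_carrier_mat)
  have cD: "D \<in> carrier_mat (2 * S * e) ((S + 1) * e)" unfolding D_def by (intro kron_carrier EF_carrier one_carrier_mat)
  have "R_mat h S J u = A * B * C * D"
    unfolding A_def B_def C_def D_def e_def by (subst (1) S', subst R_mat.simps(3), simp only: p)
  also have "\<dots> = A * (B * (C * D))"
    by (simp only: assoc_mult_mat[OF mult_carrier_mat[OF cA cB] cC cD] assoc_mult_mat[OF cA cB mult_carrier_mat[OF cC cD]])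
  finally have R: "R_mat h S J u = A * (B * (C * D))" .
  have kl: "k < e" "l < e" using assms by (simp_all add: e_def)
  have nl: "n * e + l < (S + 1) * e" "s * e + k < (S + 1) * e" using index_bound assms kl by blast+
  have "(C * D) $$ ((b * S + m) * e + k', n * e + l) = (\<Sum>p<S. R_mat h (S - 1) J (u * h) $$ (m * e + k', p * e + l) * E_mat h S $$ (b * S + p, n))"
    if "b < 2" "m < S" "k' < e" for b m k'
  proof -
    have bm: "b * S + m < 2 * S" "(b * S + m) * e + k' < 2 * S * e" using index_bound that by auto
    have "(C * D) $$ ((b * S + m) * e + k', n * e + l) = (\<Sum>c<2*S. \<Sum>z<e. C $$ ((b * S + m) * e + k', c * e + z) * D $$ (c * e + z, n * e + l))"
      by (rule mat_mult_index2[OF cC cD bm(2) nl(1)])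
    also have "\<dots> = (\<Sum>b'<2. \<Sum>p<S. \<Sum>z<e. C $$ ((b * S + m) * e + k', (b' * S + p) * e + z) * D $$ ((b' * S + p) * e + z, n * e + l))"
      unfolding sum_prod_index ..
    also have "\<dots> = (\<Sum>b'<2. \<Sum>p<S. \<Sum>z<e. if z = l then (if b' = b then R_mat h (S - 1) J (u * h) $$ (m * e + k', p * e + l) * E_mat h S $$ (b * S + p, n) else 0) else 0)"
    proof (intro sum.cong refl)
      fix b' p z :: nat assume "b' \<in> {..<2}" "p \<in> {..<S}" "z \<in> {..<e}"
      then have z: "b' < 2" "p < S" "z < e" "b' * S + p < 2 * S" using index_bound by auto
      have "D $$ ((b' * S + p) * e + z, n * e + l) = E_mat h S $$ (b' * S + p, n) * 1\<^sub>m e $$ (z, l)"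
        unfolding D_def by (rule kron_index2[OF EF_carrier(1) one_carrier_mat]) (use z kl assms in auto)
      moreover have "C $$ (b * (S * e) + (m * e + k'), b' * (S * e) + (p * e + z)) = 1\<^sub>m 2 $$ (b, b') * R_mat h (S - 1) J (u * h) $$ (m * e + k', p * e + z)"
        unfolding C_def by (rule kron_index2[OF one_carrier_mat Rc]) (use z that index_bound in auto)
      ultimately show "C $$ ((b * S + m) * e + k', (b' * S + p) * e + z) * D $$ ((b' * S + p) * e + z, n * e + l) =
        (if z = l then (if b' = b then R_mat h (S - 1) J (u * h) $$ (m * e + k', p * e + l) * E_mat h S $$ (b * S + p, n) else 0) else 0)"
        using z that kl by (auto simp: algebra_simps)
    qed
    also have "\<dots> = (\<Sum>b'<2. if b' = b then \<Sum>p<S. R_mat h (S - 1) J (u * h) $$ (m * e + k', p * e + l) * E_mat h S $$ (b * S + p, n) else 0)"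
      using kl by (intro sum.cong refl) simp
    finally show ?thesis using that by simp
  qed
  note CD = this
  have cCD: "C * D \<in> carrier_mat (2 * S * e) ((S + 1) * e)" using cC cD by (rule mult_carrier_mat)
  have "(B * (C * D)) $$ ((a * S + m) * e + k, n * e + l) = (\<Sum>b<2. \<Sum>k'<e. R_half h J (u * h powi (1 - int S)) $$ (a * e + k, b * e + k') * (C * D) $$ ((b * S + m) * e + k', n * e + l))"
    if "a < 2" "m < S" for a m
  proof -
    have bm: "(a * S + m) * e + k < 2 * S * e" using index_bound that kl by auto
    have "(B * (C * D)) $$ ((a * S + m) * e + k, n * e + l) = (\<Sum>c<2*S. \<Sum>z<e. B $$ ((a * S + m) * e + k, c * e + z) * (C * D) $$ (c * e + z, n * e + l))"
      by (rule mat_mult_index2[OF cB cCD bm nl(1)])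
    also have "\<dots> = (\<Sum>b<2. \<Sum>p<S. \<Sum>z<e. B $$ ((a * S + m) * e + k, (b * S + p) * e + z) * (C * D) $$ ((b * S + p) * e + z, n * e + l))"
      unfolding sum_prod_index ..
    also have "\<dots> = (\<Sum>b<2. \<Sum>p<S. if p = m then \<Sum>z<e. R_half h J (u * h powi (1 - int S)) $$ (a * e + k, b * e + z) * (C * D) $$ ((b * S + m) * e + z, n * e + l) else 0)"
      unfolding B_def by (intro sum.cong[OF refl]) (use that kl in \<open>auto simp: emb13_index2 intro!: sum.neutral\<close>)
    also have "\<dots> = (\<Sum>b<2. \<Sum>k'<e. R_half h J (u * h powi (1 - int S)) $$ (a * e + k, b * e + k') * (C * D) $$ ((b * S + m) * e + k', n * e + l))"
      using that by simp
    finally show ?thesis .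
  qed
  note BCD = this
  have cBCD: "B * (C * D) \<in> carrier_mat (2 * S * e) ((S + 1) * e)" using cB cCD by (rule mult_carrier_mat)
  have "R_mat h S J u $$ (s * e + k, n * e + l) = (\<Sum>c<2*S. \<Sum>z<e. A $$ (s * e + k, c * e + z) * (B * (C * D)) $$ (c * e + z, n * e + l))"
    unfolding R by (rule mat_mult_index2[OF cA cBCD nl(2,1)])
  also have "\<dots> = (\<Sum>c<2*S. \<Sum>z<e. if z = k then F_mat h S $$ (s, c) * (B * (C * D)) $$ (c * e + k, n * e + l) else 0)"
  proof (intro sum.cong refl)
    fix c z assume "c \<in> {..<2*S}" "z \<in> {..<e}"
    then have "A $$ (s * e + k, c * e + z) = F_mat h S $$ (s, c) * 1\<^sub>m e $$ (k, z)"
      unfolding A_def by (intro kron_index2[OF EF_carrier(2) one_carrier_mat]) (use kl assms in auto)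
    then show "A $$ (s * e + k, c * e + z) * (B * (C * D)) $$ (c * e + z, n * e + l) = (if z = k then F_mat h S $$ (s, c) * (B * (C * D)) $$ (c * e + k, n * e + l) else 0)"
      using kl \<open>z \<in> {..<e}\<close> by auto
  qed
  also have "\<dots> = (\<Sum>a<2. \<Sum>m<S. F_mat h S $$ (s, a * S + m) * (B * (C * D)) $$ ((a * S + m) * e + k, n * e + l))"
    using kl by (simp add: sum_prod_index)
  finally show ?thesis unfolding e_def[symmetric]
    by (simp add: BCD CD)
qed

lemma K_mat_rec:
  assumes "S \<ge> 2" "s < S + 1" "n < S + 1"
  shows "K_mat h \<beta> S u $$ (s, n) =
    (\<Sum>a<2. \<Sum>m<S. F_mat h S $$ (s, a * S + m) * (\<Sum>a1<2. K_half h \<beta> (u * h powi (1 - int S)) $$ (a, a1) *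
      (\<Sum>b<2. \<Sum>m1<S. R_half h (S - 1) (u * u * h powi (2 - int S)) $$ (a1 * S + m, b * S + m1) *
       (\<Sum>p<S. K_mat h \<beta> (S - 1) (u * h) $$ (m1, p) * E_mat h S $$ (b * S + p, n)))))"
proof -
  obtain S' where S': "S = Suc (Suc S')" by (rule that[of "S - 2"]) (use assms(1) in simp)
  define A where "A = kron (K_half h \<beta> (u * h powi (1 - int S))) (1\<^sub>m S)"
  define B where "B = R_half h (S - 1) (u * u * h powi (2 - int S))"
  define C where "C = kron (1\<^sub>m 2) (K_mat h \<beta> (S - 1) (u * h))"
 have p: "- int (S - 1) = 1 - int S" "- int (S' + 1) = 1 - int S" "- int S' = 2 - int S" "S' + 2 = S" "Suc S' = S - 1" "S' + 1 = S - 1" unfolding S' by simp_all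
  have S1: "S - 1 + 1 = S" using assms(1) by simp
  have Kc: "K_mat h \<beta> (S - 1) (u * h) \<in> carrier_mat S S" using K_mat_carrier[of \<beta> "S - 1" "u * h"] unfolding S1 .
  define Km where "Km = K_mat h \<beta> (S - 1) (u * h)"
  have cA: "A \<in> carrier_mat (2 * S) (2 * S)" unfolding A_def by (intro kron_carrier K_half_carrier one_carrier_mat)
  have cB: "B \<in> carrier_mat (2 * S) (2 * S)" unfolding B_def using R_half_carrier[of "S - 1"] unfolding S1 .
  have cC: "C \<in> carrier_mat (2 * S) (2 * S)" unfolding C_def by (intro kron_carrier Kc one_carrier_mat)
  note cE = EF_carrier(1)[of S] and cF = EF_carrier(2)[of S]
  have "K_mat h \<beta> S u = F_mat h S * A * B * C * E_mat h S"
    unfolding A_def B_def C_def power2_eq_square[symmetric] by (subst (1) S', subst K_mat.simps(3), simp only: p)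
  also have "\<dots> = F_mat h S * (A * (B * (C * E_mat h S)))"
    by (simp only: assoc_mult_mat[OF mult_carrier_mat[OF mult_carrier_mat[OF cF cA] cB] cC cE]
      assoc_mult_mat[OF mult_carrier_mat[OF cF cA] cB mult_carrier_mat[OF cC cE]]
      assoc_mult_mat[OF cF cA mult_carrier_mat[OF cB mult_carrier_mat[OF cC cE]]])
  finally have K: "K_mat h \<beta> S u = F_mat h S * (A * (B * (C * E_mat h S)))" .
  have cCE: "C * E_mat h S \<in> carrier_mat (2 * S) (S + 1)" using cC cE by (rule mult_carrier_mat)
  have cBCE: "B * (C * E_mat h S) \<in> carrier_mat (2 * S) (S + 1)" using cB cCE by (rule mult_carrier_mat)
  have cABCE: "A * (B * (C * E_mat h S)) \<in> carrier_mat (2 * S) (S + 1)" using cA cBCE by (rule mult_carrier_mat)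
  have CE: "(C * E_mat h S) $$ (b * S + m1, n) = (\<Sum>p<S. K_mat h \<beta> (S - 1) (u * h) $$ (m1, p) * E_mat h S $$ (b * S + p, n))"
    if "b < 2" "m1 < S" for b m1
  proof -
    have "(C * E_mat h S) $$ (b * S + m1, n) = (\<Sum>b'<2. \<Sum>p<S. C $$ (b * S + m1, b' * S + p) * E_mat h S $$ (b' * S + p, n))"
      by (rule mat_mult_index2[OF cC cE]) (use index_bound that assms in auto)
    also have "\<dots> = (\<Sum>b'<2. if b' = b then \<Sum>p<S. K_mat h \<beta> (S - 1) (u * h) $$ (m1, p) * E_mat h S $$ (b * S + p, n) else 0)"
      unfolding C_def Km_def[symmetric] by (intro sum.cong[OF refl]) (use that in \<open>auto simp: kron_index2[OF one_carrier_mat Kc[folded Km_def]]\<close>)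
    finally show ?thesis using that by simp
  qed
  have AX: "(A * X) $$ (a * S + m, n) = (\<Sum>a1<2. K_half h \<beta> (u * h powi (1 - int S)) $$ (a, a1) * X $$ (a1 * S + m, n))"
    if "a < 2" "m < S" "X \<in> carrier_mat (2 * S) (S + 1)" for a m X
  proof -
    have "(A * X) $$ (a * S + m, n) = (\<Sum>a1<2. \<Sum>m'<S. A $$ (a * S + m, a1 * S + m') * X $$ (a1 * S + m', n))"
      by (rule mat_mult_index2[OF cA that(3)]) (use index_bound that assms in auto)
    also have "\<dots> = (\<Sum>a1<2. \<Sum>m'<S. if m' = m then K_half h \<beta> (u * h powi (1 - int S)) $$ (a, a1) * X $$ (a1 * S + m, n) else 0)"
      unfolding A_def by (intro sum.cong[OF refl]) (use that in \<open>auto simp: kron_index2[OF K_half_carrier one_carrier_mat]\<close>)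
    finally show ?thesis using that by simp
  qed
  have BX: "(B * (C * E_mat h S)) $$ (a1 * S + m, n) = (\<Sum>b<2. \<Sum>m1<S. B $$ (a1 * S + m, b * S + m1) * (C * E_mat h S) $$ (b * S + m1, n))"
    if "a1 < 2" "m < S" for a1 m
    by (rule mat_mult_index2[OF cB cCE]) (use index_bound that assms in auto)
  have "K_mat h \<beta> S u $$ (s, n) = (\<Sum>a<2. \<Sum>m<S. F_mat h S $$ (s, a * S + m) * (A * (B * (C * E_mat h S))) $$ (a * S + m, n))"
    unfolding K by (rule mat_mult_index2[OF cF cABCE assms(2,3)])
  then show ?thesis unfolding B_def[symmetric] by (simp add: AX[OF _ _ cBCE] BX CE)
qed

lemma sum_by_weight:
  fixes Z :: "nat \<Rightarrow> nat \<Rightarrow> complex"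
  assumes "S \<ge> 2" "s < S + 1" "\<And>a. Z a S = 0"
  shows "(\<Sum>a<2. \<Sum>m<S. if a + m = s then (if a = 0 then wF S s else 1 - wF S s) * Z a m else 0)
    = wF S s * Z 0 s + (1 - wF S s) * Z 1 (s - 1)"
proof -
  have s2: "{..<2::nat} = {0, 1}" by auto
  have 0: "(\<Sum>m<S. if 0 + m = s then wF S s * Z 0 m else 0) = wF S s * Z 0 s"
    using assms by (cases "s = S") (auto simp: sum.delta)
  have 1: "(\<Sum>m<S. if 1 + m = s then (1 - wF S s) * Z 1 m else 0) = (1 - wF S s) * Z 1 (s - 1)"
  proof (cases s)
    case 0
    then show ?thesis by (simp add: wF_def)
  next
    case (Suc t)
    then have "(\<Sum>m<S. if 1 + m = s then (1 - wF S s) * Z 1 m else 0) = (\<Sum>m<S. if m = t then (1 - wF S s) * Z 1 t else 0)"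
      by (intro sum.cong refl) auto
    then show ?thesis using Suc assms(2) by simp
  qed
  have two: "(\<Sum>a<2. f a) = f 0 + f 1" for f :: "nat \<Rightarrow> complex" by (simp add: s2)
  show ?thesis unfolding two by (simp only: refl if_True one_neq_zero if_False 0 1)
qed

lemma fusedR_RG: "fusedR h RG wF"
proof
  show "h \<noteq> 0" by (rule h0)
  show "wF S 0 = 1" "wF S S = 0" if "S \<ge> 2" for S using that by (auto simp: wF_def)
  show "RG (Suc 0) J u a k a' k' = R1 h J u a k a' k'" if "J \<ge> 1" "a < 2" "a' < 2" "k < J + 1" "k' < J + 1" for J u a k a' k'
  proof -
    have g: "G J k \<noteq> 0" "G J k' \<noteq> 0" using that by (auto intro!: G0)
    have "G (Suc 0) a = 1" "G (Suc 0) a' = 1" using that by (auto simp: less_2_cases_iff)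
    then show ?thesis unfolding RG_def using R_half_index[OF that(1,2,3,4,5), of u] g by simp
  qed
  fix S J :: nat and u :: complex and s k n l :: nat assume S: "S \<ge> 2" and J: "J \<ge> 1" and i: "s < S + 1" "k < J + 1" "n < S + 1" "l < J + 1"
  define x where "x = u * h powi (1 - int S)"
  have g: "G S s \<noteq> 0" "G S n \<noteq> 0" "G J k \<noteq> 0" "G J l \<noteq> 0" using i by (auto intro!: G0)
  have g1: "G (S - 1) m \<noteq> 0" if "m < S" for m using that by (intro G0) simp
  have gJ: "G J m \<noteq> 0" if "m < J + 1" for m using that by (intro G0) simp
  have summand: "(G S s * G J k) / (G S n * G J l) * (F_mat h S $$ (s, a * S + m) * (\<Sum>b<2. \<Sum>k'<J+1. R_half h J x $$ (a * (J + 1) + k, b * (J + 1) + k') *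
       (\<Sum>p<S. R_mat h (S - 1) J (u * h) $$ (m * (J + 1) + k', p * (J + 1) + l) * E_mat h S $$ (b * S + p, n)))) =
     (if a + m = s then (if a = 0 then wF S s else 1 - wF S s) * ZR h RG S J u a m k n l else 0)"
    if am: "a < 2" "m < S" for a m
  proof (cases "a + m = s")
    case False
    then show ?thesis using F_mat_index[OF S am i(1)] by simp
  next
    case True
    define W where "W = (if a = 0 then wF S s else 1 - wF S s)"
    define c where "c = G J k * G (S - 1) m / (G S n * G J l)"
    have "c * (\<Sum>b<2. \<Sum>k'<J+1. R_half h J x $$ (a * (J + 1) + k, b * (J + 1) + k') *
       (\<Sum>p<S. R_mat h (S - 1) J (u * h) $$ (m * (J + 1) + k', p * (J + 1) + l) * E_mat h S $$ (b * S + p, n)))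
      = (\<Sum>b<2. \<Sum>k'<J+1. \<Sum>p<S. c * (R_half h J x $$ (a * (J + 1) + k, b * (J + 1) + k') *
         (R_mat h (S - 1) J (u * h) $$ (m * (J + 1) + k', p * (J + 1) + l) * E_mat h S $$ (b * S + p, n))))"
      by (simp only: sum_distrib_left)
    also have "\<dots> = (\<Sum>b<2. \<Sum>k'<J+1. \<Sum>p<S. if b + p = n then R1 h J x a k b k' * RG (S - 1) J (u * h) m k' p l else 0)"
    proof (intro sum.cong[OF refl])
      fix b k' p :: nat assume "b \<in> {..<2}" "k' \<in> {..<J+1}" "p \<in> {..<S}"
      then have b: "b < 2" "k' < J + 1" "p < S" by auto
      have nz: "G (S - 1) m \<noteq> 0" "G (S - 1) p \<noteq> 0" "G J k' \<noteq> 0" using am b g1 gJ by auto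
      have R: "R_mat h (S - 1) J (u * h) $$ (m * (J + 1) + k', p * (J + 1) + l) = RG (S - 1) J (u * h) m k' p l * ((G (S - 1) p * G J l) / (G (S - 1) m * G J k'))"
        unfolding RG_def using nz g by simp
      show "c * (R_half h J x $$ (a * (J + 1) + k, b * (J + 1) + k') *
         (R_mat h (S - 1) J (u * h) $$ (m * (J + 1) + k', p * (J + 1) + l) * E_mat h S $$ (b * S + p, n))) =
         (if b + p = n then R1 h J x a k b k' * RG (S - 1) J (u * h) m k' p l else 0)"
        unfolding R_half_index[OF J am(1) b(1) i(2) b(2)] R E_mat_index[OF b(1,3) i(3)] c_def
        using nz g by (simp add: field_simps)
    qed
    also have "\<dots> = (\<Sum>b<2. \<Sum>p<S. \<Sum>k'<J+1. if b + p = n then R1 h J x a k b k' * RG (S - 1) J (u * h) m k' p l else 0)"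
      by (rule sum.cong[OF refl], rule sum.swap)
    also have "\<dots> = ZR h RG S J u a m k n l"
      unfolding ZR_def x_def if_P[OF am(2)] by (intro sum.cong[OF refl]) simp
    finally have Z: "c * (\<Sum>b<2. \<Sum>k'<J+1. R_half h J x $$ (a * (J + 1) + k, b * (J + 1) + k') *
       (\<Sum>p<S. R_mat h (S - 1) J (u * h) $$ (m * (J + 1) + k', p * (J + 1) + l) * E_mat h S $$ (b * S + p, n))) = ZR h RG S J u a m k n l" .
    have c: "(G S s * G J k) / (G S n * G J l) * (W * (G (S - 1) m / G S s) * y) = W * (c * y)" for y
      unfolding c_def using g by (simp add: field_simps)
    show ?thesis
      unfolding F_mat_index[OF S am i(1)] if_P[OF True] W_def[symmetric] c Z ..
  qed
  have "RG S J u s k n l = (\<Sum>a<2. \<Sum>m<S. (G S s * G J k) / (G S n * G J l) * (F_mat h S $$ (s, a * S + m) * (\<Sum>b<2. \<Sum>k'<J+1. R_half h J x $$ (a * (J + 1) + k, b * (J + 1) + k') *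
       (\<Sum>p<S. R_mat h (S - 1) J (u * h) $$ (m * (J + 1) + k', p * (J + 1) + l) * E_mat h S $$ (b * S + p, n)))))"
    unfolding RG_def R_mat_rec[OF S i] x_def sum_distrib_left[of "G S s * G J k / (G S n * G J l)"] ..
  also have "\<dots> = (\<Sum>a<2. \<Sum>m<S. if a + m = s then (if a = 0 then wF S s else 1 - wF S s) * ZR h RG S J u a m k n l else 0)"
    by (intro sum.cong[OF refl] summand) auto
  also have "\<dots> = wF S s * ZR h RG S J u 0 s k n l + (1 - wF S s) * ZR h RG S J u 1 (s - 1) k n l"
    by (rule sum_by_weight[OF S i(1)]) (simp add: ZR_def)
  finally show "RG S J u s k n l = wF S s * ZR h RG S J u 0 s k n l + (1 - wF S s) * ZR h RG S J u 1 (s - 1) k n l" .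
qed

lemma K_half_index:
  assumes "a < 2" "b < 2"
  shows "K_half h (ep, em, kp, km) u $$ (a, b) = Kh h ep em kp km u a b"
proof -
  have c: "mat_of_rows_list 2 [[x, y], [z, t]] $$ (a, b) = (if a = 0 then if b = 0 then x else y else if b = 0 then z else t)" for x y z t :: complex
    using assms by (auto simp: mat_of_rows_list_def less_2_cases_iff)
  show ?thesis unfolding K_half_def prod.case c Kh_def cfun_def cf'_def by (cases "a = 0"; cases "b = 0"; simp only: if_True if_False simp_thms)
qed

lemma fusedK_KG: "fusedK h ep em kp km (KG (ep, em, kp, km)) wF"
proof
  let ?\<beta> = "(ep, em, kp, km)"
  let ?KG = "KG ?\<beta>"
  show "h \<noteq> 0" "lm \<noteq> 0" by (rule h0, rule lm0)
  show "wF S 0 = 1" "wF S S = 0" if "S \<ge> 2" for S using that by (auto simp: wF_def)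
  show "?KG (Suc 0) u a b = Kh h ep em kp km u a b" if "a < 2" "b < 2" for u a b
  proof -
    have "G (Suc 0) a = 1" "G (Suc 0) b = 1" using that by (auto simp: less_2_cases_iff)
    then show ?thesis unfolding KG_def by (simp add: K_half_index[OF that])
  qed
  fix S :: nat and u :: complex and s n :: nat assume S: "S \<ge> 2" and u: "u \<noteq> 0" and i: "s < S + 1" "n < S + 1"
  define x z where "x = u * h powi (1 - int S)" and "z = u * u * h powi (2 - int S)"
  have S1: "S - 1 \<ge> 1" "S - 1 + 1 = S" using S by auto
  have g: "G S s \<noteq> 0" "G S n \<noteq> 0" using i by (auto intro!: G0)
  have g1: "G (S - 1) m \<noteq> 0" if "m < S" for m using that by (intro G0) simp
  let ?T = "\<lambda>a m. (\<Sum>a1<2. K_half h ?\<beta> x $$ (a, a1) * (\<Sum>b<2. \<Sum>m1<S. R_half h (S - 1) z $$ (a1 * S + m, b * S + m1) *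
       (\<Sum>p<S. K_mat h ?\<beta> (S - 1) (u * h) $$ (m1, p) * E_mat h S $$ (b * S + p, n))))"
  have summand: "G S s / G S n * (F_mat h S $$ (s, a * S + m) * ?T a m) =
     (if a + m = s then (if a = 0 then wF S s else 1 - wF S s) * ZK h ?KG S u a m n else 0)"
    if am: "a < 2" "m < S" for a m
  proof (cases "a + m = s")
    case False
    then show ?thesis using F_mat_index[OF S am i(1)] by simp
  next
    case True
    define W where "W = (if a = 0 then wF S s else 1 - wF S s)"
    define c where "c = G (S - 1) m / G S n"
    have "c * ?T a m = (\<Sum>a1<2. \<Sum>b<2. \<Sum>m1<S. \<Sum>p<S. c * (K_half h ?\<beta> x $$ (a, a1) * (R_half h (S - 1) z $$ (a1 * S + m, b * S + m1) *
         (K_mat h ?\<beta> (S - 1) (u * h) $$ (m1, p) * E_mat h S $$ (b * S + p, n)))))"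
      by (simp only: sum_distrib_left)
    also have "\<dots> = (\<Sum>a1<2. \<Sum>b<2. \<Sum>m1<S. \<Sum>p<S. if b + p = n then ?KG 1 x a a1 * R1 h (S - 1) z a1 m b m1 * ?KG (S - 1) (u * h) m1 p else 0)"
    proof (intro sum.cong[OF refl])
      fix a1 b m1 p :: nat assume "a1 \<in> {..<2}" "b \<in> {..<2}" "m1 \<in> {..<S}" "p \<in> {..<S}"
      then have b: "a1 < 2" "b < 2" "m1 < S" "p < S" by auto
      have nz: "G (S - 1) m \<noteq> 0" "G (S - 1) p \<noteq> 0" "G (S - 1) m1 \<noteq> 0" using am b g1 by auto
      have "G (Suc 0) a = 1" "G (Suc 0) a1 = 1" using am b by (auto simp: less_2_cases_iff)
      then have K1: "K_half h ?\<beta> x $$ (a, a1) = ?KG 1 x a a1" by (simp add: KG_def)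
      have K: "K_mat h ?\<beta> (S - 1) (u * h) $$ (m1, p) = ?KG (S - 1) (u * h) m1 p * (G (S - 1) p / G (S - 1) m1)"
        unfolding KG_def using nz by simp
      have R: "R_half h (S - 1) z $$ (a1 * S + m, b * S + m1) = R1 h (S - 1) z a1 m b m1 * (G (S - 1) m1 / G (S - 1) m)"
        using R_half_index[of "S - 1" a1 b m m1 z] S1 am b unfolding S1(2) by simp
      show "c * (K_half h ?\<beta> x $$ (a, a1) * (R_half h (S - 1) z $$ (a1 * S + m, b * S + m1) *
         (K_mat h ?\<beta> (S - 1) (u * h) $$ (m1, p) * E_mat h S $$ (b * S + p, n)))) =
         (if b + p = n then ?KG 1 x a a1 * R1 h (S - 1) z a1 m b m1 * ?KG (S - 1) (u * h) m1 p else 0)"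
        unfolding K1 K R E_mat_index[OF b(2,4) i(2)] c_def
        using nz g by (simp add: field_simps)
    qed
    also have "\<dots> = (\<Sum>b<2. \<Sum>a1<2. \<Sum>m1<S. \<Sum>p<S. if b + p = n then ?KG 1 x a a1 * R1 h (S - 1) z a1 m b m1 * ?KG (S - 1) (u * h) m1 p else 0)"
      by (rule sum.swap)
    also have "\<dots> = (\<Sum>b<2. \<Sum>p<S. \<Sum>a1<2. \<Sum>m1<S. if b + p = n then ?KG 1 x a a1 * R1 h (S - 1) z a1 m b m1 * ?KG (S - 1) (u * h) m1 p else 0)"
      by (rule sum.cong[OF refl], rule sum_swap3)
    also have "\<dots> = ZK h ?KG S u a m n"
      unfolding ZK_def x_def z_def if_P[OF am(2)] by (intro sum.cong[OF refl]) simp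
    finally have Z: "c * ?T a m = ZK h ?KG S u a m n" .
    have c: "G S s / G S n * (W * (G (S - 1) m / G S s) * y) = W * (c * y)" for y
      unfolding c_def using g by (simp add: field_simps)
    show ?thesis
      unfolding F_mat_index[OF S am i(1)] if_P[OF True] W_def[symmetric] c Z ..
  qed
  have "?KG S u s n = (\<Sum>a<2. \<Sum>m<S. G S s / G S n * (F_mat h S $$ (s, a * S + m) * ?T a m))"
    unfolding KG_def K_mat_rec[OF S i] x_def z_def sum_distrib_left[of "G S s / G S n"] ..
  also have "\<dots> = (\<Sum>a<2. \<Sum>m<S. if a + m = s then (if a = 0 then wF S s else 1 - wF S s) * ZK h ?KG S u a m n else 0)"
    by (intro sum.cong[OF refl] summand) auto
  also have "\<dots> = wF S s * ZK h ?KG S u 0 s n + (1 - wF S s) * ZK h ?KG S u 1 (s - 1) n"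
    by (rule sum_by_weight[OF S i(1)]) (simp add: ZK_def)
  finally show "?KG S u s n = wF S s * ZK h ?KG S u 0 s n + (1 - wF S s) * ZK h ?KG S u 1 (s - 1) n" .
qed

end

section \<open>Operators on one site of the chain\<close>

locale spin_chain = generic h for h :: complex +
  fixes Js :: "nat \<Rightarrow> nat" and v :: "nat \<Rightarrow> complex" and N :: nat
  assumes Js1: "\<And>i. 1 \<le> i \<Longrightarrow> i \<le> N \<Longrightarrow> Js i \<ge> 1" and v0: "\<And>i. 1 \<le> i \<Longrightarrow> i \<le> N \<Longrightarrow> v i \<noteq> 0"
begin

abbreviation "d i \<equiv> Js i + 1"
abbreviation "D \<equiv> chain_dim Js"

lemma D_0 [simp]: "D 0 = 1" by (simp add: chain_dim_def)
lemma D_Suc: "D (Suc n) = d (Suc n) * D n"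
  by (simp add: chain_dim_def atLeastAtMostSuc_conv mult.commute)
lemma D_pos: "D n > 0" by (simp add: chain_dim_def prod_pos)
lemma D_step: "1 \<le> i \<Longrightarrow> D i = d i * D (i - 1)"
  using D_Suc[of "i - 1"] by simp
lemma D_split: "i \<le> n \<Longrightarrow> D n = (\<Prod>k\<in>{i<..n}. d k) * D i"
proof -
  assume i: "i \<le> n"
  have "{1..n} = {i<..n} \<union> {1..i}" "{i<..n} \<inter> {1..i} = {}" using i by auto
  then show ?thesis by (simp add: chain_dim_def prod.union_disjoint)
qed

definition sop :: "nat \<Rightarrow> complex mat \<Rightarrow> lop" where
  "sop i M = pm (D i) (kron M (1\<^sub>m (D (i - 1))))"

lemma sop_carrier: "1 \<le> i \<Longrightarrow> M \<in> carrier_mat (d i) (d i) \<Longrightarrow> kron M (1\<^sub>m (D (i - 1))) \<in> carrier_mat (D i) (D i)"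
  unfolding D_step by (rule kron_carrier) auto

lemma sop_mult:
  assumes "1 \<le> i" "A \<in> carrier_mat (d i) (d i)" "B \<in> carrier_mat (d i) (d i)"
  shows "sop i (A * B) = sop i A * sop i B"
proof -
  have "kron (A * B) (1\<^sub>m (D (i - 1))) = kron A (1\<^sub>m (D (i - 1))) * kron B (1\<^sub>m (D (i - 1)))"
    using kron_mult[OF assms(2,3) one_carrier_mat one_carrier_mat, of "D (i - 1)"] by simp
  then show ?thesis unfolding sop_def by (simp only: pm_mult[OF sop_carrier[OF assms(1,2)] sop_carrier[OF assms(1,3)] D_pos])
qed

lemma sop_add:
  assumes "1 \<le> i" "A \<in> carrier_mat (d i) (d i)" "B \<in> carrier_mat (d i) (d i)"
  shows "sop i (A + B) = sop i A + sop i B"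
  unfolding sop_def kron_add_left[OF assms(2,3) one_carrier_mat]
  by (rule pm_add[OF sop_carrier[OF assms(1,2)] sop_carrier[OF assms(1,3)] D_pos])

lemma sop_smult:
  assumes "1 \<le> i" "A \<in> carrier_mat (d i) (d i)"
  shows "sop i (a \<cdot>\<^sub>m A) = a *\<^sub>C sop i A"
  unfolding sop_def kron_smult_left[OF assms(2) one_carrier_mat]
  by (rule pm_smult[OF sop_carrier[OF assms] D_pos])

lemma sop_one: "1 \<le> i \<Longrightarrow> sop i (1\<^sub>m (d i)) = 1"
  unfolding sop_def kron_one_one D_step[symmetric] by (rule pm_one[OF D_pos])

text \<open>Operators of different sites act on different tensor factors. To compare them, the operator of the lower
  site is regarded as one on the longer chain by tensoring with identities on the left.\<close>

lemma sop_comm: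
  assumes "1 \<le> i" "i < j" "A \<in> carrier_mat (d i) (d i)" "B \<in> carrier_mat (d j) (d j)"
  shows "sop i A * sop j B = sop j B * sop i A"
proof -
  define m where "m = (\<Prod>k\<in>{i<..j - 1}. d k)"
  define A' where "A' = kron (1\<^sub>m m) (kron A (1\<^sub>m (D (i - 1))))"
  have m: "D (j - 1) = m * D i" "m > 0" using D_split[of i "j - 1"] assms(2) by (auto simp: m_def prod_pos)
  have A': "A' \<in> carrier_mat (D (j - 1)) (D (j - 1))"
    unfolding A'_def m(1) by (intro kron_carrier one_carrier_mat sop_carrier assms)
  have Dj: "D j = d j * D (j - 1)" using assms by (intro D_step) simp
  have "sop i A = pm (D (j - 1)) A'"
    unfolding sop_def A'_def m(1) by (rule pm_kron_one[symmetric, OF sop_carrier[OF assms(1,3)] D_pos m(2)])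
  also have "\<dots> = pm (D j) (kron (1\<^sub>m (d j)) A')"
    unfolding Dj by (rule pm_kron_one[symmetric, OF A' D_pos]) simp
  finally have a: "sop i A = pm (D j) (kron (1\<^sub>m (d j)) A')" .
  have c: "kron (1\<^sub>m (d j)) A' \<in> carrier_mat (D j) (D j)" "kron B (1\<^sub>m (D (j - 1))) \<in> carrier_mat (D j) (D j)"
    unfolding Dj by (intro kron_carrier one_carrier_mat A' assms)+
  have "kron (1\<^sub>m (d j)) A' * kron B (1\<^sub>m (D (j - 1))) = kron B (1\<^sub>m (D (j - 1))) * kron (1\<^sub>m (d j)) A'"
    using kron_mult[OF one_carrier_mat assms(4) A' one_carrier_mat] kron_mult[OF assms(4) one_carrier_mat one_carrier_mat A']
      A' assms(4) by simp
  then show ?thesis unfolding a unfolding sop_def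
    by (simp only: pm_mult[OF c D_pos, symmetric] pm_mult[OF c(2,1) D_pos, symmetric])
qed

text \<open>An operator on site \<open>i\<close>, given by its matrix in the gauge basis.\<close>

text \<open>The matrix on site \<open>i\<close> whose entries in the rescaled basis are \<open>f\<close>.\<close>

definition gm :: "nat \<Rightarrow> (nat \<Rightarrow> nat \<Rightarrow> complex) \<Rightarrow> complex mat" where
  "gm i f = mat (d i) (d i) (\<lambda>(s, n). G (Js i) n / G (Js i) s * f s n)"
definition phi :: "nat \<Rightarrow> (nat \<Rightarrow> nat \<Rightarrow> complex) \<Rightarrow> lop" where "phi i f = sop i (gm i f)"

lemma gm_carrier: "gm i f \<in> carrier_mat (d i) (d i)" by (simp add: gm_def)

lemma phi_cong: "(\<And>s n. s < d i \<Longrightarrow> n < d i \<Longrightarrow> f s n = g s n) \<Longrightarrow> phi i f = phi i g"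
proof -
  assume "\<And>s n. s < d i \<Longrightarrow> n < d i \<Longrightarrow> f s n = g s n"
  then have "gm i f = gm i g" unfolding gm_def by (intro cong_mat) auto
  then show ?thesis by (simp add: phi_def)
qed

lemma phi_mult: "1 \<le> i \<Longrightarrow> phi i f * phi i g = phi i (\<lambda>s n. \<Sum>m<d i. f s m * g m n)"
proof -
  assume i: "1 \<le> i"
  have "gm i f * gm i g = gm i (\<lambda>s n. \<Sum>m<d i. f s m * g m n)"
  proof (rule eq_matI)
    fix s n assume "s < dim_row (gm i (\<lambda>s n. \<Sum>m<d i. f s m * g m n))" "n < dim_col (gm i (\<lambda>s n. \<Sum>m<d i. f s m * g m n))"
    then have sn: "s < d i" "n < d i" by (auto simp: gm_def)
    have "(gm i f * gm i g) $$ (s, n) = (\<Sum>m<d i. (G (Js i) m / G (Js i) s * f s m) * (G (Js i) n / G (Js i) m * g m n))"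
      using sn by (simp add: gm_def scalar_prod_def atLeast0LessThan del: sum.lessThan_Suc)
    also have "\<dots> = (\<Sum>m<d i. G (Js i) n / G (Js i) s * (f s m * g m n))"
    proof (intro sum.cong refl)
      fix m assume "m \<in> {..<d i}"
      then have "G (Js i) m \<noteq> 0" by (intro G0) simp
      then show "(G (Js i) m / G (Js i) s * f s m) * (G (Js i) n / G (Js i) m * g m n) = G (Js i) n / G (Js i) s * (f s m * g m n)" by simp
    qed
    finally show "(gm i f * gm i g) $$ (s, n) = gm i (\<lambda>s n. \<Sum>m<d i. f s m * g m n) $$ (s, n)"
      using sn by (simp only: gm_def index_mat split sum_distrib_left)
  qed (auto simp: gm_def)
  then show ?thesis unfolding phi_def by (simp only: sop_mult[OF i gm_carrier gm_carrier, symmetric])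
qed

lemma phi_add: "1 \<le> i \<Longrightarrow> phi i f + phi i g = phi i (\<lambda>s n. f s n + g s n)"
proof -
  assume i: "1 \<le> i"
  have "gm i f + gm i g = gm i (\<lambda>s n. f s n + g s n)" by (rule eq_matI) (auto simp: gm_def distrib_left)
  then show ?thesis unfolding phi_def by (simp only: sop_add[OF i gm_carrier gm_carrier, symmetric])
qed

lemma phi_scC: "1 \<le> i \<Longrightarrow> a *\<^sub>C phi i f = phi i (\<lambda>s n. a * f s n)"
proof -
  assume i: "1 \<le> i"
  have "a \<cdot>\<^sub>m gm i f = gm i (\<lambda>s n. a * f s n)" by (rule eq_matI) (auto simp: gm_def)
  then show ?thesis unfolding phi_def by (simp only: sop_smult[OF i gm_carrier, symmetric])
qed

lemma phi_diff: "1 \<le> i \<Longrightarrow> phi i f - phi i g = phi i (\<lambda>s n. f s n - g s n)"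
proof -
  assume i: "1 \<le> i"
  have "phi i f - phi i g = phi i f + (-1) *\<^sub>C phi i g" by simp
  also have "\<dots> = phi i (\<lambda>s n. f s n + (-1) * g s n)" by (simp only: phi_scC[OF i] phi_add[OF i])
  finally show ?thesis by simp
qed

lemma phi_zero: "1 \<le> i \<Longrightarrow> phi i (\<lambda>s n. 0) = 0"
  using phi_scC[of i 0 "\<lambda>s n. 0"] by simp

lemma phi_sum: "1 \<le> i \<Longrightarrow> (\<Sum>x\<in>I. phi i (f x)) = phi i (\<lambda>s n. \<Sum>x\<in>I. f x s n)"
  by (induction I rule: infinite_finite_induct) (simp_all add: phi_zero phi_add)

lemma phi_one: "1 \<le> i \<Longrightarrow> phi i (\<lambda>s n. if s = n then 1 else 0) = 1"
proof -
  assume i: "1 \<le> i"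
  have "gm i (\<lambda>s n. if s = n then 1 else 0) = 1\<^sub>m (d i)" by (rule eq_matI) (auto simp: gm_def G0)
  then show ?thesis unfolding phi_def by (simp only: sop_one[OF i])
qed

lemma phi_comm: "1 \<le> i \<Longrightarrow> 1 \<le> j \<Longrightarrow> i \<noteq> j \<Longrightarrow> phi i f * phi j g = phi j g * phi i f"
proof -
  assume ij: "1 \<le> i" "1 \<le> j" "i \<noteq> j"
  consider "i < j" | "j < i" using ij by linarith
  then show ?thesis
  proof cases
    case 1
    show ?thesis unfolding phi_def by (rule sop_comm[OF ij(1) 1 gm_carrier gm_carrier])
  next
    case 2
    show ?thesis unfolding phi_def by (rule sop_comm[OF ij(2) 2 gm_carrier gm_carrier, symmetric])
  qed
qed

definition ko :: "nat \<Rightarrow> lop" where "ko i = phi i (\<lambda>s n. if s = n then h powi (int (Js i) - 2 * int s) else 0)"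
definition ki :: "nat \<Rightarrow> lop" where "ki i = phi i (\<lambda>s n. if s = n then h powi (2 * int s - int (Js i)) else 0)"
definition fo :: "nat \<Rightarrow> lop" where "fo i = phi i (\<lambda>s n. if s = Suc n then cf' (h powi (2 * int s)) else 0)"
definition eo :: "nat \<Rightarrow> lop" where "eo i = phi i (\<lambda>s n. if n = Suc s then cf' (h powi (2 * (int (Js i) - int s))) else 0)"
definition kp_of :: "nat \<Rightarrow> complex" where "kp_of i = h powi (2 * int (Js i) + 2) + h powi (- 2 * int (Js i) - 2)"

lemma phi_diag_left: "1 \<le> i \<Longrightarrow> phi i (\<lambda>s n. if s = n then x s else 0) * phi i f = phi i (\<lambda>s n. x s * f s n)"
  unfolding phi_mult
proof (rule phi_cong)
  fix s n assume "s < d i" "n < d i"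
  have "(\<Sum>m<d i. (if s = m then x s else 0) * f m n) = (\<Sum>m<d i. if s = m then x s * f s n else 0)"
    by (intro sum.cong refl) auto
  then show "(\<Sum>m<d i. (if s = m then x s else 0) * f m n) = x s * f s n" using \<open>s < d i\<close> by (simp add: sum.delta' del: sum.lessThan_Suc)
qed

lemma phi_diag_right: "1 \<le> i \<Longrightarrow> phi i f * phi i (\<lambda>s n. if s = n then x s else 0) = phi i (\<lambda>s n. f s n * x n)"
  unfolding phi_mult
proof (rule phi_cong)
  fix s n assume "s < d i" "n < d i"
  have "(\<Sum>m<d i. f s m * (if m = n then x m else 0)) = (\<Sum>m<d i. if m = n then f s n * x n else 0)"
    by (intro sum.cong refl) auto
  then show "(\<Sum>m<d i. f s m * (if m = n then x m else 0)) = f s n * x n" using \<open>n < d i\<close> by (simp add: sum.delta del: sum.lessThan_Suc)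
qed

lemma powi_add2: "h powi a * h powi b = h powi (a + b)"
  using h0 by (simp add: power_int_add)
lemma inv_powi: "inverse (h powi a) = h powi (- a)" by (simp add: power_int_minus)
lemma hh_powi: "h * h = h powi 2" "inverse h * inverse h = h powi (-2)"
  by (simp_all add: power_int_minus power2_eq_square)
lemma qsite_i:
  assumes i: "1 \<le> i"
  shows "qsite h (inverse h) (kp_of i) (eo i) (fo i) (ko i) (ki i)"
proof
  let ?S = "int (Js i)"
  show "h * inverse h = 1" using h0 by simp
  show "ko i * ki i = 1" "ki i * ko i = 1"
    unfolding ko_def ki_def phi_diag_left[OF i] phi_one[OF i, symmetric]
    by (rule phi_cong; use powi_add2 in simp)+
  have sh: "h powi (?S - 2 * int s) = h powi 2 * h powi (?S - 2 * int (Suc s))"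
    "h powi (2 * int s - ?S) = h powi (-2) * h powi (2 * int (Suc s) - ?S)"
    "h powi (?S - 2 * int (Suc s)) = h powi (-2) * h powi (?S - 2 * int s)"
    "h powi (2 * int (Suc s) - ?S) = h powi 2 * h powi (2 * int s - ?S)" for s
    unfolding powi_add2 by (simp_all add: algebra_simps)
  have up: "x s * (if n = Suc s then X else 0) = c * ((if n = Suc s then X else 0) * x n)"
    if "x s = c * x (Suc s)" for x :: "nat \<Rightarrow> complex" and s n c X
    using that by (cases "n = Suc s") simp_all
  have dn: "x s * (if s = Suc n then X else 0) = c * ((if s = Suc n then X else 0) * x n)"
    if "x (Suc n) = c * x n" for x :: "nat \<Rightarrow> complex" and s n c X
    using that by (cases "s = Suc n") simp_all
  show "ko i * eo i = (h * h) *\<^sub>C (eo i * ko i)"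
    unfolding ko_def eo_def phi_diag_left[OF i] phi_diag_right[OF i] phi_scC[OF i] hh_powi
    by (rule phi_cong, rule up[of "\<lambda>s. h powi (?S - 2 * int s)"], rule sh)
  show "ki i * eo i = (inverse h * inverse h) *\<^sub>C (eo i * ki i)"
    unfolding ki_def eo_def phi_diag_left[OF i] phi_diag_right[OF i] phi_scC[OF i] hh_powi
    by (rule phi_cong, rule up[of "\<lambda>s. h powi (2 * int s - ?S)"], rule sh)
  show "ko i * fo i = (inverse h * inverse h) *\<^sub>C (fo i * ko i)"
    unfolding ko_def fo_def phi_diag_left[OF i] phi_diag_right[OF i] phi_scC[OF i] hh_powi
    by (rule phi_cong, rule dn[of "\<lambda>s. h powi (?S - 2 * int s)"], rule sh)
  show "ki i * fo i = (h * h) *\<^sub>C (fo i * ki i)"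
    unfolding ki_def fo_def phi_diag_left[OF i] phi_diag_right[OF i] phi_scC[OF i] hh_powi
    by (rule phi_cong, rule dn[of "\<lambda>s. h powi (2 * int s - ?S)"], rule sh)
  have ff: "fo i * eo i = phi i (\<lambda>s n. if s = n then cf' (h powi (2 * int s)) * cf' (h powi (2 * (?S - int s) + 2)) else 0)"
    unfolding fo_def eo_def phi_mult[OF i]
  proof (rule phi_cong)
    fix s n assume sn: "s < d i" "n < d i"
    show "(\<Sum>m<d i. (if s = Suc m then cf' (h powi (2 * int s)) else 0) * (if n = Suc m then cf' (h powi (2 * (?S - int m))) else 0)) =
      (if s = n then cf' (h powi (2 * int s)) * cf' (h powi (2 * (?S - int s) + 2)) else 0)"
    proof (cases s)
      case 0
      then show ?thesis by (simp add: cf'_def del: sum.lessThan_Suc)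
    next
      case (Suc t)
      have S1: "(\<Sum>m<d i. (if s = Suc m then cf' (h powi (2 * int s)) else 0) * (if n = Suc m then cf' (h powi (2 * (?S - int m))) else 0)) =
         (\<Sum>m<d i. if m = t then (if s = n then cf' (h powi (2 * int s)) * cf' (h powi (2 * (?S - int t))) else 0) else 0)"
        using Suc by (intro sum.cong refl) auto
      have "2 * (?S - int t) = 2 * (?S - int s) + 2" "t < d i" using Suc sn by simp_all
      then show ?thesis unfolding S1 by (simp only: sum.delta[OF finite_lessThan] lessThan_iff if_True)
    qed
  qed
  have ee: "eo i * fo i = phi i (\<lambda>s n. if s = n then cf' (h powi (2 * (?S - int s))) * cf' (h powi (2 * int s + 2)) else 0)"
    unfolding fo_def eo_def phi_mult[OF i]
  proof (rule phi_cong)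
    fix s n assume sn: "s < d i" "n < d i"
    have "(\<Sum>m<d i. (if m = Suc s then cf' (h powi (2 * (?S - int s))) else 0) * (if m = Suc n then cf' (h powi (2 * int m)) else 0)) =
       (\<Sum>m<d i. if m = Suc s then (if s = n then cf' (h powi (2 * (?S - int s))) * cf' (h powi (2 * int s + 2)) else 0) else 0)"
      by (intro sum.cong refl) (auto simp: algebra_simps)
    also have "\<dots> = (if s = n then cf' (h powi (2 * (?S - int s))) * cf' (h powi (2 * int s + 2)) else 0)"
    proof (cases "s = Js i")
      case True
      then show ?thesis by (simp add: cf'_def del: sum.lessThan_Suc)
    next
      case False
      then have "Suc s < d i" using sn by simp
      then show ?thesis by (simp del: sum.lessThan_Suc)
    qed
    finally show "(\<Sum>m<d i. (if m = Suc s then cf' (h powi (2 * (?S - int s))) else 0) * (if m = Suc n then cf' (h powi (2 * int m)) else 0)) =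
      (if s = n then cf' (h powi (2 * (?S - int s))) * cf' (h powi (2 * int s + 2)) else 0)" .
  qed
  have gen: "(p - p') * (r - r') = p * r + p' * r' - p * r' - p' * r" for p p' r r' :: complex
    by (simp add: algebra_simps)
  have cfcf: "cf' (h powi a) * cf' (h powi b) = h powi (a + b) + h powi (- a + - b) - h powi (a + - b) - h powi (- a + b)" for a b
    unfolding cf'_def inv_powi gen powi_add2 ..
  have fe: "cf' (h powi (2 * int s)) * cf' (h powi (2 * (?S - int s) + 2)) = kp_of i - h powi 2 * (h powi (?S - 2 * int s) * h powi (?S - 2 * int s))
     - h powi (-2) * (h powi (2 * int s - ?S) * h powi (2 * int s - ?S))" for s
  proof -
    have e: "2 * int s + (2 * (?S - int s) + 2) = 2 * ?S + 2" "- (2 * int s) + - (2 * (?S - int s) + 2) = - 2 * ?S - 2"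
      "2 * int s + - (2 * (?S - int s) + 2) = - 2 + ((2 * int s - ?S) + (2 * int s - ?S))"
      "- (2 * int s) + (2 * (?S - int s) + 2) = 2 + ((?S - 2 * int s) + (?S - 2 * int s))" by simp_all
    have "a + b - c - d = a + b - d - c" for a b c d :: complex by simp
    then show ?thesis unfolding cfcf powi_add2 e kp_of_def .
  qed
  show "fo i * eo i = kp_of i *\<^sub>C 1 - (h * h) *\<^sub>C (ko i * ko i) - (inverse h * inverse h) *\<^sub>C (ki i * ki i)"
    unfolding ff ko_def ki_def phi_diag_left[OF i] phi_one[OF i, symmetric] phi_scC[OF i] phi_diff[OF i] hh_powi
  proof (rule phi_cong)
    fix s n
    show "(if s = n then cf' (h powi (2 * int s)) * cf' (h powi (2 * (?S - int s) + 2)) else 0) =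
      kp_of i * (if s = n then 1 else 0) - h powi 2 * (h powi (?S - 2 * int s) * (if s = n then h powi (?S - 2 * int s) else 0))
      - h powi - 2 * (h powi (2 * int s - ?S) * (if s = n then h powi (2 * int s - ?S) else 0))"
      using fe[of s] by (cases "s = n") (simp_all only: simp_thms if_True if_False mult_1_right mult_zero_right diff_zero)
  qed
  have ef: "cf' (h powi (2 * (?S - int s))) * cf' (h powi (2 * int s + 2)) = kp_of i - h powi (-2) * (h powi (?S - 2 * int s) * h powi (?S - 2 * int s))
     - h powi 2 * (h powi (2 * int s - ?S) * h powi (2 * int s - ?S))" for s
  proof -
    have e: "2 * (?S - int s) + (2 * int s + 2) = 2 * ?S + 2" "- (2 * (?S - int s)) + - (2 * int s + 2) = - 2 * ?S - 2"
      "2 * (?S - int s) + - (2 * int s + 2) = - 2 + ((?S - 2 * int s) + (?S - 2 * int s))"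
      "- (2 * (?S - int s)) + (2 * int s + 2) = 2 + ((2 * int s - ?S) + (2 * int s - ?S))" by simp_all
    show ?thesis unfolding cfcf powi_add2 e kp_of_def ..
  qed
  show "eo i * fo i = kp_of i *\<^sub>C 1 - (inverse h * inverse h) *\<^sub>C (ko i * ko i) - (h * h) *\<^sub>C (ki i * ki i)"
    unfolding ee ko_def ki_def phi_diag_left[OF i] phi_one[OF i, symmetric] phi_scC[OF i] phi_diff[OF i] hh_powi
  proof (rule phi_cong)
    fix s n
    show "(if s = n then cf' (h powi (2 * (?S - int s))) * cf' (h powi (2 * int s + 2)) else 0) =
      kp_of i * (if s = n then 1 else 0) - h powi - 2 * (h powi (?S - 2 * int s) * (if s = n then h powi (?S - 2 * int s) else 0))
      - h powi 2 * (h powi (2 * int s - ?S) * (if s = n then h powi (2 * int s - ?S) else 0))"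
      using ef[of s] by (cases "s = n") (simp_all only: simp_thms if_True if_False mult_1_right mult_zero_right diff_zero)
  qed
qed

section \<open>The fused monodromy of one site\<close>

definition TT :: "nat \<Rightarrow> nat \<Rightarrow> complex \<Rightarrow> nat \<Rightarrow> nat \<Rightarrow> lop" where
  "TT i J u k l = phi i (\<lambda>s n. RG (Js i) J u s k n l)"

lemma TT_split:
  assumes i: "1 \<le> i" "i \<le> N" and J: "J \<ge> 2" and u: "u \<noteq> 0"
  shows "splits1 J (TT i J u) (TT i 1 (u * h powi (1 - int J))) (TT i (J - 1) (u * h))"
proof -
  interpret fusedR h RG wF by (rule fusedR_RG)
  let ?M1 = "RG (Js i) 1 (u * h powi (1 - int J))" and ?M2 = "RG (Js i) (J - 1) (u * h)"
  have sp: "splits (d i) J (RG (Js i) J u) ?M1 ?M2"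
    by (rule splitsI[of 0 1 2]) (use RG_beta[of "Js i" J 0 1 2 u] Js1[OF i] J u in auto)
  show ?thesis unfolding splits1_def
  proof (intro allI impI)
    fix b m l :: nat assume b: "b < 2" "m < J" "l < J + 1"
    have "TT i J u (b + m) l = phi i (\<lambda>s n. \<Sum>x<d i. \<Sum>b'<2. \<Sum>p<J. if b' + p = l then ?M1 s b x b' * ?M2 x m n p else 0)"
      unfolding TT_def by (rule phi_cong) (use sp b in \<open>unfold splits_def, blast\<close>)
    also have "\<dots> = phi i (\<lambda>s n. \<Sum>b'<2. \<Sum>p<J. if b' + p = l then \<Sum>x<d i. ?M1 s b x b' * ?M2 x m n p else 0)"
    proof (rule phi_cong)
      fix s n
      have "(\<Sum>x<d i. \<Sum>b'<2. \<Sum>p<J. if b' + p = l then ?M1 s b x b' * ?M2 x m n p else 0) =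
        (\<Sum>b'<2. \<Sum>p<J. \<Sum>x<d i. if b' + p = l then ?M1 s b x b' * ?M2 x m n p else 0)"
        by (rule sum_swap3[symmetric])
      also have "\<dots> = (\<Sum>b'<2. \<Sum>p<J. if b' + p = l then \<Sum>x<d i. ?M1 s b x b' * ?M2 x m n p else 0)"
        by (intro sum.cong[OF refl]) (simp del: sum.lessThan_Suc)
      finally show "(\<Sum>x<d i. \<Sum>b'<2. \<Sum>p<J. if b' + p = l then ?M1 s b x b' * ?M2 x m n p else 0) = \<dots>" .
    qed
    also have "\<dots> = (\<Sum>b'<2. \<Sum>p<J. phi i (\<lambda>s n. if b' + p = l then \<Sum>x<d i. ?M1 s b x b' * ?M2 x m n p else 0))"
      by (simp only: phi_sum[OF i(1), symmetric])
    also have "\<dots> = (\<Sum>b'<2. \<Sum>p<J. if b' + p = l then TT i 1 (u * h powi (1 - int J)) b b' * TT i (J - 1) (u * h) m p else 0)"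
      unfolding TT_def phi_mult[OF i(1)] by (intro sum.cong[OF refl]) (simp add: phi_zero[OF i(1)] del: sum.lessThan_Suc)
    finally show "TT i J u (b + m) l = (\<Sum>b'<2. \<Sum>p<J. if b' + p = l then TT i 1 (u * h powi (1 - int J)) b b' * TT i (J - 1) (u * h) m p else 0)" .
  qed
qed

lemma RG_one_entries:
  assumes "S \<ge> 1" "u \<noteq> 0" "s < S + 1" "n < S + 1" "a < 2" "b < 2"
  shows "RG S 1 u s a n b = R1 h S u a s b n"
proof -
  interpret fusedR h RG wF by (rule fusedR_RG)
  define \<psi> :: "complex state" where "\<psi> = (\<lambda>c. if c 0 = n \<and> c 1 = b then 1 else 0)"
  define c where "c = (\<lambda>_::nat. 0::nat)(0 := s, 1 := a)"
  have c: "c 0 = s" "c 1 = a" "c (Suc 0) = a" by (simp_all add: c_def)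
  have eq: "op2 0 (S + 1) 1 2 (RG S 1 u) \<psi> c = op2 1 2 0 (S + 1) (R1 h S u) \<psi> c"
    using RG_one[of S 0 1 u \<psi>] assms by simp
  have L: "op2 0 (S + 1) 1 2 (RG S 1 u) \<psi> c = (\<Sum>x<S+1. \<Sum>y<2. RG S 1 u s a x y * (if x = n \<and> y = b then 1 else 0))"
    unfolding op2_def using c assms by (simp add: \<psi>_def del: sum.lessThan_Suc)
  have R: "op2 1 2 0 (S + 1) (R1 h S u) \<psi> c = (\<Sum>y<2. \<Sum>x<S+1. R1 h S u a s y x * (if x = n \<and> y = b then 1 else 0))"
    unfolding op2_def using c assms by (simp add: \<psi>_def del: sum.lessThan_Suc)
  have del: "(\<Sum>x<S+1. \<Sum>y<2. Z x y * (if x = n \<and> y = b then 1 else 0)) = Z n b" for Z :: "nat \<Rightarrow> nat \<Rightarrow> complex"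
  proof -
    have "(\<Sum>y<2. Z x y * (if x = n \<and> y = b then 1 else 0)) = (if x = n then Z n b else 0)" for x
      using assms(6) by (cases "b = 0") (auto simp: numeral_2_eq_2 less_Suc_eq)
    then have "(\<Sum>x<S+1. \<Sum>y<2. Z x y * (if x = n \<and> y = b then 1 else 0)) = (\<Sum>x<S+1. if x = n then Z n b else 0)"
      by (simp only:)
    then show ?thesis using assms by (simp del: sum.lessThan_Suc)
  qed
  have "(\<Sum>y<2. \<Sum>x<S+1. R1 h S u a s y x * (if x = n \<and> y = b then 1 else 0)) = (\<Sum>x<S+1. \<Sum>y<2. R1 h S u a s y x * (if x = n \<and> y = b then 1 else 0))"
    by (rule sum.swap)
  then show ?thesis using eq unfolding L R by (simp only: del)
qed

lemma TT_one:
  assumes i: "1 \<le> i" "i \<le> N" and x: "x \<noteq> 0" and ab: "a < 2" "b < 2"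
  shows "TT i 1 x a b = pf h (Js i) x *\<^sub>C qsite.Lent h (inverse h) (eo i) (fo i) (ko i) (ki i) x (inverse x) a b"
proof -
  interpret q: qsite h "inverse h" "kp_of i" "eo i" "fo i" "ko i" "ki i" by (rule qsite_i[OF i(1)])
  have T: "TT i 1 x a b = phi i (\<lambda>s n. R1 h (Js i) x a s b n)"
    unfolding TT_def by (rule phi_cong) (rule RG_one_entries[OF Js1[OF i] x _ _ ab])
  have e': "h powi (1 - int (Js i) + 2 * int s) = h * h powi (2 * int s - int (Js i))"
    "inverse (h powi (2 * int s - int (Js i))) = h powi (int (Js i) - 2 * int s)" for s
  proof -
    have "1 - int (Js i) + 2 * int s = 1 + (2 * int s - int (Js i))" by simp
    then show "h powi (1 - int (Js i) + 2 * int s) = h * h powi (2 * int s - int (Js i))"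
      by (simp only: powi_add2[symmetric] power_int_1_right)
    show "inverse (h powi (2 * int s - int (Js i))) = h powi (int (Js i) - 2 * int s)" by (simp add: inv_powi)
  qed
  have e: "h powi (int (Js i) + 1 - 2 * int s) = h * h powi (int (Js i) - 2 * int s)"
    "inverse (h powi (int (Js i) - 2 * int s)) = h powi (2 * int s - int (Js i))" for s
  proof -
    have "int (Js i) + 1 - 2 * int s = 1 + (int (Js i) - 2 * int s)" by simp
    then show "h powi (int (Js i) + 1 - 2 * int s) = h * h powi (int (Js i) - 2 * int s)"
      by (simp only: powi_add2[symmetric] power_int_1_right)
    show "inverse (h powi (int (Js i) - 2 * int s)) = h powi (2 * int s - int (Js i))" by (simp add: inv_powi)
  qed
  consider "a = 0" "b = 0" | "a = 0" "b = 1" | "a = 1" "b = 0" | "a = 1" "b = 1" using ab by linarith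
  then show ?thesis
  proof cases
    case 1
    then show ?thesis unfolding T q.Lent_def unfolding ko_def ki_def
      by (simp only: simp_thms if_True phi_scC[OF i(1)] phi_diff[OF i(1)]) (rule phi_cong, simp add: R1_def cf'_def e, (auto simp: mult_ac)?)
  next
    case 2
    then show ?thesis unfolding T q.Lent_def unfolding fo_def
      by (simp add: phi_scC[OF i(1)]) (rule phi_cong, auto simp: R1_def)
  next
    case 3
    then show ?thesis unfolding T q.Lent_def unfolding eo_def
      by (simp add: phi_scC[OF i(1)]) (rule phi_cong, auto simp: R1_def)
  next
    case 4
    then show ?thesis unfolding T q.Lent_def unfolding ko_def ki_def
      by (simp only: simp_thms one_neq_zero if_True if_False phi_scC[OF i(1)] phi_diff[OF i(1)]) (rule phi_cong, simp add: R1_def cf'_def e', (auto simp: mult_ac)?)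
  qed
qed

lemma TT_RLL:
  fixes \<psi> :: "lop state"
  assumes i: "1 \<le> i" "i \<le> N" and xy: "x \<noteq> 0" "y \<noteq> 0" and jj: "j \<noteq> j'"
  shows "op1 j' 2 (TT i 1 x) (op2 j 2 j' 2 (R1 h 1 (x * y)) (op1 j 2 (TT i 1 y) \<psi>)) =
      op1 j 2 (TT i 1 y) (op2 j 2 j' 2 (R1 h 1 (x * y)) (op1 j' 2 (TT i 1 x) \<psi>))"
proof
  fix c :: "nat \<Rightarrow> nat"
  interpret q: qsite h "inverse h" "kp_of i" "eo i" "fo i" "ko i" "ki i" by (rule qsite_i[OF i(1)])
  define R where "R = R1 h 1 (x * y)"
  define X where "X = TT i 1 x"
  define Y where "Y = TT i 1 y"
  define s where "s = pf h (Js i) x * pf h (Js i) y"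
  have R6: "R a b a' b' = R6 h (inverse h) (x * y) (inverse x * inverse y) a b a' b'" if "a < 2" "b < 2" "a' < 2" "b' < 2" for a b a' b'
    using that h0 xy by (auto simp: R_def R1_def R6_def pf_def cf'_def less_2_cases_iff power2_eq_square mult_ac)
  have rll: "(\<Sum>b1<2. \<Sum>a2<2. R a b1 a2 b' *\<^sub>C (X b b1 * Y a2 a')) = (\<Sum>a1<2. \<Sum>b2<2. R a1 b a' b2 *\<^sub>C (Y a a1 * X b2 b'))"
    if "a < 2" "b < 2" "a' < 2" "b' < 2" for a b a' b'
  proof -
    have "(\<Sum>b1<2. \<Sum>a2<2. R a b1 a2 b' *\<^sub>C (X b b1 * Y a2 a')) = s *\<^sub>C (\<Sum>b1<2. \<Sum>a2<2. R6 h (inverse h) (x * y) (inverse x * inverse y) a b1 a2 b' *\<^sub>C (q.Lent x (inverse x) b b1 * q.Lent y (inverse y) a2 a'))"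
      unfolding scC_sum_right by (intro sum.cong[OF refl]) (use that in \<open>simp add: R6 X_def Y_def TT_one[OF i xy(1), simplified] TT_one[OF i xy(2), simplified] s_def mult_ac\<close>)
    also have "\<dots> = s *\<^sub>C (\<Sum>a1<2. \<Sum>b2<2. R6 h (inverse h) (x * y) (inverse x * inverse y) a1 b a' b2 *\<^sub>C (q.Lent y (inverse y) a a1 * q.Lent x (inverse x) b2 b'))"
      using q.RLL[of x "inverse x" y "inverse y" a b a' b'] that xy by simp
    also have "\<dots> = (\<Sum>a1<2. \<Sum>b2<2. R a1 b a' b2 *\<^sub>C (Y a a1 * X b2 b'))"
      unfolding scC_sum_right by (intro sum.cong[OF refl]) (use that in \<open>simp add: R6 X_def Y_def TT_one[OF i xy(1), simplified] TT_one[OF i xy(2), simplified] s_def mult_ac\<close>)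
    finally show ?thesis .
  qed
  show "op1 j' 2 (TT i 1 x) (op2 j 2 j' 2 (R1 h 1 (x * y)) (op1 j 2 (TT i 1 y) \<psi>)) c =
      op1 j 2 (TT i 1 y) (op2 j 2 j' 2 (R1 h 1 (x * y)) (op1 j' 2 (TT i 1 x) \<psi>)) c"
    unfolding X_def[symmetric] Y_def[symmetric] R_def[symmetric]
  proof (cases "c j < 2 \<and> c j' < 2")
    case True
    define a b where "a = c j" and "b = c j'"
    have ab: "a < 2" "b < 2" using True by (simp_all add: a_def b_def)
    define F where "F a' b' = \<psi> (c(j := a', j' := b'))" for a' b'
    have e: "c(j' := z, j := t, j' := b', j := a') = c(j := a', j' := b')" "c(j := z, j := t, j' := b', j' := a') = c(j := t, j' := a')"
       "c(j := z, j := a', j' := b', j' := y') = c(j := a', j' := y')" "c(j' := b', j := a') = c(j := a', j' := b')" for z t a' b' y'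
      using jj by (auto simp: fun_eq_iff)
    have s2: "(\<Sum>k<2. g k) = g 0 + g 1" for g :: "nat \<Rightarrow> lop" by (simp add: numeral_2_eq_2)
    have L: "op1 j' 2 X (op2 j 2 j' 2 R (op1 j 2 Y \<psi>)) c = (\<Sum>b1<2. X b b1 * (\<Sum>a2<2. \<Sum>b'<2. R a b1 a2 b' *\<^sub>C (\<Sum>a'<2. Y a2 a' * F a' b')))"
      using ab jj by (simp add: op1_def op2_def a_def b_def F_def e)
    have Rr: "op1 j 2 Y (op2 j 2 j' 2 R (op1 j' 2 X \<psi>)) c = (\<Sum>a1<2. Y a a1 * (\<Sum>a'<2. \<Sum>b2<2. R a1 b a' b2 *\<^sub>C (\<Sum>b'<2. X b2 b' * F a' b')))"
      using ab jj by (simp add: op1_def op2_def a_def b_def F_def e)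
    have "(\<Sum>b1<2. X b b1 * (\<Sum>a2<2. \<Sum>b'<2. R a b1 a2 b' *\<^sub>C (\<Sum>a'<2. Y a2 a' * F a' b'))) =
       (\<Sum>a'<2. \<Sum>b'<2. (\<Sum>b1<2. \<Sum>a2<2. R a b1 a2 b' *\<^sub>C (X b b1 * Y a2 a')) * F a' b')"
      unfolding s2 by (simp add: scC_add_right distrib_left distrib_right mult.assoc add_ac)
    also have "\<dots> = (\<Sum>a'<2. \<Sum>b'<2. (\<Sum>a1<2. \<Sum>b2<2. R a1 b a' b2 *\<^sub>C (Y a a1 * X b2 b')) * F a' b')"
      by (intro sum.cong[OF refl] arg_cong2[where f = "(*)"] rll) (use ab in auto)
    also have "\<dots> = (\<Sum>a1<2. Y a a1 * (\<Sum>a'<2. \<Sum>b2<2. R a1 b a' b2 *\<^sub>C (\<Sum>b'<2. X b2 b' * F a' b')))"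
      unfolding s2 by (simp add: scC_add_right distrib_left distrib_right mult.assoc add_ac)
    finally show "op1 j' 2 X (op2 j 2 j' 2 R (op1 j 2 Y \<psi>)) c = op1 j 2 Y (op2 j 2 j' 2 R (op1 j' 2 X \<psi>)) c"
      unfolding L Rr .
  next
    case False
    then show "op1 j' 2 X (op2 j 2 j' 2 R (op1 j 2 Y \<psi>)) c = op1 j 2 Y (op2 j 2 j' 2 R (op1 j' 2 X \<psi>)) c"
      using jj by (auto simp: op1_def op2_def)
  qed
qed

lemma siteT_TT:
  assumes i: "1 \<le> i" "i \<le> N" shows "siteT h (TT i)"
proof
  show "h \<noteq> 0" by (rule h0)
  show "splits1 J (TT i J u) (TT i 1 (u * h powi (1 - int J))) (TT i (J - 1) (u * h))" if "J \<ge> 2" "u \<noteq> 0" for J u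
    using that by (rule TT_split[OF i])
  show "op1 j' 2 (TT i 1 x) (op2 j 2 j' 2 (R1 h 1 (x * y)) (op1 j 2 (TT i 1 y) \<psi>)) =
      op1 j 2 (TT i 1 y) (op2 j 2 j' 2 (R1 h 1 (x * y)) (op1 j' 2 (TT i 1 x) \<psi>))"
    if "x \<noteq> 0" "y \<noteq> 0" "j \<noteq> j'" for x y j j' \<psi>
    using that by (rule TT_RLL[OF i])
qed

end

section \<open>The dressed K-matrix\<close>

definition ent :: "'r::calg m22 \<Rightarrow> nat \<Rightarrow> nat \<Rightarrow> 'r" where
  "ent M a b = (if a = 0 then if b = 0 then m11 M else m12 M else if b = 0 then m21 M else m22 M)"

lemma ent_mult: "a < 2 \<Longrightarrow> b < 2 \<Longrightarrow> ent (A * B) a b = mmul 2 (ent A) (ent B) a b"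
  by (cases A; cases B) (auto simp: ent_def mmul_def numeral_2_eq_2 less_Suc_eq)

lemma (in qsite) ent_L: "a < 2 \<Longrightarrow> b < 2 \<Longrightarrow> ent (L x xi) a b = Lent x xi a b"
  by (auto simp: ent_def L_def Lent_def less_2_cases_iff)

lemma mmul_scC:
  assumes "\<And>a b. a < d \<Longrightarrow> b < d \<Longrightarrow> A a b = p *\<^sub>C A' a b" "\<And>a b. a < d \<Longrightarrow> b < d \<Longrightarrow> B a b = q *\<^sub>C B' a b"
    and "a < d" "b < d"
  shows "mmul d A B a b = (p * q) *\<^sub>C mmul d A' B' a b"
  using assms by (simp add: mmul_def scC_sum_right mult.commute[of q p])

lemma cm_sum: "(\<And>m. m \<in> I \<Longrightarrow> cm x (g m)) \<Longrightarrow> cm x (sum g I)"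
  by (simp add: cm_def sum_distrib_left sum_distrib_right)

locale bchain = spin_chain h Js v N for h :: complex and Js v N +
  fixes ep em kp km :: complex
  assumes kpm: "kp \<noteq> 0" "km \<noteq> 0" and N1: "1 \<le> N"
begin

abbreviation "\<beta> \<equiv> (ep, em, kp, km)"

sublocale Q: qchain h v kp_of eo fo ko ki ep em kp km N
proof (rule qchain.intro)
  show "qsite h (inverse h) (kp_of i) (eo i) (fo i) (ko i) (ki i)" if "1 \<le> i" for i by (rule qsite_i[OF that])
  show "v i \<noteq> 0" if "1 \<le> i" "i \<le> N" for i by (rule v0[OF that])
  show "x * y = y * x" if ij: "1 \<le> i" "i < j" "x \<in> {eo i, fo i, ko i, ki i}" "y \<in> {eo j, fo j, ko j, ki j}" for i j x y
  proof -
    have j: "1 \<le> j" "i \<noteq> j" using ij by auto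
    obtain f g where "x = phi i f" "y = phi j g"
      using ij(3,4) unfolding eo_def fo_def ko_def ki_def by blast
    then show ?thesis by (simp only: phi_comm[OF ij(1) j])
  qed
  show "h \<noteq> 0" by (rule h0)
  show "(h * h) ^ n \<noteq> 1" if "n > 0" for n using nonroot[OF that] by (simp add: power2_eq_square)
qed (rule kpm)+

text \<open>The dressed K-matrix of auxiliary spin \<open>J/2\<close>, without normalising factors and in the rescaled basis.\<close>

primrec KC :: "nat \<Rightarrow> nat \<Rightarrow> complex \<Rightarrow> nat \<Rightarrow> nat \<Rightarrow> lop" where
  "KC 0 = (\<lambda>J u a b. KG \<beta> J u a b *\<^sub>C 1)"
| "KC (Suc n) = (\<lambda>J u. mmul (J + 1) (mmul (J + 1) (TT (Suc n) J (u * v (Suc n))) (KC n J u)) (TT (Suc n) J (u * inverse (v (Suc n)))))"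

lemma KC_comm: "n < i \<Longrightarrow> cm (phi i f) (KC n J u a b)"
proof (induction n arbitrary: a b)
  case 0
  then show ?case by (simp add: cm_def)
next
  case (Suc n)
  have T: "cm (phi i f) (TT (Suc n) J x k l)" for x k l
    unfolding TT_def cm_def by (rule phi_comm) (use Suc.prems in auto)
  show ?case unfolding KC.simps mmul_def
    by (intro cm_sum cm_intros(5) T Suc.IH) (use Suc.prems in simp)
qed

lemma FusK_KC: "n \<le> N \<Longrightarrow> FusK h (KC n)"
proof (induction n)
  case 0
  interpret fusedK h ep em kp km "KG \<beta>" wF by (rule fusedK_KG)
  show ?case unfolding KC.simps by (rule FusK_KG)
next
  case (Suc n)
  have i: "1 \<le> Suc n" by simp
  show ?case unfolding KC.simps
  proof (rule FusK_dress[OF siteT_TT[OF i Suc.prems]])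
    show "FusK h (KC n)" using Suc by simp
    show "v (Suc n) \<noteq> 0" by (rule v0[OF i Suc.prems])
    show "TT (Suc n) J u a b * KC n J' u' a' b' = KC n J' u' a' b' * TT (Suc n) J u a b" for J u J' u' a b a' b'
      unfolding TT_def using KC_comm[of n "Suc n"] unfolding cm_def by blast
  qed
qed

text \<open>For auxiliary spin one half the general construction differs from \<open>KK\<close> only by the scalar prefactors of
  the R-matrices. Their nonvanishing is recorded for the sake of the exact degree.\<close>

lemma KC_one:
  assumes "n \<le> N" "u \<noteq> 0"
  shows "\<exists>s. ((\<forall>i\<in>{1..n}. pf h (Js i) (u * v i) \<noteq> 0 \<and> pf h (Js i) (u * inverse (v i)) \<noteq> 0) \<longrightarrow> s \<noteq> 0) \<and>
    (\<forall>a<2. \<forall>b<2. KC n 1 u a b = s *\<^sub>C ent (Q.KK n u) a b)"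
  using assms(1)
proof (induction n)
  case 0
  interpret fusedK h ep em kp km "KG \<beta>" wF by (rule fusedK_KG)
  have k: "KG \<beta> 1 u a b = Kh h ep em kp km u a b" if "a < 2" "b < 2" for a b using KG1[OF that, of u] by simp
  have "KC 0 1 u a b = 1 *\<^sub>C ent (Q.KK 0 u) a b" if "a < 2" "b < 2" for a b
    unfolding KC.simps k[OF that] Kh_def Q.KK_def kmat_def Q.quad_defs Q.quad.simps ent_def
    by (auto simp: scC_add_left cf'_def power2_eq_square divide_inverse mult_ac)
  then show ?case by (intro exI[of _ 1]) simp
next
  case (Suc n)
  then obtain s where s: "(\<forall>i\<in>{1..n}. pf h (Js i) (u * v i) \<noteq> 0 \<and> pf h (Js i) (u * inverse (v i)) \<noteq> 0) \<longrightarrow> s \<noteq> 0"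
    and K: "\<And>a b. a < 2 \<Longrightarrow> b < 2 \<Longrightarrow> KC n 1 u a b = s *\<^sub>C ent (Q.KK n u) a b" by auto
  have i: "1 \<le> Suc n" by simp
  interpret q: qsite h "inverse h" "kp_of (Suc n)" "eo (Suc n)" "fo (Suc n)" "ko (Suc n)" "ki (Suc n)" by (rule qsite_i[OF i])
  let ?p = "pf h (Js (Suc n)) (u * v (Suc n))" and ?p' = "pf h (Js (Suc n)) (u * inverse (v (Suc n)))"
  have nz: "u * v (Suc n) \<noteq> 0" "u * inverse (v (Suc n)) \<noteq> 0" using assms(2) v0[OF i Suc.prems] by simp_all
  let ?L = "q.L (u * v (Suc n)) (inverse (u * v (Suc n)))" and ?L' = "q.L (u * inverse (v (Suc n))) (inverse (u * inverse (v (Suc n))))"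
  have T: "TT (Suc n) 1 (u * v (Suc n)) a b = ?p *\<^sub>C ent ?L a b"
    "TT (Suc n) 1 (u * inverse (v (Suc n))) a b = ?p' *\<^sub>C ent ?L' a b" if "a < 2" "b < 2" for a b
    unfolding q.ent_L[OF that] by (rule TT_one[OF i Suc.prems nz(1) that], rule TT_one[OF i Suc.prems nz(2) that])
  have two: "1 + 1 = (2::nat)" by simp
  have "KC (Suc n) 1 u a b = (?p * s * ?p') *\<^sub>C ent (Q.KK (Suc n) u) a b" if "a < 2" "b < 2" for a b
  proof -
    have "KC (Suc n) 1 u a b = (?p * s * ?p') *\<^sub>C mmul 2 (mmul 2 (ent ?L) (ent (Q.KK n u))) (ent ?L') a b"
      unfolding KC.simps two by (intro mmul_scC T K that)
    also have "mmul 2 (mmul 2 (ent ?L) (ent (Q.KK n u))) (ent ?L') a b = ent (?L * Q.KK n u * ?L') a b"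
      unfolding ent_mult[OF that] unfolding mmul_def[of 2 "ent (?L * Q.KK n u)"] mmul_def[of 2 "mmul 2 (ent ?L) (ent (Q.KK n u))"]
      by (intro sum.cong[OF refl]) (use that in \<open>simp add: ent_mult\<close>)
    finally show ?thesis unfolding Q.KK_Suc[OF Suc.prems assms(2)] .
  qed
  then show ?case using s by (intro exI[of _ "?p * s * ?p'"]) auto
qed

abbreviation "FW \<equiv> filt (Q.Wa N) (Q.Wb N)"

lemma KK_filt:
  assumes "u \<noteq> 0" shows "ent (Q.KK N u) a b \<in> FW (2 * N)"
proof -
  obtain rX rY rb rc where ex: "Q.expansion N rX rY rb rc" using Q.expansion_exists by blast
  note e = Q.entries_filt[OF order.refl ex N1]
  have "Q.Xf N U \<in> FW (2 * N)" "Q.Yf N U \<in> FW (2 * N)" for U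
    by (rule filt_mono[OF e(3)], simp, rule filt_mono[OF e(4)], simp)
  then show ?thesis unfolding Q.KK_def kmat_def ent_def by (auto intro!: filt.add filt.scC e(1,2))
qed

text \<open>The induction over the auxiliary spin that combines fusion with the degree bound for spin one half.\<close>

lemma KC_filt:
  assumes "J \<ge> 1" "u \<noteq> 0" "k < J + 1" "n < J + 1"
  shows "KC N J u k n \<in> FW (2 * N * J)"
  using assms
proof (induction J arbitrary: u k n)
  case 0 then show ?case by simp
next
  case (Suc J')
  have one: "KC N 1 u a b \<in> FW (2 * N)" if z: "u \<noteq> 0" "a < 2" "b < 2" for u a b
  proof -
    obtain s where "KC N 1 u a b = s *\<^sub>C ent (Q.KK N u) a b" using KC_one[OF order.refl z(1)] z(2,3) by blast
    then show ?thesis using KK_filt[OF z(1)] by (simp add: filt.scC)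
  qed
  show ?case
  proof (cases "J' = 0")
    case True
    then show ?thesis using one[of u k n] Suc.prems by simp
  next
    case False
    define J where "J = Suc J'"
    have J: "J \<ge> 2" "J - 1 = J'" "J' \<ge> 1" using False by (auto simp: J_def)
    have IH: "KC N (J - 1) (u * h) m1 m2 \<in> FW (2 * N * J')" if "m1 < J" "m2 < J" for m1 m2
      unfolding J(2) by (rule Suc.IH) (use that J h0 Suc.prems in \<open>auto simp: J_def\<close>)
    have i: "k < J + 1" "n < J + 1" "u * h powi (1 - int J) \<noteq> 0" using Suc.prems h0 by (simp_all add: J_def)
    obtain X where "KC N J u k n = (\<Sum>a1<2. KC N 1 (u * h powi (1 - int J)) (if k < J then 0 else 1) a1 * 
     (\<Sum>a2<2. \<Sum>m1<J. X a1 a2 m1 *\<^sub>C (\<Sum>m2<J. KC N (J - 1) (u * h) m1 m2 * (if a2 + m2 = n then 1 else 0))))"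
      using FusK_filt_step[OF FusK_KC[OF order.refl] J(1) Suc.prems(2) i(1,2)] by blast
    moreover have "\<dots> \<in> FW (2 * N * J)"
    proof (intro filt_sum)
      fix a1 :: nat assume "a1 \<in> {..<2}"
      then have 1: "KC N 1 (u * h powi (1 - int J)) (if k < J then 0 else 1) a1 \<in> FW (2 * N)"
        by (intro one i(3)) auto
      have 2: "(\<Sum>a2<2. \<Sum>m1<J. X a1 a2 m1 *\<^sub>C (\<Sum>m2<J. KC N (J - 1) (u * h) m1 m2 * (if a2 + m2 = n then 1 else 0))) \<in> FW (2 * N * J')"
        by (intro filt_sum filt.scC) (auto simp: filt_zero intro!: IH[unfolded One_nat_def])
      show "KC N 1 (u * h powi (1 - int J)) (if k < J then 0 else 1) a1 * (\<Sum>a2<2. \<Sum>m1<J. X a1 a2 m1 *\<^sub>C (\<Sum>m2<J. KC N (J - 1) (u * h) m1 m2 * (if a2 + m2 = n then 1 else 0))) \<in> FW (2 * N * J)"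
        by (rule filt_mult_le[OF 1 2]) (simp add: J_def)
    qed
    ultimately show ?thesis unfolding J_def[symmetric] by simp
  qed
qed

section \<open>The two operators\<close>

lemma sop_S:
  assumes "1 \<le> i"
  shows "sop i (S_plus h (Js i)) = inverse lm *\<^sub>C eo i" "sop i (S_minus h (Js i)) = inverse lm *\<^sub>C fo i"
    "sop i (pow_S3 h (Js i)) = ko i" "sop i (pow_S3 (inverse h) (Js i)) = ki i"
    "sop i (pow_S3 (h ^ 2) (Js i)) = ko i * ko i" "sop i (pow_S3 (inverse (h ^ 2)) (Js i)) = ki i * ki i"
proof -
  have g: "G (Js i) n \<noteq> 0" if "n < d i" for n using that by (intro G0) simp
  have il: "inverse lm * (lm * y) = y" for y
    by (simp only: mult.assoc[symmetric] left_inverse[OF lm0] mult_1)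
  have pw: "pow_S3 x (Js i) = gm i (\<lambda>s n. if s = n then x powi (int (Js i) - 2 * int s) else 0)" for x
    unfolding pow_S3_def gm_def mat1_def by (rule cong_mat) (auto simp: S3_eig_def g)
  have sp: "S_plus h (Js i) = gm i (\<lambda>s n. inverse lm * (if n = Suc s then cf' (h powi (2 * (int (Js i) - int s))) else 0))"
    unfolding S_plus_def gm_def mat1_def
  proof (rule cong_mat)
    fix s n assume sn: "s < Js i + 1" "n < Js i + 1"
    have "Bq (Js i) s = G (Js i) (Suc s) / G (Js i) s * (inverse lm * cf' (h powi (2 * (int (Js i) - int s))))" if "n = Suc s"
      unfolding cf_qn il using G_down[of s "Js i"] that sn g[of s] by (simp add: field_simps)
    then show "(case (s, n) of (i', j) \<Rightarrow> if j + 1 = i' + 1 + 1 then qB h (int (Js i)) (int (Js i) + 2 - 2 * int (i' + 1)) else 0) =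
       (case (s, n) of (s, n) \<Rightarrow> G (Js i) n / G (Js i) s * (inverse lm * (if n = Suc s then cf' (h powi (2 * (int (Js i) - int s))) else 0)))"
      by (auto simp: Bq_def)
  qed auto
  have sm: "S_minus h (Js i) = gm i (\<lambda>s n. inverse lm * (if s = Suc n then cf' (h powi (2 * int s)) else 0))"
    unfolding S_minus_def gm_def mat1_def
  proof (rule cong_mat)
    fix s n assume sn: "s < Js i + 1" "n < Js i + 1"
    have "Bq (Js i) n = G (Js i) n / G (Js i) (Suc n) * (inverse lm * cf' (h powi (2 * int (Suc n))))" if "s = Suc n"
      unfolding cf_qn il using G_up[of n "Js i"] that sn g[of s] by (simp add: field_simps)
    then show "(case (s, n) of (i', j) \<Rightarrow> if i' + 1 = j + 1 + 1 then qB h (int (Js i)) (int (Js i) + 2 - 2 * int (j + 1)) else 0) =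
       (case (s, n) of (s, n) \<Rightarrow> G (Js i) n / G (Js i) s * (inverse lm * (if s = Suc n then cf' (h powi (2 * int s)) else 0)))"
      by (auto simp: Bq_def)
  qed auto
  show "sop i (S_plus h (Js i)) = inverse lm *\<^sub>C eo i" unfolding sp phi_def[symmetric] eo_def phi_scC[OF assms] ..
  show "sop i (S_minus h (Js i)) = inverse lm *\<^sub>C fo i" unfolding sm phi_def[symmetric] fo_def phi_scC[OF assms] ..
  have x: "inverse h powi (int (Js i) - 2 * int s) = h powi (2 * int s - int (Js i))"
    "(h ^ 2) powi (int (Js i) - 2 * int s) = h powi (int (Js i) - 2 * int s) * h powi (int (Js i) - 2 * int s)"
    "inverse (h ^ 2) powi (int (Js i) - 2 * int s) = h powi (2 * int s - int (Js i)) * h powi (2 * int s - int (Js i))" for s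
  proof -
    have iv: "inverse y powi (int (Js i) - 2 * int s) = y powi (2 * int s - int (Js i))" for y :: complex
      by (simp add: power_int_inverse power_int_minus[symmetric])
    have sq: "(h ^ 2) powi y = h powi y * h powi y" for y
      by (simp add: power2_eq_square power_int_mult_distrib)
    show "inverse h powi (int (Js i) - 2 * int s) = h powi (2 * int s - int (Js i))"
      "(h ^ 2) powi (int (Js i) - 2 * int s) = h powi (int (Js i) - 2 * int s) * h powi (int (Js i) - 2 * int s)"
      "inverse (h ^ 2) powi (int (Js i) - 2 * int s) = h powi (2 * int s - int (Js i)) * h powi (2 * int s - int (Js i))"
      by (simp_all only: iv sq)
  qed
  show "sop i (pow_S3 h (Js i)) = ko i" unfolding pw phi_def[symmetric] ko_def ..
  show "sop i (pow_S3 (inverse h) (Js i)) = ki i" unfolding pw phi_def[symmetric] ki_def x ..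
  show "sop i (pow_S3 (h ^ 2) (Js i)) = ko i * ko i" "sop i (pow_S3 (inverse (h ^ 2)) (Js i)) = ki i * ki i"
    unfolding pw phi_def[symmetric] ko_def ki_def x phi_diag_left[OF assms] by (rule phi_cong, simp)+
qed

lemma pm_site_op:
  assumes "1 \<le> Suc n" "W \<in> carrier_mat (D n) (D n)" "A \<in> carrier_mat (d (Suc n)) (d (Suc n))" "B \<in> carrier_mat (d (Suc n)) (d (Suc n))"
     "P \<in> carrier_mat (d (Suc n)) (d (Suc n))" "P2 \<in> carrier_mat (d (Suc n)) (d (Suc n))"
  shows "kron (a \<cdot>\<^sub>m (A * P) + b \<cdot>\<^sub>m (B * P)) (1\<^sub>m (D n)) + kron P2 W \<in> carrier_mat (D (Suc n)) (D (Suc n))"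
    and "pm (D (Suc n)) (kron (a \<cdot>\<^sub>m (A * P) + b \<cdot>\<^sub>m (B * P)) (1\<^sub>m (D n)) + kron P2 W) = a *\<^sub>C (sop (Suc n) A * sop (Suc n) P) + b *\<^sub>C (sop (Suc n) B * sop (Suc n) P) + sop (Suc n) P2 * pm (D n) W"
proof -
  have AP: "A * P \<in> carrier_mat (d (Suc n)) (d (Suc n))" "B * P \<in> carrier_mat (d (Suc n)) (d (Suc n))"
    using assms by (auto intro: mult_carrier_mat)
  have S: "a \<cdot>\<^sub>m (A * P) + b \<cdot>\<^sub>m (B * P) \<in> carrier_mat (d (Suc n)) (d (Suc n))"
    using AP by (intro add_carrier_mat smult_carrier_mat)
  have n: "Suc n - 1 = n" by simp
  have c1: "kron (a \<cdot>\<^sub>m (A * P) + b \<cdot>\<^sub>m (B * P)) (1\<^sub>m (D n)) \<in> carrier_mat (D (Suc n)) (D (Suc n))"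
    unfolding D_Suc by (intro kron_carrier S one_carrier_mat)
  have c2: "kron P2 W \<in> carrier_mat (D (Suc n)) (D (Suc n))" unfolding D_Suc by (intro kron_carrier assms)
  have c3: "kron P2 (1\<^sub>m (D n)) \<in> carrier_mat (D (Suc n)) (D (Suc n))" "kron (1\<^sub>m (d (Suc n))) W \<in> carrier_mat (D (Suc n)) (D (Suc n))"
    unfolding D_Suc by (intro kron_carrier assms one_carrier_mat)+
  show "(kron (a \<cdot>\<^sub>m (A * P) + b \<cdot>\<^sub>m (B * P)) (1\<^sub>m (D n)) + kron P2 W) \<in> carrier_mat (D (Suc n)) (D (Suc n))" by (rule add_carrier_mat[OF c2])
  have k: "kron P2 W = kron P2 (1\<^sub>m (D n)) * kron (1\<^sub>m (d (Suc n))) W"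
    using kron_mult[OF assms(6) one_carrier_mat one_carrier_mat assms(2)] assms(2,6) by simp
  have "pm (D (Suc n)) (kron P2 W) = sop (Suc n) P2 * pm (D n) W"
    unfolding k pm_mult[OF c3 D_pos] sop_def n
    by (simp only: D_Suc[of n] pm_kron_one[OF assms(2) D_pos, of "d (Suc n)", simplified])
       (subst pm_kron_one[OF assms(2) D_pos], simp_all)
  moreover have "pm (D (Suc n)) (kron (a \<cdot>\<^sub>m (A * P) + b \<cdot>\<^sub>m (B * P)) (1\<^sub>m (D n))) =
     a *\<^sub>C (sop (Suc n) A * sop (Suc n) P) + b *\<^sub>C (sop (Suc n) B * sop (Suc n) P)"
  proof -
    have "pm (D (Suc n)) (kron (a \<cdot>\<^sub>m (A * P) + b \<cdot>\<^sub>m (B * P)) (1\<^sub>m (D n))) = sop (Suc n) (a \<cdot>\<^sub>m (A * P) + b \<cdot>\<^sub>m (B * P))"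
      unfolding sop_def n ..
    also have "\<dots> = a *\<^sub>C (sop (Suc n) A * sop (Suc n) P) + b *\<^sub>C (sop (Suc n) B * sop (Suc n) P)"
      using AP by (simp only: sop_add[OF assms(1) smult_carrier_mat smult_carrier_mat] sop_smult[OF assms(1)]
        sop_mult[OF assms(1,3,5)] sop_mult[OF assms(1,4,5)])
    finally show ?thesis .
  qed
  ultimately show "pm (D (Suc n)) (kron (a \<cdot>\<^sub>m (A * P) + b \<cdot>\<^sub>m (B * P)) (1\<^sub>m (D n)) + kron P2 W) = a *\<^sub>C (sop (Suc n) A * sop (Suc n) P) + b *\<^sub>C (sop (Suc n) B * sop (Suc n) P) + sop (Suc n) P2 * pm (D n) W"
    by (simp only: pm_add[OF c1 c2 D_pos])
qed

text \<open>The recursions for the two operators on the chain and in the abstract algebra agree site by site; the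
  factor \<open>1/(q - 1/q)\<close> undoes the scaling of the raising and lowering operators.\<close>

lemma W_op:
  "W0_op h Js v \<beta> n \<in> carrier_mat (D n) (D n) \<and> pm (D n) (W0_op h Js v \<beta> n) = Q.Wa n"
  "W1_op h Js v \<beta> n \<in> carrier_mat (D n) (D n) \<and> pm (D n) (W1_op h Js v \<beta> n) = Q.Wb n"
proof -
  have c: "S_plus h J \<in> carrier_mat (J + 1) (J + 1)" "S_minus h J \<in> carrier_mat (J + 1) (J + 1)" "pow_S3 x J \<in> carrier_mat (J + 1) (J + 1)" for J x
    by (simp_all add: S_plus_def S_minus_def pow_S3_def mat1_def)
  have lm: "Q.lam = lm" by (simp add: power2_eq_square)
  have i: "1 \<le> Suc n" for n :: nat by simp
  show "W0_op h Js v \<beta> n \<in> carrier_mat (D n) (D n) \<and> pm (D n) (W0_op h Js v \<beta> n) = Q.Wa n"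
  proof (induction n)
    case 0
    then show ?case by (simp add: pm_smult pm_one)
  next
    case (Suc n)
    note A = pm_site_op[OF i conjunct1[OF Suc.IH] c(1,2,3,3)]
    show ?case unfolding W0_op.simps prod.case
      by (intro conjI A(1)) (simp only: A(2) conjunct2[OF Suc.IH] sop_S[OF i] Q.Wa.simps lm scC_mult_left scC_scC scC_add_right mult.assoc mult.commute[of "inverse lm"])
  qed
  show "W1_op h Js v \<beta> n \<in> carrier_mat (D n) (D n) \<and> pm (D n) (W1_op h Js v \<beta> n) = Q.Wb n"
  proof (induction n)
    case 0
    then show ?case by (simp add: pm_smult pm_one)
  next
    case (Suc n)
    note A = pm_site_op[OF i conjunct1[OF Suc.IH] c(1,2,3,3)]
    show ?case unfolding W1_op.simps prod.case
      by (intro conjI A(1)) (simp only: A(2) conjunct2[OF Suc.IH] sop_S[OF i] Q.Wb.simps lm scC_mult_left scC_scC scC_add_right mult.assoc mult.commute[of "inverse lm"])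
  qed
qed

section \<open>The transfer matrix\<close>

lemma bk_R_site:
  assumes i: "1 \<le> i" "i \<le> N" and kl: "k < J + 1" "l < J + 1"
  shows "R_site h Js N J i u \<in> carrier_mat (D N * (J + 1)) (D N * (J + 1))"
    and "bk (D N) (J + 1) (R_site h Js N J i u) k l = (inverse (R_norm h (Js i) J u) * (G J l / G J k)) *\<^sub>C TT i J u k l"
proof -
  define m where "m = (\<Prod>k\<in>{i<..N}. Js k + 1)"
  have m: "m > 0" by (simp add: m_def prod_pos)
  have low: "(\<Prod>k\<in>{1..<i}. Js k + 1) = D (i - 1)"
    unfolding chain_dim_def by (rule prod.cong) (use i in auto)
  have Di: "D i = d i * D (i - 1)" by (rule D_step[OF i(1)])
  have DN: "D N = m * (d i * D (i - 1))" using D_split[OF i(2)] by (simp add: m_def Di)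
  have R: "R_site h Js N J i u = kron (1\<^sub>m m) (emb13 (d i) (D (i - 1)) (J + 1) (R_tilde h (Js i) J u))"
    unfolding R_site_def m_def[symmetric] low ..
  show "R_site h Js N J i u \<in> carrier_mat (D N * (J + 1)) (D N * (J + 1))"
  proof -
    have "R_site h Js N J i u \<in> carrier_mat (m * (d i * D (i - 1) * (J + 1))) (m * (d i * D (i - 1) * (J + 1)))"
      unfolding R by (intro kron_carrier one_carrier_mat emb13_carrier)
    moreover have "m * (d i * D (i - 1) * (J + 1)) = D N * (J + 1)" unfolding DN by (simp only: mult.assoc)
    ultimately show ?thesis by (simp only:)
  qed
  have b: "blk (d i) (J + 1) (R_tilde h (Js i) J u) k l = (inverse (R_norm h (Js i) J u) * (G J l / G J k)) \<cdot>\<^sub>m gm i (\<lambda>s n. RG (Js i) J u s k n l)"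
  proof (rule eq_matI)
    fix s n assume "s < dim_row ((inverse (R_norm h (Js i) J u) * (G J l / G J k)) \<cdot>\<^sub>m gm i (\<lambda>s n. RG (Js i) J u s k n l))"
      "n < dim_col ((inverse (R_norm h (Js i) J u) * (G J l / G J k)) \<cdot>\<^sub>m gm i (\<lambda>s n. RG (Js i) J u s k n l))"
    then have sn: "s < d i" "n < d i" by (auto simp: gm_def)
    have g: "G (Js i) s \<noteq> 0" "G (Js i) n \<noteq> 0" "G J k \<noteq> 0" "G J l \<noteq> 0" using sn kl by (auto intro!: G0)
    have bd: "s * (J + 1) + k < d i * (J + 1)" "n * (J + 1) + l < d i * (J + 1)"
      by (rule index_bound[OF sn(1) kl(1)], rule index_bound[OF sn(2) kl(2)])
    have "blk (d i) (J + 1) (R_tilde h (Js i) J u) k l $$ (s, n) = inverse (R_norm h (Js i) J u) * R_mat h (Js i) J u $$ (s * (J + 1) + k, n * (J + 1) + l)"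
      using sn bd R_mat_carrier[of "Js i" J u] unfolding blk_def R_tilde_def by (auto simp del: mult_Suc_right add_Suc_right)
    then show "blk (d i) (J + 1) (R_tilde h (Js i) J u) k l $$ (s, n) = ((inverse (R_norm h (Js i) J u) * (G J l / G J k)) \<cdot>\<^sub>m gm i (\<lambda>s n. RG (Js i) J u s k n l)) $$ (s, n)"
      using sn g by (simp add: gm_def RG_def)
  qed (auto simp: blk_def gm_def)
  have "bk (D N) (J + 1) (R_site h Js N J i u) k l = sop i (blk (d i) (J + 1) (R_tilde h (Js i) J u) k l)"
    unfolding R DN sop_def Di using kl by (intro bk_site m D_pos) auto
  also have "\<dots> = (inverse (R_norm h (Js i) J u) * (G J l / G J k)) *\<^sub>C TT i J u k l"
    unfolding b TT_def phi_def by (rule sop_smult[OF i(1) gm_carrier])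
  finally show "bk (D N) (J + 1) (R_site h Js N J i u) k l = (inverse (R_norm h (Js i) J u) * (G J l / G J k)) *\<^sub>C TT i J u k l" .
qed

lemma prod_mats_Cons: "prod_mats n (A # As) = A * prod_mats n As"
  by (simp add: prod_mats_def)
lemma prod_mats_carrier: "(\<And>A. A \<in> set As \<Longrightarrow> A \<in> carrier_mat n n) \<Longrightarrow> prod_mats n As \<in> carrier_mat n n"
  by (induction As) (auto simp: prod_mats_def intro: mult_carrier_mat)
lemma prod_mats_snoc:
  assumes "\<And>A. A \<in> set As \<Longrightarrow> A \<in> carrier_mat n n" "B \<in> carrier_mat n n"
  shows "prod_mats n (As @ [B]) = prod_mats n As * B"
  using assms(1)
proof (induction As)
  case Nil
  then show ?case using assms(2) by (simp add: prod_mats_def)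
next
  case (Cons A As)
  have c: "A \<in> carrier_mat n n" "prod_mats n As \<in> carrier_mat n n" using Cons.prems by (auto intro: prod_mats_carrier)
  show ?case using Cons by (simp add: prod_mats_Cons assoc_mult_mat[OF c assms(2)])
qed

lemma gauge_mmul:
  assumes "\<And>k l. k < dd \<Longrightarrow> l < dd \<Longrightarrow> X k l = (x * (g l / g k)) *\<^sub>C X' k l"
    "\<And>k l. k < dd \<Longrightarrow> l < dd \<Longrightarrow> Y k l = (y * (g l / g k)) *\<^sub>C Y' k l" "\<And>k. k < dd \<Longrightarrow> g k \<noteq> 0" "k < dd" "l < dd"
  shows "mmul dd X Y k l = ((x * y) * (g l / g k)) *\<^sub>C mmul dd X' Y' k l"
proof -
  have "mmul dd X Y k l = (\<Sum>m<dd. ((x * y) * (g l / g k)) *\<^sub>C (X' k m * Y' m l))"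
    unfolding mmul_def
  proof (rule sum.cong[OF refl])
    fix m assume "m \<in> {..<dd}"
    then have m: "m < dd" by simp
    have "(x * (g m / g k)) * (y * (g l / g m)) = (x * y) * (g l / g k)" using assms(3)[OF m] by simp
    moreover from this have "(y * (g l / g m)) * (x * (g m / g k)) = (x * y) * (g l / g k)" by (simp only: mult.commute)
    ultimately show "X k m * Y m l = ((x * y) * (g l / g k)) *\<^sub>C (X' k m * Y' m l)"
      using assms(1)[OF assms(4) m] assms(2)[OF m assms(5)] by (simp only: scC_mult_left scC_mult_right scC_scC)
  qed
  then show ?thesis by (simp add: mmul_def scC_sum_right)
qed

text \<open>Passing to blocks turns products of matrices on the whole space into products of matrices over the
  operators on the chain. The rescaling of the auxiliary basis cancels between neighbouring factors.\<close>

lemma transfer_KC: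
  assumes u: "u \<noteq> 0"
  shows "\<exists>s. (transfer_regular h Js v N J u \<longrightarrow> s \<noteq> 0) \<and>
    transfer_mat h Js v \<beta> \<beta>' N J u \<in> carrier_mat (D N) (D N) \<and>
    pm (D N) (transfer_mat h Js v \<beta> \<beta>' N J u) = (\<Sum>k<J+1. \<Sum>m<J+1. (K_tilde_plus h \<beta>' J u $$ (k, m) * (s * (G J k / G J m))) *\<^sub>C KC N J u m k)"
proof -
  define e where "e = J + 1"
  define M where "M = D N * e"
  define K where "K = kron (1\<^sub>m (D N)) (K_tilde h \<beta> J u)"
  define A where "A n = prod_mats M (map (\<lambda>i. R_site h Js N J i (u * v i)) (rev [1..<n + 1]))" for n
  define B where "B n = prod_mats M (map (\<lambda>i. R_site h Js N J i (u * inverse (v i))) [1..<n + 1])" for n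
  have R: "R_site h Js N J i x \<in> carrier_mat M M" if "1 \<le> i" "i \<le> N" for i x
    unfolding M_def e_def by (rule bk_R_site(1)[OF that, of 0 J 0]) auto
  have KT: "K_tilde h \<beta>'' J x \<in> carrier_mat e e" for \<beta>'' x unfolding K_tilde_def e_def by (intro smult_carrier_mat K_mat_carrier)
  have Kc: "K \<in> carrier_mat M M" unfolding K_def M_def by (intro kron_carrier one_carrier_mat KT)
  have AB: "A n \<in> carrier_mat M M" "B n \<in> carrier_mat M M" if "n \<le> N" for n
    unfolding A_def B_def by (rule prod_mats_carrier; use that in \<open>auto intro!: R\<close>)+
  have g: "G J k \<noteq> 0" if "k < e" for k using that unfolding e_def by (intro G0) simp
  have main: "\<exists>s. ((K_norm h J u \<noteq> 0 \<and> (\<forall>i\<in>{1..n}. R_norm h (Js i) J (u * v i) \<noteq> 0 \<and> R_norm h (Js i) J (u * inverse (v i)) \<noteq> 0)) \<longrightarrow> s \<noteq> 0) \<and>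
    (\<forall>k<e. \<forall>l<e. bk (D N) e (A n * (K * B n)) k l = (s * (G J l / G J k)) *\<^sub>C KC n J u k l)" if "n \<le> N" for n
    using that
  proof (induction n)
    case 0
    have AB0: "A 0 * (K * B 0) = K" using Kc unfolding A_def B_def by (simp add: prod_mats_def)
    have "bk (D N) e K k l = (inverse (K_norm h J u) * (G J l / G J k)) *\<^sub>C KC 0 J u k l" if kl: "k < e" "l < e" for k l
    proof -
      have "bk (D N) e K k l = K_tilde h \<beta> J u $$ (k, l) *\<^sub>C 1" unfolding K_def by (rule bk_kron_one[OF KT D_pos kl])
      moreover have "K_tilde h \<beta> J u $$ (k, l) = inverse (K_norm h J u) * (G J l / G J k) * KG \<beta> J u k l"
        using kl K_mat_carrier[of \<beta> J u] g unfolding K_tilde_def KG_def e_def by auto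
      ultimately show ?thesis by simp
    qed
    then show ?case unfolding AB0 by (intro exI[of _ "inverse (K_norm h J u)"]) simp
  next
    case (Suc n)
    then obtain s where s: "(K_norm h J u \<noteq> 0 \<and> (\<forall>i\<in>{1..n}. R_norm h (Js i) J (u * v i) \<noteq> 0 \<and> R_norm h (Js i) J (u * inverse (v i)) \<noteq> 0)) \<longrightarrow> s \<noteq> 0"
      and IH: "\<And>k l. k < e \<Longrightarrow> l < e \<Longrightarrow> bk (D N) e (A n * (K * B n)) k l = (s * (G J l / G J k)) *\<^sub>C KC n J u k l" by auto
    have i: "1 \<le> Suc n" by simp
    define P where "P = R_site h Js N J (Suc n) (u * v (Suc n))"
    define P' where "P' = R_site h Js N J (Suc n) (u * inverse (v (Suc n)))"
    have Pc: "P \<in> carrier_mat M M" "P' \<in> carrier_mat M M" unfolding P_def P'_def by (intro R i Suc.prems)+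
    have nN: "n \<le> N" using Suc.prems by simp
    note AB = AB[OF nN]
    have A: "A (Suc n) = P * A n" unfolding A_def P_def by (simp add: prod_mats_Cons)
    have B: "B (Suc n) = B n * P'"
    proof -
      have "[1..<Suc n + 1] = [1..<n + 1] @ [Suc n]" by simp
      then show ?thesis unfolding B_def P'_def by (simp only: map_append list.map) (rule prod_mats_snoc; use Suc.prems in \<open>auto intro!: R\<close>)
    qed
    have KB: "K * B n \<in> carrier_mat M M" "A n * (K * B n) \<in> carrier_mat M M" using AB Kc by (auto intro: mult_carrier_mat)
    have eq: "A (Suc n) * (K * B (Suc n)) = P * (A n * (K * B n)) * P'"
      unfolding A B by (simp only: assoc_mult_mat[OF Pc(1) KB(2) Pc(2)] assoc_mult_mat[OF AB(1) KB(1) Pc(2)]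
        assoc_mult_mat[OF Kc AB(2) Pc(2)] assoc_mult_mat[OF Pc(1) AB(1) mult_carrier_mat[OF Kc mult_carrier_mat[OF AB(2) Pc(2)]]])
    let ?r = "inverse (R_norm h (Js (Suc n)) J (u * v (Suc n)))" and ?r' = "inverse (R_norm h (Js (Suc n)) J (u * inverse (v (Suc n))))"
    have bP: "bk (D N) e P k l = (?r * (G J l / G J k)) *\<^sub>C TT (Suc n) J (u * v (Suc n)) k l"
      "bk (D N) e P' k l = (?r' * (G J l / G J k)) *\<^sub>C TT (Suc n) J (u * inverse (v (Suc n))) k l" if "k < e" "l < e" for k l
      using that unfolding P_def P'_def e_def by (intro bk_R_site(2)[OF i Suc.prems]; simp)+
    have "bk (D N) e (A (Suc n) * (K * B (Suc n))) k l = ((?r * s * ?r') * (G J l / G J k)) *\<^sub>C KC (Suc n) J u k l" if kl: "k < e" "l < e" for k l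
    proof -
      have c: "P * (A n * (K * B n)) \<in> carrier_mat (D N * e) (D N * e)" "P' \<in> carrier_mat (D N * e) (D N * e)"
        "P \<in> carrier_mat (D N * e) (D N * e)" "A n * (K * B n) \<in> carrier_mat (D N * e) (D N * e)"
        using Pc KB unfolding M_def by (auto intro: mult_carrier_mat)
      have step: "bk (D N) e (P * (A n * (K * B n))) k l = ((?r * s) * (G J l / G J k)) *\<^sub>C mmul e (TT (Suc n) J (u * v (Suc n))) (KC n J u) k l" if "k < e" "l < e" for k l
        unfolding bk_mult[OF c(3,4) D_pos that] by (rule gauge_mmul[OF bP(1) IH g that])
      show ?thesis unfolding eq bk_mult[OF c(1,2) D_pos kl] KC.simps e_def[symmetric]
        by (rule gauge_mmul[OF step bP(2) g kl])
    qed
    then show ?case using s by (intro exI[of _ "?r * s * ?r'"]) auto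
  qed
  obtain s where s: "(K_norm h J u \<noteq> 0 \<and> (\<forall>i\<in>{1..N}. R_norm h (Js i) J (u * v i) \<noteq> 0 \<and> R_norm h (Js i) J (u * inverse (v i)) \<noteq> 0)) \<longrightarrow> s \<noteq> 0"
    and bk: "\<And>k l. k < e \<Longrightarrow> l < e \<Longrightarrow> bk (D N) e (A N * (K * B N)) k l = (s * (G J l / G J k)) *\<^sub>C KC N J u k l" using main[OF order.refl] by auto
  define KP where "KP = kron (1\<^sub>m (D N)) (K_tilde_plus h \<beta>' J u)"
  have KPc: "K_tilde_plus h \<beta>' J u \<in> carrier_mat e e"
    unfolding K_tilde_plus_def by (cases \<beta>' rule: prod_cases4) (simp only: prod.case transpose_carrier_mat KT)
  have KP: "KP \<in> carrier_mat M M" unfolding KP_def M_def by (intro kron_carrier one_carrier_mat KPc)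
  note ABN = AB[OF order.refl]
  have KB: "K * B N \<in> carrier_mat M M" "A N * (K * B N) \<in> carrier_mat M M" using ABN Kc by (auto intro: mult_carrier_mat)
  have t: "transfer_mat h Js v \<beta> \<beta>' N J u = ptrace (D N) e (KP * (A N * (K * B N)))"
  proof -
    have "transfer_mat h Js v \<beta> \<beta>' N J u = ptrace (D N) e (KP * A N * K * B N)"
      unfolding transfer_mat_def KP_def A_def K_def B_def M_def e_def ..
    also have "KP * A N * K * B N = KP * (A N * (K * B N))"
      by (simp only: assoc_mult_mat[OF mult_carrier_mat[OF KP ABN(1)] Kc ABN(2)] assoc_mult_mat[OF KP ABN(1) KB(1)])
    finally show ?thesis .
  qed
  have "pm (D N) (transfer_mat h Js v \<beta> \<beta>' N J u) = (\<Sum>k<e. bk (D N) e (KP * (A N * (K * B N))) k k)"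
    unfolding t by (rule pm_ptrace[OF D_pos])
  also have "\<dots> = (\<Sum>k<e. \<Sum>m<e. (K_tilde_plus h \<beta>' J u $$ (k, m) * (s * (G J k / G J m))) *\<^sub>C KC N J u m k)"
  proof (rule sum.cong[OF refl])
    fix k assume "k \<in> {..<e}"
    then have k: "k < e" by simp
    have "bk (D N) e (KP * (A N * (K * B N))) k k = mmul e (bk (D N) e KP) (bk (D N) e (A N * (K * B N))) k k"
      by (rule bk_mult) (use KP KB k D_pos in \<open>simp_all add: M_def\<close>)
    also have "\<dots> = (\<Sum>m<e. (K_tilde_plus h \<beta>' J u $$ (k, m) * (s * (G J k / G J m))) *\<^sub>C KC N J u m k)"
      unfolding mmul_def
    proof (rule sum.cong[OF refl])
      fix m assume "m \<in> {..<e}"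
      then have m: "m < e" by simp
      show "bk (D N) e KP k m * bk (D N) e (A N * (K * B N)) m k = (K_tilde_plus h \<beta>' J u $$ (k, m) * (s * (G J k / G J m))) *\<^sub>C KC N J u m k"
        unfolding bk[OF m k] KP_def bk_kron_one[OF KPc D_pos k m] by (simp add: mult_ac)
    qed
    finally show "bk (D N) e (KP * (A N * (K * B N))) k k = (\<Sum>m<e. (K_tilde_plus h \<beta>' J u $$ (k, m) * (s * (G J k / G J m))) *\<^sub>C KC N J u m k)" .
  qed
  finally have "pm (D N) (transfer_mat h Js v \<beta> \<beta>' N J u) = \<dots>" .
  moreover have "transfer_mat h Js v \<beta> \<beta>' N J u \<in> carrier_mat (D N) (D N)" unfolding t by (simp add: ptrace_def)
  moreover have "transfer_regular h Js v N J u \<longrightarrow> s \<noteq> 0" using s by (simp add: transfer_regular_def)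
  ultimately show ?thesis unfolding e_def by blast
qed


lemma transfer_filt:
  assumes "J \<ge> 1" "u \<noteq> 0" shows "pm (D N) (transfer_mat h Js v \<beta> \<beta>' N J u) \<in> FW (2 * N * J)"
proof -
  obtain s where t: "pm (D N) (transfer_mat h Js v \<beta> \<beta>' N J u) =
      (\<Sum>k<J+1. \<Sum>m<J+1. (K_tilde_plus h \<beta>' J u $$ (k, m) * (s * (G J k / G J m))) *\<^sub>C KC N J u m k)"
    using transfer_KC[OF assms(2), of J \<beta>'] by blast
  show ?thesis unfolding t by (intro filt_sum filt.scC KC_filt assms) auto
qed

text \<open>The prefactor of the R-matrix is a partial product of its normalising factor.\<close>

lemma pf_nz: "R_norm h S 1 x \<noteq> 0 \<Longrightarrow> pf h S x \<noteq> 0"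
proof -
  assume R: "R_norm h S 1 x \<noteq> 0"
  have R': "(\<Prod>k<S. cfun (x * h powi (int S + 1 - 2 * int k))) \<noteq> 0" using R by (simp add: R_norm_def)
  have all: "cfun (x * h powi (int S + 1 - 2 * int k)) \<noteq> 0" if "k < S" for k
    using R' prod_zero[OF finite_lessThan bexI[of "\<lambda>k. cfun (x * h powi (int S + 1 - 2 * int k)) = 0" k "{..<S}"]] that by auto
  have "cf' (x * h powi (int S - 1 - 2 * int k)) \<noteq> 0" if "k < S - 1" for k
  proof -
    have "cfun (x * h powi (int S + 1 - 2 * int (Suc k))) \<noteq> 0"
      by (rule all) (use that in simp)
    moreover have "int S + 1 - 2 * int (Suc k) = int S - 1 - 2 * int k" by simp
    ultimately show ?thesis by (simp only: cfun_def cf'_def not_False_eq_True)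
  qed
  then show ?thesis by (simp add: pf_def)
qed

text \<open>For one site the off-diagonal entries have the form \<open>U c\<^sub>0 + c\<^sub>1\<close> with \<open>c\<^sub>0\<close> a scalar, so their
  part of degree two is a fixed \<open>q\<close>-commutator of the two operators.\<close>

lemma second_degree:
  defines "\<alpha> \<equiv> Q.q / (1 + Q.q ^ 2)"
  shows "Q.q ^ 2 + 1 \<noteq> 0"
    and "\<exists>s. Q.cf 1 U = (\<alpha> / kp) *\<^sub>C (Q.q *\<^sub>C (Q.Wa 1 * Q.Wb 1) - Q.qi *\<^sub>C (Q.Wb 1 * Q.Wa 1)) + s *\<^sub>C 1"
    and "\<exists>s. Q.bf 1 U = (\<alpha> / km) *\<^sub>C (Q.q *\<^sub>C (Q.Wb 1 * Q.Wa 1) - Q.qi *\<^sub>C (Q.Wa 1 * Q.Wb 1)) + s *\<^sub>C 1"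
proof -
  show qq: "Q.q ^ 2 + 1 \<noteq> 0"
  proof
    assume "Q.q ^ 2 + 1 = 0"
    then have "Q.q ^ 2 = -1" by (simp add: eq_neg_iff_add_eq_0)
    then have "(Q.q ^ 2) ^ 2 = 1" by simp
    then have "Q.q ^ 4 = 1" by (simp only: power_mult[symmetric]) simp
    then show False using Q.nonroot[of 4] by simp
  qed
  obtain rX rY rb rc where ex: "Q.expansion 1 rX rY rb rc" using Q.expansion_exists by blast
  note e = Q.exs[OF N1 ex]
  have U1: "UP_fps Q.q 1 r $ 1 = r 1" for r :: "nat \<Rightarrow> lop"
    using UP_fps_nth[of 1 1 Q.q r] by (simp add: coeff_P_pow)
  obtain s where s: "(1 + Q.q ^ 2) *\<^sub>C (kp *\<^sub>C rc 1) = Q.q ^ 1 *\<^sub>C (Q.q *\<^sub>C (Q.Wa 1 * Q.Wb 1) - Q.qi *\<^sub>C (Q.Wb 1 * Q.Wa 1)) + s *\<^sub>C 1"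
    "(1 + Q.q ^ 2) *\<^sub>C (km *\<^sub>C rb 1) = Q.q ^ 1 *\<^sub>C (Q.q *\<^sub>C (Q.Wb 1 * Q.Wa 1) - Q.qi *\<^sub>C (Q.Wa 1 * Q.Wb 1)) + s *\<^sub>C 1"
    using Q.first_coeffs[OF N1 ex] unfolding U1 by blast
  have solve: "\<exists>s'. z + y = (\<alpha> / k) *\<^sub>C x + s' *\<^sub>C 1"
    if "(1 + Q.q ^ 2) *\<^sub>C (k *\<^sub>C y) = Q.q ^ 1 *\<^sub>C x + s *\<^sub>C 1" "z = a *\<^sub>C 1" "k \<noteq> 0" for x y z :: lop and k s a :: complex
  proof -
    have q1: "1 + Q.q ^ 2 \<noteq> 0" using qq by (simp add: add.commute)
    have one: "inverse ((1 + Q.q ^ 2) * k) * ((1 + Q.q ^ 2) * k) = 1" by (rule left_inverse) (use q1 that(3) in simp)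
    have "y = inverse ((1 + Q.q ^ 2) * k) *\<^sub>C ((1 + Q.q ^ 2) *\<^sub>C (k *\<^sub>C y))"
      by (simp only: scC_scC mult.assoc one scC_one)
    also have "\<dots> = inverse ((1 + Q.q ^ 2) * k) *\<^sub>C (Q.q ^ 1 *\<^sub>C x + s *\<^sub>C 1)" by (simp only: that(1))
    also have "\<dots> = (\<alpha> / k) *\<^sub>C x + (inverse ((1 + Q.q ^ 2) * k) * s) *\<^sub>C 1"
      by (simp add: scC_add_right \<alpha>_def divide_inverse mult_ac)
    finally have "z + y = (\<alpha> / k) *\<^sub>C x + (a + inverse ((1 + Q.q ^ 2) * k) * s) *\<^sub>C 1"
      unfolding that(2) by (simp add: scC_add_left add_ac)
    then show ?thesis by blast
  qed
  have c: "Q.cf 1 U = (U * (km / Q.lam)) *\<^sub>C 1 + rc 1" "Q.bf 1 U = (U * (kp / Q.lam)) *\<^sub>C 1 + rb 1"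
    unfolding e(3,4)[of U] using e(5,6) by simp_all
  show "\<exists>s. Q.cf 1 U = (\<alpha> / kp) *\<^sub>C (Q.q *\<^sub>C (Q.Wa 1 * Q.Wb 1) - Q.qi *\<^sub>C (Q.Wb 1 * Q.Wa 1)) + s *\<^sub>C 1"
    unfolding c by (rule solve[OF s(1) refl kpm(1)])
  show "\<exists>s. Q.bf 1 U = (\<alpha> / km) *\<^sub>C (Q.q *\<^sub>C (Q.Wb 1 * Q.Wa 1) - Q.qi *\<^sub>C (Q.Wa 1 * Q.Wb 1)) + s *\<^sub>C 1"
    unfolding c by (rule solve[OF s(2) refl kpm(2)])
qed

text \<open>Only the off-diagonal entries contribute in degree two. If both coefficients vanished, the two
  numbers \<open>a\<close> and \<open>b\<close> would satisfy \<open>a q\<^sup>2 = b\<close> and \<open>b q\<^sup>2 = a\<close>, which forces \<open>q\<^sup>4 = 1\<close>.\<close>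

lemma transfer_two:
  assumes N: "N = 1" and reg: "transfer_regular h Js v N 1 u"
  shows "\<exists>c1 c2 y. pm (D N) (transfer_mat h Js v \<beta> (ep', em', kp', km') N 1 u) = c1 *\<^sub>C (Q.Wa N * Q.Wb N) + c2 *\<^sub>C (Q.Wb N * Q.Wa N) + y
    \<and> y \<in> FW 1 \<and> (kp' \<noteq> 0 \<and> u ^ 4 \<noteq> 1 \<and> (u * h ^ 2) ^ 4 \<noteq> 1 \<longrightarrow> c1 \<noteq> 0 \<or> c2 \<noteq> 0)"
proof -
  have u: "u \<noteq> 0" using reg by (simp add: transfer_regular_def)
  let ?T = "transfer_mat h Js v \<beta> (ep', em', kp', km') N 1 u"
  define KP where "KP = K_tilde_plus h (ep', em', kp', km') 1 u"
  obtain s where s: "s \<noteq> 0" and t: "pm (D N) ?T = (\<Sum>k<1+1. \<Sum>m<1+1. (KP $$ (k, m) * (s * (G 1 k / G 1 m))) *\<^sub>C KC N 1 u m k)"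
    using transfer_KC[OF u, of 1 "(ep', em', kp', km')"] reg unfolding KP_def by blast
  obtain s1 where s1: "(\<forall>i\<in>{1..N}. pf h (Js i) (u * v i) \<noteq> 0 \<and> pf h (Js i) (u * inverse (v i)) \<noteq> 0) \<longrightarrow> s1 \<noteq> 0"
    and K: "\<And>a b. a < 2 \<Longrightarrow> b < 2 \<Longrightarrow> KC N 1 u a b = s1 *\<^sub>C ent (Q.KK N u) a b"
    using KC_one[OF order.refl u] by blast
  have s10: "s1 \<noteq> 0" using s1 reg by (simp add: transfer_regular_def pf_nz)
  obtain rX rY rb rc where ex: "Q.expansion 1 rX rY rb rc" using Q.expansion_exists by blast
  have XY: "Q.Xf N U \<in> FW 1" "Q.Yf N U \<in> FW 1" for U
    using Q.entries_filt(3,4)[OF N1 ex, of U] unfolding N by simp_all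
  define z where "z = u * u - inverse u * inverse u"
  define \<alpha> where "\<alpha> = Q.q / (1 + Q.q ^ 2)"
  define A B where "A = Q.Wa N" and "B = Q.Wb N"
  obtain r r' where cb: "Q.cf N (Q.Uu u) = (\<alpha> / kp) *\<^sub>C (Q.q *\<^sub>C (A * B) - Q.qi *\<^sub>C (B * A)) + r *\<^sub>C 1"
    "Q.bf N (Q.Uu u) = (\<alpha> / km) *\<^sub>C (Q.q *\<^sub>C (B * A) - Q.qi *\<^sub>C (A * B)) + r' *\<^sub>C 1"
    using second_degree(2,3)[of "Q.Uu u"] unfolding N \<alpha>_def A_def B_def by blast
  define w where "w = s * s1"
  define a b where "a = w * z * (KP $$ (0, 1)) * (\<alpha> / kp)" and "b = w * z * (KP $$ (1, 0)) * (\<alpha> / km)"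
  define y where "y = (w * KP $$ (0, 0)) *\<^sub>C (u *\<^sub>C Q.Xf N (Q.Uu u) + inverse u *\<^sub>C Q.Yf N (Q.Uu u))
     + (w * KP $$ (1, 1)) *\<^sub>C (inverse u *\<^sub>C Q.Xf N (Q.Uu u) + u *\<^sub>C Q.Yf N (Q.Uu u))
     + (w * z * KP $$ (0, 1) * r + w * z * KP $$ (1, 0) * r') *\<^sub>C 1"
  have s2: "(\<Sum>k<1+1. g k) = g 0 + g 1" for g :: "nat \<Rightarrow> lop" by simp
  have G1: "G 1 0 = 1" "G 1 1 = 1" by simp_all
  have lt: "0 < (2::nat)" "1 < (2::nat)" by simp_all
  have en: "ent (Q.KK N u) 0 0 = u *\<^sub>C Q.Xf N (Q.Uu u) + inverse u *\<^sub>C Q.Yf N (Q.Uu u)"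
    "ent (Q.KK N u) 0 1 = z *\<^sub>C Q.bf N (Q.Uu u)" "ent (Q.KK N u) 1 0 = z *\<^sub>C Q.cf N (Q.Uu u)"
    "ent (Q.KK N u) 1 1 = inverse u *\<^sub>C Q.Xf N (Q.Uu u) + u *\<^sub>C Q.Yf N (Q.Uu u)"
    by (simp_all add: ent_def Q.KK_def kmat_def z_def)
  have "pm (D N) ?T = (KP $$ (0, 0) * s) *\<^sub>C KC N 1 u 0 0 + (KP $$ (0, 1) * s) *\<^sub>C KC N 1 u 1 0
      + ((KP $$ (1, 0) * s) *\<^sub>C KC N 1 u 0 1 + (KP $$ (1, 1) * s) *\<^sub>C KC N 1 u 1 1)"
    unfolding t s2 G1 by (simp only: div_by_1 mult_1_right)
  also have "\<dots> = (a * Q.q - b * Q.qi) *\<^sub>C (A * B) + (b * Q.q - a * Q.qi) *\<^sub>C (B * A) + y"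
    unfolding K[OF lt(1,1)] K[OF lt(1,2)] K[OF lt(2,1)] K[OF lt(2,2)] en cb y_def a_def b_def w_def
    by (simp add: scC_add_right scC_add_left scC_diff_right scC_diff_left mult_ac)
  finally have T: "pm (D N) ?T = (a * Q.q - b * Q.qi) *\<^sub>C (A * B) + (b * Q.q - a * Q.qi) *\<^sub>C (B * A) + y" .
  have y: "y \<in> FW 1" unfolding y_def by (intro filt.add filt.scC XY filt_one)
  have nz: "a * Q.q - b * Q.qi \<noteq> 0 \<or> b * Q.q - a * Q.qi \<noteq> 0" if *: "kp' \<noteq> 0" "u ^ 4 \<noteq> 1" "(u * h ^ 2) ^ 4 \<noteq> 1"
  proof -
    have sq: "x ^ 4 = 1" if "x * x - inverse x * inverse x = 0" "x \<noteq> 0" for x :: complex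
    proof -
      have "x ^ 4 = x * x * (x * x)" by (simp add: small_powers)
      also have "\<dots> = x * x * (inverse x * inverse x)" using that by simp
      also have "\<dots> = (x * inverse x) * (x * inverse x)" by (simp only: mult_ac)
      also have "\<dots> = 1" unfolding right_inverse[OF that(2)] by simp
      finally show ?thesis .
    qed
    have z0: "z \<noteq> 0" using sq[of u] u *(2) by (auto simp: z_def)
    define u' where "u' = inverse u * inverse (h ^ 2)"
    have u'0: "u' \<noteq> 0" using u h0 by (simp add: u'_def)
    have c0: "cf' (u' ^ 2) \<noteq> 0"
    proof
      assume "cf' (u' ^ 2) = 0"
      then have "u' ^ 4 = 1" by (intro sq u'0) (simp add: cf'_def power2_eq_square)
      moreover have "u * h ^ 2 = inverse u'" using u h0 by (simp add: u'_def)
      ultimately show False using *(3) by (simp add: power_inverse)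
    qed
    have K1: "K_half h (em', ep', - km', - kp') u' \<in> carrier_mat 2 2" by (rule K_half_carrier)
    have "KP $$ (0, 1) = K_half h (em', ep', - km', - kp') u' $$ (1, 0)"
      unfolding KP_def K_tilde_plus_def prod.case K_tilde_def K_norm_def u'_def[symmetric] using K1 by simp
    also have "\<dots> = - kp' * cf' (u' ^ 2) / lm" by (subst K_half_index) (simp_all add: Kh_def)
    finally have KP0: "KP $$ (0, 1) \<noteq> 0" using *(1) c0 lm0 by simp
    have a0: "a \<noteq> 0" unfolding a_def w_def \<alpha>_def using s s10 z0 KP0 second_degree(1) kpm h0 by (simp add: add.commute)
    show ?thesis
    proof (rule ccontr)
      assume "\<not> ?thesis"
      then have e: "a * Q.q = b * Q.qi" "b * Q.q = a * Q.qi" by simp_all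
      have "Q.q * Q.qi = (h * inverse h) * (h * inverse h)" by (simp only: mult_ac)
      then have hh: "Q.q * Q.qi = 1" unfolding right_inverse[OF h0] by simp
      have "a * Q.q ^ 4 = (a * Q.q) * (Q.q * Q.q * Q.q)" by (simp only: small_powers mult_ac)
      also have "\<dots> = (b * Q.q) * (Q.q * Q.qi) * Q.q" unfolding e(1) by (simp only: mult_ac)
      also have "\<dots> = (a * Q.qi) * Q.q" unfolding hh mult_1_right e(2) ..
      also have "\<dots> = a * (Q.q * Q.qi)" by (simp only: mult_ac)
      also have "\<dots> = a" unfolding hh by simp
      finally have "Q.q ^ 4 = 1" using a0 by simp
      then show False using Q.nonroot[of 4] by simp
    qed
  qed
  show ?thesis using T y nz unfolding A_def B_def by blast
qed

end

section \<open>From the filtration to noncommutative polynomials\<close>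

definition Wd :: "nat \<Rightarrow> nc_var list set" where "Wd m = {w. length w \<le> m}"

lemma finite_Wd: "finite (Wd m)"
proof -
  have "(UNIV :: nc_var set) \<subseteq> {X0, X1}" using nc_var.exhaust by blast
  then have "finite (UNIV :: nc_var set)" by (rule finite_subset) simp
  from finite_lists_length_le[OF this, of m] show ?thesis by (simp add: Wd_def)
qed

definition cs :: "'r::calg \<Rightarrow> 'r \<Rightarrow> nat \<Rightarrow> (nc_var list \<Rightarrow> complex) \<Rightarrow> 'r" where
  "cs A B m c = (\<Sum>w\<in>Wd m. c w *\<^sub>C wordv A B w)"
definition sg :: "nc_var list \<Rightarrow> complex \<Rightarrow> nc_var list \<Rightarrow> complex" where
  "sg w0 a w = (if w = w0 then a else 0)"

lemma cs_add: "cs A B m (\<lambda>w. c w + c' w) = cs A B m c + cs A B m c'"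
  by (simp add: cs_def scC_add_left sum.distrib)
lemma cs_scC: "cs A B m (\<lambda>w. a * c w) = a *\<^sub>C cs A B m c"
  by (simp add: cs_def scC_sum_right)
lemma cs_sg: "length w0 \<le> m \<Longrightarrow> cs A B m (sg w0 a) = a *\<^sub>C wordv A B w0"
proof -
  assume w: "length w0 \<le> m"
  have "cs A B m (sg w0 a) = (\<Sum>w\<in>Wd m. if w = w0 then a *\<^sub>C wordv A B w0 else 0)"
    unfolding cs_def sg_def by (rule sum.cong) auto
  then show ?thesis using w finite_Wd[of m] by (simp add: Wd_def)
qed

lemma filt_cs: "x \<in> filt A B m \<Longrightarrow> \<exists>c. x = cs A B m c"
proof (induction rule: filt.induct)
  case (word w)
  then show ?case using cs_sg[of w m A B 1] by (intro exI[of _ "sg w 1"]) simp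
next
  case (add x y)
  then obtain c c' where "x = cs A B m c" "y = cs A B m c'" by blast
  then show ?case by (intro exI[of _ "\<lambda>w. c w + c' w"]) (simp only: cs_add)
next
  case (scC x a)
  then obtain c where "x = cs A B m c" by blast
  then show ?case by (intro exI[of _ "\<lambda>w. a * c w"]) (simp only: cs_scC)
qed

lemma poly_exists:
  fixes A B :: "'r::calg"
  shows "\<exists>p :: nc_poly. (\<Sum>w\<in>Poly_Mapping.keys p. Poly_Mapping.lookup p w *\<^sub>C wordv A B w) = cs A B m c \<and>
    nc_degree p \<le> m \<and> ((\<exists>w. length w = m \<and> c w \<noteq> 0) \<longrightarrow> nc_degree p = m)"
proof -
  define f where "f w = (if length w \<le> m then c w else 0)" for w
  have "finite {w. f w \<noteq> 0}" by (rule finite_subset[OF _ finite_Wd[of m]]) (auto simp: Wd_def f_def)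
  then have p: "Poly_Mapping.lookup (Abs_poly_mapping f) = f" by (simp add: Abs_poly_mapping_inverse)
  define P where "P = Abs_poly_mapping f"
  have k: "w \<in> Poly_Mapping.keys P \<longleftrightarrow> f w \<noteq> 0" for w by (simp add: in_keys_iff P_def p)
  have sub: "Poly_Mapping.keys P \<subseteq> Wd m" by (auto simp: k f_def Wd_def split: if_splits)
  have "(\<Sum>w\<in>Poly_Mapping.keys P. Poly_Mapping.lookup P w *\<^sub>C wordv A B w) = (\<Sum>w\<in>Wd m. f w *\<^sub>C wordv A B w)"
    unfolding P_def p by (rule sum.mono_neutral_left[OF finite_Wd]) (use sub k in \<open>auto simp: P_def\<close>)
  also have "\<dots> = cs A B m c" unfolding cs_def by (rule sum.cong) (auto simp: f_def Wd_def)
  finally have e: "(\<Sum>w\<in>Poly_Mapping.keys P. Poly_Mapping.lookup P w *\<^sub>C wordv A B w) = cs A B m c" .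
  have le: "nc_degree P \<le> m" unfolding nc_degree_def using sub by (intro Max.boundedI) (auto simp: Wd_def)
  have "nc_degree P = m" if "length w = m" "c w \<noteq> 0" for w
  proof -
    have "w \<in> Poly_Mapping.keys P" using that by (simp add: k f_def)
    then have "m \<le> nc_degree P" unfolding nc_degree_def using that by (intro Max_ge) auto
    then show ?thesis using le by simp
  qed
  then show ?thesis using e le by blast
qed

text \<open>The Dolan-Grady relation, padded by powers of \<open>\<W>\<^sub>0\<close>, is a nonzero combination of words that
  evaluates to zero and contains a word of any prescribed length from four on.\<close>

lemma cs_relation:
  fixes A B :: "'r::calg"
  assumes m: "m \<ge> 4" and dg: "A * (A * (A * B)) = t *\<^sub>C (A * (A * (B * A))) - t *\<^sub>C (A * (B * (A * A)))
     + B * (A * (A * A)) + s *\<^sub>C (A * B) - s *\<^sub>C (B * A)"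
  shows "\<exists>r w. cs A B m r = 0 \<and> length w = m \<and> r w = 1"
proof -
  (* The padding on the right brings the four-letter words of the relation to length m. *)
  define sf where "sf = replicate (m - 4) X0"
  have l: "length sf = m - 4" by (simp add: sf_def)
  define S where "S = wordv A B sf"
  define r where "r = (\<lambda>w. sg (X0 # X0 # X0 # X1 # sf) 1 w + (sg (X0 # X0 # X1 # X0 # sf) (- t) w + (sg (X0 # X1 # X0 # X0 # sf) t w
     + (sg (X1 # X0 # X0 # X0 # sf) (-1) w + (sg (X0 # X1 # sf) (- s) w + sg (X1 # X0 # sf) s w)))))"
  have w: "wordv A B (X0 # ws) = A * wordv A B ws" "wordv A B (X1 # ws) = B * wordv A B ws" for ws by (simp_all add: wordv_def)
  have "cs A B m r = A * (A * (A * (B * S))) + (- (t *\<^sub>C (A * (A * (B * (A * S))))) + (t *\<^sub>C (A * (B * (A * (A * S))))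
     + (- (B * (A * (A * (A * S)))) + (- (s *\<^sub>C (A * (B * S))) + s *\<^sub>C (B * (A * S))))))"
    unfolding r_def cs_add using m l by (simp add: cs_sg w S_def)
  also have "A * (A * (A * (B * S))) = (A * (A * (A * B))) * S" by (simp only: mult.assoc)
  also have "(A * (A * (A * B))) * S = t *\<^sub>C (A * (A * (B * (A * S)))) - t *\<^sub>C (A * (B * (A * (A * S))))
     + B * (A * (A * (A * S))) + s *\<^sub>C (A * (B * S)) - s *\<^sub>C (B * (A * S))"
    unfolding dg by (simp add: distrib_right left_diff_distrib mult.assoc)
  finally have "cs A B m r = 0" by simp
  moreover have "length (X0 # X0 # X0 # X1 # sf) = m" using l m by simp
  moreover have "r (X0 # X0 # X0 # X1 # sf) = 1" unfolding r_def sg_def by simp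
  ultimately show ?thesis by blast
qed

context bchain begin

text \<open>If the polynomial found by the degree bound happens to lack the word of maximal length occurring in the
  relation of \<open>cs_relation\<close>, adding that relation supplies it.\<close>

lemma transfer_poly:
  assumes J: "J \<ge> 1" and reg: "transfer_regular h Js v N J u"
  shows "\<exists>p. transfer_mat h Js v \<beta> (ep', em', kp', km') N J u = nc_eval p (W0_op h Js v \<beta> N) (W1_op h Js v \<beta> N) \<and>
    nc_degree p \<le> 2 * N * J \<and>
    (N * J \<ge> 2 \<or> kp' \<noteq> 0 \<and> u ^ 4 \<noteq> 1 \<and> (u * h ^ 2) ^ 4 \<noteq> 1 \<longrightarrow> nc_degree p = 2 * N * J)"
proof -
  let ?T = "transfer_mat h Js v \<beta> (ep', em', kp', km') N J u"
  let ?g = "kp' \<noteq> 0 \<and> u ^ 4 \<noteq> 1 \<and> (u * h ^ 2) ^ 4 \<noteq> 1"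
  have u: "u \<noteq> 0" using reg by (simp add: transfer_regular_def)
  define A B where "A = Q.Wa N" and "B = Q.Wb N"
  have "\<exists>c. pm (D N) ?T = cs A B (2 * N * J) c \<and> (N * J \<ge> 2 \<or> ?g \<longrightarrow> (\<exists>w. length w = 2 * N * J \<and> c w \<noteq> 0))"
  proof (cases "N * J \<ge> 2")
    case True
    obtain c where c: "pm (D N) ?T = cs A B (2 * N * J) c"
      using filt_cs[OF transfer_filt[OF J u]] unfolding A_def B_def by blast
    obtain rX rY rb rc where ex: "Q.expansion N rX rY rb rc" using Q.expansion_exists by blast
    have m: "2 * N * J \<ge> 4" using True by (simp only: mult.assoc)
    obtain r w where r: "cs A B (2 * N * J) r = 0" "length w = 2 * N * J" "r w = 1"
      using Q.dolan_grady[OF order.refl ex] cs_relation[OF m] unfolding A_def B_def by blast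
    show ?thesis
    proof (cases "c w = 0")
      case True
      have "pm (D N) ?T = cs A B (2 * N * J) (\<lambda>w. c w + r w)" unfolding cs_add r(1) c by simp
      then show ?thesis using True r(2,3) by (intro exI[of _ "\<lambda>w. c w + r w"] conjI impI exI[of _ w]) auto
    next
      case False
      then show ?thesis using c r(2) by blast
    qed
  next
    case False
    moreover have "N * J \<ge> 1" using N1 J by simp
    ultimately have "N * J = 1" by linarith
    then have NJ: "N = 1" "J = 1" by simp_all
    obtain c1 c2 y where t: "pm (D N) ?T = c1 *\<^sub>C (A * B) + c2 *\<^sub>C (B * A) + y" and y: "y \<in> filt A B 1"
      and nz: "?g \<longrightarrow> c1 \<noteq> 0 \<or> c2 \<noteq> 0"
      using transfer_two[OF NJ(1) reg[unfolded NJ(2)]] unfolding A_def B_def NJ(2) by blast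
    obtain c where c: "y = cs A B 1 c" using filt_cs[OF y] by blast
    define c0 where "c0 w = (if length w \<le> 1 then c w else 0)" for w
    define c' where "c' = (\<lambda>w. sg [X0, X1] c1 w + (sg [X1, X0] c2 w + c0 w))"
    have "cs A B 2 c0 = y"
      unfolding c cs_def by (rule sum.mono_neutral_cong_right[OF finite_Wd]) (auto simp: Wd_def c0_def)
    then have "pm (D N) ?T = cs A B 2 c'"
      unfolding t c'_def cs_add by (simp add: cs_sg wordv_def add.assoc)
    moreover have "\<exists>w. length w = 2 \<and> c' w \<noteq> 0" if ?g
    proof -
      have "c' [X0, X1] = c1" "c' [X1, X0] = c2" by (simp_all add: c'_def sg_def c0_def)
      then show ?thesis using nz that by (metis length_Cons list.size(3) numeral_2_eq_2)
    qed
    ultimately show ?thesis using False unfolding NJ by (intro exI[of _ c']) simp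
  qed
  then obtain c where c: "pm (D N) ?T = cs A B (2 * N * J) c"
    and w: "N * J \<ge> 2 \<or> ?g \<longrightarrow> (\<exists>w. length w = 2 * N * J \<and> c w \<noteq> 0)" by blast
  obtain p :: nc_poly where p: "(\<Sum>w\<in>Poly_Mapping.keys p. Poly_Mapping.lookup p w *\<^sub>C wordv A B w) = cs A B (2 * N * J) c"
    "nc_degree p \<le> 2 * N * J" "(\<exists>w. length w = 2 * N * J \<and> c w \<noteq> 0) \<longrightarrow> nc_degree p = 2 * N * J"
    using poly_exists[of A B "2 * N * J" c] by blast
  note W = conjunct1[OF W_op(1)[of N]] conjunct1[OF W_op(2)[of N]]
  have "pm (D N) (nc_eval p (W0_op h Js v \<beta> N) (W1_op h Js v \<beta> N)) = pm (D N) ?T"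
    using p(1) unfolding nc_eval_pm(2)[OF W D_pos] conjunct2[OF W_op(1)[of N]] conjunct2[OF W_op(2)[of N]] c A_def B_def .
  moreover have "?T \<in> carrier_mat (D N) (D N)" using transfer_KC[OF u, of J "(ep', em', kp', km')"] by blast
  ultimately have "?T = nc_eval p (W0_op h Js v \<beta> N) (W1_op h Js v \<beta> N)"
    by (intro pm_inject[OF _ nc_eval_pm(1)[OF W D_pos]]) simp_all
  then show ?thesis using p w by blast
qed

end

text \<open>The exceptional values are \<open>k\<^sub>+ = 0\<close> for the barred parameters and finitely many \<open>u\<close>.\<close>

lemma open_dense_params:
  fixes q :: complex assumes "q \<noteq> 0"
  defines "U \<equiv> {u. u \<noteq> 0 \<and> u ^ 4 \<noteq> 1 \<and> (u * q) ^ 4 \<noteq> 1}"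
  shows "open ((UNIV :: bparams set) \<times> (((UNIV :: complex set) \<times> (UNIV :: complex set) \<times> (- {0 :: complex}) \<times> (UNIV :: complex set)) \<times> U))"
    and "closure ((UNIV :: bparams set) \<times> (((UNIV :: complex set) \<times> (UNIV :: complex set) \<times> (- {0 :: complex}) \<times> (UNIV :: complex set)) \<times> U)) = UNIV"
proof -
  have "finite {u::complex. u ^ 4 = 1}" by (rule finite_roots_unity) simp
  moreover have "{u. (u * q) ^ 4 = 1} \<subseteq> (\<lambda>w. w / q) ` {u. u ^ 4 = 1}"
  proof
    fix u assume "u \<in> {u. (u * q) ^ 4 = 1}"
    then show "u \<in> (\<lambda>w. w / q) ` {u. u ^ 4 = 1}" using assms(1) by (intro image_eqI[of _ _ "u * q"]) auto
  qed
  ultimately have f: "finite ({0} \<union> {u. u ^ 4 = 1} \<union> {u. (u * q) ^ 4 = 1})" (is "finite ?F")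
    by (meson finite.emptyI finite.insertI finite_UnI finite_imageI finite_subset)
  have U: "U = - ?F" by (auto simp: U_def)
  have cl: "closure (- F) = UNIV" if "finite F" for F :: "complex set"
  proof -
    have "interior F = {}"
    proof (rule ccontr)
      assume "interior F \<noteq> {}"
      then obtain x where x: "x \<in> interior F" by blast
      then have "x islimpt F" by (rule interior_limit_point)
      then show False using islimpt_finite[OF that] by simp
    qed
    then show ?thesis unfolding closure_complement by simp
  qed
  show "open ((UNIV :: bparams set) \<times> (((UNIV :: complex set) \<times> (UNIV :: complex set) \<times> (- {0 :: complex}) \<times> (UNIV :: complex set)) \<times> U))"
    unfolding U by (intro open_Times open_UNIV open_Compl finite_imp_closed f) simp
  show "closure ((UNIV :: bparams set) \<times> (((UNIV :: complex set) \<times> (UNIV :: complex set) \<times> (- {0 :: complex}) \<times> (UNIV :: complex set)) \<times> U)) = UNIV"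
    unfolding U closure_Times cl[OF f] by (simp add: cl closure_UNIV)
qed

theorem corollary5p13:
  fixes q h :: complex and N J :: nat and Js :: "nat \<Rightarrow> nat" and v :: "nat \<Rightarrow> complex"
  assumes "h^2 = q"
    and "q \<noteq> 0"
    and "\<forall>n>0. q ^ n \<noteq> 1"
    and "N \<ge> 1"
    and "J \<ge> 1"
    and "\<forall>i\<in>{1..N}. Js i \<ge> 1"
    and "\<forall>i\<in>{1..N}. v i \<noteq> 0"
  shows "\<exists>(P :: bparams \<Rightarrow> bparams \<Rightarrow> complex \<Rightarrow> nc_poly) (G :: (bparams \<times> bparams \<times> complex) set).
    open G \<and> closure G = UNIV \<and>
    (\<forall>ep em kp km ep' em' kp' km' u.
      let \<beta> = (ep, em, kp, km); \<beta>' = (ep', em', kp', km') in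
      kp \<noteq> 0 \<longrightarrow> km \<noteq> 0 \<longrightarrow> transfer_regular h Js v N J u \<longrightarrow>
        transfer_mat h Js v \<beta> \<beta>' N J u
          = nc_eval (P \<beta> \<beta>' u) (W0_op h Js v \<beta> N) (W1_op h Js v \<beta> N)
        \<and> nc_degree (P \<beta> \<beta>' u) \<le> 2 * N * J
        \<and> ((\<beta>, \<beta>', u) \<in> G \<longrightarrow> nc_degree (P \<beta> \<beta>' u) = 2 * N * J))"
proof -
  define U where "U = {u. u \<noteq> 0 \<and> u ^ 4 \<noteq> 1 \<and> (u * q) ^ 4 \<noteq> 1}"
  define G0 :: "(bparams \<times> bparams \<times> complex) set" where "G0 = UNIV \<times> ((UNIV \<times> UNIV \<times> (- {0}) \<times> UNIV) \<times> U)"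
  have oc: "open G0" "closure G0 = UNIV" unfolding G0_def U_def by (rule open_dense_params[OF assms(2)])+
  define \<Phi> where "\<Phi> \<beta> \<beta>' u p \<longleftrightarrow> transfer_mat h Js v \<beta> \<beta>' N J u = nc_eval p (W0_op h Js v \<beta> N) (W1_op h Js v \<beta> N)
        \<and> nc_degree p \<le> 2 * N * J \<and> ((\<beta>, \<beta>', u) \<in> G0 \<longrightarrow> nc_degree p = 2 * N * J)" for \<beta> \<beta>' u p
  define P where "P \<beta> \<beta>' u = (SOME p. \<Phi> \<beta> \<beta>' u p)" for \<beta> \<beta>' u
  have P: "\<Phi> (ep, em, kp, km) (ep', em', kp', km') u (P (ep, em, kp, km) (ep', em', kp', km') u)"
    if k: "kp \<noteq> 0" "km \<noteq> 0" "transfer_regular h Js v N J u" for ep em kp km ep' em' kp' km' u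
  proof -
    interpret bchain h Js v N ep em kp km
      by unfold_locales (use assms k in auto)
    obtain p where p: "transfer_mat h Js v (ep, em, kp, km) (ep', em', kp', km') N J u = nc_eval p (W0_op h Js v (ep, em, kp, km) N) (W1_op h Js v (ep, em, kp, km) N)"
      "nc_degree p \<le> 2 * N * J" "N * J \<ge> 2 \<or> kp' \<noteq> 0 \<and> u ^ 4 \<noteq> 1 \<and> (u * h ^ 2) ^ 4 \<noteq> 1 \<longrightarrow> nc_degree p = 2 * N * J"
      using transfer_poly[OF assms(5) k(3), of ep' em' kp' km'] by blast
    have "nc_degree p = 2 * N * J" if "((ep, em, kp, km), (ep', em', kp', km'), u) \<in> G0"
      using that p(3) unfolding assms(1) by (auto simp: G0_def U_def)
    then have "\<Phi> (ep, em, kp, km) (ep', em', kp', km') u p" unfolding \<Phi>_def using p(1,2) by blast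
    then show ?thesis unfolding P_def by (rule someI)
  qed
  show ?thesis
    by (rule exI[of _ P], rule exI[of _ G0], intro conjI oc allI, unfold Let_def, intro impI)
      (rule P[unfolded \<Phi>_def])
qed

end
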